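(* Assume $\mu\ge2$, let $\gamma(\varepsilon)$ be as in the context, and for small $\varepsilon>0$ put $$\omega(\varepsilon):=\frac{\varepsilon^{\alpha(\mu^{-\{\gamma(\varepsilon)\}}-1)}}{\log(1/\varepsilon)},\qquad\text{where } \{x\}:=\lceil x\rceil-x.$$ (a) If $\varepsilon_j\downarrow0$ is such that $\omega(\varepsilon_j)\to\infty$, then $$\lim_{j\to\infty}\mathbb{P}\big(K=\lceil\gamma(\varepsilon_j)\rceil\,\big|\,W<\varepsilon_j\big)=1.$$ (b) If $\varepsilon_j\downarrow0$ is such that $\omega(\varepsilon_j)$ is asymptotically bounded away from zero and infinity, then each of the two sequences $$\mathbb{P}\big(K=\lceil\gamma(\varepsilon_j)\rceil\,\big|\,W<\varepsilon_j\big)\quad\text{and}\quad \mathbb{P}\big(K=\lceil\gamma(\varepsilon_j)\rceil+1\,\big|\,W<\varepsilon_j\big)$$ is asymptotically (as $j\to\infty$) bounded away from zero and one. (c) If $\varepsilon_j\downarrow0$ is such that $\omega(\varepsilon_j)\to0$, then $$\lim_{j\to\infty}\mathbb{P}\big(K=\lceil\gamma(\varepsilon_j)\rceil+1\,\big|\,W<\varepsilon_j\big)=1.$$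
   Context: $(Z_n)_{n\ge 0}$ is the sequence of generation sizes of a Galton–Watson tree with $Z_0=1$ whose offspring variable $N$ is nondegenerate (not almost surely constant), with $P(N=0)=0$ and $E[N\log N]<\infty$. Put $p_n:=P(N=n)$, $a:=E[N]\in(1,\infty)$, $\mu:=\min\{n\in\mathbb{N}:p_n>0\}$, assumed $\ge 2$, and $\lambda:=\min\{n>\mu:p_n>0\}$. The martingale limit $W:=\lim_{n\to\infty}Z_n/a^n$ exists and is strictly positive almost surely. Let $K:=\min\{k\in\mathbb{N}:Z_k>\mu^k\}$. Let $\beta:=\log\mu/\log a$, $\alpha:=\beta/(1-\beta)$, $\kappa(\varepsilon):=\lfloor\log(1/\varepsilon)/\log(a/\mu)\rfloor$, $y=y(\varepsilon):=\varepsilon(a/\mu)^{\kappa(\varepsilon)}\in(\mu/a,1]$. Let $\phi(z):=\mathbb{E}e^{-zW}$, $f(s):=\sum_j p_js^j$, $f_0(s):=s$, $f_m:=f\circ f_{m-1}$, and $b(s):=\lim_{m\to\infty}\mu^{-m}\log f_m(s)$ for $s\in(0,1]$ (the limit exists). One has $b\circ\phi<0$ on $(0,\infty)$, and $(b\circ\phi)'$ increases from $-\infty$ to $0$ on $(0,\infty)$, so there is a unique $u_1=u_1(\varepsilon)>0$ with $(b\circ\phi)'(u_1)=-y(\varepsilon)$. Put $$H(\varepsilon):=\frac{1}{\log\mu}\log\Big(-\frac{b(\phi(u_1))\,y^{\alpha}(\lambda-\mu)}{\alpha}\Big),\qquad \gamma(\varepsilon):=\frac{\log(1/\varepsilon)}{\log(a/\mu)}-\frac{\log\log(1/\varepsilon)}{\log\mu}+H(\varepsilon).$$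 *)

theory Defs
  imports "HOL-Probability.Probability"
begin

text \<open>
  A Galton--Watson tree in Ulam--Harris coding: individuals are finite words over the natural
  numbers, the root is the empty word, and the variables N v, one for every potential individual v,
  are i.i.d. with law p. The children of v are the words v @ [i] with i < N v.
\<close>

locale galton_watson = prob_space M for M :: "'a measure" +
  fixes p :: "nat pmf" and N :: "nat list \<Rightarrow> 'a \<Rightarrow> nat"
  assumes offspring_indep: "indep_vars (\<lambda>_. count_space UNIV) N UNIV"
    and offspring_distr: "\<And>v. distr M (count_space UNIV) (N v) = measure_pmf p"

primrec gw_generation :: "(nat list \<Rightarrow> 'a \<Rightarrow> nat) \<Rightarrow> nat \<Rightarrow> 'a \<Rightarrow> nat list set" where
  "gw_generation N 0 x = {[]}"
| "gw_generation N (Suc n) x = {v @ [i] | v i. v \<in> gw_generation N n x \<and> i < N v x}"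

definition gw_Z :: "(nat list \<Rightarrow> 'a \<Rightarrow> nat) \<Rightarrow> nat \<Rightarrow> 'a \<Rightarrow> nat" where
  "gw_Z N n x = card (gw_generation N n x)"

definition gw_mean :: "nat pmf \<Rightarrow> real" where
  "gw_mean p = measure_pmf.expectation p real"

definition gw_mu :: "nat pmf \<Rightarrow> nat" where
  "gw_mu p = (LEAST n. pmf p n > 0)"

definition gw_lambda :: "nat pmf \<Rightarrow> nat" where
  "gw_lambda p = (LEAST n. n > gw_mu p \<and> pmf p n > 0)"

text \<open>
  The limit exists almost surely, and almost surely Z k > \<open>\<mu>\<close> ^ k for some k; the unspecified
  values of W and K elsewhere concern a null set only.
\<close>

definition gw_W :: "nat pmf \<Rightarrow> (nat list \<Rightarrow> 'a \<Rightarrow> nat) \<Rightarrow> 'a \<Rightarrow> real" where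
  "gw_W p N x = lim (\<lambda>n. real (gw_Z N n x) / gw_mean p ^ n)"

definition gw_K :: "nat pmf \<Rightarrow> (nat list \<Rightarrow> 'a \<Rightarrow> nat) \<Rightarrow> 'a \<Rightarrow> nat" where
  "gw_K p N x = (LEAST k. gw_Z N k x > gw_mu p ^ k)"

definition gw_beta :: "nat pmf \<Rightarrow> real" where
  "gw_beta p = ln (gw_mu p) / ln (gw_mean p)"

definition gw_alpha :: "nat pmf \<Rightarrow> real" where
  "gw_alpha p = gw_beta p / (1 - gw_beta p)"

definition gw_kappa :: "nat pmf \<Rightarrow> real \<Rightarrow> int" where
  "gw_kappa p \<epsilon> = \<lfloor>ln (1 / \<epsilon>) / ln (gw_mean p / gw_mu p)\<rfloor>"

definition gw_y :: "nat pmf \<Rightarrow> real \<Rightarrow> real" where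
  "gw_y p \<epsilon> = \<epsilon> * (gw_mean p / gw_mu p) powi gw_kappa p \<epsilon>"

definition gw_phi :: "'a measure \<Rightarrow> nat pmf \<Rightarrow> (nat list \<Rightarrow> 'a \<Rightarrow> nat) \<Rightarrow> real \<Rightarrow> real" where
  "gw_phi M p N z = (\<integral>x. exp (- z * gw_W p N x) \<partial>M)"

definition gw_pgf :: "nat pmf \<Rightarrow> real \<Rightarrow> real" where
  "gw_pgf p s = (\<Sum>j. pmf p j * s ^ j)"

definition gw_b :: "nat pmf \<Rightarrow> real \<Rightarrow> real" where
  "gw_b p s = lim (\<lambda>m. ln ((gw_pgf p ^^ m) s) / real (gw_mu p) ^ m)"

definition gw_u1 :: "'a measure \<Rightarrow> nat pmf \<Rightarrow> (nat list \<Rightarrow> 'a \<Rightarrow> nat) \<Rightarrow> real \<Rightarrow> real" where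
  "gw_u1 M p N \<epsilon> =
    (THE u. u > 0 \<and> (gw_b p \<circ> gw_phi M p N has_real_derivative - gw_y p \<epsilon>) (at u))"

definition gw_H :: "'a measure \<Rightarrow> nat pmf \<Rightarrow> (nat list \<Rightarrow> 'a \<Rightarrow> nat) \<Rightarrow> real \<Rightarrow> real" where
  "gw_H M p N \<epsilon> =
    1 / ln (gw_mu p) *
    ln (- gw_b p (gw_phi M p N (gw_u1 M p N \<epsilon>)) * gw_y p \<epsilon> powr gw_alpha p
         * (real (gw_lambda p) - real (gw_mu p)) / gw_alpha p)"

definition gw_gamma :: "'a measure \<Rightarrow> nat pmf \<Rightarrow> (nat list \<Rightarrow> 'a \<Rightarrow> nat) \<Rightarrow> real \<Rightarrow> real" where
  "gw_gamma M p N \<epsilon> =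
    ln (1 / \<epsilon>) / ln (gw_mean p / gw_mu p) - ln (ln (1 / \<epsilon>)) / ln (gw_mu p) + gw_H M p N \<epsilon>"

text \<open>The distance to the next integer above, in contrast to the library's \<open>frac\<close>.\<close>

definition upper_frac :: "real \<Rightarrow> real" where
  "upper_frac x = of_int \<lceil>x\<rceil> - x"

definition gw_omega :: "'a measure \<Rightarrow> nat pmf \<Rightarrow> (nat list \<Rightarrow> 'a \<Rightarrow> nat) \<Rightarrow> real \<Rightarrow> real" where
  "gw_omega M p N \<epsilon> =
    \<epsilon> powr (gw_alpha p * (real (gw_mu p) powr (- upper_frac (gw_gamma M p N \<epsilon>)) - 1))
      / ln (1 / \<epsilon>)"

end

theory Submission
  imports Defs "HOL-Probability.Probability" "HOL-Real_Asymp.Real_Asymp"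
begin

text \<open>
  Given the tree up to generation \<open>k = \<kappa>(\<epsilon>)\<close>, the variable \<open>a ^ k W\<close> is a sum of \<open>Z k\<close> independent
  copies of W. Tilt the law of the tree by \<open>exp (- u a ^ k W)\<close> with \<open>u = u\<^sub>1(\<epsilon>)\<close>, which makes
  \<open>a ^ k \<epsilon>\<close> the typical size of \<open>a ^ k W\<close>; here \<open>Z k\<close> is about \<open>\<mu> ^ k\<close>. A local limit bound, uniform
  over u in a compact set, shows that the probability of \<open>W < \<epsilon>\<close> given generation k is of order at
  most \<open>exp (u \<mu> ^ k y) \<mu> ^ (- k / 2)\<close> times the tilting density, and of exactly this order for all
  generations apart from a set of small tilted probability. Hence conditioning on \<open>W < \<epsilon>\<close> is
  comparable, up to constants, with the tilted law.

  The tilted probability of \<open>Z k = \<mu> ^ k\<close> is explicit. With \<open>f (exp (- t)) = exp (- G t)\<close>, its negative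
  logarithm is \<open>\<mu> ^ k\<close> times the defect in the linearisation of G along the Boettcher function b,
  which is of order \<open>exp (- (\<lambda> - \<mu>) \<mu> ^ (\<kappa>(\<epsilon>) - k) \<bar>b (\<phi> u)\<bar>)\<close>. At \<open>k = \<lceil>\<gamma>(\<epsilon>)\<rceil>\<close> the product is of order \<open>\<omega>(\<epsilon>)\<close>,
  one generation earlier it is \<open>O (1 / log (1 / \<epsilon>))\<close>, and one generation later it tends to infinity.
\<close>

section \<open>Laplace transforms of nonnegative random variables\<close>

text \<open>Bounds up to constants suffice, because the theorem only asks whether conditional
  probabilities tend to 0 or 1 or stay away from both. This shapes the local limit bound:
  characteristic functions are controlled only near 0, uniformly in the tilt, so windows of fixed
  length are smoothed by a kernel whose Fourier transform has compact support. The comparison of the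
  two laws is asymmetric. The upper bound holds for every event of the first generations, while the
  lower bound loses an arbitrarily small \<open>\<eta>\<close> for untypical generation sizes. A
  conditional limit 1 is therefore obtained by bounding the complementary event from above; lower
  bounds serve for \<open>W < \<epsilon>\<close> itself and where the tilted probabilities are
  already away from 0 and 1. The tilt stays in a compact interval because
  \<open>y(\<epsilon>)\<close> runs through a single period of a self-similar derivative. Finally, K
  = k + 1 is the difference of two nested events, Z k = \<open>\<mu> ^ k\<close> and its successor,
  so three consecutive generations around the ceiling of \<open>\<gamma>(\<epsilon>)\<close> decide
  all three claims.\<close>

locale nonneg_random_variable = prob_space M for M :: "'a measure" +
  fixes X :: "'a \<Rightarrow> real"
  assumes X_measurable [measurable]: "X \<in> borel_measurable M"
    and X_nonneg: "AE x in M. 0 \<le> X x"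
begin

text \<open>Up to the sign \<open>(- 1) ^ k\<close>, the k-th derivative of the Laplace transform of
  \<open>X\<close>; for \<open>u > 0\<close> the integrand is integrable even if \<open>X\<close>
  has no moments.\<close>

definition laplace_moment :: "nat \<Rightarrow> real \<Rightarrow> real" where
  "laplace_moment k u = (\<integral>x. X x ^ k * exp (- u * X x) \<partial>M)"

definition neg_log_laplace :: "real \<Rightarrow> real" where
  "neg_log_laplace u = - ln (laplace_moment 0 u)"

definition tilted_mean :: "real \<Rightarrow> real" where
  "tilted_mean u = laplace_moment 1 u / laplace_moment 0 u"

definition tilted_variance :: "real \<Rightarrow> real" where
  "tilted_variance u = laplace_moment 2 u / laplace_moment 0 u - (tilted_mean u)\<^sup>2"

text \<open>A single term of the exponential series of \<open>u * y\<close> is at most the whole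
  sum. Besides integrability, this later converts exponential decay into the polynomial decay that
  makes series converge.\<close>

lemma power_exp_le:
  fixes u y :: real
  assumes "u > 0" "y \<ge> 0"
  shows "y ^ k * exp (- u * y) \<le> fact k / u ^ k"
proof -
  have "(u * y) ^ k / fact k \<le> (\<Sum>n. (u * y) ^ n /\<^sub>R fact n)"
    using sum_le_suminf[of "\<lambda>n. (u * y) ^ n /\<^sub>R fact n" "{k}"] exp_converges[of "u * y"] assms
    by (auto simp: sums_iff divide_inverse mult.commute)
  then have "(u * y) ^ k / fact k \<le> exp (u * y)"
    using exp_converges[of "u * y"] by (simp add: sums_iff)
  then show ?thesis
    using assms by (simp add: field_simps exp_minus power_mult_distrib)
qed

lemma integrable_laplace_moment:
  assumes "u > 0"
  shows "integrable M (\<lambda>x. X x ^ k * exp (- u * X x))"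
proof (rule integrable_const_bound[where B = "fact k / u ^ k"])
  show "AE x in M. norm (X x ^ k * exp (- u * X x)) \<le> fact k / u ^ k"
    using X_nonneg
  proof eventually_elim
    case (elim x)
    then show ?case using power_exp_le[OF assms, of "X x" k] by (simp add: abs_mult)
  qed
qed measurable

lemma integrable_exp_laplace:
  assumes "u \<ge> 0"
  shows "integrable M (\<lambda>x. exp (- u * X x))"
proof (rule integrable_const_bound[where B = 1])
  show "AE x in M. norm (exp (- u * X x)) \<le> 1"
    using X_nonneg
  proof eventually_elim
    case (elim x)
    then show ?case using assms by (simp add: mult_nonneg_nonneg)
  qed
qed measurable

lemma laplace_moment_nonneg: "laplace_moment k u \<ge> 0"
  unfolding laplace_moment_def using X_nonneg by (intro integral_nonneg_AE) auto

lemma laplace_moment_0_pos: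
  assumes "u \<ge> 0"
  shows "laplace_moment 0 u > 0"
proof -
  have "(\<integral>x. exp (- u * X x) \<partial>M) > 0"
    using integrable_exp_laplace[OF assms]
    using integral_less_AE_space[of "\<lambda>_. 0" "\<lambda>x. exp (- u * X x)"]
    by (simp add: emeasure_space_1)
  then show ?thesis by (simp add: laplace_moment_def)
qed

lemma laplace_moment_0_le_1:
  assumes "u \<ge> 0"
  shows "laplace_moment 0 u \<le> 1"
proof -
  have "(\<integral>x. exp (- u * X x) \<partial>M) \<le> (\<integral>x. 1 \<partial>M)"
    using integrable_exp_laplace[OF assms] X_nonneg assms
    by (intro integral_mono_AE) (auto elim!: eventually_mono)
  then show ?thesis by (simp add: laplace_moment_def prob_space)
qed

lemma abs_exp_minus_linear_le:
  fixes z :: real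
  shows "\<bar>exp z - 1 - z\<bar> \<le> z\<^sup>2 / 2 * exp \<bar>z\<bar>"
proof -
  obtain t where t: "\<bar>t\<bar> \<le> \<bar>z\<bar>" "exp z = (\<Sum>m<2. z ^ m / fact m) + exp t / fact 2 * z ^ 2"
    using Maclaurin_exp_le[of z 2] by blast
  have *: "exp z - 1 - z = z\<^sup>2 / 2 * exp t"
    using t(2) by (simp add: eval_nat_numeral)
  have "\<bar>exp z - 1 - z\<bar> = z\<^sup>2 / 2 * exp t" unfolding * by (simp add: abs_mult)
  also have "\<dots> \<le> z\<^sup>2 / 2 * exp \<bar>z\<bar>" using t(1) by (intro mult_left_mono) auto
  finally show ?thesis .
qed

text \<open>Expand \<open>exp (- h * X)\<close> to second order. The error factor
  \<open>exp \<bar>h * X\<bar>\<close> is at most \<open>exp (u / 2 * X)\<close>, which is paid for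
  by halving the tilt, so the remainder is again a finite moment.\<close>

lemma laplace_moment_taylor:
  assumes "u > 0" "\<bar>h\<bar> \<le> u / 2"
  shows "\<bar>laplace_moment k (u + h) - laplace_moment k u + h * laplace_moment (Suc k) u\<bar>
          \<le> h\<^sup>2 * laplace_moment (k + 2) (u / 2)"
proof -
  have h: "u + h > 0" using assms by linarith
  have *: "laplace_moment k (u + h) - laplace_moment k u + h * laplace_moment (Suc k) u
     = (\<integral>x. X x ^ k * exp (- (u + h) * X x) - X x ^ k * exp (- u * X x)
          + h * (X x ^ Suc k * exp (- u * X x)) \<partial>M)"
    unfolding laplace_moment_def
    using integrable_laplace_moment[OF h, of k] integrable_laplace_moment[OF assms(1), of k]
      integrable_laplace_moment[OF assms(1), of "Suc k"]
    by (simp del: power_Suc)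
  have pt: "\<bar>X x ^ k * exp (- (u + h) * X x) - X x ^ k * exp (- u * X x)
          + h * (X x ^ Suc k * exp (- u * X x))\<bar> \<le> h\<^sup>2 * (X x ^ (k + 2) * exp (- (u / 2) * X x))"
    if "X x \<ge> 0" for x
  proof -
    let ?y = "X x"
    have "\<bar>exp (- h * ?y) - 1 - (- h * ?y)\<bar> \<le> (- h * ?y)\<^sup>2 / 2 * exp \<bar>- h * ?y\<bar>"
      by (rule abs_exp_minus_linear_le)
    also have "\<dots> \<le> (h * ?y)\<^sup>2 * exp (u / 2 * ?y)"
    proof -
      have "\<bar>- h * ?y\<bar> \<le> u / 2 * ?y"
        using assms that mult_right_mono[of "\<bar>h\<bar>" "u / 2" "X x"] by (simp add: abs_mult)
      then have "exp \<bar>- h * ?y\<bar> \<le> exp (u / 2 * ?y)" by simp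
      then have "(- h * ?y)\<^sup>2 / 2 * exp \<bar>- h * ?y\<bar> \<le> (h * ?y)\<^sup>2 * exp (u / 2 * ?y)"
        by (intro mult_mono) auto
      then show ?thesis .
    qed
    finally have *: "\<bar>exp (- h * ?y) - 1 + h * ?y\<bar> \<le> (h * ?y)\<^sup>2 * exp (u / 2 * ?y)" by simp
    have e1: "exp (- (u + h) * ?y) = exp (- u * ?y) * exp (- h * ?y)"
      by (simp add: exp_add[symmetric] algebra_simps)
    have e2: "exp (- (u / 2) * ?y) = exp (- u * ?y) * exp (u / 2 * ?y)"
      by (simp add: exp_add[symmetric] algebra_simps)
    have "?y ^ k * exp (- (u + h) * ?y) - ?y ^ k * exp (- u * ?y) + h * (?y ^ Suc k * exp (- u * ?y))
      = ?y ^ k * exp (- u * ?y) * (exp (- h * ?y) - 1 + h * ?y)"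
      unfolding e1 by (simp add: algebra_simps)
    also have "\<bar>\<dots>\<bar> = ?y ^ k * exp (- u * ?y) * \<bar>exp (- h * ?y) - 1 + h * ?y\<bar>"
      using that by (simp add: abs_mult)
    also have "\<dots> \<le> ?y ^ k * exp (- u * ?y) * ((h * ?y)\<^sup>2 * exp (u / 2 * ?y))"
      using * that by (intro mult_left_mono) auto
    also have "\<dots> = h\<^sup>2 * (?y ^ (k + 2) * exp (- (u / 2) * ?y))"
      unfolding e2 by (simp add: power_add power2_eq_square algebra_simps)
    finally show ?thesis .
  qed
  have i1: "integrable M (\<lambda>x. X x ^ k * exp (- (u + h) * X x) - X x ^ k * exp (- u * X x)
          + h * (X x ^ Suc k * exp (- u * X x)))"
    by (intro Bochner_Integration.integrable_add Bochner_Integration.integrable_diff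
        integrable_mult_right integrable_laplace_moment h assms)
  have i2: "integrable M (\<lambda>x. h\<^sup>2 * (X x ^ (k + 2) * exp (- (u / 2) * X x)))"
    using assms by (intro integrable_mult_right integrable_laplace_moment) simp
  have "norm (\<integral>x. X x ^ k * exp (- (u + h) * X x) - X x ^ k * exp (- u * X x)
          + h * (X x ^ Suc k * exp (- u * X x)) \<partial>M)
     \<le> (\<integral>x. norm (X x ^ k * exp (- (u + h) * X x) - X x ^ k * exp (- u * X x)
          + h * (X x ^ Suc k * exp (- u * X x))) \<partial>M)"
    by (rule integral_norm_bound)
  also have "\<dots> \<le> (\<integral>x. h\<^sup>2 * (X x ^ (k + 2) * exp (- (u / 2) * X x)) \<partial>M)"
  proof (rule integral_mono_AE[OF integrable_norm[OF i1] i2])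
    show "AE x in M. norm (X x ^ k * exp (- (u + h) * X x) - X x ^ k * exp (- u * X x)
          + h * (X x ^ Suc k * exp (- u * X x))) \<le> h\<^sup>2 * (X x ^ (k + 2) * exp (- (u / 2) * X x))"
      using X_nonneg by eventually_elim (use pt in simp)
  qed
  finally show ?thesis
    unfolding * by (simp add: laplace_moment_def)
qed

lemma DERIV_laplace_moment:
  assumes "u > 0"
  shows "(laplace_moment k has_real_derivative - laplace_moment (Suc k) u) (at u)"
proof -
  let ?q = "\<lambda>h. (laplace_moment k (u + h) - laplace_moment k u) / h"
  let ?C = "laplace_moment (k + 2) (u / 2)"
  have "((\<lambda>h. ?q h + laplace_moment (Suc k) u) \<longlongrightarrow> 0) (at 0)"
  proof (rule Lim_null_comparison)
    show "\<forall>\<^sub>F h in at 0. norm (?q h + laplace_moment (Suc k) u) \<le> \<bar>h\<bar> * ?C"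
    proof -
      have "norm (?q h + laplace_moment (Suc k) u) \<le> \<bar>h\<bar> * ?C" if "h \<noteq> 0" "\<bar>h\<bar> \<le> u / 2" for h
      proof -
        have "\<bar>h\<bar> * \<bar>?q h + laplace_moment (Suc k) u\<bar>
            = \<bar>laplace_moment k (u + h) - laplace_moment k u + h * laplace_moment (Suc k) u\<bar>"
          using that(1) by (simp add: abs_mult[symmetric] field_simps)
        also have "\<dots> \<le> \<bar>h\<bar> * (\<bar>h\<bar> * ?C)"
          using laplace_moment_taylor[OF assms that(2), of k] by (simp add: power2_eq_square mult.assoc[symmetric])
        finally show ?thesis
          using that(1) by simp
      qed
      then show ?thesis
        using assms by (auto simp: eventually_at intro!: exI[of _ "u / 2"])
    qed
    show "((\<lambda>h. \<bar>h\<bar> * ?C) \<longlongrightarrow> 0) (at 0)"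
      by (auto intro!: tendsto_eq_intros)
  qed
  then have "(?q \<longlongrightarrow> - laplace_moment (Suc k) u) (at 0)"
    by (subst Lim_null) simp
  then show ?thesis
    unfolding DERIV_def .
qed

text \<open>Up to signs this is a cumulant generating function: its first two derivatives are the
  mean and minus the variance of the law with density proportional to
  \<open>exp (- u * X)\<close>.\<close>

lemma DERIV_neg_log_laplace:
  assumes "u > 0"
  shows "(neg_log_laplace has_real_derivative tilted_mean u) (at u)"
  unfolding neg_log_laplace_def[abs_def] tilted_mean_def
  using laplace_moment_0_pos[of u] assms
  by (auto intro!: derivative_eq_intros DERIV_laplace_moment simp: divide_inverse)

lemma DERIV_tilted_mean:
  assumes "u > 0"
  shows "(tilted_mean has_real_derivative - tilted_variance u) (at u)"
proof -
  have *: "laplace_moment 0 u \<noteq> 0" using laplace_moment_0_pos[of u] assms by simp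
  show ?thesis
    unfolding tilted_mean_def[abs_def] tilted_variance_def
    using *
    by (auto intro!: derivative_eq_intros DERIV_laplace_moment assms
        simp: divide_simps power2_eq_square numeral_2_eq_2)
qed

lemma continuous_laplace_moment: "continuous_on {0<..} (laplace_moment k)"
  by (intro continuous_at_imp_continuous_on ballI DERIV_isCont[OF DERIV_laplace_moment]) simp

lemma tilted_mean_nonneg: "u \<ge> 0 \<Longrightarrow> tilted_mean u \<ge> 0"
  unfolding tilted_mean_def using laplace_moment_0_pos[of u] laplace_moment_nonneg[of 1 u] by simp

text \<open>Variance plus squared bias under the tilted law, before normalisation. The centre
  \<open>c\<close> is free because later a convenient value takes the place of the exact tilted
  mean.\<close>

lemma integral_centred_sq:
  assumes "u > 0"
  shows "(\<integral>x. (X x - c)\<^sup>2 * exp (- u * X x) \<partial>M)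
     = laplace_moment 0 u * (tilted_variance u + (tilted_mean u - c)\<^sup>2)"
    and "integrable M (\<lambda>x. (X x - c)\<^sup>2 * exp (- u * X x))"
proof -
  have *: "(\<lambda>x. (X x - c)\<^sup>2 * exp (- u * X x)) = (\<lambda>x. X x ^ 2 * exp (- u * X x)
       - 2 * c * (X x ^ 1 * exp (- u * X x)) + c\<^sup>2 * (X x ^ 0 * exp (- u * X x)))"
    by (simp add: fun_eq_iff power2_eq_square algebra_simps)
  show "integrable M (\<lambda>x. (X x - c)\<^sup>2 * exp (- u * X x))"
    unfolding * by (intro Bochner_Integration.integrable_add Bochner_Integration.integrable_diff
        integrable_mult_right integrable_laplace_moment assms)
  have "(\<integral>x. (X x - c)\<^sup>2 * exp (- u * X x) \<partial>M)
      = laplace_moment 2 u - 2 * c * laplace_moment 1 u + c\<^sup>2 * laplace_moment 0 u"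
    unfolding * laplace_moment_def
    by (subst Bochner_Integration.integral_add Bochner_Integration.integral_diff integral_mult_right_zero,
        (intro Bochner_Integration.integrable_add Bochner_Integration.integrable_diff
        integrable_mult_right integrable_laplace_moment assms)+)+ simp
  also have "\<dots> = laplace_moment 0 u * (tilted_variance u + (tilted_mean u - c)\<^sup>2)"
    using laplace_moment_0_pos[of u] assms
    by (simp add: tilted_variance_def tilted_mean_def divide_simps power2_eq_square algebra_simps)
  finally show "(\<integral>x. (X x - c)\<^sup>2 * exp (- u * X x) \<partial>M)
     = laplace_moment 0 u * (tilted_variance u + (tilted_mean u - c)\<^sup>2)" .
qed

lemma tilted_variance_nonneg:
  assumes "u > 0"
  shows "tilted_variance u \<ge> 0"
proof -
  have "0 \<le> (\<integral>x. (X x - tilted_mean u)\<^sup>2 * exp (- u * X x) \<partial>M)"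
    by (intro integral_nonneg_AE AE_I2) simp
  then have "0 \<le> laplace_moment 0 u * tilted_variance u"
    unfolding integral_centred_sq(1)[OF assms, of "tilted_mean u"] by simp
  then show ?thesis
    using laplace_moment_0_pos[of u] assms by (simp add: zero_le_mult_iff)
qed

lemma tilted_variance_pos:
  assumes "u > 0" and nonconst: "\<And>c. \<not> (AE x in M. X x = c)"
  shows "tilted_variance u > 0"
proof (rule ccontr)
  assume "\<not> ?thesis"
  then have "tilted_variance u = 0" using tilted_variance_nonneg[OF assms(1)] by simp
  then have "(\<integral>x. (X x - tilted_mean u)\<^sup>2 * exp (- u * X x) \<partial>M) = 0"
    using integral_centred_sq(1)[OF assms(1), of "tilted_mean u"] by simp
  then have "AE x in M. (X x - tilted_mean u)\<^sup>2 * exp (- u * X x) = 0"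
    using integral_nonneg_eq_0_iff_AE[OF integral_centred_sq(2)[OF assms(1)]] by simp
  then have "AE x in M. X x = tilted_mean u" by simp
  then show False using nonconst by blast
qed

lemma tilted_mean_antimono:
  assumes "0 < u" "u \<le> v"
  shows "tilted_mean v \<le> tilted_mean u"
  using assms(2)
proof (rule DERIV_nonpos_imp_nonincreasing)
  fix x assume "u \<le> x" "x \<le> v"
  then show "\<exists>y. (tilted_mean has_real_derivative y) (at x) \<and> y \<le> 0"
    using DERIV_tilted_mean[of x] tilted_variance_nonneg[of x] assms by fastforce
qed

lemma tilted_mean_strict_antimono:
  assumes "0 < u" "u < v" and nonconst: "\<And>c. \<not> (AE x in M. X x = c)"
  shows "tilted_mean v < tilted_mean u"
  using assms(2)
proof (rule DERIV_neg_imp_decreasing)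
  fix x assume "u \<le> x" "x \<le> v"
  then show "\<exists>y. (tilted_mean has_real_derivative y) (at x) \<and> y < 0"
    using DERIV_tilted_mean[of x] tilted_variance_pos[of x] assms by fastforce
qed

lemma neg_log_laplace_nonneg: "u \<ge> 0 \<Longrightarrow> neg_log_laplace u \<ge> 0"
  unfolding neg_log_laplace_def using laplace_moment_0_pos[of u] laplace_moment_0_le_1[of u] by simp

lemma exp_neg_log_laplace: "u \<ge> 0 \<Longrightarrow> exp (- neg_log_laplace u) = laplace_moment 0 u"
  unfolding neg_log_laplace_def using laplace_moment_0_pos[of u] by simp

end

section \<open>Gaussian integrals and the Fejer kernel\<close>

text \<open>Rescaling the standard moments by \<open>sqrt a\<close>. The cases \<open>k = 0\<close>
  and \<open>k = 1\<close> are the ones that occur, as errors \<open>\<bar>\<tau>\<bar>\<close> and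
  \<open>\<bar>\<tau>\<bar> ^ 3\<close> against a Gaussian.\<close>

lemma has_bochner_integral_gaussian:
  fixes a :: real assumes a: "a > 0"
  shows "has_bochner_integral lborel (\<lambda>x. exp (- a * x\<^sup>2)) (sqrt (pi / a))"
    and "has_bochner_integral lborel (\<lambda>x. exp (- a * x\<^sup>2) * \<bar>x\<bar> ^ (2 * k + 1)) (fact k / a ^ (k + 1))"
proof -
  have e: "exp (- (sqrt a * x)\<^sup>2) = exp (- a * x\<^sup>2)" for x
    using a by (simp add: power_mult_distrib)
  have "has_bochner_integral lborel (\<lambda>x::real. exp (- x\<^sup>2)) (sqrt pi)"
    using has_bochner_integral_even_function[OF gaussian_moment_0] by simp
  then show "has_bochner_integral lborel (\<lambda>x. exp (- a * x\<^sup>2)) (sqrt (pi / a))"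
    using a e by (subst (asm) lborel_has_bochner_integral_real_affine_iff[where c = "sqrt a" and t = 0])
      (simp_all add: real_sqrt_mult real_sqrt_inverse divide_inverse mult.commute)
  have "has_bochner_integral lborel (\<lambda>x::real. indicator {0..} x *\<^sub>R (exp (-x\<^sup>2)*\<bar>x\<bar>^(2 * k + 1))) (fact k / 2)"
    by (rule has_bochner_integral_cong[THEN iffD1, OF _ _ _ gaussian_moment_odd_pos[of k]]) auto
  from has_bochner_integral_even_function[OF this]
  have "has_bochner_integral lborel (\<lambda>x::real. exp (-x\<^sup>2)*\<bar>x\<bar>^(2 * k + 1)) (fact k)"
    by simp
  then have "has_bochner_integral lborel (\<lambda>x::real. exp (- (sqrt a * x)\<^sup>2)*\<bar>sqrt a * x\<bar>^(2 * k + 1)) (fact k /\<^sub>R \<bar>sqrt a\<bar>)"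
    using a by (subst (asm) lborel_has_bochner_integral_real_affine_iff[where c = "sqrt a" and t = 0]) simp_all
  then have "has_bochner_integral lborel (\<lambda>x::real. (1 / sqrt a ^ (2 * k + 1)) * (exp (- (sqrt a * x)\<^sup>2)*\<bar>sqrt a * x\<bar>^(2 * k + 1))) ((1 / sqrt a ^ (2 * k + 1)) * (fact k /\<^sub>R \<bar>sqrt a\<bar>))"
    by (intro has_bochner_integral_mult_right)
  also have "(\<lambda>x::real. (1 / sqrt a ^ (2 * k + 1)) * (exp (- (sqrt a * x)\<^sup>2)*\<bar>sqrt a * x\<bar>^(2 * k + 1)))
     = (\<lambda>x. exp (- a * x\<^sup>2) * \<bar>x\<bar> ^ (2 * k + 1))"
    using a unfolding e by (auto simp: abs_mult power_mult_distrib)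
  also have "(1 / sqrt a ^ (2 * k + 1)) * (fact k /\<^sub>R \<bar>sqrt a\<bar>) = fact k / (sqrt a ^ 2) ^ (k + 1)"
    using a unfolding power_mult[symmetric] by (simp add: divide_inverse)
  also have "(sqrt a ^ 2) = a" using a by simp
  finally show "has_bochner_integral lborel (\<lambda>x. exp (- a * x\<^sup>2) * \<bar>x\<bar> ^ (2 * k + 1)) (fact k / a ^ (k + 1))" .
qed

lemma integral_cos_gaussian:
  fixes a d :: real assumes a: "a > 0"
  shows "(\<integral>x. cos (x * d) * exp (- a * x\<^sup>2) \<partial>lborel) = sqrt (pi / a) * exp (- d\<^sup>2 / (4 * a))"
proof -
  \<comment> \<open>Chosen so that rescaling by \<open>sqrt (2 * a)\<close> turns the integral into
    the real part of the standard normal characteristic function at \<open>t\<close>.\<close>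
  define t where "t = d / sqrt (2 * a)"
  have "(\<integral>x. cos (t * x) \<partial>std_normal_distribution) = Re (char std_normal_distribution t)"
    unfolding char_def
    by (subst integral_Re[symmetric])
       (auto intro!: finite_measure.integrable_const_bound[where B=1] simp: Re_exp prob_space.finite_measure real_distribution.axioms(1) real_dist_normal_dist)
  then have "(\<integral>x. std_normal_density x * cos (t * x) \<partial>lborel) = exp (- t\<^sup>2 / 2)"
    unfolding char_std_normal_distribution
    by (subst (asm) integral_density) (auto simp: Re_exp)
  also have "(\<integral>x. std_normal_density x * cos (t * x) \<partial>lborel)
     = sqrt (2 * a) * (\<integral>x. std_normal_density (sqrt (2 * a) * x) * cos (t * (sqrt (2 * a) * x)) \<partial>lborel)"
    using a by (subst lborel_integral_real_affine[where c = "sqrt (2 * a)" and t = 0]) auto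
  also have "(\<lambda>x. std_normal_density (sqrt (2 * a) * x) * cos (t * (sqrt (2 * a) * x)))
     = (\<lambda>x. 1 / sqrt (2 * pi) * (cos (x * d) * exp (- a * x\<^sup>2)))"
    using a by (auto simp: std_normal_density_def t_def power_mult_distrib fun_eq_iff mult_ac)
  also have "t\<^sup>2 = d\<^sup>2 / (2 * a)" using a by (simp add: t_def power_divide)
  finally have "sqrt (2 * a) * (1 / sqrt (2 * pi)) * (\<integral>x. cos (x * d) * exp (- a * x\<^sup>2) \<partial>lborel) = exp (- (d\<^sup>2 / (2*a)) / 2)"
    by simp
  moreover have "sqrt (2 * a) * (1 / sqrt (2 * pi)) = 1 / sqrt (pi / a)"
    using a by (simp add: real_sqrt_divide real_sqrt_mult field_simps)
  ultimately show ?thesis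
    using a by (simp add: field_simps)
qed

text \<open>Supported in \<open>{- \<delta>..\<delta>}\<close>, so that integrating against it sees
  a characteristic function only near 0. Its Fourier transform \<open>fejer_kernel\<close> is
  nonnegative and decays like an inverse square, which allows interval probabilities to be bounded
  from both sides.\<close>

definition triangle_kernel :: "real \<Rightarrow> real \<Rightarrow> real" where
  "triangle_kernel \<delta> \<tau> = max 0 (1 - \<bar>\<tau>\<bar> / \<delta>)"

definition fejer_kernel :: "real \<Rightarrow> real \<Rightarrow> real" where
  "fejer_kernel \<delta> w = (\<integral>\<tau>. triangle_kernel \<delta> \<tau> * cos (\<tau> * w) \<partial>lborel)"

lemma triangle_kernel_measurable [measurable]: "triangle_kernel \<delta> \<in> borel_measurable borel"
  unfolding triangle_kernel_def by measurable

lemma triangle_kernel_bounds: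
  assumes "\<delta> > 0"
  shows "0 \<le> triangle_kernel \<delta> \<tau>" "triangle_kernel \<delta> \<tau> \<le> 1" "\<bar>\<tau>\<bar> > \<delta> \<Longrightarrow> triangle_kernel \<delta> \<tau> = 0"
    "1 - triangle_kernel \<delta> \<tau> \<le> \<bar>\<tau>\<bar> / \<delta>"
  using assms by (auto simp: triangle_kernel_def max_def field_simps)

lemma integrable_triangle_kernel:
  fixes f :: "real \<Rightarrow> real"
  assumes "\<delta> > 0" and [measurable]: "f \<in> borel_measurable borel" and "\<And>\<tau>. \<bar>f \<tau>\<bar> \<le> 1"
  shows "integrable lborel (\<lambda>\<tau>. triangle_kernel \<delta> \<tau> * f \<tau>)"
proof (rule Bochner_Integration.integrable_bound[where f = "indicat_real {-\<delta>..\<delta>}"])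
  show "AE \<tau> in lborel. norm (triangle_kernel \<delta> \<tau> * f \<tau>) \<le> norm (indicat_real {-\<delta>..\<delta>} \<tau>)"
  proof (intro AE_I2)
    fix \<tau>
    show "norm (triangle_kernel \<delta> \<tau> * f \<tau>) \<le> norm (indicat_real {-\<delta>..\<delta>} \<tau>)"
      using triangle_kernel_bounds[OF assms(1), of \<tau>] assms(3)[of \<tau>]
        mult_mono[of "triangle_kernel \<delta> \<tau>" 1 "\<bar>f \<tau>\<bar>" 1]
      by (cases "\<bar>\<tau>\<bar> > \<delta>") (auto simp: abs_mult indicator_def)
  qed
qed (use assms in auto)

text \<open>Integration by parts on \<open>{0..\<delta>}\<close>, doubled by evenness. Nonnegativity
  and the inverse-square decay are read off from this form.\<close>

lemma fejer_kernel_eq: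
  assumes "\<delta> > 0" "w \<noteq> 0"
  shows "fejer_kernel \<delta> w = 2 * (1 - cos (\<delta> * w)) / (\<delta> * w\<^sup>2)"
proof -
  let ?F = "\<lambda>\<tau>. (1 - \<tau> / \<delta>) * sin (\<tau> * w) / w - cos (\<tau> * w) / (\<delta> * w\<^sup>2)"
  have "has_bochner_integral lborel (\<lambda>\<tau>. indicator {0..\<delta>} \<tau> *\<^sub>R ((1 - \<tau> / \<delta>) * cos (\<tau> * w))) (?F \<delta> - ?F 0)"
  proof (rule has_bochner_integral_FTC_Icc)
    show "(?F has_vector_derivative (1 - \<tau> / \<delta>) * cos (\<tau> * w)) (at \<tau> within {0..\<delta>})" for \<tau>
      unfolding has_real_derivative_iff_has_vector_derivative[symmetric]
      using assms by (auto intro!: derivative_eq_intros simp: field_simps power2_eq_square)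
    show "continuous_on {0..\<delta>} (\<lambda>\<tau>. (1 - \<tau> / \<delta>) * cos (\<tau> * w))"
      using assms by (intro continuous_intros) auto
  qed (use assms in auto)
  also have "(\<lambda>\<tau>. indicator {0..\<delta>} \<tau> *\<^sub>R ((1 - \<tau> / \<delta>) * cos (\<tau> * w)))
      = (\<lambda>\<tau>. indicator {0..} \<tau> *\<^sub>R (triangle_kernel \<delta> \<tau> * cos (\<tau> * w)))"
    using assms by (auto simp: fun_eq_iff indicator_def triangle_kernel_def max_def field_simps)
  finally have "has_bochner_integral lborel (\<lambda>\<tau>. indicator {0..} \<tau> *\<^sub>R (triangle_kernel \<delta> \<tau> * cos (\<tau> * w))) (?F \<delta> - ?F 0)" .
  from has_bochner_integral_even_function[OF this]
  have "has_bochner_integral lborel (\<lambda>\<tau>. triangle_kernel \<delta> \<tau> * cos (\<tau> * w)) (2 * (?F \<delta> - ?F 0))"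
    by (simp add: triangle_kernel_def)
  then have "fejer_kernel \<delta> w = 2 * (?F \<delta> - ?F 0)"
    unfolding fejer_kernel_def by (rule has_bochner_integral_integral_eq)
  also have "\<dots> = 2 * (1 - cos (\<delta> * w)) / (\<delta> * w\<^sup>2)"
    using assms by (simp add: field_simps)
  finally show ?thesis .
qed

lemma fejer_kernel_0:
  assumes "\<delta> > 0"
  shows "fejer_kernel \<delta> 0 = \<delta>"
proof -
  let ?F = "\<lambda>\<tau>. \<tau> - \<tau>\<^sup>2 / (2 * \<delta>)"
  have "has_bochner_integral lborel (\<lambda>\<tau>. indicator {0..\<delta>} \<tau> *\<^sub>R (1 - \<tau> / \<delta>)) (?F \<delta> - ?F 0)"
  proof (rule has_bochner_integral_FTC_Icc)
    show "(?F has_vector_derivative (1 - \<tau> / \<delta>)) (at \<tau> within {0..\<delta>})" for \<tau>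
      unfolding has_real_derivative_iff_has_vector_derivative[symmetric]
      using assms by (auto intro!: derivative_eq_intros simp: field_simps power2_eq_square)
    show "continuous_on {0..\<delta>} (\<lambda>\<tau>. (1 - \<tau> / \<delta>))"
      using assms by (intro continuous_intros) auto
  qed (use assms in auto)
  also have "(\<lambda>\<tau>. indicator {0..\<delta>} \<tau> *\<^sub>R (1 - \<tau> / \<delta>))
      = (\<lambda>\<tau>. indicator {0..} \<tau> *\<^sub>R (triangle_kernel \<delta> \<tau>))"
    using assms by (auto simp: fun_eq_iff indicator_def triangle_kernel_def max_def field_simps)
  finally have "has_bochner_integral lborel (\<lambda>\<tau>. indicator {0..} \<tau> *\<^sub>R (triangle_kernel \<delta> \<tau>)) (?F \<delta> - ?F 0)" .
  from has_bochner_integral_even_function[OF this]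
  have "has_bochner_integral lborel (\<lambda>\<tau>. triangle_kernel \<delta> \<tau>) (2 * (?F \<delta> - ?F 0))"
    by (simp add: triangle_kernel_def)
  then have "fejer_kernel \<delta> 0 = 2 * (?F \<delta> - ?F 0)"
    unfolding fejer_kernel_def by (simp add: has_bochner_integral_integral_eq)
  also have "\<dots> = \<delta>"
    using assms by (simp add: field_simps power2_eq_square)
  finally show ?thesis .
qed

lemma fejer_kernel_nonneg:
  assumes "\<delta> > 0"
  shows "fejer_kernel \<delta> w \<ge> 0"
  by (cases "w = 0") (use assms in \<open>auto simp: fejer_kernel_eq fejer_kernel_0\<close>)

lemma fejer_kernel_le:
  assumes "\<delta> > 0" "w \<noteq> 0"
  shows "fejer_kernel \<delta> w \<le> 4 / (\<delta> * w\<^sup>2)"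
proof -
  have "2 * (1 - z) \<le> 4" if "- 1 \<le> z" for z :: real using that by simp
  from this[OF cos_ge_minus_one] have "2 * (1 - cos (\<delta> * w)) \<le> 4" .
  then show ?thesis
    using assms by (simp add: fejer_kernel_eq divide_right_mono)
qed

lemma fejer_kernel_le_delta:
  assumes "\<delta> > 0"
  shows "fejer_kernel \<delta> w \<le> \<delta>"
proof -
  have "fejer_kernel \<delta> w \<le> fejer_kernel \<delta> 0"
    unfolding fejer_kernel_def
    using triangle_kernel_bounds(1)[OF assms]
    by (intro integral_mono integrable_triangle_kernel assms) (auto intro!: mult_left_le)
  then show ?thesis using fejer_kernel_0[OF assms] by simp
qed

text \<open>On the support of the tent \<open>\<bar>\<tau> * w\<bar> \<le> 1 \<le> pi / 3\<close>,
  so the cosine is at least \<open>1 / 2\<close> and half of the peak value survives.\<close>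

lemma fejer_kernel_ge:
  assumes "\<delta> > 0" "\<bar>\<delta> * w\<bar> \<le> 1"
  shows "fejer_kernel \<delta> w \<ge> \<delta> / 2"
proof -
  have "(1 / 2) * fejer_kernel \<delta> 0 \<le> fejer_kernel \<delta> w"
    unfolding fejer_kernel_def integral_mult_right_zero[symmetric]
  proof (rule integral_mono)
    fix \<tau> :: real
    show "1 / 2 * (triangle_kernel \<delta> \<tau> * cos (\<tau> * 0)) \<le> triangle_kernel \<delta> \<tau> * cos (\<tau> * w)"
    proof (cases "\<bar>\<tau>\<bar> > \<delta>")
      case False
      then have "\<bar>\<tau> * w\<bar> \<le> \<bar>\<delta> * w\<bar>" using assms(1) by (simp add: abs_mult mult_right_mono)
      also note assms(2)
      also have "1 \<le> pi / 3" using pi_gt3 by simp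
      finally have "cos \<bar>\<tau> * w\<bar> \<ge> cos (pi / 3)" by (intro cos_monotone_0_pi_le) auto
      then have "cos (\<tau> * w) \<ge> 1 / 2" by (simp add: cos_60)
      then show ?thesis
        using triangle_kernel_bounds(1)[OF assms(1), of \<tau>] mult_left_mono[of "1/2" "cos (\<tau> * w)" "triangle_kernel \<delta> \<tau>"] by simp
    qed (simp add: triangle_kernel_bounds assms)
  qed (use integrable_triangle_kernel[OF assms(1), of "\<lambda>_. 1 / 2"]
        integrable_triangle_kernel[OF assms(1), of "\<lambda>\<tau>. cos (\<tau> * w)"] in auto)
  then show ?thesis using fejer_kernel_0[OF assms(1)] by simp
qed

lemma mult_right_le_one_le': "(1::real) \<le> y \<Longrightarrow> 0 \<le> x \<Longrightarrow> x \<le> x * y"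
  using mult_left_mono[of 1 y x] by simp

text \<open>Telescoping; it sums the tail of the Fejer kernel over the unit intervals at distance at
  least \<open>L\<close>.\<close>

lemma sums_inverse_product:
  fixes L :: nat assumes "L > 0"
  shows "(\<lambda>j. 1 / (real (L + j) * real (L + Suc j))) sums (1 / real L)"
proof -
  have "(\<lambda>j. 1 / real (L + j) - 1 / real (L + Suc j)) sums (1 / real (L + 0) - 0)"
    by (rule telescope_sums') (use assms in real_asymp)
  also have "(\<lambda>j. 1 / real (L + j) - 1 / real (L + Suc j)) = (\<lambda>j. 1 / (real (L + j) * real (L + Suc j)))"
    using assms by (auto simp: fun_eq_iff field_simps)
  finally show ?thesis by simp
qed

section \<open>Interval probabilities from characteristic functions near zero\<close>

context real_distribution begin

text \<open>Fubini trades the kernel for its Fourier transform: a probability smoothed around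
  \<open>t\<close> becomes an integral of the characteristic function over
  \<open>{- \<delta>..\<delta>}\<close>.\<close>

lemma integral_fejer_kernel:
  assumes "\<delta> > 0"
  shows "integrable M (\<lambda>x. fejer_kernel \<delta> (x - t))"
    and "(\<integral>x. fejer_kernel \<delta> (x - t) \<partial>M)
      = (\<integral>\<tau>. triangle_kernel \<delta> \<tau> * Re (iexp (- \<tau> * t) * char M \<tau>) \<partial>lborel)"
proof -
  interpret p: pair_sigma_finite M lborel ..
  let ?f = "\<lambda>(x, \<tau>). triangle_kernel \<delta> \<tau> * cos (\<tau> * (x - t))"
  have m[measurable]: "?f \<in> borel_measurable (M \<Otimes>\<^sub>M lborel)"
    by measurable
  have int: "integrable (M \<Otimes>\<^sub>M lborel) ?f"
  proof (rule p.Fubini_integrable[OF m])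
    have "(\<integral>\<tau>. norm (triangle_kernel \<delta> \<tau> * cos (\<tau> * (x - t))) \<partial>lborel) \<le> \<delta>" for x
    proof -
      have "(\<integral>\<tau>. norm (triangle_kernel \<delta> \<tau> * cos (\<tau> * (x - t))) \<partial>lborel)
          \<le> (\<integral>\<tau>. triangle_kernel \<delta> \<tau> * cos (\<tau> * 0) \<partial>lborel)"
        using triangle_kernel_bounds(1)[OF assms]
        by (intro integral_mono integrable_norm integrable_triangle_kernel assms)
           (auto intro!: mult_left_le simp: abs_mult)
      then show ?thesis using fejer_kernel_0[OF assms] by (simp add: fejer_kernel_def)
    qed
    then show "integrable M (\<lambda>x. \<integral>\<tau>. norm (?f (x, \<tau>)) \<partial>lborel)"
      by (intro integrable_const_bound[where B = \<delta>]) (auto intro!: AE_I2)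
    show "AE x in M. integrable lborel (\<lambda>\<tau>. ?f (x, \<tau>))"
      using integrable_triangle_kernel[OF assms] by auto
  qed
  show "integrable M (\<lambda>x. fejer_kernel \<delta> (x - t))"
    unfolding fejer_kernel_def using p.integrable_fst[OF int] by simp
  have "(\<integral>x. fejer_kernel \<delta> (x - t) \<partial>M) = (\<integral>\<tau>. (\<integral>x. triangle_kernel \<delta> \<tau> * cos (\<tau> * (x - t)) \<partial>M) \<partial>lborel)"
    unfolding fejer_kernel_def using p.Fubini_integral[OF int] by simp
  also have "\<dots> = (\<integral>\<tau>. triangle_kernel \<delta> \<tau> * Re (iexp (- \<tau> * t) * char M \<tau>) \<partial>lborel)"
  proof (intro Bochner_Integration.integral_cong refl)
    fix \<tau>
    have "Re (iexp (- \<tau> * t) * char M \<tau>) = Re (\<integral>x. iexp (- \<tau> * t) * iexp (\<tau> * x) \<partial>M)"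
      unfolding char_def by (subst integral_mult_right_zero) simp
    also have "\<dots> = (\<integral>x. Re (iexp (- \<tau> * t) * iexp (\<tau> * x)) \<partial>M)"
      by (intro integral_Re[symmetric] integrable_const_bound[where B = 1])
         (auto simp: norm_mult)
    also have "(\<lambda>x. Re (iexp (- \<tau> * t) * iexp (\<tau> * x))) = (\<lambda>x. cos (\<tau> * (x - t)))"
      by (simp add: exp_add[symmetric] fun_eq_iff Re_exp algebra_simps)
    finally show "(\<integral>x. triangle_kernel \<delta> \<tau> * cos (\<tau> * (x - t)) \<partial>M) = triangle_kernel \<delta> \<tau> * Re (iexp (- \<tau> * t) * char M \<tau>)"
      by simp
  qed
  finally show "(\<integral>x. fejer_kernel \<delta> (x - t) \<partial>M)
      = (\<integral>\<tau>. triangle_kernel \<delta> \<tau> * Re (iexp (- \<tau> * t) * char M \<tau>) \<partial>lborel)" .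
qed

text \<open>A concentration inequality of Esseen type: \<open>\<delta> \<le> 1\<close> makes the
  kernel at least \<open>\<delta> / 2\<close> on the unit interval, and the Gaussian majorant of the
  characteristic function is integrated over the whole line.\<close>

lemma prob_interval_le:
  assumes "0 < \<delta>" "\<delta> \<le> 1" "a > 0"
    and char: "\<And>\<tau>. \<bar>\<tau>\<bar> \<le> \<delta> \<Longrightarrow> norm (char M \<tau>) \<le> exp (- a * \<tau>\<^sup>2)"
  shows "prob {t..t+1} \<le> 2 / \<delta> * sqrt (pi / a)"
proof -
  have "prob {t..t+1} * (\<delta> / 2) = (\<integral>x. indicator {t..t+1} x * (\<delta> / 2) \<partial>M)"
    by simp
  also have "\<dots> \<le> (\<integral>x. fejer_kernel \<delta> (x - t) \<partial>M)"
  proof (intro integral_mono integral_fejer_kernel assms)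
    fix x
    have "\<bar>\<delta> * (x - t)\<bar> \<le> 1" if "x \<in> {t..t+1}"
      using that assms(1,2) mult_mono[of \<delta> 1 "\<bar>x - t\<bar>" 1] by (simp add: abs_mult)
    then show "indicator {t..t+1} x * (\<delta> / 2) \<le> fejer_kernel \<delta> (x - t)"
      using fejer_kernel_ge[OF assms(1), of "x - t"] fejer_kernel_nonneg[OF assms(1), of "x - t"]
      by (auto simp: indicator_def)
  qed (auto intro!: integrable_divide integrable_mult_left integrable_real_indicator simp: emeasure_eq_measure)
  also have "\<dots> = (\<integral>\<tau>. triangle_kernel \<delta> \<tau> * Re (iexp (- \<tau> * t) * char M \<tau>) \<partial>lborel)"
    by (rule integral_fejer_kernel[OF assms(1)])
  also have "\<dots> \<le> (\<integral>\<tau>. exp (- a * \<tau>\<^sup>2) \<partial>lborel)"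
  proof (rule integral_mono')
    show "integrable lborel (\<lambda>\<tau>. exp (- a * \<tau>\<^sup>2))"
      using has_bochner_integral_gaussian(1)[OF assms(3)] by (simp add: has_bochner_integral_iff)
    fix \<tau>
    show "triangle_kernel \<delta> \<tau> * Re (iexp (- \<tau> * t) * char M \<tau>) \<le> exp (- a * \<tau>\<^sup>2)"
    proof (cases "\<bar>\<tau>\<bar> > \<delta>")
      case False
      have "Re (iexp (- \<tau> * t) * char M \<tau>) \<le> norm (iexp (- \<tau> * t) * char M \<tau>)"
        by (rule complex_Re_le_cmod)
      also have "\<dots> \<le> exp (- a * \<tau>\<^sup>2)" using char[of \<tau>] False by (simp add: norm_mult)
      finally have "triangle_kernel \<delta> \<tau> * Re (iexp (- \<tau> * t) * char M \<tau>) \<le> triangle_kernel \<delta> \<tau> * exp (- a * \<tau>\<^sup>2)"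
        by (intro mult_left_mono triangle_kernel_bounds assms)
      also have "\<dots> \<le> 1 * exp (- a * \<tau>\<^sup>2)"
        by (intro mult_right_mono triangle_kernel_bounds assms) auto
      finally show ?thesis by simp
    qed (simp add: triangle_kernel_bounds assms)
  qed auto
  also have "\<dots> = sqrt (pi / a)"
    using has_bochner_integral_gaussian(1)[OF assms(3)] by (rule has_bochner_integral_integral_eq)
  finally show ?thesis using assms(1) by (simp add: field_simps)
qed

text \<open>Comparison with a normal law of mean \<open>m\<close> and variance \<open>n * s\<close>,
  whose contribution is of order \<open>1 / sqrt n\<close>. Replacing the tent by 1 costs
  \<open>2 / (\<delta> * n * s)\<close>, the cubic error costs \<open>K / (c\<^sup>2 * n)\<close>;
  both are of the smaller order \<open>1 / n\<close>.\<close>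

lemma integral_fejer_kernel_ge:
  assumes "\<delta> > 0" "n > 0" "K \<ge> 0" "c > 0" "s > 0"
    and close: "\<And>\<tau>. \<bar>\<tau>\<bar> \<le> \<delta> \<Longrightarrow>
      norm (char M \<tau> - iexp (\<tau> * m) * exp (- (n * s / 2) * \<tau>\<^sup>2)) \<le> K * n * \<bar>\<tau>\<bar> ^ 3 * exp (- (c * n) * \<tau>\<^sup>2)"
  shows "(\<integral>x. fejer_kernel \<delta> (x - t) \<partial>M)
    \<ge> sqrt (2 * pi / (n * s)) * exp (- (m - t)\<^sup>2 / (2 * n * s)) - 2 / (\<delta> * n * s) - K / (c\<^sup>2 * n)"
proof -
  let ?E = "\<lambda>\<tau>. exp (- (n * s / 2) * \<tau>\<^sup>2)"
  let ?R = "\<lambda>\<tau>. K * n * \<bar>\<tau>\<bar> ^ 3 * exp (- (c * n) * \<tau>\<^sup>2)"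
  have ns: "n * s / 2 > 0" and cn: "c * n > 0" using assms by auto
  have h1: "has_bochner_integral lborel (\<lambda>\<tau>. cos (\<tau> * (m - t)) * ?E \<tau>)
      (sqrt (pi / (n * s / 2)) * exp (- (m - t)\<^sup>2 / (4 * (n * s / 2))))"
    unfolding has_bochner_integral_iff
  proof
    show "integrable lborel (\<lambda>\<tau>. cos (\<tau> * (m - t)) * ?E \<tau>)"
      using has_bochner_integral_gaussian(1)[OF ns] unfolding has_bochner_integral_iff
      by (rule Bochner_Integration.integrable_bound[OF conjunct1]) (auto simp: abs_mult intro!: mult_left_le_one_le)
  qed (rule integral_cos_gaussian[OF ns])
  have h2: "has_bochner_integral lborel (\<lambda>\<tau>. (1 / \<delta>) * (?E \<tau> * \<bar>\<tau>\<bar>)) ((1 / \<delta>) * (1 / (n * s / 2)))"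
    using has_bochner_integral_gaussian(2)[OF ns, of 0] by (intro has_bochner_integral_mult_right) simp
  have h3: "has_bochner_integral lborel (\<lambda>\<tau>. (K * n) * (exp (- (c * n) * \<tau>\<^sup>2) * \<bar>\<tau>\<bar> ^ 3)) ((K * n) * (1 / (c * n)\<^sup>2))"
    using has_bochner_integral_gaussian(2)[OF cn, of 1]
    by (intro has_bochner_integral_mult_right) (simp add: numeral_3_eq_3 numeral_2_eq_2)
  have h: "has_bochner_integral lborel
     (\<lambda>\<tau>. cos (\<tau> * (m - t)) * ?E \<tau> - (1 / \<delta>) * (?E \<tau> * \<bar>\<tau>\<bar>) - (K * n) * (exp (- (c * n) * \<tau>\<^sup>2) * \<bar>\<tau>\<bar> ^ 3))
     (sqrt (pi / (n * s / 2)) * exp (- (m - t)\<^sup>2 / (4 * (n * s / 2))) - (1 / \<delta>) * (1 / (n * s / 2)) - (K * n) * (1 / (c * n)\<^sup>2))"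
    by (intro has_bochner_integral_diff h1 h2 h3)
  have "sqrt (2 * pi / (n * s)) * exp (- (m - t)\<^sup>2 / (2 * n * s)) - 2 / (\<delta> * n * s) - K / (c\<^sup>2 * n)
    = sqrt (pi / (n * s / 2)) * exp (- (m - t)\<^sup>2 / (4 * (n * s / 2))) - (1 / \<delta>) * (1 / (n * s / 2)) - (K * n) * (1 / (c * n)\<^sup>2)"
    using assms by (simp add: power2_eq_square field_simps)
  also have "\<dots> = (\<integral>\<tau>. cos (\<tau> * (m - t)) * ?E \<tau> - (1 / \<delta>) * (?E \<tau> * \<bar>\<tau>\<bar>) - (K * n) * (exp (- (c * n) * \<tau>\<^sup>2) * \<bar>\<tau>\<bar> ^ 3) \<partial>lborel)"
    using h by (rule has_bochner_integral_integral_eq[symmetric])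
  also have "\<dots> \<le> (\<integral>\<tau>. triangle_kernel \<delta> \<tau> * Re (iexp (- \<tau> * t) * char M \<tau>) \<partial>lborel)"
  proof (rule integral_mono)
    show "integrable lborel (\<lambda>\<tau>. triangle_kernel \<delta> \<tau> * Re (iexp (- \<tau> * t) * char M \<tau>))"
    proof (rule integrable_triangle_kernel[OF assms(1)])
      show "\<bar>Re (iexp (- \<tau> * t) * char M \<tau>)\<bar> \<le> 1" for \<tau>
        using abs_Re_le_cmod[of "iexp (- \<tau> * t) * char M \<tau>"] cmod_char_le_1[of \<tau>]
        by (simp add: norm_mult)
    qed measurable
    fix \<tau> :: real
    let ?k = "triangle_kernel \<delta> \<tau>"
    have k: "0 \<le> ?k" "?k \<le> 1" "1 - ?k \<le> \<bar>\<tau>\<bar> / \<delta>" using triangle_kernel_bounds[OF assms(1)] by auto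
    let ?C = "cos (\<tau> * (m - t))"
    have a1: "(1 - ?k) * ?C * ?E \<tau> \<le> (1 / \<delta>) * (?E \<tau> * \<bar>\<tau>\<bar>)"
    proof -
      have "(1 - ?k) * ?C \<le> (1 - ?k) * 1" using k by (intro mult_left_mono) auto
      then have "(1 - ?k) * ?C \<le> \<bar>\<tau>\<bar> / \<delta>" using k by simp
      then have "(1 - ?k) * ?C * ?E \<tau> \<le> \<bar>\<tau>\<bar> / \<delta> * ?E \<tau>" by (intro mult_right_mono) auto
      then show ?thesis by (simp add: mult_ac)
    qed
    have a2: "?k * (?C * ?E \<tau> - ?R \<tau>) \<le> ?k * Re (iexp (- \<tau> * t) * char M \<tau>)"
    proof (cases "\<bar>\<tau>\<bar> > \<delta>")
      case False
      have "Re (iexp (- \<tau> * t) * (iexp (\<tau> * m) * exp (- (n * s / 2) * \<tau>\<^sup>2))) - Re (iexp (- \<tau> * t) * char M \<tau>)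
        \<le> norm (iexp (- \<tau> * t) * (iexp (\<tau> * m) * exp (- (n * s / 2) * \<tau>\<^sup>2)) - iexp (- \<tau> * t) * char M \<tau>)"
        using complex_Re_le_cmod by (metis minus_complex.simps(1))
      also have "\<dots> = norm (iexp (- \<tau> * t) * (iexp (\<tau> * m) * exp (- (n * s / 2) * \<tau>\<^sup>2) - char M \<tau>))"
        by (simp only: right_diff_distrib)
      also have "\<dots> \<le> ?R \<tau>" using close[of \<tau>] False by (simp add: norm_mult norm_minus_commute)
      finally have "Re (iexp (- \<tau> * t) * (iexp (\<tau> * m) * exp (- (n * s / 2) * \<tau>\<^sup>2))) - ?R \<tau> \<le> Re (iexp (- \<tau> * t) * char M \<tau>)"
        by simp
      also have "iexp (- \<tau> * t) * (iexp (\<tau> * m) * exp (- (n * s / 2) * \<tau>\<^sup>2)) = iexp (\<tau> * (m - t)) * of_real (?E \<tau>)"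
        by (simp add: exp_add[symmetric] algebra_simps flip: exp_of_real)
      also have "Re \<dots> = ?C * ?E \<tau>" by (simp add: Re_exp)
      finally show ?thesis using k by (intro mult_left_mono) auto
    qed (simp add: triangle_kernel_bounds assms)
    have a3: "?k * ?R \<tau> \<le> ?R \<tau>" using k assms by (intro mult_left_le_one_le) auto
    show "?C * ?E \<tau> - (1 / \<delta>) * (?E \<tau> * \<bar>\<tau>\<bar>) - (K * n) * (exp (- (c * n) * \<tau>\<^sup>2) * \<bar>\<tau>\<bar> ^ 3)
        \<le> ?k * Re (iexp (- \<tau> * t) * char M \<tau>)"
      using a1 a2 a3 by (simp add: algebra_simps)
  qed (use h in \<open>simp add: has_bochner_integral_iff\<close>)
  also have "\<dots> = (\<integral>x. fejer_kernel \<delta> (x - t) \<partial>M)"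
    by (rule integral_fejer_kernel(2)[OF assms(1), symmetric])
  finally show ?thesis .
qed

text \<open>The kernel never exceeds \<open>\<delta>\<close>, and beyond distance \<open>L\<close>
  its tail is summed over unit intervals of probability at most \<open>q\<close>. For large
  \<open>L\<close>, a lower bound on the smoothed probability therefore yields one for a genuine
  interval.\<close>

lemma integral_fejer_kernel_le:
  fixes L :: nat
  assumes "\<delta> > 0" "L > 0" and q: "\<And>t. prob {t..t+1} \<le> q"
  shows "(\<integral>x. fejer_kernel \<delta> (x - t) \<partial>M) \<le> \<delta> * prob {t - L..t + L} + 16 * q / (\<delta> * L)"
proof -
  have q0: "q \<ge> 0" using q[of 0] measure_nonneg[of M "{0..0+1}"] by linarith
  \<comment> \<open>The bound \<open>4 / (\<delta> * (x - t)\<^sup>2)\<close> at distance at least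
    \<open>L + j\<close>, with a factor 2 for replacing the square of \<open>L + j\<close> by the
    telescoping product.\<close>
  define c where "c j = 8 / \<delta> * (1 / (real (L + j) * real (L + Suc j)))" for j
  have c0: "c j \<ge> 0" for j using assms(1) by (simp add: c_def)
  have csum: "c sums (8 / \<delta> * (1 / real L))"
    unfolding c_def by (intro sums_mult sums_inverse_product assms)
  let ?I = "\<lambda>j x. indicator {t + real (L + j)..t + real (L + j) + 1} x
      + indicator {t - real (L + j) - 1..t - real (L + j) - 1 + 1} x :: real"
  have "ennreal (\<integral>x. fejer_kernel \<delta> (x - t) \<partial>M) = (\<integral>\<^sup>+x. ennreal (fejer_kernel \<delta> (x - t)) \<partial>M)"
    by (intro nn_integral_eq_integral[symmetric] integral_fejer_kernel assms AE_I2 fejer_kernel_nonneg)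
  also have "\<dots> \<le> (\<integral>\<^sup>+x. ennreal (\<delta> * indicator {t - L..t + L} x) + (\<Sum>j. ennreal (c j * ?I j x)) \<partial>M)"
  proof (rule nn_integral_mono)
    fix x
    show "ennreal (fejer_kernel \<delta> (x - t)) \<le> ennreal (\<delta> * indicator {t - L..t + L} x) + (\<Sum>j. ennreal (c j * ?I j x))"
    proof (cases "\<bar>x - t\<bar> \<le> L")
      case True
      then have "fejer_kernel \<delta> (x - t) \<le> \<delta> * indicator {t - L..t + L} x"
        using fejer_kernel_le_delta[OF assms(1)] by (simp add: indicator_def abs_le_iff)
      then show ?thesis by (intro add_increasing2 ennreal_leI) auto
    next
      case False
      define i where "i = nat \<lfloor>\<bar>x - t\<bar>\<rfloor>"
      have i: "real i \<le> \<bar>x - t\<bar>" "\<bar>x - t\<bar> < real i + 1" unfolding i_def by linarith+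
      have "i \<ge> L" using False unfolding i_def by linarith
      define j where "j = i - L"
      have j: "real (L + j) \<le> \<bar>x - t\<bar>" "\<bar>x - t\<bar> < real (L + j) + 1"
        using i \<open>i \<ge> L\<close> by (auto simp: j_def)
      have Lj: "real (L + j) \<ge> 1" using assms(2) by simp
      have "fejer_kernel \<delta> (x - t) \<le> 4 / (\<delta> * (x - t)\<^sup>2)"
        using False by (intro fejer_kernel_le assms) auto
      also have "\<dots> = 4 / \<delta> * (1 / (\<bar>x - t\<bar> * \<bar>x - t\<bar>))" by (simp add: power2_eq_square)
      also have "\<dots> \<le> 4 / \<delta> * (1 / (real (L + j) * real (L + j)))"
        using j Lj assms(1) by (intro mult_left_mono divide_left_mono mult_mono mult_pos_pos) auto
      also have "\<dots> \<le> 4 / \<delta> * (2 * (1 / (real (L + j) * real (L + Suc j))))"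
      proof (intro mult_left_mono)
        have "1 / real (L + j) \<le> 2 * (1 / real (L + Suc j))"
          using Lj by (simp add: field_simps)
        then have "1 / real (L + j) * (1 / real (L + j)) \<le> 1 / real (L + j) * (2 * (1 / real (L + Suc j)))"
          using Lj by (intro mult_left_mono) auto
        then show "1 / (real (L + j) * real (L + j)) \<le> 2 * (1 / (real (L + j) * real (L + Suc j)))"
          by simp
      qed (use assms(1) in simp)
      also have "\<dots> = c j" by (simp add: c_def)
      also have "\<dots> \<le> c j * ?I j x"
      proof (rule mult_right_le_one_le')
        have "x \<in> {t + real (L + j)..t + real (L + j) + 1} \<or> x \<in> {t - real (L + j) - 1..t - real (L + j) - 1 + 1}"
          using j by auto
        then show "1 \<le> ?I j x"
          by (auto simp: indicator_def)
      qed (rule c0)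
      finally have "ennreal (fejer_kernel \<delta> (x - t)) \<le> ennreal (c j * ?I j x)" by (rule ennreal_leI)
      also have "\<dots> \<le> (\<Sum>j. ennreal (c j * ?I j x))"
        using sum_le_suminf[of "\<lambda>j. ennreal (c j * ?I j x)" "{j}"] by simp
      finally show ?thesis by (intro add_increasing) auto
    qed
  qed
  also have "\<dots> = (\<integral>\<^sup>+x. ennreal (\<delta> * indicator {t - L..t + L} x) \<partial>M) + (\<Sum>j. \<integral>\<^sup>+x. ennreal (c j * ?I j x) \<partial>M)"
    by (subst nn_integral_add, simp, simp, subst nn_integral_suminf) auto
  also have "(\<integral>\<^sup>+x. ennreal (\<delta> * indicator {t - L..t + L} x) \<partial>M) = ennreal (\<delta> * prob {t - L..t + L})"
    using assms(1) by (subst nn_integral_eq_integral)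
      (auto simp: emeasure_eq_measure intro!: integrable_mult_right integrable_real_indicator)
  also have "(\<Sum>j. \<integral>\<^sup>+x. ennreal (c j * ?I j x) \<partial>M) \<le> (\<Sum>j. ennreal (c j * (2 * q)))"
  proof (rule suminf_le)
    fix j
    have "(\<integral>\<^sup>+x. ennreal (c j * ?I j x) \<partial>M) = ennreal (\<integral>x. c j * ?I j x \<partial>M)"
      using c0[of j] by (intro nn_integral_eq_integral)
        (auto intro!: integrable_mult_right Bochner_Integration.integrable_add
          integrable_real_indicator simp: emeasure_eq_measure simp del: mult_eq_0_iff)
    also have "(\<integral>x. c j * ?I j x \<partial>M) = c j * (prob {t + real (L + j)..t + real (L + j) + 1}
       + prob {t - real (L + j) - 1..t - real (L + j) - 1 + 1})"
      by (subst integral_mult_right_zero, subst Bochner_Integration.integral_add)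
         (auto intro!: integrable_real_indicator simp: emeasure_eq_measure)
    also have "\<dots> \<le> c j * (2 * q)"
      using c0[of j] q[of "t + real (L + j)"] q[of "t - real (L + j) - 1"] by (intro mult_left_mono) auto
    finally show "(\<integral>\<^sup>+x. ennreal (c j * ?I j x) \<partial>M) \<le> ennreal (c j * (2 * q))"
      by (simp add: ennreal_leI)
  qed auto
  also have "(\<Sum>j. ennreal (c j * (2 * q))) = ennreal (8 / \<delta> * (1 / real L) * (2 * q))"
    using c0 q0 csum by (intro suminf_ennreal_eq sums_mult2) auto
  also have "ennreal (\<delta> * prob {t - L..t + L}) + ennreal (8 / \<delta> * (1 / real L) * (2 * q))
     = ennreal (\<delta> * prob {t - L..t + L} + 16 * q / (\<delta> * L))"
    using assms q0 by (subst ennreal_plus[symmetric]) auto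
  finally have "ennreal (\<integral>x. fejer_kernel \<delta> (x - t) \<partial>M) \<le> ennreal (\<delta> * prob {t - L..t + L} + 16 * q / (\<delta> * L))"
    by (simp add: add_left_mono)
  then show ?thesis
    using assms q0 by (subst (asm) ennreal_le_iff) auto
qed

end

section \<open>A uniform local limit bound for tilted sums\<close>

text \<open>Scaling by \<open>R\<close> reduces to the unit disc and keeps the factor
  \<open>R ^ (m - 1)\<close>, which in the application is the Gaussian decay of an m-th
  power.\<close>

lemma norm_power_diff_le:
  fixes z w :: complex
  assumes "norm z \<le> R" "norm w \<le> R" "R > 0"
  shows "norm (z ^ m - w ^ m) \<le> m * norm (z - w) * R ^ (m - 1)"
proof (cases m)
  case (Suc k)
  have "norm ((z / R) ^ m - (w / R) ^ m) \<le> m * norm (z / R - w / R)"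
    using assms by (intro norm_power_diff) (auto simp: norm_divide)
  also have "(z / R) ^ m - (w / R) ^ m = (z ^ m - w ^ m) / R ^ m"
    by (simp add: power_divide diff_divide_distrib)
  also have "z / R - w / R = (z - w) / R" by (simp add: diff_divide_distrib)
  finally have "norm (z ^ m - w ^ m) / R ^ m \<le> m * (norm (z - w) / R)"
    using assms(3) by (simp add: norm_divide norm_power)
  then show ?thesis
    using assms(3) by (simp add: Suc field_simps)
qed simp

lemma abs_exp_minus_le: "\<bar>exp (- x) - (1 - x)\<bar> \<le> x\<^sup>2 / 2" if "(x::real) \<ge> 0"
proof -
  obtain t where t: "exp (- x) = (\<Sum>m<2. (- x) ^ m / fact m) + exp t / fact 2 * (- x) ^ 2" "\<bar>t\<bar> \<le> \<bar>- x\<bar>"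
    using Maclaurin_exp_le[of "- x" 2] by blast
  have l: "exp (- x) \<le> 1 - x + x\<^sup>2 / 2"
  proof -
    let ?g = "\<lambda>x::real. 1 - x + x\<^sup>2 / 2 - exp (- x)"
    have "?g 0 \<le> ?g x"
      using that
    proof (rule DERIV_nonneg_imp_nondecreasing)
      fix y :: real assume "0 \<le> y"
      have "(?g has_real_derivative (- 1 + y + exp (- y))) (at y)"
        by (auto intro!: derivative_eq_intros)
      moreover have "- 1 + y + exp (- y) \<ge> 0" using exp_ge_add_one_self[of "- y"] by simp
      ultimately show "\<exists>d. (?g has_real_derivative d) (at y) \<and> 0 \<le> d" by blast
    qed
    then show ?thesis by simp
  qed
  then show ?thesis using exp_ge_add_one_self[of "- x"] by (simp add: abs_le_iff)
qed

context nonneg_random_variable begin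

definition tilted_char :: "real \<Rightarrow> real \<Rightarrow> complex" where
  "tilted_char u \<tau> = (\<integral>x. iexp (\<tau> * X x) * exp (- u * X x) \<partial>M) / laplace_moment 0 u"

definition tilt_measure :: "real \<Rightarrow> 'a measure" where
  "tilt_measure u = density M (\<lambda>x. ennreal (exp (- u * X x) / laplace_moment 0 u))"

lemma prob_space_tilt_measure:
  assumes "u > 0"
  shows "prob_space (tilt_measure u)"
proof
  have "emeasure (tilt_measure u) (space (tilt_measure u)) = (\<integral>\<^sup>+x. ennreal (exp (- u * X x) / laplace_moment 0 u) \<partial>M)"
    unfolding tilt_measure_def by (subst emeasure_density) (auto simp: cong: nn_integral_cong)
  also have "\<dots> = ennreal (\<integral>x. exp (- u * X x) / laplace_moment 0 u \<partial>M)"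
    using integrable_exp_laplace[of u] assms laplace_moment_0_pos[of u]
    by (intro nn_integral_eq_integral) auto
  also have "(\<integral>x. exp (- u * X x) / laplace_moment 0 u \<partial>M) = 1"
    using laplace_moment_0_pos[of u] assms by (simp add: laplace_moment_def)
  finally show "emeasure (tilt_measure u) (space (tilt_measure u)) = 1" by simp
qed

lemma integral_tilt_measure:
  fixes f :: "'a \<Rightarrow> 'b::{banach, second_countable_topology}"
  assumes "u > 0" "f \<in> borel_measurable M"
  shows "(\<integral>x. f x \<partial>tilt_measure u) = (\<integral>x. (exp (- u * X x) / laplace_moment 0 u) *\<^sub>R f x \<partial>M)"
    and "integrable (tilt_measure u) f \<longleftrightarrow> integrable M (\<lambda>x. (exp (- u * X x) / laplace_moment 0 u) *\<^sub>R f x)"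
proof -
  have *: "AE x in M. 0 \<le> exp (- u * X x) / laplace_moment 0 u"
    using laplace_moment_0_pos[of u] assms by (intro AE_I2) simp
  show "(\<integral>x. f x \<partial>tilt_measure u) = (\<integral>x. (exp (- u * X x) / laplace_moment 0 u) *\<^sub>R f x \<partial>M)"
    unfolding tilt_measure_def using assms * by (intro integral_density) auto
  show "integrable (tilt_measure u) f \<longleftrightarrow> integrable M (\<lambda>x. (exp (- u * X x) / laplace_moment 0 u) *\<^sub>R f x)"
    unfolding tilt_measure_def using assms * by (intro integrable_density) auto
qed

text \<open>A majorant of the third absolute central moment of the tilted law, by \<open>\<bar>y -
  m\<bar> ^ 3 \<le> (y + m) ^ 3 \<le> 4 * (y ^ 3 + m ^ 3)\<close> for nonnegative \<open>y\<close>
  and \<open>m\<close>. Being built from Laplace moments, it is continuous in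
  \<open>u\<close>.\<close>

definition tilted_abs3 :: "real \<Rightarrow> real" where
  "tilted_abs3 u = 4 * (laplace_moment 3 u / laplace_moment 0 u + tilted_mean u ^ 3)"

text \<open>Third-order expansion of the characteristic function of the centred tilted law; the
  factor \<open>iexp (- \<tau> * tilted_mean u)\<close> does the centring.\<close>

lemma tilted_char_approx:
  assumes "u > 0"
  shows "norm (iexp (- \<tau> * tilted_mean u) * tilted_char u \<tau> - (1 - \<tau>\<^sup>2 * tilted_variance u / 2))
     \<le> tilted_abs3 u / 6 * \<bar>\<tau>\<bar> ^ 3"
proof -
  interpret T: prob_space "tilt_measure u" by (rule prob_space_tilt_measure[OF assms])
  define m where "m = tilted_mean u"
  have L0: "laplace_moment 0 u > 0" using laplace_moment_0_pos[of u] assms by simp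
  have m0: "m \<ge> 0" using tilted_mean_nonneg[of u] assms by (simp add: m_def)
  have [measurable_cong, simp]: "sets (tilt_measure u) = sets M" by (simp add: tilt_measure_def)
  define D where "D = distr (tilt_measure u) borel (\<lambda>x. X x - m)"
  interpret D: real_distribution D
    unfolding D_def by (rule T.real_distribution_distr) measurable
  have im: "integrable M (\<lambda>x. exp (- u * X x) / laplace_moment 0 u * X x ^ k)" for k
    using integrable_divide[OF integrable_laplace_moment[OF assms, of k], of "laplace_moment 0 u"]
    by (simp add: mult.commute)
  have tk: "integrable (tilt_measure u) (\<lambda>x. X x ^ k)"
       "(\<integral>x. X x ^ k \<partial>tilt_measure u) = laplace_moment k u / laplace_moment 0 u" for k
    using im[of k] integral_tilt_measure[OF assms, of "\<lambda>x. X x ^ k"]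
    by (simp_all add: laplace_moment_def mult.commute)
  have t1: "integrable (tilt_measure u) X" "(\<integral>x. X x \<partial>tilt_measure u) = m"
    using tk[of 1] by (simp_all add: m_def tilted_mean_def)
  have i1: "integrable D (\<lambda>x. x)" unfolding D_def
    using t1 by (subst integrable_distr_eq) auto
  have e1: "D.expectation (\<lambda>x. x) = 0" unfolding D_def
    using t1 by (subst integral_distr) (auto simp: T.prob_space)
  have sq: "(X x - m)\<^sup>2 = X x ^ 2 - 2 * m * X x + m\<^sup>2" for x
    by (simp add: power2_eq_square algebra_simps)
  have i2: "integrable D (\<lambda>x. x\<^sup>2)" unfolding D_def
    using t1 tk[of 2] by (subst integrable_distr_eq) (auto simp: sq)
  have e2: "D.variance (\<lambda>x. x) = tilted_variance u"
    unfolding e1 unfolding D_def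
    using t1 tk[of 2]
    by (subst integral_distr) (auto simp: sq T.prob_space tilted_variance_def m_def[symmetric],
        simp add: power2_eq_square)
  have X0: "AE x in tilt_measure u. 0 \<le> X x"
    unfolding tilt_measure_def using X_nonneg by (subst AE_density) auto
  have cube: "\<bar>X x - m\<bar> ^ 3 \<le> 4 * (X x ^ 3 + m ^ 3)" if "X x \<ge> 0" for x
  proof -
    define y where "y = X x"
    have y: "y \<ge> 0" using that by (simp add: y_def)
    have "\<bar>y - m\<bar> ^ 3 \<le> (y + m) ^ 3" using y m0 by (intro power_mono) auto
    also have "\<dots> \<le> 4 * (y ^ 3 + m ^ 3)"
    proof -
      have "4 * (y ^ 3 + m ^ 3) - (y + m) ^ 3 = 3 * (y + m) * (y - m)\<^sup>2"
        by (simp add: power2_eq_square power3_eq_cube algebra_simps)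
      moreover have "3 * (y + m) * (y - m)\<^sup>2 \<ge> 0" using y m0 by simp
      ultimately show ?thesis by linarith
    qed
    finally show ?thesis by (simp add: y_def)
  qed
  have i3b: "integrable (tilt_measure u) (\<lambda>x. 4 * (X x ^ 3 + m ^ 3))"
    using tk[of 3] by auto
  have i3: "integrable (tilt_measure u) (\<lambda>x. \<bar>X x - m\<bar> ^ 3)"
    using X0 by (intro Bochner_Integration.integrable_bound[OF i3b])
      (auto elim!: eventually_mono dest!: cube)
  have e3: "(\<integral>x. \<bar>X x - m\<bar> ^ 3 \<partial>tilt_measure u) \<le> tilted_abs3 u"
  proof -
    have "(\<integral>x. \<bar>X x - m\<bar> ^ 3 \<partial>tilt_measure u) \<le> (\<integral>x. 4 * (X x ^ 3 + m ^ 3) \<partial>tilt_measure u)"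
      using X0 by (intro integral_mono_AE i3 i3b) (auto elim!: eventually_mono dest!: cube)
    also have "\<dots> = tilted_abs3 u"
      using tk[of 3] by (simp add: T.prob_space tilted_abs3_def m_def)
    finally show ?thesis .
  qed
  have "cmod (char D \<tau> - (1 - \<tau>\<^sup>2 * tilted_variance u / 2))
     \<le> (\<tau>\<^sup>2 / 6) * D.expectation (\<lambda>x. min (6 * x\<^sup>2) (\<bar>\<tau>\<bar> * \<bar>x\<bar> ^ 3))"
    by (rule D.char_approx3[OF i1 e1 i2 e2])
  also have "\<dots> \<le> (\<tau>\<^sup>2 / 6) * (\<bar>\<tau>\<bar> * tilted_abs3 u)"
  proof (rule mult_left_mono)
    have "D.expectation (\<lambda>x. min (6 * x\<^sup>2) (\<bar>\<tau>\<bar> * \<bar>x\<bar> ^ 3)) = (\<integral>x. min (6 * (X x - m)\<^sup>2) (\<bar>\<tau>\<bar> * \<bar>X x - m\<bar> ^ 3) \<partial>tilt_measure u)"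
      unfolding D_def by (subst integral_distr) auto
    also have "\<dots> \<le> (\<integral>x. \<bar>\<tau>\<bar> * \<bar>X x - m\<bar> ^ 3 \<partial>tilt_measure u)"
      using i3 by (intro integral_mono Bochner_Integration.integrable_bound[OF integrable_mult_right[OF i3, of "\<bar>\<tau>\<bar>"]]) auto
    also have "\<dots> \<le> \<bar>\<tau>\<bar> * tilted_abs3 u" using e3 by (simp add: mult_left_mono)
    finally show "D.expectation (\<lambda>x. min (6 * x\<^sup>2) (\<bar>\<tau>\<bar> * \<bar>x\<bar> ^ 3)) \<le> \<bar>\<tau>\<bar> * tilted_abs3 u" .
  qed auto
  also have "\<dots> = tilted_abs3 u / 6 * \<bar>\<tau>\<bar> ^ 3"
    by (simp add: power2_eq_square power3_eq_cube flip: abs_mult)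
  also have "char D \<tau> = iexp (- \<tau> * m) * tilted_char u \<tau>"
  proof -
    have "char D \<tau> = (\<integral>x. iexp (\<tau> * (X x - m)) \<partial>tilt_measure u)"
      unfolding char_def D_def by (subst integral_distr) auto
    also have "\<dots> = (\<integral>x. (exp (- u * X x) / laplace_moment 0 u) *\<^sub>R iexp (\<tau> * (X x - m)) \<partial>M)"
      by (rule integral_tilt_measure[OF assms]) auto
    also have "\<dots> = (\<integral>x. (iexp (- \<tau> * m) / laplace_moment 0 u) * (iexp (\<tau> * X x) * exp (- u * X x)) \<partial>M)"
      by (intro Bochner_Integration.integral_cong refl)
         (simp add: scaleR_conv_of_real right_diff_distrib exp_diff exp_minus field_simps)
    also have "\<dots> = iexp (- \<tau> * m) * tilted_char u \<tau>"
      by (subst integral_mult_right_zero) (simp add: tilted_char_def)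
    finally show ?thesis .
  qed
  finally show ?thesis unfolding m_def .
qed

text \<open>Variance and third moment depend continuously on the tilt, so on a compact interval they
  are bounded, and the variance is bounded away from 0. One choice of constants then serves all
  tilts and all powers \<open>r\<close>.\<close>

lemma tilted_char_uniform_bounds:
  assumes "0 < U" "U \<le> V" and nonconst: "\<And>c. \<not> (AE x in M. X x = c)"
  obtains \<delta> c K s1 s2 where "0 < \<delta>" "\<delta> \<le> 1" "0 < c" "0 \<le> K" "0 < s1"
    "\<And>u. u \<in> {U..V} \<Longrightarrow> s1 \<le> tilted_variance u \<and> tilted_variance u \<le> s2"
    "\<And>u \<tau>. u \<in> {U..V} \<Longrightarrow> \<bar>\<tau>\<bar> \<le> \<delta> \<Longrightarrow> norm (tilted_char u \<tau>) \<le> exp (- c * \<tau>\<^sup>2)"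
    "\<And>u \<tau> r. u \<in> {U..V} \<Longrightarrow> \<bar>\<tau>\<bar> \<le> \<delta> \<Longrightarrow> r \<ge> 1 \<Longrightarrow>
       norm (tilted_char u \<tau> ^ r - iexp (\<tau> * (r * tilted_mean u)) * exp (- (r * tilted_variance u / 2) * \<tau>\<^sup>2))
       \<le> K * r * \<bar>\<tau>\<bar> ^ 3 * exp (- (c * r) * \<tau>\<^sup>2)"
proof -
  have UV: "{U..V} \<subseteq> {0<..}" "{U..V} \<noteq> {}" using assms by auto
  have ne: "laplace_moment 0 u \<noteq> 0" if "u \<in> {U..V}" for u
    using laplace_moment_0_pos[of u] that assms(1) by auto
  have cm: "continuous_on {U..V} (laplace_moment k)" for k
    using continuous_on_subset[OF continuous_laplace_moment UV(1)] .
  have cv: "continuous_on {U..V} tilted_variance"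
    unfolding tilted_variance_def[abs_def] tilted_mean_def[abs_def]
    by (intro continuous_intros cm ballI ne)
  have c3: "continuous_on {U..V} tilted_abs3"
    unfolding tilted_abs3_def[abs_def] tilted_mean_def[abs_def]
    by (intro continuous_intros cm ballI ne)
  obtain ua where ua: "ua \<in> {U..V}" "\<And>u. u \<in> {U..V} \<Longrightarrow> tilted_variance ua \<le> tilted_variance u"
    using continuous_attains_inf[OF compact_Icc UV(2) cv] by blast
  obtain ub where ub: "ub \<in> {U..V}" "\<And>u. u \<in> {U..V} \<Longrightarrow> tilted_variance u \<le> tilted_variance ub"
    using continuous_attains_sup[OF compact_Icc UV(2) cv] by blast
  obtain uc where uc: "uc \<in> {U..V}" "\<And>u. u \<in> {U..V} \<Longrightarrow> tilted_abs3 u \<le> tilted_abs3 uc"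
    using continuous_attains_sup[OF compact_Icc UV(2) c3] by blast
  define s1 s2 K3 where "s1 = tilted_variance ua" and "s2 = tilted_variance ub" and "K3 = tilted_abs3 uc"
  have s1: "s1 > 0" unfolding s1_def using ua(1) assms by (intro tilted_variance_pos nonconst) auto
  have s2: "s2 > 0" using s1 ub(2)[OF ua(1)] by (simp add: s1_def s2_def)
  have K3: "K3 \<ge> 0"
    unfolding K3_def tilted_abs3_def
    using uc(1) assms laplace_moment_nonneg[of 3 uc] laplace_moment_nonneg[of 0 uc] tilted_mean_nonneg[of uc]
    by auto
  \<comment> \<open>\<open>s2 * \<delta> \<le> 1\<close> keeps
    \<open>1 - \<tau>\<^sup>2 * s / 2\<close> nonnegative, and \<open>K3 * \<delta> \<le> s1\<close>
    keeps the cubic error below half of the quadratic term.\<close>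
  define \<delta> where "\<delta> = min 1 (min (1 / (1 + s2)) (s1 / (1 + K3)))"
  have d: "0 < \<delta>" "\<delta> \<le> 1" "\<delta> \<le> 1 / (1 + s2)" "\<delta> \<le> s1 / (1 + K3)"
    using s1 s2 K3 unfolding \<delta>_def by auto
  have d2: "s2 * \<delta> \<le> 1" using mult_left_mono[OF d(3), of "1 + s2"] s2 d(1) by (simp add: algebra_simps)
  have d3: "K3 * \<delta> \<le> s1"
  proof -
    have "(1 + K3) * \<delta> \<le> s1" using d(4) K3 by (simp add: field_simps)
    then show ?thesis using d(1) by (simp add: algebra_simps)
  qed
  \<comment> \<open>What remains of \<open>s / 2 \<ge> s1 / 2\<close> after the cubic error has
    taken \<open>s1 / 4\<close>.\<close>
  define c where "c = s1 / 4"
  \<comment> \<open>\<open>K3 / 6\<close> and \<open>s2\<^sup>2 / 8\<close> are the two Taylor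
    errors; \<open>exp c\<close> pays for the exponent \<open>r - 1\<close> becoming
    \<open>r\<close>.\<close>
  define K where "K = (K3 / 6 + s2\<^sup>2 / 8) * exp c"
  have main: "norm (tilted_char u \<tau>) \<le> exp (- c * \<tau>\<^sup>2)"
      "r \<ge> 1 \<Longrightarrow> norm (tilted_char u \<tau> ^ r - iexp (\<tau> * (r * tilted_mean u)) * exp (- (r * tilted_variance u / 2) * \<tau>\<^sup>2))
       \<le> K * r * \<bar>\<tau>\<bar> ^ 3 * exp (- (c * r) * \<tau>\<^sup>2)"
    if u: "u \<in> {U..V}" and tau: "\<bar>\<tau>\<bar> \<le> \<delta>" for u \<tau> r
  proof -
    define s where "s = tilted_variance u"
    have u0: "u > 0" using u assms(1) by auto
    have s: "s1 \<le> s" "s \<le> s2" using ua(2)[OF u] ub(2)[OF u] by (simp_all add: s_def s1_def s2_def)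
    define m where "m = tilted_mean u"
    define \<psi> where "\<psi> = iexp (- \<tau> * m) * tilted_char u \<tau>"
    have t2: "\<tau>\<^sup>2 \<le> \<delta>"
      using tau d(1,2) mult_mono[of "\<bar>\<tau>\<bar>" \<delta> "\<bar>\<tau>\<bar>" 1] by (simp add: power2_eq_square abs_mult[symmetric])
    have st: "s * \<tau>\<^sup>2 \<le> 1" using mult_mono[OF s(2) t2] d2 s2 by auto
    have ap: "norm (\<psi> - (1 - \<tau>\<^sup>2 * s / 2)) \<le> K3 / 6 * \<bar>\<tau>\<bar> ^ 3"
    proof -
      have "norm (\<psi> - (1 - \<tau>\<^sup>2 * s / 2)) \<le> tilted_abs3 u / 6 * \<bar>\<tau>\<bar> ^ 3"
        unfolding \<psi>_def m_def s_def using tilted_char_approx[OF u0, of \<tau>] by simp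
      also have "\<dots> \<le> K3 / 6 * \<bar>\<tau>\<bar> ^ 3"
        using uc(2)[OF u] by (intro mult_right_mono) (auto simp: K3_def)
      finally show ?thesis .
    qed
    have t3: "K3 / 6 * \<bar>\<tau>\<bar> ^ 3 \<le> s1 / 4 * \<tau>\<^sup>2"
    proof -
      have "K3 * \<bar>\<tau>\<bar> \<le> s1" using mult_left_mono[OF tau K3] d3 by linarith
      then have "K3 * \<bar>\<tau>\<bar> / 6 \<le> s1 / 4" using s1 by linarith
      then have "(K3 * \<bar>\<tau>\<bar> / 6) * \<tau>\<^sup>2 \<le> s1 / 4 * \<tau>\<^sup>2" by (rule mult_right_mono) simp
      then show ?thesis by (simp add: power2_eq_square power3_eq_cube abs_mult[symmetric]) 
    qed
    have n\<psi>: "norm \<psi> \<le> exp (- c * \<tau>\<^sup>2)"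
    proof -
      have "norm \<psi> \<le> norm (complex_of_real (1 - \<tau>\<^sup>2 * s / 2)) + norm (\<psi> - (1 - \<tau>\<^sup>2 * s / 2))"
        using norm_triangle_sub[of \<psi> "complex_of_real (1 - \<tau>\<^sup>2 * s / 2)"] by simp
      also have "norm (complex_of_real (1 - \<tau>\<^sup>2 * s / 2)) = 1 - \<tau>\<^sup>2 * s / 2"
        unfolding norm_of_real using st by (simp add: mult.commute)
      also have "norm (\<psi> - (1 - \<tau>\<^sup>2 * s / 2)) \<le> s1 / 4 * \<tau>\<^sup>2" using ap t3 by linarith
      also have "1 - \<tau>\<^sup>2 * s / 2 + s1 / 4 * \<tau>\<^sup>2 \<le> 1 + (- c * \<tau>\<^sup>2)"
        using mult_right_mono[OF s(1), of "\<tau>\<^sup>2"] by (simp add: c_def algebra_simps)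
      also have "\<dots> \<le> exp (- c * \<tau>\<^sup>2)" by (rule exp_ge_add_one_self)
      finally show ?thesis by simp
    qed
    have "norm (tilted_char u \<tau>) = norm \<psi>" unfolding \<psi>_def by (simp add: norm_mult)
    then show "norm (tilted_char u \<tau>) \<le> exp (- c * \<tau>\<^sup>2)" using n\<psi> by simp
    assume r: "r \<ge> 1"
    define w where "w = complex_of_real (exp (- (s / 2) * \<tau>\<^sup>2))"
    have nw: "norm w \<le> exp (- c * \<tau>\<^sup>2)"
      using s(1) s1 mult_right_mono[of "s1 / 4" "s / 2" "\<tau>\<^sup>2"] by (simp add: w_def c_def)
    have "norm (w - (1 - \<tau>\<^sup>2 * s / 2)) = \<bar>exp (- (s / 2 * \<tau>\<^sup>2)) - (1 - s / 2 * \<tau>\<^sup>2)\<bar>"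
      unfolding w_def norm_of_real[symmetric, where ?'a = complex] by (simp add: mult.commute)
    also have "\<dots> \<le> (s / 2 * \<tau>\<^sup>2)\<^sup>2 / 2" using s(1) s1 by (intro abs_exp_minus_le) auto
    also have "\<dots> = s\<^sup>2 / 8 * (\<bar>\<tau>\<bar> ^ 3 * \<bar>\<tau>\<bar>)"
      by (simp add: power2_eq_square power3_eq_cube flip: abs_mult)
    also have "\<dots> \<le> s2\<^sup>2 / 8 * (\<bar>\<tau>\<bar> ^ 3 * 1)"
      using s s1 tau d(2) by (intro mult_mono power_mono divide_right_mono) auto
    finally have "norm (w - (1 - \<tau>\<^sup>2 * s / 2)) \<le> s2\<^sup>2 / 8 * \<bar>\<tau>\<bar> ^ 3" by simp
    then have "norm (\<psi> - w) \<le> K3 / 6 * \<bar>\<tau>\<bar> ^ 3 + s2\<^sup>2 / 8 * \<bar>\<tau>\<bar> ^ 3"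
      using ap norm_triangle_ineq4[of "\<psi> - (1 - \<tau>\<^sup>2 * s / 2)" "w - (1 - \<tau>\<^sup>2 * s / 2)"] by simp
    then have dw: "norm (\<psi> - w) \<le> (K3 / 6 + s2\<^sup>2 / 8) * \<bar>\<tau>\<bar> ^ 3" by (simp add: algebra_simps)
    have "norm (\<psi> ^ r - w ^ r) \<le> r * norm (\<psi> - w) * exp (- c * \<tau>\<^sup>2) ^ (r - 1)"
      by (rule norm_power_diff_le[OF n\<psi> nw]) simp
    also have "exp (- c * \<tau>\<^sup>2) ^ (r - 1) = exp (c * \<tau>\<^sup>2) * exp (- (c * r) * \<tau>\<^sup>2)"
      using r by (simp add: exp_of_nat_mult[symmetric] exp_add[symmetric] of_nat_diff algebra_simps)
    also have "r * norm (\<psi> - w) * (exp (c * \<tau>\<^sup>2) * exp (- (c * r) * \<tau>\<^sup>2))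
       \<le> r * ((K3 / 6 + s2\<^sup>2 / 8) * \<bar>\<tau>\<bar> ^ 3) * (exp c * exp (- (c * r) * \<tau>\<^sup>2))"
    proof (intro mult_mono mult_nonneg_nonneg)
      have "c * \<tau>\<^sup>2 \<le> c * 1" using t2 d(2) s1 by (intro mult_left_mono) (auto simp: c_def)
      then show "exp (c * \<tau>\<^sup>2) \<le> exp c" by simp
    qed (use dw K3 in auto)
    also have "\<dots> = K * r * \<bar>\<tau>\<bar> ^ 3 * exp (- (c * r) * \<tau>\<^sup>2)" by (simp add: K_def)
    finally have fin: "norm (\<psi> ^ r - w ^ r) \<le> K * r * \<bar>\<tau>\<bar> ^ 3 * exp (- (c * r) * \<tau>\<^sup>2)" .
    have t\<psi>: "tilted_char u \<tau> = iexp (\<tau> * m) * \<psi>"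
      unfolding \<psi>_def by (simp add: mult.assoc[symmetric] exp_add[symmetric])
    have "tilted_char u \<tau> ^ r - iexp (\<tau> * (r * m)) * exp (- (r * s / 2) * \<tau>\<^sup>2)
       = iexp (\<tau> * (r * m)) * (\<psi> ^ r - w ^ r)"
      unfolding t\<psi> w_def
      by (simp add: power_mult_distrib right_diff_distrib exp_of_nat_mult[symmetric] mult_ac flip: of_real_power)
    then have "norm (tilted_char u \<tau> ^ r - iexp (\<tau> * (r * m)) * exp (- (r * s / 2) * \<tau>\<^sup>2)) = norm (\<psi> ^ r - w ^ r)"
      by (simp add: norm_mult)
    with fin show "norm (tilted_char u \<tau> ^ r - iexp (\<tau> * (r * tilted_mean u)) * exp (- (r * tilted_variance u / 2) * \<tau>\<^sup>2))
       \<le> K * r * \<bar>\<tau>\<bar> ^ 3 * exp (- (c * r) * \<tau>\<^sup>2)"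
      by (simp add: m_def s_def)
  qed
  show ?thesis
  proof (rule that[of \<delta> c K s1 s2])
    show "s1 \<le> tilted_variance u \<and> tilted_variance u \<le> s2" if "u \<in> {U..V}" for u
      using ua(2)[OF that] ub(2)[OF that] by (simp add: s1_def s2_def)
  qed (use d s1 K3 main in \<open>auto simp: c_def K_def\<close>)
qed

text \<open>On a window \<open>{a..b}\<close> the factor \<open>exp (u * X)\<close> that undoes the
  tilt lies between \<open>exp (u * a)\<close> and \<open>exp (u * b)\<close>, so the window
  probabilities under the two laws are comparable.\<close>

lemma tilted_law:
  assumes "u > 0"
  defines "D \<equiv> distr (tilt_measure u) borel X"
  shows "real_distribution D" "char D \<tau> = tilted_char u \<tau>"
    and "a \<le> b \<Longrightarrow> prob {x \<in> space M. X x \<in> {a..b}} \<le> laplace_moment 0 u * exp (u * b) * measure D {a..b}"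
    and "a \<le> b \<Longrightarrow> laplace_moment 0 u * exp (u * a) * measure D {a..b} \<le> prob {x \<in> space M. X x \<in> {a..b}}"
proof -
  interpret T: prob_space "tilt_measure u" by (rule prob_space_tilt_measure[OF assms(1)])
  have L0: "laplace_moment 0 u > 0" using laplace_moment_0_pos[of u] assms by simp
  have [measurable_cong, simp]: "sets (tilt_measure u) = sets M" by (simp add: tilt_measure_def)
  have sp: "space (tilt_measure u) = space M" by (simp add: tilt_measure_def)
  show "real_distribution D" unfolding D_def by (rule T.real_distribution_distr) measurable
  have "char D \<tau> = (\<integral>x. iexp (\<tau> * X x) \<partial>tilt_measure u)"
    unfolding char_def D_def by (subst integral_distr) auto
  also have "\<dots> = (\<integral>x. (exp (- u * X x) / laplace_moment 0 u) *\<^sub>R iexp (\<tau> * X x) \<partial>M)"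
    by (rule integral_tilt_measure[OF assms(1)]) auto
  also have "\<dots> = (\<integral>x. iexp (\<tau> * X x) * exp (- u * X x) / laplace_moment 0 u \<partial>M)"
    by (intro Bochner_Integration.integral_cong refl) (simp add: scaleR_conv_of_real field_simps)
  also have "\<dots> = tilted_char u \<tau>"
    by (subst integral_divide_zero) (simp add: tilted_char_def)
  finally show "char D \<tau> = tilted_char u \<tau>" .
  let ?B = "{x \<in> space M. X x \<in> {a..b}}"
  have "measure D {a..b} = measure (tilt_measure u) ?B"
    unfolding D_def by (subst measure_distr) (auto simp: sp vimage_def Int_def conj_commute)
  also have "\<dots> = (\<integral>x. indicator ?B x \<partial>tilt_measure u)" using sp by simp
  also have "\<dots> = (\<integral>x. (exp (- u * X x) / laplace_moment 0 u) *\<^sub>R indicat_real ?B x \<partial>M)"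
    by (rule integral_tilt_measure[OF assms(1)]) auto
  also have "\<dots> = (\<integral>x. exp (- u * X x) * indicat_real ?B x / laplace_moment 0 u \<partial>M)"
    by simp
  also have "\<dots> = (\<integral>x. exp (- u * X x) * indicat_real ?B x \<partial>M) / laplace_moment 0 u"
    by (subst integral_divide_zero) simp
  finally have D: "laplace_moment 0 u * measure D {a..b} = (\<integral>x. exp (- u * X x) * indicat_real ?B x \<partial>M)"
    using L0 by simp
  have int: "integrable M (\<lambda>x. exp (- u * X x) * indicat_real ?B x)"
    using integrable_exp_laplace[of u] assms(1)
    by (intro integrable_real_mult_indicator) auto
  have intc: "integrable M (\<lambda>x. z * indicat_real ?B x)" for z
    by (intro integrable_mult_right integrable_real_indicator) (auto simp: emeasure_eq_measure)
  have "exp (- u * b) * prob ?B = (\<integral>x. exp (- u * b) * indicat_real ?B x \<partial>M)" by simp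
  also have "\<dots> \<le> (\<integral>x. exp (- u * X x) * indicat_real ?B x \<partial>M)"
    using assms(1) by (intro integral_mono intc int) (auto simp: indicator_def)
  finally have "exp (- u * b) * prob ?B \<le> laplace_moment 0 u * measure D {a..b}" unfolding D .
  then have "exp (u * b) * (exp (- u * b) * prob ?B) \<le> exp (u * b) * (laplace_moment 0 u * measure D {a..b})"
    by (rule mult_left_mono) simp
  then show "prob ?B \<le> laplace_moment 0 u * exp (u * b) * measure D {a..b}"
    by (simp add: exp_minus field_simps)
  have "(\<integral>x. exp (- u * X x) * indicat_real ?B x \<partial>M) \<le> (\<integral>x. exp (- u * a) * indicat_real ?B x \<partial>M)"
    using assms(1) by (intro integral_mono intc int) (auto simp: indicator_def)
  also have "\<dots> = exp (- u * a) * prob ?B" by simp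
  finally have "laplace_moment 0 u * measure D {a..b} \<le> exp (- u * a) * prob ?B" unfolding D .
  then have "exp (u * a) * (laplace_moment 0 u * measure D {a..b}) \<le> exp (u * a) * (exp (- u * a) * prob ?B)"
    by (rule mult_left_mono) simp
  then show "laplace_moment 0 u * exp (u * a) * measure D {a..b} \<le> prob ?B"
    by (simp add: exp_minus field_simps)
qed

text \<open>Cut the half-line below \<open>s\<close> into unit windows. Undoing the tilt gains a
  factor \<open>exp (- u)\<close> with each window further to the left, so the sum is
  geometric.\<close>

lemma prob_less_le:
  assumes "u > 0" and q: "\<And>t. measure (distr (tilt_measure u) borel X) {t..t+1} \<le> q"
  shows "prob {x \<in> space M. X x < s} \<le> q / (1 - exp (- u)) * exp (u * s) * laplace_moment 0 u"
proof -
  let ?L = "laplace_moment 0 u"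
  have L0: "?L > 0" using laplace_moment_0_pos[of u] assms by simp
  have q0: "q \<ge> 0" using q[of 0] measure_nonneg order_trans by blast
  let ?A = "\<lambda>j. {x \<in> space M. X x \<in> {s - real j - 1..s - real j}}"
  have su: "(\<lambda>j. exp (- u) ^ j) sums (1 / (1 - exp (- u)))"
    using assms(1) by (intro geometric_sums) auto
  have su': "(\<lambda>j. ?L * exp (u * s) * q * exp (- u) ^ j) sums (?L * exp (u * s) * q * (1 / (1 - exp (- u))))"
    by (rule sums_mult[OF su])
  have le: "prob (?A j) \<le> ?L * exp (u * s) * q * exp (- u) ^ j" for j
  proof -
    have "prob (?A j) \<le> ?L * exp (u * (s - real j)) * measure (distr (tilt_measure u) borel X) {s - real j - 1..s - real j}"
      by (rule tilted_law(3)[OF assms(1)]) simp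
    also have "\<dots> \<le> ?L * exp (u * (s - real j)) * q"
      using q[of "s - real j - 1"] L0 by (intro mult_left_mono) auto
    also have "exp (u * (s - real j)) = exp (u * s) * exp (- u) ^ j"
      by (simp add: exp_of_nat_mult[symmetric] exp_add[symmetric] algebra_simps)
    finally show ?thesis by (simp add: mult_ac)
  qed
  have sm: "summable (\<lambda>j. prob (?A j))"
    by (rule summable_comparison_test'[OF sums_summable[OF su'], of 0]) (use le in auto)
  have "prob {x \<in> space M. X x < s} \<le> prob (\<Union>j. ?A j)"
  proof (rule finite_measure_mono)
    show "{x \<in> space M. X x < s} \<subseteq> (\<Union>j. ?A j)"
    proof
      fix x assume x: "x \<in> {x \<in> space M. X x < s}"
      then have "X x \<in> {s - real (nat \<lfloor>s - X x\<rfloor>) - 1..s - real (nat \<lfloor>s - X x\<rfloor>)}"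
        by auto linarith+
      then show "x \<in> (\<Union>j. ?A j)" using x by blast
    qed
  qed measurable
  also have "\<dots> \<le> (\<Sum>j. prob (?A j))"
    by (rule finite_measure_subadditive_countably[OF _ sm]) auto
  also have "\<dots> \<le> (\<Sum>j. ?L * exp (u * s) * q * exp (- u) ^ j)"
    by (intro suminf_le le sm sums_summable[OF su'])
  also have "\<dots> = q / (1 - exp (- u)) * exp (u * s) * ?L"
    using sums_unique[OF su', symmetric] by (simp add: mult_ac)
  finally show ?thesis .
qed

text \<open>By independence the transforms of the sum are powers. The index set is an arbitrary
  finite set because in the application it is a generation of the tree.\<close>

lemma sum_iid_laplace:
  assumes ind: "indep_vars (\<lambda>_. borel) Y A" and A: "finite A" "A \<noteq> {}"
    and law: "\<forall>i\<in>A. distr M borel (Y i) = distr M borel X"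
    and "u > 0"
  defines "S \<equiv> (\<lambda>x. \<Sum>i\<in>A. Y i x)"
  shows "nonneg_random_variable M S"
    and "nonneg_random_variable.laplace_moment M S 0 u = laplace_moment 0 u ^ card A"
    and "nonneg_random_variable.tilted_char M S u \<tau> = tilted_char u \<tau> ^ card A"
proof -
  have Ym[measurable]: "\<And>i. i \<in> A \<Longrightarrow> Y i \<in> borel_measurable M"
    using ind by (auto simp: indep_vars_def)
  have Y0: "AE x in M. 0 \<le> Y i x" if "i \<in> A" for i
  proof -
    have "AE y in distr M borel X. 0 \<le> y" using X_nonneg by (subst AE_distr_iff) auto
    then have "AE y in distr M borel (Y i). 0 \<le> y" unfolding bspec[OF law that] .
    then show ?thesis using that by (subst (asm) AE_distr_iff) auto
  qed
  show S: "nonneg_random_variable M S"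
  proof unfold_locales
    show "S \<in> borel_measurable M" unfolding S_def by measurable
    have "AE x in M. \<forall>i\<in>A. 0 \<le> Y i x" using A(1) Y0 by (subst AE_ball_countable) (auto intro: countable_finite)
    then show "AE x in M. 0 \<le> S x" unfolding S_def by (auto elim!: eventually_mono intro: sum_nonneg)
  qed
  interpret S: nonneg_random_variable M S by (rule S)
  have E: "(\<integral>x. f (Y i x) \<partial>M) = (\<integral>x. f (X x) \<partial>M)"
    if "i \<in> A" "f \<in> borel_measurable borel" for i and f :: "real \<Rightarrow> complex"
    using integral_distr[OF Ym[OF that(1)] that(2)] integral_distr[OF X_measurable that(2)] bspec[OF law that(1)] by simp
  have int: "integrable M (\<lambda>x. f (Y i x))"
    if "i \<in> A" "f \<in> borel_measurable borel" "integrable M (\<lambda>x. f (X x))" for i and f :: "real \<Rightarrow> complex"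
    using integrable_distr_eq[OF Ym[OF that(1)] that(2)] integrable_distr_eq[OF X_measurable that(2)] bspec[OF law that(1)] that(3) by simp
  \<comment> \<open>One complex identity covers both claims: \<open>\<sigma> = 0\<close> gives the
    Laplace transform, \<open>\<sigma> = \<tau>\<close> the tilted characteristic function.\<close>
  have key: "(\<integral>x. iexp (\<sigma> * S x) * exp (- u * S x) \<partial>M) = (\<integral>x. iexp (\<sigma> * X x) * exp (- u * X x) \<partial>M) ^ card A" for \<sigma>
  proof -
    define f where "f y = iexp (\<sigma> * y) * complex_of_real (exp (- u * y))" for y :: real
    have fm[measurable]: "f \<in> borel_measurable borel" unfolding f_def by measurable
    have fi: "integrable M (\<lambda>x. f (X x))"
      using integrable_exp_laplace[of u] assms(5)
      by (intro Bochner_Integration.integrable_bound[OF integrable_exp_laplace[of u]])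
         (auto simp: f_def norm_mult)
    have "(\<lambda>x. iexp (\<sigma> * S x) * exp (- u * S x)) = (\<lambda>x. \<Prod>i\<in>A. f (Y i x))"
      using A(1) by (simp add: f_def S_def prod.distrib exp_sum sum_distrib_left flip: exp_of_real)
    then have "(\<integral>x. iexp (\<sigma> * S x) * exp (- u * S x) \<partial>M) = (\<integral>x. (\<Prod>i\<in>A. f (Y i x)) \<partial>M)" by simp
    also have "\<dots> = (\<Prod>i\<in>A. \<integral>x. f (Y i x) \<partial>M)"
      using A(1) int[OF _ fm fi]
      by (intro indep_vars_lebesgue_integral indep_vars_compose2[OF ind]) auto
    also have "\<dots> = (\<Prod>i\<in>A. \<integral>x. f (X x) \<partial>M)" by (intro prod.cong refl E fm)
    finally show ?thesis by (simp add: f_def)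
  qed
  have "complex_of_real (S.laplace_moment 0 u) = (\<integral>x. iexp (0 * S x) * exp (- u * S x) \<partial>M)"
    unfolding S.laplace_moment_def by (simp flip: integral_complex_of_real)
  also have "\<dots> = (\<integral>x. iexp (0 * X x) * exp (- u * X x) \<partial>M) ^ card A" by (rule key)
  also have "\<dots> = complex_of_real (laplace_moment 0 u ^ card A)"
    unfolding laplace_moment_def by (simp flip: integral_complex_of_real)
  finally show l: "S.laplace_moment 0 u = laplace_moment 0 u ^ card A" by (simp only: of_real_eq_iff)
  show "S.tilted_char u \<tau> = tilted_char u \<tau> ^ card A"
    unfolding S.tilted_char_def tilted_char_def key l by (simp add: power_divide)
qed

text \<open>Chernoff's bound improved by \<open>1 / sqrt (card A)\<close>, the order of the mass
  that a tilted sum can put on a unit window. The constant depends neither on the tilt in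
  \<open>{U..V}\<close> nor on \<open>s\<close>.\<close>

theorem prob_sum_iid_less_le:
  assumes "0 < U" "U \<le> V" and nonconst: "\<And>c. \<not> (AE x in M. X x = c)"
  shows "\<exists>C>0. \<forall>u\<in>{U..V}. \<forall>(A :: 'i set) Y s. finite A \<longrightarrow> A \<noteq> {} \<longrightarrow> indep_vars (\<lambda>_. borel) Y A \<longrightarrow>
     (\<forall>i\<in>A. distr M borel (Y i) = distr M borel X) \<longrightarrow>
     prob {x \<in> space M. (\<Sum>i\<in>A. Y i x) < s} \<le> C / sqrt (card A) * exp (u * s) * laplace_moment 0 u ^ card A"
proof -
  obtain \<delta> c K s1 s2 where b: "0 < \<delta>" "\<delta> \<le> 1" "0 < c" "0 \<le> K" "0 < s1"
    "\<And>u. u \<in> {U..V} \<Longrightarrow> s1 \<le> tilted_variance u \<and> tilted_variance u \<le> s2"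
    "\<And>u \<tau>. u \<in> {U..V} \<Longrightarrow> \<bar>\<tau>\<bar> \<le> \<delta> \<Longrightarrow> norm (tilted_char u \<tau>) \<le> exp (- c * \<tau>\<^sup>2)"
    "\<And>u \<tau> r. u \<in> {U..V} \<Longrightarrow> \<bar>\<tau>\<bar> \<le> \<delta> \<Longrightarrow> r \<ge> 1 \<Longrightarrow>
       norm (tilted_char u \<tau> ^ r - iexp (\<tau> * (r * tilted_mean u)) * exp (- (r * tilted_variance u / 2) * \<tau>\<^sup>2))
       \<le> K * r * \<bar>\<tau>\<bar> ^ 3 * exp (- (c * r) * \<tau>\<^sup>2)"
    by (rule tilted_char_uniform_bounds[OF assms]) blast
  \<comment> \<open>Concentration constant times the geometric sum over the windows, which is
    largest at the left end \<open>U\<close>.\<close>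
  define C where "C = 2 / \<delta> * sqrt (pi / c) / (1 - exp (- U))"
  have "C > 0" unfolding C_def using b assms(1) by (intro divide_pos_pos mult_pos_pos) auto
  moreover have "prob {x \<in> space M. (\<Sum>i\<in>A. Y i x) < s} \<le> C / sqrt (card A) * exp (u * s) * laplace_moment 0 u ^ card A"
    if u: "u \<in> {U..V}" and A: "finite A" "A \<noteq> {}" and ind: "indep_vars (\<lambda>_. borel) Y A"
      and law: "\<forall>i\<in>A. distr M borel (Y i) = distr M borel X" for u s Y and A :: "'i set"
  proof -
    have u0: "u > 0" using u assms(1) by auto
    define S where "S = (\<lambda>x. \<Sum>i\<in>A. Y i x)"
    note iid = sum_iid_laplace[OF ind A law u0, folded S_def]
    interpret S: nonneg_random_variable M S by (rule iid(1))
    have r: "card A \<ge> 1" using A by (simp add: Suc_leI card_gt_0_iff)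
    define q where "q = 2 / \<delta> * sqrt (pi / (c * card A))"
    have q: "measure (distr (S.tilt_measure u) borel S) {t..t+1} \<le> q" for t
      unfolding q_def
    proof (rule real_distribution.prob_interval_le[OF S.tilted_law(1)[OF u0] b(1,2)])
      show "0 < c * real (card A)" using b(3) r by simp
      fix \<tau> assume "\<bar>\<tau>\<bar> \<le> \<delta>"
      then have "norm (tilted_char u \<tau>) ^ card A \<le> exp (- c * \<tau>\<^sup>2) ^ card A"
        using b(7)[OF u] by (intro power_mono) auto
      then show "norm (char (distr (S.tilt_measure u) borel S) \<tau>) \<le> exp (- (c * card A) * \<tau>\<^sup>2)"
        unfolding S.tilted_law(2)[OF u0] iid(3) by (simp add: norm_power exp_of_nat_mult[symmetric] mult_ac)
    qed
    have "prob {x \<in> space M. S x < s} \<le> q / (1 - exp (- u)) * exp (u * s) * laplace_moment 0 u ^ card A"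
      using S.prob_less_le[OF u0 q] unfolding iid(2) .
    also have "q / (1 - exp (- u)) \<le> q / (1 - exp (- U))"
    proof (rule divide_left_mono)
      show "0 \<le> q" using b by (simp add: q_def)
      show "1 - exp (- U) \<le> 1 - exp (- u)" using u by simp
      show "0 < (1 - exp (- u)) * (1 - exp (- U))" using u0 assms(1) by (intro mult_pos_pos) auto
    qed
    also have "q / (1 - exp (- U)) = C / sqrt (card A)"
      unfolding C_def q_def by (simp add: real_sqrt_divide real_sqrt_mult)
    finally show ?thesis
      unfolding S_def using laplace_moment_nonneg[of 0 u] by (simp add: mult_right_mono)
  qed
  ultimately show ?thesis by blast
qed

text \<open>When \<open>s\<close> is within order \<open>sqrt (card A)\<close> of the tilted mean, a
  window of fixed length just below \<open>s\<close> carries tilted mass of order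
  \<open>1 / sqrt (card A)\<close>, and undoing the tilt there costs only a constant.\<close>

theorem prob_sum_iid_less_ge:
  assumes "0 < U" "U \<le> V" "a > 0" and nonconst: "\<And>c. \<not> (AE x in M. X x = c)"
  shows "\<exists>c'>0. \<exists>r0. \<forall>u\<in>{U..V}. \<forall>(A :: 'i set) Y s. finite A \<longrightarrow> card A \<ge> r0 \<longrightarrow> A \<noteq> {} \<longrightarrow> indep_vars (\<lambda>_. borel) Y A \<longrightarrow>
     (\<forall>i\<in>A. distr M borel (Y i) = distr M borel X) \<longrightarrow> \<bar>s - card A * tilted_mean u\<bar> \<le> a * sqrt (card A) \<longrightarrow>
     c' / sqrt (card A) * exp (u * s) * laplace_moment 0 u ^ card A \<le> prob {x \<in> space M. (\<Sum>i\<in>A. Y i x) < s}"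
proof -
  obtain \<delta> c K s1 s2 where b: "0 < \<delta>" "\<delta> \<le> 1" "0 < c" "0 \<le> K" "0 < s1"
    "\<And>u. u \<in> {U..V} \<Longrightarrow> s1 \<le> tilted_variance u \<and> tilted_variance u \<le> s2"
    "\<And>u \<tau>. u \<in> {U..V} \<Longrightarrow> \<bar>\<tau>\<bar> \<le> \<delta> \<Longrightarrow> norm (tilted_char u \<tau>) \<le> exp (- c * \<tau>\<^sup>2)"
    "\<And>u \<tau> r. u \<in> {U..V} \<Longrightarrow> \<bar>\<tau>\<bar> \<le> \<delta> \<Longrightarrow> r \<ge> 1 \<Longrightarrow>
       norm (tilted_char u \<tau> ^ r - iexp (\<tau> * (r * tilted_mean u)) * exp (- (r * tilted_variance u / 2) * \<tau>\<^sup>2))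
       \<le> K * r * \<bar>\<tau>\<bar> ^ 3 * exp (- (c * r) * \<tau>\<^sup>2)"
    by (rule tilted_char_uniform_bounds[OF assms(1,2) nonconst]) blast
  define C where "C = 2 / \<delta> * sqrt (pi / c)"
  have C: "C > 0" using b by (simp add: C_def)
  have s12: "s1 \<le> s2" using b(6)[of U] assms(2) by auto
  \<comment> \<open>\<open>a + 1\<close> in place of \<open>a\<close>, since the window will be
    centred at \<open>s - L - 1\<close> with \<open>L + 1 \<le> sqrt (card A)\<close>. The prefactor
    uses the largest variance, the exponent the smallest.\<close>
  define c1 where "c1 = sqrt (2 * pi / s2) * exp (- (a + 1)\<^sup>2 / (2 * s1))"
  have c1: "c1 > 0" using s12 b(5) by (simp add: c1_def)
  \<comment> \<open>Large enough for the Fejer tail outside the window to take at most a quarter of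
    the main term.\<close>
  define L where "L = nat \<lceil>64 * C / (\<delta> * c1)\<rceil> + 1"
  have L: "L > 0" by (simp add: L_def)
  have L2: "16 * C / (\<delta> * L) \<le> c1 / 4"
  proof -
    have "64 * C / (\<delta> * c1) \<le> real L" unfolding L_def by linarith
    then show ?thesis using b(1) c1 L by (simp add: field_simps)
  qed
  define E where "E = 2 / (\<delta> * s1) + K / c\<^sup>2"
  have E: "E \<ge> 0" using b by (simp add: E_def)
  \<comment> \<open>The first summand limits the errors of order \<open>1 / card A\<close> to
    another quarter of the main term; the second secures
    \<open>L + 1 \<le> sqrt (card A)\<close>.\<close>
  define r0 where "r0 = nat \<lceil>(4 * E / c1)\<^sup>2\<rceil> + (L + 1)\<^sup>2"
  \<comment> \<open>Half of the main term survives; the exponential is the worst change of measure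
    over the distance \<open>2 * L + 1\<close> from \<open>s\<close> to the far end of the
    window.\<close>
  define c' where "c' = c1 / (2 * \<delta>) * exp (- V * (2 * L + 1))"
  have "c' > 0" using c1 b by (simp add: c'_def)
  moreover have "c' / sqrt (card A) * exp (u * s) * laplace_moment 0 u ^ card A \<le> prob {x \<in> space M. (\<Sum>i\<in>A. Y i x) < s}"
    if u: "u \<in> {U..V}" and A: "finite A" "card A \<ge> r0" "A \<noteq> {}" and ind: "indep_vars (\<lambda>_. borel) Y A"
      and law: "\<forall>i\<in>A. distr M borel (Y i) = distr M borel X"
      and near: "\<bar>s - card A * tilted_mean u\<bar> \<le> a * sqrt (card A)" for u s Y and A :: "'i set"
  proof -
    have u0: "u > 0" using u assms(1) by auto
    define S where "S = (\<lambda>x. \<Sum>i\<in>A. Y i x)"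
    note iid = sum_iid_laplace[OF ind A(1,3) law u0, folded S_def]
    interpret S: nonneg_random_variable M S by (rule iid(1))
    define D where "D = distr (S.tilt_measure u) borel S"
    interpret D: real_distribution D unfolding D_def by (rule S.tilted_law(1)[OF u0])
    define r where "r = card A"
    have r: "r \<ge> 1" using A by (simp add: r_def Suc_leI card_gt_0_iff)
    define R where "R = sqrt (real r)"
    have R: "R > 0" "R\<^sup>2 = r" using r by (auto simp: R_def)
    have RL: "real L + 1 \<le> R"
    proof -
      have "(L + 1)\<^sup>2 \<le> r" using A(2) unfolding r0_def r_def by linarith
      then have "real ((L + 1)\<^sup>2) \<le> real r" by linarith
      then have "(real L + 1)\<^sup>2 \<le> real r" by (simp add: add.commute)
      then show ?thesis unfolding R_def by (rule real_le_rsqrt)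
    qed
    have RE: "4 * E / c1 \<le> R"
    proof -
      have "(4 * E / c1)\<^sup>2 \<le> real (nat \<lceil>(4 * E / c1)\<^sup>2\<rceil>)" by linarith
      also have "\<dots> \<le> real r" using A(2) unfolding r0_def r_def by linarith
      finally show ?thesis unfolding R_def by (rule real_le_rsqrt)
    qed
    define s' where "s' = tilted_variance u"
    have s': "s1 \<le> s'" "s' \<le> s2" using b(6)[OF u] by (auto simp: s'_def)
    have s'0: "s' > 0" using s' b(5) by simp
    define m where "m = r * tilted_mean u"
    \<comment> \<open>The window \<open>{t - L..t + L}\<close> then ends at \<open>s - 1\<close>,
      strictly below \<open>s\<close>.\<close>
    define t where "t = s - real L - 1"
    have mt: "\<bar>m - t\<bar> \<le> (a + 1) * R"
      using near RL unfolding t_def m_def r_def R_def[unfolded r_def] by (simp add: algebra_simps abs_le_iff)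
    have charD: "norm (char D \<tau>) \<le> exp (- (c * r) * \<tau>\<^sup>2)" if "\<bar>\<tau>\<bar> \<le> \<delta>" for \<tau>
    proof -
      have "norm (tilted_char u \<tau>) ^ card A \<le> exp (- c * \<tau>\<^sup>2) ^ card A"
        using b(7)[OF u that] by (intro power_mono) auto
      then show ?thesis
        unfolding D_def S.tilted_law(2)[OF u0] iid(3) r_def by (simp add: norm_power exp_of_nat_mult[symmetric] mult_ac)
    qed
    have q: "D.prob {t..t+1} \<le> C / R" for t
    proof -
      have "D.prob {t..t+1} \<le> 2 / \<delta> * sqrt (pi / (c * r))"
        using b(1,2,3) r charD by (intro D.prob_interval_le) auto
      then show ?thesis by (simp add: C_def R_def real_sqrt_divide real_sqrt_mult)
    qed
    have "sqrt (2 * pi / (r * s')) * exp (- (m - t)\<^sup>2 / (2 * real r * s')) - 2 / (\<delta> * r * s') - K / (c\<^sup>2 * r)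
        \<le> (\<integral>x. fejer_kernel \<delta> (x - t) \<partial>D)"
    proof (rule D.integral_fejer_kernel_ge[OF b(1) _ b(4) b(3) s'0])
      fix \<tau> assume "\<bar>\<tau>\<bar> \<le> \<delta>"
      from b(8)[OF u this r]
      show "norm (char D \<tau> - iexp (\<tau> * m) * exp (- (r * s' / 2) * \<tau>\<^sup>2)) \<le> K * r * \<bar>\<tau>\<bar> ^ 3 * exp (- (c * r) * \<tau>\<^sup>2)"
        unfolding D_def S.tilted_law(2)[OF u0] iid(3) r_def m_def s'_def by simp
    qed (use r in simp)
    also have "\<dots> \<le> \<delta> * D.prob {t - L..t + L} + 16 * (C / R) / (\<delta> * L)"
      by (rule D.integral_fejer_kernel_le[OF b(1) L q])
    finally have main: "sqrt (2 * pi / (r * s')) * exp (- (m - t)\<^sup>2 / (2 * real r * s')) - 2 / (\<delta> * r * s') - K / (c\<^sup>2 * r)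
       - 16 * (C / R) / (\<delta> * L) \<le> \<delta> * D.prob {t - L..t + L}" by simp
    have m1: "c1 / R \<le> sqrt (2 * pi / (r * s')) * exp (- (m - t)\<^sup>2 / (2 * real r * s'))"
    proof -
      have "(m - t)\<^sup>2 \<le> ((a + 1) * R)\<^sup>2" using mt by (metis abs_ge_zero power2_abs power_mono)
      then have "(m - t)\<^sup>2 / (2 * real r * s') \<le> ((a + 1) * R)\<^sup>2 / (2 * real r * s1)"
        using s' b(5) r by (intro frac_le) auto
      also have "\<dots> = (a + 1)\<^sup>2 / (2 * s1)" using R r by (simp add: power_mult_distrib)
      finally have "exp (- (a + 1)\<^sup>2 / (2 * s1)) \<le> exp (- (m - t)\<^sup>2 / (2 * real r * s'))" by simp
      moreover have "sqrt (2 * pi / s2) / R \<le> sqrt (2 * pi / (r * s'))"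
      proof -
        have "2 * pi / (s2 * r) \<le> 2 * pi / (r * s')"
          using s' s'0 r by (intro divide_left_mono) (auto simp: mult.commute)
        then show ?thesis by (simp add: R_def flip: real_sqrt_divide)
      qed
      ultimately have "sqrt (2 * pi / s2) / R * exp (- (a + 1)\<^sup>2 / (2 * s1)) \<le> sqrt (2 * pi / (r * s')) * exp (- (m - t)\<^sup>2 / (2 * real r * s'))"
        using s'0 r by (intro mult_mono) auto
      then show ?thesis by (simp add: c1_def)
    qed
    have m2: "2 / (\<delta> * r * s') + K / (c\<^sup>2 * r) \<le> (c1 / 4) / R"
    proof -
      have "2 / (\<delta> * r * s') \<le> 2 / (\<delta> * r * s1)"
        using s' b(1,5) r by (intro divide_left_mono) auto
      then have "2 / (\<delta> * r * s') + K / (c\<^sup>2 * r) \<le> E / r"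
        by (simp add: E_def add_divide_distrib mult.commute mult.left_commute)
      also have "\<dots> = E / R / R" by (simp add: R(2)[symmetric] power2_eq_square)
      also have "\<dots> \<le> (c1 / 4) / R"
        using RE R c1 by (intro divide_right_mono) (auto simp: field_simps)
      finally show ?thesis .
    qed
    have m3: "16 * (C / R) / (\<delta> * L) \<le> (c1 / 4) / R"
      using divide_right_mono[OF L2, of R] R by (simp add: mult.commute)
    have "c1 / R - (c1 / 4) / R - (c1 / 4) / R \<le> \<delta> * D.prob {t - L..t + L}"
      using main m1 m2 m3 by linarith
    then have pD: "c1 / (2 * \<delta>) / R \<le> D.prob {t - L..t + L}"
      using b(1) R(1) by (simp add: field_simps)
    have "c' / R * exp (u * s) * laplace_moment 0 u ^ r
        = laplace_moment 0 u ^ r * (exp (u * s) * exp (- V * (2 * L + 1))) * (c1 / (2 * \<delta>) / R)"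
      by (simp add: c'_def)
    also have "\<dots> \<le> laplace_moment 0 u ^ r * exp (u * (t - L)) * D.prob {t - L..t + L}"
    proof (intro mult_mono)
      have "u * (2 * L + 1) \<le> V * (2 * L + 1)" using u by (intro mult_right_mono) auto
      then show "exp (u * s) * exp (- V * (2 * L + 1)) \<le> exp (u * (t - L))"
        unfolding t_def exp_add[symmetric] by (simp add: algebra_simps)
    qed (use pD laplace_moment_nonneg[of 0 u] c1 b(1) R in auto)
    also have "\<dots> \<le> prob {x \<in> space M. S x \<in> {t - L..t + L}}"
      using S.tilted_law(4)[OF u0, of "t - L" "t + L"] unfolding iid(2) D_def r_def by simp
    also have "\<dots> \<le> prob {x \<in> space M. S x < s}"
      by (rule finite_measure_mono) (auto simp: t_def)
    finally show ?thesis unfolding S_def r_def R_def .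
  qed
  ultimately show ?thesis by blast
qed

end

section \<open>The space of offspring arrays\<close>

abbreviation tree_space :: "(nat list \<Rightarrow> nat) measure" where
  "tree_space \<equiv> PiM UNIV (\<lambda>_. count_space UNIV)"

abbreviation tree_gen :: "nat \<Rightarrow> (nat list \<Rightarrow> nat) \<Rightarrow> nat list set" where
  "tree_gen \<equiv> gw_generation (\<lambda>v t. t v)"

abbreviation tree_Z :: "nat \<Rightarrow> (nat list \<Rightarrow> nat) \<Rightarrow> nat" where
  "tree_Z \<equiv> gw_Z (\<lambda>v t. t v)"

definition subtree :: "nat list \<Rightarrow> (nat list \<Rightarrow> nat) \<Rightarrow> nat list \<Rightarrow> nat" where
  "subtree v t = (\<lambda>w. t (v @ w))"

lemma gw_generation_eq_tree: "gw_generation N n x = tree_gen n (\<lambda>v. N v x)"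
  by (induction n) auto

lemma gw_Z_eq_tree: "gw_Z N n x = tree_Z n (\<lambda>v. N v x)"
  by (simp add: gw_Z_def gw_generation_eq_tree[of N])

lemma gw_W_eq_tree: "gw_W p N x = gw_W p (\<lambda>v t. t v) (\<lambda>v. N v x)"
  by (simp add: gw_W_def gw_Z_eq_tree[of N])

lemma length_tree_gen: "v \<in> tree_gen n t \<Longrightarrow> length v = n"
  by (induction n arbitrary: v) auto

lemma tree_gen_Suc: "tree_gen (Suc n) t = (\<Union>v\<in>tree_gen n t. (\<lambda>i. v @ [i]) ` {..<t v})"
  by auto

lemma finite_tree_gen [simp]: "finite (tree_gen n t)"
  by (induction n) (simp_all add: tree_gen_Suc del: gw_generation.simps(2))

text \<open>Membership in a generation is decided by offspring numbers on strictly earlier levels.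
  This locality separates the first \<open>n\<close> levels from the subtrees rooted in generation
  \<open>n\<close>.\<close>

lemma tree_gen_cong:
  assumes "\<And>v. length v < n \<Longrightarrow> t v = s v" "k \<le> n"
  shows "tree_gen k t = tree_gen k s"
  using assms(2)
proof (induction k)
  case (Suc k)
  then have IH: "tree_gen k t = tree_gen k s" by simp
  have "t v = s v" if "v \<in> tree_gen k s" for v
    using length_tree_gen[OF that] Suc.prems by (intro assms) auto
  then show ?case unfolding tree_gen_Suc IH by auto
qed simp

lemma tree_Z_0 [simp]: "tree_Z 0 t = 1"
  by (simp add: gw_Z_def)

lemma tree_Z_Suc: "tree_Z (Suc n) t = (\<Sum>v\<in>tree_gen n t. t v)"
proof -
  have "tree_Z (Suc n) t = (\<Sum>v\<in>tree_gen n t. card ((\<lambda>i. v @ [i]) ` {..<t v}))"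
    unfolding gw_Z_def tree_gen_Suc
    by (rule card_UN_disjoint) auto
  also have "\<dots> = (\<Sum>v\<in>tree_gen n t. t v)"
    by (intro sum.cong refl, subst card_image) (auto simp: inj_on_def)
  finally show ?thesis .
qed

lemma tree_gen_add: "tree_gen (n + k) t = (\<Union>v\<in>tree_gen n t. (@) v ` tree_gen k (subtree v t))"
proof (induction k)
  case (Suc k)
  have "tree_gen (n + Suc k) t = (\<Union>u\<in>tree_gen (n + k) t. (\<lambda>i. u @ [i]) ` {..<t u})"
    using tree_gen_Suc[of "n + k" t] by simp
  also have "\<dots> = (\<Union>v\<in>tree_gen n t. (@) v ` (\<Union>w\<in>tree_gen k (subtree v t). (\<lambda>i. w @ [i]) ` {..<subtree v t w}))"
    unfolding Suc by (auto simp: subtree_def image_iff)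
  finally show ?case unfolding tree_gen_Suc .
qed auto

lemma tree_Z_add: "tree_Z (n + k) t = (\<Sum>v\<in>tree_gen n t. tree_Z k (subtree v t))"
proof -
  have "tree_Z (n + k) t = (\<Sum>v\<in>tree_gen n t. card ((@) v ` tree_gen k (subtree v t)))"
    unfolding gw_Z_def tree_gen_add
  proof (rule card_UN_disjoint)
    show "\<forall>v\<in>tree_gen n t. \<forall>w\<in>tree_gen n t. v \<noteq> w \<longrightarrow>
        (@) v ` tree_gen k (subtree v t) \<inter> (@) w ` tree_gen k (subtree w t) = {}"
      by (auto dest!: length_tree_gen)
  qed auto
  also have "\<dots> = (\<Sum>v\<in>tree_gen n t. tree_Z k (subtree v t))"
    unfolding gw_Z_def by (intro sum.cong refl card_image) (auto simp: inj_on_def)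
  finally show ?thesis .
qed

lemma measurable_tree_component [measurable]: "(\<lambda>t. t v) \<in> tree_space \<rightarrow>\<^sub>M count_space UNIV"
  by measurable

lemma measurable_subtree [measurable]: "subtree v \<in> tree_space \<rightarrow>\<^sub>M tree_space"
  unfolding subtree_def[abs_def] by (rule measurable_PiM_single') (auto simp: space_PiM)

lemma pred_in_tree_gen [measurable]: "Measurable.pred tree_space (\<lambda>t. v \<in> tree_gen n t)"
proof (induction n arbitrary: v)
  case (Suc n)
  note Suc[measurable]
  have "v \<in> tree_gen (Suc n) t \<longleftrightarrow> v \<noteq> [] \<and> butlast v \<in> tree_gen n t \<and> last v < t (butlast v)" for t
    by (cases v rule: rev_cases) auto
  then show ?case by simp measurable
qed simp

lemma measurable_tree_gen [measurable]: "tree_gen n \<in> tree_space \<rightarrow>\<^sub>M count_space (Collect finite)"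
proof (subst measurable_count_space_eq_countable)
  show "countable (Collect finite :: nat list set set)" by (rule countable_Collect_finite)
  have "tree_gen n -` {A} \<inter> space tree_space \<in> sets tree_space" for A
  proof -
    have "tree_gen n -` {A} \<inter> space tree_space = {t \<in> space tree_space. \<forall>v. v \<in> tree_gen n t \<longleftrightarrow> v \<in> A}" by auto
    also have "\<dots> \<in> sets tree_space" by measurable
    finally show ?thesis .
  qed
  then show "tree_gen n \<in> space tree_space \<rightarrow> Collect finite \<and>
      (\<forall>a\<in>Collect finite. tree_gen n -` {a} \<inter> space tree_space \<in> sets tree_space)"
    by auto
qed

lemma measurable_tree_Z [measurable]: "tree_Z n \<in> tree_space \<rightarrow>\<^sub>M count_space UNIV"
  unfolding gw_Z_def[abs_def] by (rule measurable_compose[OF measurable_tree_gen]) simp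

text \<open>A generation takes only countably many values, so sums, products and probabilities
  indexed by it reduce to fixed finite index sets.\<close>

lemma measurable_gen_compose:
  assumes "g \<in> K \<rightarrow>\<^sub>M tree_space" "\<And>A. finite A \<Longrightarrow> f A \<in> K \<rightarrow>\<^sub>M L"
  shows "(\<lambda>x. f (tree_gen n (g x)) x) \<in> K \<rightarrow>\<^sub>M L"
proof (rule measurable_compose_countable'[where I = "Collect finite"])
  show "(\<lambda>x. tree_gen n (g x)) \<in> K \<rightarrow>\<^sub>M count_space (Collect finite)"
    using assms(1) measurable_tree_gen by (rule measurable_compose)
  show "countable (Collect finite :: nat list set set)" by (rule countable_Collect_finite)
qed (use assms(2) in auto)

lemma measurable_tree_W [measurable]: "gw_W p (\<lambda>v t. t v) \<in> borel_measurable tree_space"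
  unfolding gw_W_def[abs_def] by measurable

context galton_watson begin

definition tree :: "'a \<Rightarrow> nat list \<Rightarrow> nat" where
  "tree x = (\<lambda>v. N v x)"

lemma measurable_offspring [measurable]: "N v \<in> M \<rightarrow>\<^sub>M count_space UNIV"
  using offspring_indep by (auto simp: indep_vars_def)

lemma measurable_tree [measurable]: "tree \<in> M \<rightarrow>\<^sub>M tree_space"
  unfolding tree_def by (rule measurable_PiM_single') auto

lemma distr_tree: "distr M tree_space tree = PiM UNIV (\<lambda>_. measure_pmf p)"
  using indep_vars_iff_distr_eq_PiM'[of UNIV N "\<lambda>_. count_space UNIV"] offspring_indep
  by (simp add: offspring_distr tree_def[abs_def] restrict_UNIV)

lemma galton_watson_subtree: "galton_watson M p (\<lambda>w. N (v @ w))"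
proof unfold_locales
  have "indep_vars (\<lambda>w. PiM {v @ w} (\<lambda>_. count_space UNIV)) (\<lambda>w x. restrict (\<lambda>i. N i x) {v @ w}) UNIV"
    by (rule indep_vars_restrict[OF offspring_indep]) (auto simp: disjoint_family_on_def)
  then have "indep_vars (\<lambda>_. count_space UNIV) (\<lambda>w x. (\<lambda>r. r (v @ w)) (restrict (\<lambda>i. N i x) {v @ w})) UNIV"
    by (rule indep_vars_compose2) auto
  then have "indep_vars (\<lambda>_. count_space UNIV) (\<lambda>w x. N (v @ w) x) UNIV" by simp
  then show "indep_vars (\<lambda>_. count_space UNIV) (\<lambda>w. N (v @ w)) UNIV" .
qed (rule offspring_distr)

lemma distr_subtree: "distr M tree_space (\<lambda>x. subtree v (tree x)) = distr M tree_space tree"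
proof -
  interpret s: galton_watson M p "\<lambda>w. N (v @ w)" by (rule galton_watson_subtree)
  have "s.tree = (\<lambda>x. subtree v (tree x))"
    by (simp add: s.tree_def tree_def subtree_def fun_eq_iff)
  then show ?thesis using s.distr_tree distr_tree by simp
qed

text \<open>Offspring numbers below level \<open>n\<close> are independent of those from
  \<open>n\<close> on. A function that reads its first argument only below \<open>n\<close> and its
  second only from \<open>n\<close> on may thus be evaluated at two independent trees; this plays
  the part of conditioning on generation \<open>n\<close>.\<close>

lemma nn_integral_split_levels:
  assumes f [measurable]: "f \<in> borel_measurable (tree_space \<Otimes>\<^sub>M tree_space)"
    and loc: "\<And>t t' s s'. (\<And>v. length v < n \<Longrightarrow> t v = s v) \<Longrightarrow> (\<And>v. length v \<ge> n \<Longrightarrow> t' v = s' v) \<Longrightarrow> f (t, t') = f (s, s')"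
  shows "(\<integral>\<^sup>+x. f (tree x, tree x) \<partial>M) = (\<integral>\<^sup>+x. (\<integral>\<^sup>+y. f (tree x, tree y) \<partial>M) \<partial>M)"
proof -
  let ?A = "{v :: nat list. length v < n}" and ?B = "{v :: nat list. length v \<ge> n}"
  \<comment> \<open>Coordinates outside \<open>I\<close> are padded with 0, so that both halves live
    in \<open>tree_space\<close>; by \<open>loc\<close> the padding is never read.\<close>
  let ?e = "\<lambda>(I :: nat list set) r v. if v \<in> I then r v else (0::nat)"
  have e: "?e I \<in> PiM I (\<lambda>_. count_space UNIV) \<rightarrow>\<^sub>M tree_space" for I
  proof (rule measurable_PiM_single')
    show "(\<lambda>r. ?e I r v) \<in> PiM I (\<lambda>_. count_space UNIV) \<rightarrow>\<^sub>M count_space UNIV" for v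
      by (cases "v \<in> I") auto
  qed auto
  have "indep_var (PiM ?A (\<lambda>_. count_space UNIV)) (\<lambda>x. restrict (\<lambda>i. N i x) ?A)
                  (PiM ?B (\<lambda>_. count_space UNIV)) (\<lambda>x. restrict (\<lambda>i. N i x) ?B)"
    by (rule indep_var_restrict[OF offspring_indep]) auto
  from indep_var_compose[OF this e[of ?A] e[of ?B]]
  have ind: "indep_var tree_space (\<lambda>x. ?e ?A (tree x)) tree_space (\<lambda>x. ?e ?B (tree x))"
    by (rule back_subst[of "\<lambda>(X, Y). indep_var tree_space X tree_space Y" "(a, b)" "(c, d)" for a b c d, simplified])
       (auto simp: fun_eq_iff tree_def)
  have m: "(\<lambda>x. ?e I (tree x)) \<in> M \<rightarrow>\<^sub>M tree_space" for I
    by (rule measurable_PiM_single') (auto simp: tree_def)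
  note mA[measurable] = m[of ?A] and mB[measurable] = m[of ?B]
  interpret B: prob_space "distr M tree_space (\<lambda>x. ?e ?B (tree x))" by (rule prob_space_distr) measurable
  have "(\<integral>\<^sup>+x. f (tree x, tree x) \<partial>M) = (\<integral>\<^sup>+x. f (?e ?A (tree x), ?e ?B (tree x)) \<partial>M)"
    by (intro nn_integral_cong loc) auto
  also have "\<dots> = (\<integral>\<^sup>+z. f z \<partial>distr M (tree_space \<Otimes>\<^sub>M tree_space) (\<lambda>x. (?e ?A (tree x), ?e ?B (tree x))))"
    by (subst nn_integral_distr[OF measurable_Pair[OF mA mB]]) auto
  also have "distr M (tree_space \<Otimes>\<^sub>M tree_space) (\<lambda>x. (?e ?A (tree x), ?e ?B (tree x)))
      = distr M tree_space (\<lambda>x. ?e ?A (tree x)) \<Otimes>\<^sub>M distr M tree_space (\<lambda>x. ?e ?B (tree x))"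
    using ind unfolding indep_var_distribution_eq by simp
  also have "(\<integral>\<^sup>+z. f z \<partial>\<dots>) = (\<integral>\<^sup>+s. (\<integral>\<^sup>+s'. f (s, s') \<partial>distr M tree_space (\<lambda>x. ?e ?B (tree x))) \<partial>distr M tree_space (\<lambda>x. ?e ?A (tree x)))"
    by (subst B.nn_integral_fst[symmetric]) auto
  also have "\<dots> = (\<integral>\<^sup>+x. (\<integral>\<^sup>+y. f (?e ?A (tree x), ?e ?B (tree y)) \<partial>M) \<partial>M)"
  proof -
    have i: "(\<integral>\<^sup>+s'. f (s, s') \<partial>distr M tree_space (\<lambda>x. ?e ?B (tree x))) = (\<integral>\<^sup>+y. f (s, ?e ?B (tree y)) \<partial>M)" for s
    proof (rule nn_integral_distr[OF mB])
      have "(\<lambda>s'. f (s, s')) \<in> borel_measurable tree_space"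
        by (rule measurable_compose[OF _ f]) (simp add: space_PiM)
      then show "(\<lambda>s'. f (s, s')) \<in> borel_measurable (distr M tree_space (\<lambda>x. ?e ?B (tree x)))"
        by simp
    qed
    have "(\<lambda>s. \<integral>\<^sup>+s'. f (s, s') \<partial>distr M tree_space (\<lambda>x. ?e ?B (tree x))) \<in> borel_measurable tree_space"
      by measurable
    then have "(\<lambda>s. \<integral>\<^sup>+s'. f (s, s') \<partial>distr M tree_space (\<lambda>x. ?e ?B (tree x)))
        \<in> borel_measurable (distr M tree_space (\<lambda>x. ?e ?A (tree x)))" by simp
    from nn_integral_distr[OF mA this] show ?thesis unfolding i .
  qed
  also have "\<dots> = (\<integral>\<^sup>+x. (\<integral>\<^sup>+y. f (tree x, tree y) \<partial>M) \<partial>M)"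
    by (intro nn_integral_cong loc) auto
  finally show ?thesis .
qed

text \<open>Words extending distinct prefixes of equal length are distinct, so these subtrees read
  disjoint blocks of coordinates.\<close>

lemma indep_vars_subtrees: "indep_vars (\<lambda>_. tree_space) (\<lambda>v x. subtree v (tree x)) {v. length v = n}"
proof -
  let ?K = "\<lambda>v :: nat list. range ((@) v)"
  have "disjoint_family_on ?K {v. length v = n}"
    by (auto simp: disjoint_family_on_def)
  then have "indep_vars (\<lambda>v. PiM (?K v) (\<lambda>_. count_space UNIV)) (\<lambda>v x. restrict (\<lambda>i. N i x) (?K v)) {v. length v = n}"
    by (intro indep_vars_restrict[OF offspring_indep]) auto
  then have "indep_vars (\<lambda>_. tree_space) (\<lambda>v x. (\<lambda>r w. r (v @ w)) (restrict (\<lambda>i. N i x) (?K v))) {v. length v = n}"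
  proof (rule indep_vars_compose2)
    show "(\<lambda>r w. r (v @ w)) \<in> PiM (?K v) (\<lambda>_. count_space UNIV) \<rightarrow>\<^sub>M tree_space" for v
      by (rule measurable_PiM_single') (auto simp: space_PiM)
  qed
  then show ?thesis by (simp add: subtree_def tree_def)
qed

end

section \<open>Moments of sums of independent variables\<close>

lemma abs_le_imp_sq_le: "\<bar>y :: real\<bar> \<le> B \<Longrightarrow> y\<^sup>2 \<le> B\<^sup>2"
  by (metis abs_ge_zero power2_abs power_mono)

lemma (in prob_space) prob_eq_integral_of_bool:
  assumes [measurable]: "Measurable.pred M P"
  shows "prob {x \<in> space M. P x} = (\<integral>x. of_bool (P x) \<partial>M)"
proof -
  have "(\<integral>x. of_bool (P x) \<partial>M) = (\<integral>x. indicat_real {x \<in> space M. P x} x \<partial>M)"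
    by (intro Bochner_Integration.integral_cong) (auto simp: indicator_def)
  then show ?thesis by simp
qed

lemma (in prob_space) sum_indep_second_moment_le:
  fixes X :: "'i \<Rightarrow> 'a \<Rightarrow> real" and v B :: real
  assumes "finite A" "indep_vars (\<lambda>_. borel) X A"
    and "\<And>i x. i \<in> A \<Longrightarrow> \<bar>X i x\<bar> \<le> B" "\<And>i. i \<in> A \<Longrightarrow> expectation (X i) = 0"
    and "\<And>i. i \<in> A \<Longrightarrow> expectation (\<lambda>x. (X i x)\<^sup>2) \<le> v"
  shows "expectation (\<lambda>x. (\<Sum>i\<in>A. X i x)\<^sup>2) \<le> card A * v"
  using assms
proof (induction A rule: finite_induct)
  case (insert j A)
  have m[measurable]: "\<And>i. i \<in> insert j A \<Longrightarrow> X i \<in> borel_measurable M"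
    using insert.prems(1) by (auto simp: indep_vars_def)
  have S[measurable]: "(\<lambda>x. \<Sum>i\<in>A. X i x) \<in> borel_measurable M" by simp
  have ij: "integrable M (X j)"
    using insert.prems(2)[of j] by (intro integrable_const_bound[where B = "B"]) auto
  have ij2: "integrable M (\<lambda>x. (X j x)\<^sup>2)"
    using insert.prems(2)[of j] by (intro integrable_const_bound[where B = "B\<^sup>2"]) (auto intro!: abs_le_imp_sq_le)
  have Sb: "\<bar>\<Sum>i\<in>A. X i x\<bar> \<le> card A * B" for x
    by (rule order_trans[OF sum_abs sum_bounded_above]) (use insert.prems(2) in auto)
  have iS: "integrable M (\<lambda>x. \<Sum>i\<in>A. X i x)"
    using Sb by (intro integrable_const_bound[where B = "card A * B"]) auto
  have iS2: "integrable M (\<lambda>x. (\<Sum>i\<in>A. X i x)\<^sup>2)"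
    using Sb by (intro integrable_const_bound[where B = "(card A * B)\<^sup>2"]) (auto intro!: abs_le_imp_sq_le)
  have ind: "indep_var borel (X j) borel (\<lambda>x. \<Sum>i\<in>A. X i x)"
    by (rule indep_vars_sum[OF insert.hyps insert.prems(1)])
  have c: "expectation (\<lambda>x. X j x * (\<Sum>i\<in>A. X i x)) = 0"
    using indep_var_lebesgue_integral[OF ind ij iS] insert.prems(3)[of j] by simp
  have ic: "integrable M (\<lambda>x. X j x * (\<Sum>i\<in>A. X i x))"
    by (rule indep_var_integrable[OF ind ij iS])
  have "(\<lambda>x. (\<Sum>i\<in>insert j A. X i x)\<^sup>2) = (\<lambda>x. (X j x)\<^sup>2 + 2 * (X j x * (\<Sum>i\<in>A. X i x)) + (\<Sum>i\<in>A. X i x)\<^sup>2)"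
    using insert.hyps by (simp add: fun_eq_iff power2_eq_square algebra_simps)
  then have "expectation (\<lambda>x. (\<Sum>i\<in>insert j A. X i x)\<^sup>2) = expectation (\<lambda>x. (X j x)\<^sup>2) + expectation (\<lambda>x. (\<Sum>i\<in>A. X i x)\<^sup>2)"
    using ij2 iS2 ic c by simp
  also have "\<dots> \<le> v + card A * v"
  proof (rule add_mono)
    show "expectation (\<lambda>x. (X j x)\<^sup>2) \<le> v" using insert.prems(4)[of j] by simp
    show "expectation (\<lambda>x. (\<Sum>i\<in>A. X i x)\<^sup>2) \<le> card A * v"
      using insert.prems by (intro insert.IH indep_vars_subset[OF insert.prems(1)]) auto
  qed
  also have "\<dots> = card (insert j A) * v" using insert.hyps by (simp add: algebra_simps)
  finally show ?case .
qed simp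

text \<open>\<open>\<bar>s\<bar> \<le> s\<^sup>2 / (2 * \<theta>) + \<theta> / 2\<close> takes the
  place of Cauchy-Schwarz: the resulting bound is affine in \<open>card A\<close> and can be
  averaged over a random generation size.\<close>

lemma (in prob_space) expectation_abs_sum_indep_le:
  fixes X :: "'i \<Rightarrow> 'a \<Rightarrow> real" and v B \<theta> :: real
  assumes "finite A" "indep_vars (\<lambda>_. borel) X A"
    and "\<And>i x. i \<in> A \<Longrightarrow> \<bar>X i x\<bar> \<le> B" "\<And>i. i \<in> A \<Longrightarrow> expectation (X i) = 0"
    and "\<And>i. i \<in> A \<Longrightarrow> expectation (\<lambda>x. (X i x)\<^sup>2) \<le> v" and "\<theta> > 0"
  shows "expectation (\<lambda>x. \<bar>\<Sum>i\<in>A. X i x\<bar>) \<le> (card A * v / \<theta> + \<theta>) / 2"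
proof -
  have m[measurable]: "\<And>i. i \<in> A \<Longrightarrow> X i \<in> borel_measurable M"
    using assms(2) by (auto simp: indep_vars_def)
  have Sb: "\<bar>\<Sum>i\<in>A. X i x\<bar> \<le> card A * B" for x
    by (rule order_trans[OF sum_abs sum_bounded_above]) (use assms(3) in auto)
  have iS: "integrable M (\<lambda>x. \<bar>\<Sum>i\<in>A. X i x\<bar>)"
    using Sb by (intro integrable_const_bound[where B = "card A * B"]) auto
  have iS2: "integrable M (\<lambda>x. (\<Sum>i\<in>A. X i x)\<^sup>2)"
    using Sb by (intro integrable_const_bound[where B = "(card A * B)\<^sup>2"]) (auto intro!: abs_le_imp_sq_le)
  have "\<bar>s\<bar> \<le> s\<^sup>2 / (2 * \<theta>) + \<theta> / 2" for s :: real
  proof -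
    have "0 \<le> (\<bar>s\<bar> - \<theta>)\<^sup>2" by simp
    then have "2 * \<theta> * \<bar>s\<bar> \<le> s\<^sup>2 + \<theta>\<^sup>2" by (simp add: power2_eq_square algebra_simps)
    then show ?thesis using assms(6) by (simp add: field_simps power2_eq_square)
  qed
  then have "expectation (\<lambda>x. \<bar>\<Sum>i\<in>A. X i x\<bar>) \<le> expectation (\<lambda>x. (\<Sum>i\<in>A. X i x)\<^sup>2 / (2 * \<theta>) + \<theta> / 2)"
    using iS iS2 by (intro integral_mono) auto
  also have "\<dots> = expectation (\<lambda>x. (\<Sum>i\<in>A. X i x)\<^sup>2) / (2 * \<theta>) + \<theta> / 2"
    using iS2 by (simp add: prob_space)
  also have "\<dots> \<le> (card A * v) / (2 * \<theta>) + \<theta> / 2"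
    using assms(6) sum_indep_second_moment_le[OF assms(1-5)] by (intro add_right_mono divide_right_mono) auto
  finally show ?thesis by (simp add: add_divide_distrib)
qed

section \<open>The branching property and generating functions\<close>

context galton_watson begin

lemma integral_offspring:
  fixes g :: "nat \<Rightarrow> real"
  shows "(\<integral>x. g (N v x) \<partial>M) = (\<integral>n. g n \<partial>measure_pmf p)"
    and "integrable M (\<lambda>x. g (N v x)) \<longleftrightarrow> integrable (measure_pmf p) g"
  using integral_distr[of "N v" M "count_space UNIV" g] integrable_distr_eq[of "N v" M "count_space UNIV" g]
  by (simp_all add: offspring_distr)

lemma AE_offspring: "(AE x in M. P (N v x)) \<longleftrightarrow> (AE n in measure_pmf p. P n)"
  using AE_distr_iff[of "N v" M "count_space UNIV" P] unfolding offspring_distr by simp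

lemma integral_subtree:
  fixes F :: "_ \<Rightarrow> real"
  assumes "F \<in> borel_measurable tree_space"
  shows "(\<integral>x. F (subtree v (tree x)) \<partial>M) = (\<integral>x. F (tree x) \<partial>M)"
  using integral_distr[of "\<lambda>x. subtree v (tree x)" M tree_space F] integral_distr[of tree M tree_space F] assms
  by (simp add: distr_subtree)

lemma AE_subtree:
  assumes "Measurable.pred tree_space P"
  shows "(AE x in M. P (subtree v (tree x))) \<longleftrightarrow> (AE x in M. P (tree x))"
  using AE_distr_iff[of "\<lambda>x. subtree v (tree x)" M tree_space P] AE_distr_iff[of tree M tree_space P] assms
  unfolding distr_subtree by (simp add: pred_def)

lemma distr_subtree_fun:
  assumes [measurable]: "F \<in> borel_measurable tree_space"
  shows "distr M borel (\<lambda>x. F (subtree v (tree x))) = distr M borel (\<lambda>x. F (tree x))"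
  using distr_distr[of F tree_space borel "\<lambda>x. subtree v (tree x)" M] distr_distr[of F tree_space borel tree M]
  by (simp add: distr_subtree comp_def)

lemma indep_vars_subtree_fun:
  assumes "F \<in> borel_measurable tree_space" "\<And>v. v \<in> A \<Longrightarrow> length v = n"
  shows "indep_vars (\<lambda>_. borel) (\<lambda>v x. F (subtree v (tree x))) A"
  by (rule indep_vars_compose2[OF indep_vars_subset[OF indep_vars_subtrees[of n], of A], of "\<lambda>_. F"]) (use assms in auto)

text \<open>Given the first \<open>n\<close> levels, the subtrees rooted in generation
  \<open>n\<close> are independent copies of the tree, so their product integrates to a power.
  \<open>\<psi>\<close> carries information from the first \<open>n\<close> levels, and the bounds 0
  and 1 provide integrability.\<close>

lemma expectation_gen_prod:
  fixes F \<psi> :: "(nat list \<Rightarrow> nat) \<Rightarrow> real"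
  assumes [measurable]: "F \<in> borel_measurable tree_space" "\<psi> \<in> borel_measurable tree_space"
    and F: "\<And>t. 0 \<le> F t" "\<And>t. F t \<le> 1" and \<psi>: "\<And>t. 0 \<le> \<psi> t" "\<And>t. \<psi> t \<le> 1"
    and loc: "\<And>t s. (\<And>v. length v < n \<Longrightarrow> t v = s v) \<Longrightarrow> \<psi> t = \<psi> s"
  shows "(\<integral>x. \<psi> (tree x) * (\<Prod>v\<in>tree_gen n (tree x). F (subtree v (tree x))) \<partial>M)
       = (\<integral>x. \<psi> (tree x) * (\<integral>y. F (tree y) \<partial>M) ^ tree_Z n (tree x) \<partial>M)"
proof -
  define e where "e = (\<integral>y. F (tree y) \<partial>M)"
  have iF: "integrable M (\<lambda>y. F (subtree v (tree y)))" for v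
    using F by (intro integrable_const_bound[where B = 1]) auto
  have e: "0 \<le> e" "e \<le> 1"
  proof -
    have "integrable M (\<lambda>y. F (tree y))" using F by (intro integrable_const_bound[where B = 1]) auto
    then have "e \<le> (\<integral>y. 1 \<partial>M)" unfolding e_def using F by (intro integral_mono) auto
    then show "e \<le> 1" by (simp add: prob_space)
    show "0 \<le> e" unfolding e_def using F by simp
  qed
  have P: "0 \<le> (\<Prod>v\<in>A. F (subtree v t))" "(\<Prod>v\<in>A. F (subtree v t)) \<le> 1" for A t
    using F by (auto intro: prod_nonneg prod_le_1)
  have b: "0 \<le> \<psi> t * z" "\<psi> t * z \<le> 1" if "0 \<le> z" "z \<le> 1" for t z
    using \<psi>[of t] that by (auto intro: mult_le_one)
  have m1[measurable]: "(\<lambda>(t, t'). \<Prod>v\<in>tree_gen n t. F (subtree v t')) \<in> borel_measurable (tree_space \<Otimes>\<^sub>M tree_space)"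
    unfolding case_prod_beta by (rule measurable_gen_compose[of fst]) auto
  have m2[measurable]: "(\<lambda>t. \<Prod>v\<in>tree_gen n t. F (subtree v t)) \<in> borel_measurable tree_space"
    using measurable_gen_compose[of "\<lambda>t. t" tree_space "\<lambda>A t. \<Prod>v\<in>A. F (subtree v t)" borel n] by simp
  have "ennreal (\<integral>x. \<psi> (tree x) * (\<Prod>v\<in>tree_gen n (tree x). F (subtree v (tree x))) \<partial>M)
      = (\<integral>\<^sup>+x. ennreal (\<psi> (tree x) * (\<Prod>v\<in>tree_gen n (tree x). F (subtree v (tree x)))) \<partial>M)"
    using b[OF P] by (intro nn_integral_eq_integral[symmetric] integrable_const_bound[where B = 1]) auto
  also have "\<dots> = (\<integral>\<^sup>+x. (\<lambda>(t, t'). ennreal (\<psi> t * (\<Prod>v\<in>tree_gen n t. F (subtree v t')))) (tree x, tree x) \<partial>M)"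
    by simp
  also have "\<dots> = (\<integral>\<^sup>+x. (\<integral>\<^sup>+y. (\<lambda>(t, t'). ennreal (\<psi> t * (\<Prod>v\<in>tree_gen n t. F (subtree v t')))) (tree x, tree y) \<partial>M) \<partial>M)"
  proof (rule nn_integral_split_levels[where n = n])
    fix t t' s s' :: "nat list \<Rightarrow> nat"
    assume 1: "\<And>v. length v < n \<Longrightarrow> t v = s v" and 2: "\<And>v. length v \<ge> n \<Longrightarrow> t' v = s' v"
    have "tree_gen n t = tree_gen n s" by (rule tree_gen_cong[OF 1]) auto
    moreover have "subtree v t' = subtree v s'" if "v \<in> tree_gen n s" for v
      using length_tree_gen[OF that] 2 by (simp add: subtree_def fun_eq_iff)
    ultimately show "(\<lambda>(t, t'). ennreal (\<psi> t * (\<Prod>v\<in>tree_gen n t. F (subtree v t')))) (t, t')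
        = (\<lambda>(t, t'). ennreal (\<psi> t * (\<Prod>v\<in>tree_gen n t. F (subtree v t')))) (s, s')"
      using loc[OF 1] by (simp cong: prod.cong)
  qed measurable
  also have "\<dots> = (\<integral>\<^sup>+x. ennreal (\<psi> (tree x) * e ^ tree_Z n (tree x)) \<partial>M)"
  proof (rule nn_integral_cong)
    fix x
    let ?A = "tree_gen n (tree x)"
    have "(\<integral>y. (\<Prod>v\<in>?A. F (subtree v (tree y))) \<partial>M) = (\<Prod>v\<in>?A. \<integral>y. F (subtree v (tree y)) \<partial>M)"
      using length_tree_gen by (intro indep_vars_lebesgue_integral indep_vars_subtree_fun[where n = n] iF) auto
    also have "\<dots> = e ^ card ?A" by (simp add: integral_subtree e_def)
    finally have E: "(\<integral>y. (\<Prod>v\<in>?A. F (subtree v (tree y))) \<partial>M) = e ^ card ?A" .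
    have "(\<integral>\<^sup>+y. ennreal (\<psi> (tree x) * (\<Prod>v\<in>?A. F (subtree v (tree y)))) \<partial>M)
        = ennreal (\<integral>y. \<psi> (tree x) * (\<Prod>v\<in>?A. F (subtree v (tree y))) \<partial>M)"
      using b[OF P] by (intro nn_integral_eq_integral integrable_const_bound[where B = 1]) auto
    then show "(\<integral>\<^sup>+y. (\<lambda>(t, t'). ennreal (\<psi> t * (\<Prod>v\<in>tree_gen n t. F (subtree v t')))) (tree x, tree y) \<partial>M)
        = ennreal (\<psi> (tree x) * e ^ tree_Z n (tree x))"
      using E by (simp add: gw_Z_def)
  qed
  also have "\<dots> = ennreal (\<integral>x. \<psi> (tree x) * e ^ tree_Z n (tree x) \<partial>M)"
    using b e by (intro nn_integral_eq_integral integrable_const_bound[where B = 1]) (auto simp: power_le_one)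
  finally show ?thesis
    unfolding e_def[symmetric] using b[OF P] b e
    by (subst (asm) ennreal_inj) (auto intro!: integral_nonneg_AE AE_I2 simp: power_le_one)
qed

text \<open>The generation is taken from one tree and the values of \<open>F\<close> from an
  independent one; inside the inner probability the index set is frozen, and bounds for sums of
  independent copies apply.\<close>

lemma prob_split_sum_subtrees:
  fixes F :: "(nat list \<Rightarrow> nat) \<Rightarrow> real"
  assumes F [measurable]: "F \<in> borel_measurable tree_space" and Q [measurable]: "Measurable.pred tree_space Q"
    and loc: "\<And>t s. (\<And>v. length v < n \<Longrightarrow> t v = s v) \<Longrightarrow> Q t = Q s"
  shows "prob {x \<in> space M. Q (tree x) \<and> (\<Sum>v\<in>tree_gen n (tree x). F (subtree v (tree x))) < s}
     = (\<integral>x. of_bool (Q (tree x)) * prob {y \<in> space M. (\<Sum>v\<in>tree_gen n (tree x). F (subtree v (tree y))) < s} \<partial>M)"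
proof -
  have m1[measurable]: "(\<lambda>(t, t'). \<Sum>v\<in>tree_gen n t. F (subtree v t')) \<in> borel_measurable (tree_space \<Otimes>\<^sub>M tree_space)"
    unfolding case_prod_beta by (rule measurable_gen_compose[of fst]) auto
  have m2[measurable]: "(\<lambda>t. \<Sum>v\<in>tree_gen n t. F (subtree v t)) \<in> borel_measurable tree_space"
    using measurable_gen_compose[of "\<lambda>t. t" tree_space "\<lambda>A t. \<Sum>v\<in>A. F (subtree v t)" borel n] by simp
  have m3[measurable]: "(\<lambda>t. prob {y \<in> space M. (\<Sum>v\<in>tree_gen n t. F (subtree v (tree y))) < s}) \<in> borel_measurable tree_space"
    using measurable_gen_compose[of "\<lambda>t. t" tree_space "\<lambda>A t. prob {y \<in> space M. (\<Sum>v\<in>A. F (subtree v (tree y))) < s}" borel n] by simp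
  let ?f = "\<lambda>(t, t'). (of_bool (Q t \<and> (\<Sum>v\<in>tree_gen n t. F (subtree v t')) < s) :: ennreal)"
  let ?B = "{x \<in> space M. Q (tree x) \<and> (\<Sum>v\<in>tree_gen n (tree x). F (subtree v (tree x))) < s}"
  have "ennreal (prob ?B) = (\<integral>\<^sup>+x. indicator ?B x \<partial>M)" by (simp add: emeasure_eq_measure)
  also have "\<dots> = (\<integral>\<^sup>+x. ?f (tree x, tree x) \<partial>M)"
    by (intro nn_integral_cong) (auto simp: indicator_def)
  also have "\<dots> = (\<integral>\<^sup>+x. (\<integral>\<^sup>+y. ?f (tree x, tree y) \<partial>M) \<partial>M)"
  proof (rule nn_integral_split_levels[where n = n])
    fix t t' s s' :: "nat list \<Rightarrow> nat"
    assume 1: "\<And>v. length v < n \<Longrightarrow> t v = s v" and 2: "\<And>v. length v \<ge> n \<Longrightarrow> t' v = s' v"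
    have "tree_gen n t = tree_gen n s" by (rule tree_gen_cong[OF 1]) auto
    moreover have "subtree v t' = subtree v s'" if "v \<in> tree_gen n s" for v
      using length_tree_gen[OF that] 2 by (simp add: subtree_def fun_eq_iff)
    ultimately show "?f (t, t') = ?f (s, s')"
      using loc[OF 1] by (simp cong: sum.cong)
  qed measurable
  also have "\<dots> = (\<integral>\<^sup>+x. ennreal (of_bool (Q (tree x)) * prob {y \<in> space M. (\<Sum>v\<in>tree_gen n (tree x). F (subtree v (tree y))) < s}) \<partial>M)"
  proof (rule nn_integral_cong)
    fix x
    let ?C = "{y \<in> space M. (\<Sum>v\<in>tree_gen n (tree x). F (subtree v (tree y))) < s}"
    have "(\<integral>\<^sup>+y. ?f (tree x, tree y) \<partial>M) = (\<integral>\<^sup>+y. of_bool (Q (tree x)) * indicator ?C y \<partial>M)"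
      by (intro nn_integral_cong) (auto simp: indicator_def)
    also have "\<dots> = of_bool (Q (tree x)) * ennreal (prob ?C)"
      by (subst nn_integral_cmult_indicator) (auto simp: emeasure_eq_measure)
    finally show "(\<integral>\<^sup>+y. ?f (tree x, tree y) \<partial>M) = ennreal (of_bool (Q (tree x)) * prob ?C)" by simp
  qed
  also have "\<dots> = ennreal (\<integral>x. of_bool (Q (tree x)) * prob {y \<in> space M. (\<Sum>v\<in>tree_gen n (tree x). F (subtree v (tree y))) < s} \<partial>M)"
    by (intro nn_integral_eq_integral integrable_const_bound[where B = 1]) auto
  finally show ?thesis
    by (subst (asm) ennreal_inj) auto
qed

lemma gw_pgf_eq_integral:
  assumes "0 \<le> s" "s \<le> 1"
  shows "gw_pgf p s = (\<integral>n. s ^ n \<partial>measure_pmf p)"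
proof -
  have "integrable (measure_pmf p) (\<lambda>n. s ^ n)"
    using assms by (intro measure_pmf.integrable_const_bound[where B = 1]) (auto simp: power_le_one)
  then have "integrable (count_space UNIV) (\<lambda>n. pmf p n *\<^sub>R s ^ n)"
    by (simp add: measure_pmf_eq_density integrable_density)
  then have "(\<integral>n. pmf p n *\<^sub>R s ^ n \<partial>count_space UNIV) = gw_pgf p s"
    by (subst integral_count_space_nat) (auto simp: gw_pgf_def)
  moreover have "(\<integral>n. s ^ n \<partial>measure_pmf p) = (\<integral>n. pmf p n *\<^sub>R s ^ n \<partial>count_space UNIV)"
    by (simp add: measure_pmf_eq_density integral_density)
  ultimately show ?thesis by simp
qed

lemma gw_pgf_bounds:
  assumes "0 \<le> s" "s \<le> 1"
  shows "0 \<le> gw_pgf p s" "gw_pgf p s \<le> 1"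
proof -
  have i: "integrable (measure_pmf p) (\<lambda>n. s ^ n)"
    using assms by (intro measure_pmf.integrable_const_bound[where B = 1]) (auto simp: power_le_one)
  show "0 \<le> gw_pgf p s" unfolding gw_pgf_eq_integral[OF assms] using assms by simp
  have "(\<integral>n. s ^ n \<partial>measure_pmf p) \<le> (\<integral>n. 1 \<partial>measure_pmf p)"
    using i assms by (intro integral_mono) (auto simp: power_le_one)
  then show "gw_pgf p s \<le> 1" unfolding gw_pgf_eq_integral[OF assms] by simp
qed

text \<open>Given generation \<open>n\<close>, its offspring turn \<open>s\<close> into
  \<open>gw_pgf p s\<close>; hence the induction is for arbitrary \<open>s\<close>.\<close>

lemma expectation_power_Z:
  assumes "0 \<le> s" "s \<le> 1"
  shows "(\<integral>x. s ^ tree_Z n (tree x) \<partial>M) = (gw_pgf p ^^ n) s"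
  using assms
proof (induction n arbitrary: s)
  case (Suc n)
  have "(\<integral>x. s ^ tree_Z (Suc n) (tree x) \<partial>M) = (\<integral>x. 1 * (\<Prod>v\<in>tree_gen n (tree x). s ^ (subtree v (tree x) [])) \<partial>M)"
    unfolding tree_Z_Suc by (simp add: power_sum subtree_def)
  also have "\<dots> = (\<integral>x. 1 * (\<integral>y. s ^ (tree y []) \<partial>M) ^ tree_Z n (tree x) \<partial>M)"
    using Suc.prems by (intro expectation_gen_prod[where \<psi> = "\<lambda>_. 1" and F = "\<lambda>t. s ^ (t [])"])
      (auto simp: power_le_one)
  also have "(\<integral>y. s ^ (tree y []) \<partial>M) = gw_pgf p s"
    unfolding gw_pgf_eq_integral[OF Suc.prems] tree_def by (rule integral_offspring(1))
  also have "(\<integral>x. 1 * gw_pgf p s ^ tree_Z n (tree x) \<partial>M) = (gw_pgf p ^^ n) (gw_pgf p s)"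
    using Suc.IH gw_pgf_bounds[OF Suc.prems] by simp
  finally show ?case by (simp only: funpow_Suc_right comp_def)
qed (simp add: prob_space)

text \<open>With \<open>s = exp (- t)\<close> this makes the tilted probability of a value of
  \<open>Z k\<close> explicit.\<close>

lemma expectation_indicator_power_Z:
  assumes "0 \<le> s" "s \<le> 1"
  shows "(\<integral>x. of_bool (tree_Z k (tree x) = m) * s ^ tree_Z (k + j) (tree x) \<partial>M)
    = prob {x \<in> space M. tree_Z k (tree x) = m} * (gw_pgf p ^^ j) s ^ m"
proof -
  have "(\<integral>x. of_bool (tree_Z k (tree x) = m) * s ^ tree_Z (k + j) (tree x) \<partial>M)
     = (\<integral>x. of_bool (tree_Z k (tree x) = m) * (\<Prod>v\<in>tree_gen k (tree x). s ^ tree_Z j (subtree v (tree x))) \<partial>M)"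
    by (simp add: tree_Z_add power_sum)
  also have "\<dots> = (\<integral>x. of_bool (tree_Z k (tree x) = m) * (\<integral>y. s ^ tree_Z j (tree y) \<partial>M) ^ tree_Z k (tree x) \<partial>M)"
  proof (rule expectation_gen_prod[where \<psi> = "\<lambda>t. of_bool (tree_Z k t = m)" and F = "\<lambda>t. s ^ tree_Z j t"])
    fix t t' :: "nat list \<Rightarrow> nat"
    assume "\<And>v. length v < k \<Longrightarrow> t v = t' v"
    then show "(of_bool (tree_Z k t = m) :: real) = of_bool (tree_Z k t' = m)"
      using tree_gen_cong[of k t t' k] by (simp add: gw_Z_def)
  qed (use assms in \<open>auto simp: power_le_one\<close>)
  also have "\<dots> = (\<integral>x. indicator {x \<in> space M. tree_Z k (tree x) = m} x * (gw_pgf p ^^ j) s ^ m \<partial>M)"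
    unfolding expectation_power_Z[OF assms]
    by (intro Bochner_Integration.integral_cong) (auto simp: indicator_def)
  finally show ?thesis by simp
qed

text \<open>A generation has the smallest possible size \<open>m ^ Suc k\<close> exactly if the
  preceding one has size \<open>m ^ k\<close> and each of its members has exactly \<open>m\<close>
  children.\<close>

lemma prob_Z_Suc_minimal:
  assumes min: "\<And>k. k < m \<Longrightarrow> pmf p k = 0" and "m > 0"
  shows "prob {x \<in> space M. tree_Z (Suc k) (tree x) = m ^ Suc k}
    = prob {x \<in> space M. tree_Z k (tree x) = m ^ k} * pmf p m ^ (m ^ k)"
proof -
  have ge: "AE x in M. \<forall>v. m \<le> N v x"
    unfolding AE_all_countable
  proof
    fix v
    have "AE n in measure_pmf p. m \<le> n"
      using min by (intro AE_pmfI) (metis not_le set_pmf_iff)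
    then show "AE x in M. m \<le> N v x" by (simp add: AE_offspring)
  qed
  have Zge: "m ^ n \<le> tree_Z n (tree x)" if "\<forall>v. m \<le> N v x" for x n
  proof (induction n)
    case (Suc n)
    have "m * tree_Z n (tree x) \<le> tree_Z (Suc n) (tree x)"
      unfolding tree_Z_Suc using that sum_bounded_below[of "tree_gen n (tree x)" m "tree x"]
      by (simp add: gw_Z_def tree_def mult.commute)
    then show ?case using order_trans[OF mult_le_mono2[OF Suc, of m]] by simp
  qed simp
  have eq: "tree_Z (Suc k) (tree x) = m ^ Suc k \<longleftrightarrow> tree_Z k (tree x) = m ^ k \<and> (\<forall>v\<in>tree_gen k (tree x). tree x v = m)"
    if "\<forall>v. m \<le> N v x" for x
  proof
    assume "tree_Z k (tree x) = m ^ k \<and> (\<forall>v\<in>tree_gen k (tree x). tree x v = m)"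
    then show "tree_Z (Suc k) (tree x) = m ^ Suc k" unfolding tree_Z_Suc by (simp add: gw_Z_def)
  next
    assume L: "tree_Z (Suc k) (tree x) = m ^ Suc k"
    have "m * tree_Z k (tree x) \<le> tree_Z (Suc k) (tree x)"
      unfolding tree_Z_Suc using that sum_bounded_below[of "tree_gen k (tree x)" m "tree x"]
      by (simp add: gw_Z_def tree_def mult.commute)
    then have "tree_Z k (tree x) \<le> m ^ k" using L assms(2) by simp
    then have Zk: "tree_Z k (tree x) = m ^ k" using Zge[OF that, of k] by simp
    have "tree x v = m" if v: "v \<in> tree_gen k (tree x)" for v
    proof (rule ccontr)
      assume "tree x v \<noteq> m"
      then have "(\<Sum>v\<in>tree_gen k (tree x). m) < (\<Sum>v\<in>tree_gen k (tree x). tree x v)"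
        using \<open>\<forall>v. m \<le> N v x\<close> v by (intro sum_strict_mono_ex1 bexI[of _ v]) (auto simp: tree_def le_neq_implies_less[OF _ not_sym])
      then show False using L Zk unfolding tree_Z_Suc by (simp add: gw_Z_def)
    qed
    with Zk show "tree_Z k (tree x) = m ^ k \<and> (\<forall>v\<in>tree_gen k (tree x). tree x v = m)" by blast
  qed
  have "prob {x \<in> space M. tree_Z (Suc k) (tree x) = m ^ Suc k} = (\<integral>x. of_bool (tree_Z (Suc k) (tree x) = m ^ Suc k) \<partial>M)"
    by (rule prob_eq_integral_of_bool) measurable
  also have "\<dots> = (\<integral>x. of_bool (tree_Z k (tree x) = m ^ k) * (\<Prod>v\<in>tree_gen k (tree x). of_bool (subtree v (tree x) [] = m)) \<partial>M)"
  proof (rule integral_cong_AE)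
    have "(\<lambda>t. \<Prod>v\<in>tree_gen k t. of_bool (subtree v t [] = m) :: real) \<in> borel_measurable tree_space"
      using measurable_gen_compose[of "\<lambda>t. t" tree_space "\<lambda>A t. \<Prod>v\<in>A. of_bool (subtree v t [] = m) :: real" borel k] by simp
    note [measurable] = this
    show "(\<lambda>x. of_bool (tree_Z k (tree x) = m ^ k) * (\<Prod>v\<in>tree_gen k (tree x). of_bool (subtree v (tree x) [] = m)) :: real) \<in> borel_measurable M"
      by measurable
    show "AE x in M. of_bool (tree_Z (Suc k) (tree x) = m ^ Suc k) =
       (of_bool (tree_Z k (tree x) = m ^ k) * (\<Prod>v\<in>tree_gen k (tree x). of_bool (subtree v (tree x) [] = m)) :: real)"
      using ge
    proof eventually_elim
      case (elim x)
      have "(\<Prod>v\<in>tree_gen k (tree x). of_bool (subtree v (tree x) [] = m)) = (of_bool (\<forall>v\<in>tree_gen k (tree x). tree x v = m) :: real)"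
        by (auto simp: subtree_def intro!: prod_zero)
      then show ?case unfolding eq[OF elim] by simp
    qed
  qed measurable
  also have "\<dots> = (\<integral>x. of_bool (tree_Z k (tree x) = m ^ k) * (\<integral>y. of_bool (tree y [] = m) \<partial>M) ^ tree_Z k (tree x) \<partial>M)"
  proof (rule expectation_gen_prod[where \<psi> = "\<lambda>t. of_bool (tree_Z k t = m ^ k)" and F = "\<lambda>t. of_bool (t [] = m)"])
    fix t t' :: "nat list \<Rightarrow> nat"
    assume "\<And>v. length v < k \<Longrightarrow> t v = t' v"
    then show "(of_bool (tree_Z k t = m ^ k) :: real) = of_bool (tree_Z k t' = m ^ k)"
      using tree_gen_cong[of k t t' k] by (simp add: gw_Z_def)
  qed auto
  also have "(\<integral>y. of_bool (tree y [] = m) \<partial>M) = pmf p m"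
  proof -
    have "(\<integral>y. of_bool (tree y [] = m) \<partial>M) = (\<integral>n. (of_bool (n = m) :: real) \<partial>measure_pmf p)"
      unfolding tree_def by (rule integral_offspring(1))
    also have "\<dots> = measure_pmf.prob p {m}"
      using measure_pmf.prob_eq_integral_of_bool[where P = "\<lambda>n. n = m"] by simp
    finally show ?thesis by (simp add: pmf.rep_eq)
  qed
  also have "(\<integral>x. of_bool (tree_Z k (tree x) = m ^ k) * pmf p m ^ tree_Z k (tree x) \<partial>M)
      = (\<integral>x. indicator {x \<in> space M. tree_Z k (tree x) = m ^ k} x * pmf p m ^ (m ^ k) \<partial>M)"
    by (intro Bochner_Integration.integral_cong) (auto simp: indicator_def)
  finally show ?thesis by simp
qed

end

section \<open>Standing assumptions and the martingale limit\<close>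

locale boettcher_galton_watson = galton_watson M p N
  for M :: "'a measure" and p :: "nat pmf" and N :: "nat list \<Rightarrow> 'a \<Rightarrow> nat" +
  assumes nondegenerate: "\<And>c. \<not> (AE n in measure_pmf p. n = c)"
    and NlogN: "integrable (measure_pmf p) (\<lambda>n. real n * ln (real n))"
    and mu_ge_2: "gw_mu p \<ge> 2"
begin

abbreviation a :: real where "a \<equiv> gw_mean p"
abbreviation \<mu> :: nat where "\<mu> \<equiv> gw_mu p"

lemma pmf_mu_pos: "pmf p \<mu> > 0"
proof -
  obtain n where "n \<in> set_pmf p" using set_pmf_not_empty[of p] by blast
  then have "pmf p n > 0" by (simp add: pmf_positive)
  then show ?thesis unfolding gw_mu_def by (rule LeastI)
qed

lemma pmf_less_mu: "k < \<mu> \<Longrightarrow> pmf p k = 0"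
  using not_less_Least[of k "\<lambda>n. pmf p n > 0"] pmf_nonneg[of p k] by (force simp: gw_mu_def)

lemma AE_mu_le: "AE n in measure_pmf p. \<mu> \<le> n"
  using pmf_less_mu by (intro AE_pmfI) (metis not_le set_pmf_iff)

text \<open>From \<open>n = 4\<close> on \<open>ln n \<ge> 1\<close>; the constant 3 covers the
  smaller values.\<close>

lemma integrable_N: "integrable (measure_pmf p) real"
proof (rule Bochner_Integration.integrable_bound[where f = "\<lambda>n. real n * ln (real n) + 3"])
  show "AE n in measure_pmf p. norm (real n) \<le> norm (real n * ln (real n) + 3)"
  proof (intro AE_I2)
    fix n :: nat
    have "real n \<le> real n * ln (real n) + 3"
    proof (cases "n \<le> 3")
      case False
      have "exp 1 \<le> real n" using exp_le False by linarith
      then have "1 \<le> ln (real n)" using False by (subst ln_ge_iff) auto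
      then have "real n * 1 \<le> real n * ln (real n)" by (intro mult_left_mono) auto
      then show ?thesis by simp
    next
      case True
      have "0 \<le> real n * ln (real n)" by (cases "n = 0") auto
      then show ?thesis using True by simp
    qed
    then show "norm (real n) \<le> norm (real n * ln (real n) + 3)" by simp
  qed
qed (use NlogN in auto)

lemma mu_less_mean: "real \<mu> < a"
proof -
  have le: "AE n in measure_pmf p. real \<mu> \<le> real n" using AE_mu_le by eventually_elim simp
  have "real \<mu> \<le> a"
    using integral_mono_AE[OF _ integrable_N, of "\<lambda>_. real \<mu>"] le by (simp add: gw_mean_def)
  moreover have "real \<mu> \<noteq> a"
  proof
    assume "real \<mu> = a"
    then have "(\<integral>n. real n - real \<mu> \<partial>measure_pmf p) = 0"
      using integrable_N by (simp add: gw_mean_def)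
    then have "AE n in measure_pmf p. real n - real \<mu> = 0"
      using le by (subst (asm) integral_nonneg_eq_0_iff_AE) (auto intro: integrable_N)
    then have "AE n in measure_pmf p. n = \<mu>" by simp
    then show False using nondegenerate by blast
  qed
  ultimately show ?thesis by simp
qed

lemma mean_gt_1: "a > 1" using mu_less_mean mu_ge_2 by linarith

lemma nn_integral_Z: "(\<integral>\<^sup>+x. ennreal (tree_Z n (tree x)) \<partial>M) = ennreal (a ^ n)"
proof (induction n)
  case (Suc n)
  have [measurable]: "(\<lambda>(t, t'). \<Sum>v\<in>tree_gen n t. real (t' v)) \<in> borel_measurable (tree_space \<Otimes>\<^sub>M tree_space)"
    unfolding case_prod_beta by (rule measurable_gen_compose[of fst]) auto
  have "(\<integral>\<^sup>+x. ennreal (tree_Z (Suc n) (tree x)) \<partial>M)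
     = (\<integral>\<^sup>+x. (\<lambda>(t, t'). ennreal (\<Sum>v\<in>tree_gen n t. real (t' v))) (tree x, tree x) \<partial>M)"
    by (simp add: tree_Z_Suc)
  also have "\<dots> = (\<integral>\<^sup>+x. (\<integral>\<^sup>+y. (\<lambda>(t, t'). ennreal (\<Sum>v\<in>tree_gen n t. real (t' v))) (tree x, tree y) \<partial>M) \<partial>M)"
  proof (rule nn_integral_split_levels[where n = n])
    fix t t' s s' :: "nat list \<Rightarrow> nat"
    assume 1: "\<And>v. length v < n \<Longrightarrow> t v = s v" and 2: "\<And>v. length v \<ge> n \<Longrightarrow> t' v = s' v"
    have "tree_gen n t = tree_gen n s" by (rule tree_gen_cong[OF 1]) auto
    then show "(\<lambda>(t, t'). ennreal (\<Sum>v\<in>tree_gen n t. real (t' v))) (t, t') =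
        (\<lambda>(t, t'). ennreal (\<Sum>v\<in>tree_gen n t. real (t' v))) (s, s')"
      using 2 by (auto dest!: length_tree_gen intro!: arg_cong[where f = ennreal] sum.cong)
  qed measurable
  also have "\<dots> = (\<integral>\<^sup>+x. ennreal a * ennreal (tree_Z n (tree x)) \<partial>M)"
  proof (rule nn_integral_cong)
    fix x
    have i: "integrable M (\<lambda>y. real (tree y v))" for v
      unfolding tree_def by (subst integral_offspring(2)) (rule integrable_N)
    have e: "(\<integral>y. real (tree y v) \<partial>M) = a" for v
      unfolding tree_def gw_mean_def by (rule integral_offspring(1))
    have "(\<integral>\<^sup>+y. ennreal (\<Sum>v\<in>tree_gen n (tree x). real (tree y v)) \<partial>M)
        = ennreal (\<integral>y. (\<Sum>v\<in>tree_gen n (tree x). real (tree y v)) \<partial>M)"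
      using i by (intro nn_integral_eq_integral) (auto intro!: sum_nonneg)
    also have "(\<integral>y. (\<Sum>v\<in>tree_gen n (tree x). real (tree y v)) \<partial>M) = a * tree_Z n (tree x)"
      using i by (simp add: e gw_Z_def)
    finally show "(\<integral>\<^sup>+y. (\<lambda>(t, t'). ennreal (\<Sum>v\<in>tree_gen n t. real (t' v))) (tree x, tree y) \<partial>M)
        = ennreal a * ennreal (tree_Z n (tree x))"
      using mean_gt_1 by (simp add: ennreal_mult)
  qed
  also have "\<dots> = ennreal a * ennreal (a ^ n)"
    by (subst nn_integral_cmult) (auto simp: Suc)
  also have "\<dots> = ennreal (a ^ Suc n)"
    using mean_gt_1 by (simp add: ennreal_mult)
  finally show ?case .
qed (simp add: emeasure_space_1)

lemma integral_Z: "integrable M (\<lambda>x. real (tree_Z n (tree x)))" "(\<integral>x. real (tree_Z n (tree x)) \<partial>M) = a ^ n"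
  using nn_integral_Z[of n] mean_gt_1
  by (auto intro!: integrableI_nonneg integral_eq_nn_integral[THEN trans])

definition tail_mean :: "real \<Rightarrow> real" where
  "tail_mean b = (\<integral>n. real n * of_bool (b < real n) \<partial>measure_pmf p)"

lemma tail_mean_nonneg: "tail_mean b \<ge> 0"
  unfolding tail_mean_def by (intro integral_nonneg_AE AE_I2) auto

lemma integrable_tail: "integrable (measure_pmf p) (\<lambda>n. real n * of_bool (b < real n))"
  by (rule Bochner_Integration.integrable_bound[OF integrable_N]) auto

text \<open>Offspring numbers are truncated at a level b so that second moments exist.\<close>

lemma expectation_abs_centred_sum_le:
  assumes A: "finite A" and "b > 0" "\<theta> > 0"
  shows "(\<integral>\<^sup>+y. ennreal \<bar>\<Sum>v\<in>A. real (tree y v) - a\<bar> \<partial>M)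
     \<le> ennreal ((card A * (b * a) / \<theta> + \<theta>) / 2 + 2 * card A * tail_mean b)"
proof -
  let ?g = "\<lambda>n :: nat. real n * of_bool (real n \<le> b)"
  let ?h = "\<lambda>n :: nat. real n * of_bool (b < real n)"
  have gh: "real n = ?g n + ?h n" for n by auto
  define m where "m = (\<integral>n. ?g n \<partial>measure_pmf p)"
  have ig: "integrable (measure_pmf p) ?g"
    by (rule Bochner_Integration.integrable_bound[OF integrable_N]) auto
  have ma: "m = a - tail_mean b"
    using Bochner_Integration.integral_add[OF ig integrable_tail[of b]] unfolding m_def tail_mean_def gw_mean_def gh[symmetric] by simp
  have m0: "0 \<le> m" unfolding m_def by (intro integral_nonneg_AE AE_I2) auto
  have mb: "m \<le> b"
  proof -
    have "m \<le> (\<integral>n. b \<partial>measure_pmf p)" unfolding m_def using assms(2) by (intro integral_mono ig) auto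
    then show ?thesis by simp
  qed
  let ?X = "\<lambda>v y. ?g (N v y) - m"
  have indN: "indep_vars (\<lambda>_. borel) (\<lambda>v y. ?g (N v y) - m) A"
    by (rule indep_vars_compose2[OF indep_vars_subset[OF offspring_indep]]) auto
  have b1: "\<bar>?X v y\<bar> \<le> b" for v y using m0 mb assms(2) by (auto simp: abs_le_iff)
  have igN: "integrable M (\<lambda>y. ?g (N v y))" "(\<integral>y. ?g (N v y) \<partial>M) = m" for v
    using ig integral_offspring[of ?g v] by (simp_all add: m_def)
  have e1: "expectation (?X v) = 0" for v
    using igN[of v] by (simp add: prob_space)
  have ig2: "integrable M (\<lambda>y. (?g (N v y))\<^sup>2)" for v
    using assms(2) by (intro integrable_const_bound[where B = "b\<^sup>2"]) (auto intro!: power_mono)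
  have e2: "expectation (\<lambda>y. (?X v y)\<^sup>2) \<le> b * a" for v
  proof -
    have "expectation (\<lambda>y. (?X v y)\<^sup>2) = expectation (\<lambda>y. (?g (N v y))\<^sup>2 - 2 * m * ?g (N v y) + m\<^sup>2)"
      by (simp add: power2_eq_square algebra_simps)
    also have "\<dots> = expectation (\<lambda>y. (?g (N v y))\<^sup>2) - m\<^sup>2"
      using igN[of v] ig2[of v] by (simp add: prob_space power2_eq_square)
    also have "\<dots> \<le> expectation (\<lambda>y. (?g (N v y))\<^sup>2)" by simp
    also have "\<dots> \<le> expectation (\<lambda>y. b * real (N v y))"
      using assms(2) integral_offspring(2)[of real v] integrable_N
      by (intro integral_mono ig2) (auto simp: power2_eq_square intro!: mult_right_mono)
    also have "\<dots> = b * a" using integral_offspring(1)[of real v] by (simp add: gw_mean_def)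
    finally show ?thesis .
  qed
  have ihN: "integrable M (\<lambda>y. ?h (N v y))" "(\<integral>y. ?h (N v y) \<partial>M) = tail_mean b" for v
    using integrable_tail[of b] integral_offspring[of ?h v] by (simp_all add: tail_mean_def)
  have iX: "integrable M (\<lambda>y. \<Sum>v\<in>A. ?X v y)" using igN by auto
  \<comment> \<open>Truncated centred part, tail, and mean of the tail. The last two have the same
    expectation, whence the factor 2 in the claim.\<close>
  have pt: "\<bar>\<Sum>v\<in>A. real (tree y v) - a\<bar> \<le> \<bar>\<Sum>v\<in>A. ?X v y\<bar> + (\<Sum>v\<in>A. ?h (N v y)) + card A * tail_mean b" for y
  proof -
    have "(\<Sum>v\<in>A. real (tree y v) - a) = (\<Sum>v\<in>A. ?X v y + ?h (N v y) - tail_mean b)"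
      by (intro sum.cong) (auto simp: tree_def ma)
    also have "\<dots> = (\<Sum>v\<in>A. ?X v y) + (\<Sum>v\<in>A. ?h (N v y)) - card A * tail_mean b"
      by (simp add: sum.distrib sum_subtractf)
    finally have *: "(\<Sum>v\<in>A. real (tree y v) - a) = (\<Sum>v\<in>A. ?X v y) + (\<Sum>v\<in>A. ?h (N v y)) - card A * tail_mean b" .
    have "0 \<le> (\<Sum>v\<in>A. ?h (N v y))" by (intro sum_nonneg) auto
    moreover have "0 \<le> card A * tail_mean b" using tail_mean_nonneg[of b] by simp
    ultimately show ?thesis unfolding * by linarith
  qed
  have iR: "integrable M (\<lambda>y. \<bar>\<Sum>v\<in>A. ?X v y\<bar> + (\<Sum>v\<in>A. ?h (N v y)) + card A * tail_mean b)"
  proof (intro Bochner_Integration.integrable_add)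
    show "integrable M (\<lambda>y. \<bar>\<Sum>v\<in>A. ?X v y\<bar>)" using iX by (rule integrable_abs)
    show "integrable M (\<lambda>y. \<Sum>v\<in>A. ?h (N v y))" using ihN(1) by (rule Bochner_Integration.integrable_sum)
  qed simp
  have "(\<integral>\<^sup>+y. ennreal \<bar>\<Sum>v\<in>A. real (tree y v) - a\<bar> \<partial>M)
     \<le> (\<integral>\<^sup>+y. ennreal (\<bar>\<Sum>v\<in>A. ?X v y\<bar> + (\<Sum>v\<in>A. ?h (N v y)) + card A * tail_mean b) \<partial>M)"
    by (intro nn_integral_mono ennreal_leI pt)
  also have "\<dots> = ennreal (\<integral>y. \<bar>\<Sum>v\<in>A. ?X v y\<bar> + (\<Sum>v\<in>A. ?h (N v y)) + card A * tail_mean b \<partial>M)"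
    using tail_mean_nonneg[of b] by (intro nn_integral_eq_integral iR) (auto intro!: add_nonneg_nonneg sum_nonneg)
  also have "(\<integral>y. \<bar>\<Sum>v\<in>A. ?X v y\<bar> + (\<Sum>v\<in>A. ?h (N v y)) + card A * tail_mean b \<partial>M)
     = (\<integral>y. \<bar>\<Sum>v\<in>A. ?X v y\<bar> \<partial>M) + card A * tail_mean b + card A * tail_mean b"
  proof -
    define S1 S2 where "S1 y = \<bar>\<Sum>v\<in>A. ?X v y\<bar>" and "S2 y = (\<Sum>v\<in>A. ?h (N v y))" for y
    have "integrable M S2" unfolding S2_def[abs_def] using ihN by (intro Bochner_Integration.integrable_sum) auto
    moreover have "integrable M S1" unfolding S1_def[abs_def] using iX by (rule integrable_abs)
    moreover have "(\<integral>y. S2 y \<partial>M) = card A * tail_mean b"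
      unfolding S2_def using ihN by (subst Bochner_Integration.integral_sum) auto
    ultimately show ?thesis
      unfolding S1_def[symmetric] S2_def[symmetric] by (simp add: prob_space)
  qed
  also have "\<dots> \<le> (card A * (b * a) / \<theta> + \<theta>) / 2 + card A * tail_mean b + card A * tail_mean b"
    using expectation_abs_sum_indep_le[OF A indN b1 e1 e2 assms(3)] by simp
  finally show ?thesis by (simp add: ennreal_leI algebra_simps)
qed

text \<open>The bound for a fixed generation is affine in its size, so averaging over generation
  \<open>n\<close> merely replaces the size by \<open>a ^ n\<close>.\<close>

lemma expectation_increment_le:
  assumes "b > 0" "\<theta> > 0"
  shows "(\<integral>\<^sup>+x. ennreal \<bar>tree_Z (Suc n) (tree x) / a ^ Suc n - tree_Z n (tree x) / a ^ n\<bar> \<partial>M)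
    \<le> ennreal (((a ^ n * (b * a) / \<theta> + \<theta>) / 2 + 2 * a ^ n * tail_mean b) / a ^ Suc n)"
proof -
  have a0: "a > 0" using mean_gt_1 by simp
  have [measurable]: "(\<lambda>(t, t'). \<Sum>v\<in>tree_gen n t. real (t' v) - a) \<in> borel_measurable (tree_space \<Otimes>\<^sub>M tree_space)"
    unfolding case_prod_beta by (rule measurable_gen_compose[of fst]) auto
  have eq: "\<bar>tree_Z (Suc n) t / a ^ Suc n - tree_Z n t / a ^ n\<bar> = \<bar>\<Sum>v\<in>tree_gen n t. real (t v) - a\<bar> * (1 / a ^ Suc n)" for t
  proof -
    have "tree_Z (Suc n) t / a ^ Suc n - tree_Z n t / a ^ n = (\<Sum>v\<in>tree_gen n t. real (t v) - a) * (1 / a ^ Suc n)"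
      using a0 unfolding tree_Z_Suc by (simp add: sum_subtractf gw_Z_def field_simps)
    then show ?thesis using a0 by (simp add: abs_mult)
  qed
  let ?f = "\<lambda>(t, t'). ennreal \<bar>\<Sum>v\<in>tree_gen n t. real (t' v) - a\<bar>"
  have "(\<integral>\<^sup>+x. ?f (tree x, tree x) \<partial>M) = (\<integral>\<^sup>+x. (\<integral>\<^sup>+y. ?f (tree x, tree y) \<partial>M) \<partial>M)"
  proof (rule nn_integral_split_levels[where n = n])
    fix t t' s s' :: "nat list \<Rightarrow> nat"
    assume 1: "\<And>v. length v < n \<Longrightarrow> t v = s v" and 2: "\<And>v. length v \<ge> n \<Longrightarrow> t' v = s' v"
    have "tree_gen n t = tree_gen n s" by (rule tree_gen_cong[OF 1]) auto
    moreover have "(\<Sum>v\<in>tree_gen n s. real (t' v) - a) = (\<Sum>v\<in>tree_gen n s. real (s' v) - a)"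
      using 2 by (intro sum.cong refl) (auto dest!: length_tree_gen)
    ultimately show "?f (t, t') = ?f (s, s')" by simp
  qed measurable
  also have "\<dots> \<le> (\<integral>\<^sup>+x. ennreal ((b * a / \<theta> / 2 + 2 * tail_mean b) * tree_Z n (tree x) + \<theta> / 2) \<partial>M)"
  proof (rule nn_integral_mono)
    fix x
    show "(\<integral>\<^sup>+y. ?f (tree x, tree y) \<partial>M) \<le> ennreal ((b * a / \<theta> / 2 + 2 * tail_mean b) * tree_Z n (tree x) + \<theta> / 2)"
      using expectation_abs_centred_sum_le[OF finite_tree_gen assms, of n "tree x"]
      by (simp add: gw_Z_def field_simps)
  qed
  also have "\<dots> = ennreal (\<integral>x. (b * a / \<theta> / 2 + 2 * tail_mean b) * tree_Z n (tree x) + \<theta> / 2 \<partial>M)"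
    using integral_Z(1)[of n] assms a0 tail_mean_nonneg[of b] by (intro nn_integral_eq_integral) auto
  also have "(\<integral>x. (b * a / \<theta> / 2 + 2 * tail_mean b) * tree_Z n (tree x) + \<theta> / 2 \<partial>M) = (a ^ n * (b * a) / \<theta> + \<theta>) / 2 + 2 * a ^ n * tail_mean b"
    using integral_Z[of n] by (simp add: prob_space field_simps)
  finally have main: "(\<integral>\<^sup>+x. ?f (tree x, tree x) \<partial>M) \<le> ennreal ((a ^ n * (b * a) / \<theta> + \<theta>) / 2 + 2 * a ^ n * tail_mean b)" .
  have [measurable]: "(\<lambda>t. \<Sum>v\<in>tree_gen n t. real (t v) - a) \<in> borel_measurable tree_space"
    using measurable_gen_compose[of "\<lambda>t. t" tree_space "\<lambda>A t. \<Sum>v\<in>A. real (t v) - a" borel n] by simp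
  have "(\<integral>\<^sup>+x. ennreal \<bar>tree_Z (Suc n) (tree x) / a ^ Suc n - tree_Z n (tree x) / a ^ n\<bar> \<partial>M)
      = (\<integral>\<^sup>+x. ?f (tree x, tree x) * ennreal (1 / a ^ Suc n) \<partial>M)"
  proof -
    have "ennreal (\<bar>s\<bar> * (1 / a ^ Suc n)) = ennreal \<bar>s\<bar> * ennreal (1 / a ^ Suc n)" for s
      by (rule ennreal_mult) (use a0 in auto)
    then show ?thesis by (simp only: eq prod.case)
  qed
  also have "\<dots> = (\<integral>\<^sup>+x. ?f (tree x, tree x) \<partial>M) * ennreal (1 / a ^ Suc n)"
    by (rule nn_integral_multc) measurable
  also have "\<dots> \<le> ennreal ((a ^ n * (b * a) / \<theta> + \<theta>) / 2 + 2 * a ^ n * tail_mean b) * ennreal (1 / a ^ Suc n)"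
    by (rule mult_right_mono[OF main]) simp
  also have "\<dots> = ennreal (((a ^ n * (b * a) / \<theta> + \<theta>) / 2 + 2 * a ^ n * tail_mean b) / a ^ Suc n)"
    using a0 assms tail_mean_nonneg[of b] by (subst ennreal_mult[symmetric]) auto
  finally show ?thesis .
qed

text \<open>Tonelli turns this sum into the expectation of N times the number of n with \<open>\<rho> ^ (2 * n) < N\<close>,
  which is of order N log N.\<close>

lemma summable_tail_mean:
  assumes "\<rho> > 1"
  shows "(\<Sum>n. ennreal (tail_mean (\<rho> ^ (2 * n)))) < \<infinity>"
proof -
  have "(\<Sum>n. ennreal (tail_mean (\<rho> ^ (2 * n))))
      = (\<Sum>n. \<integral>\<^sup>+k. ennreal (real k * of_bool (\<rho> ^ (2 * n) < real k)) \<partial>measure_pmf p)"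
    unfolding tail_mean_def
    by (intro suminf_cong nn_integral_eq_integral[symmetric] integrable_tail) auto
  also have "\<dots> = (\<integral>\<^sup>+k. (\<Sum>n. ennreal (real k * of_bool (\<rho> ^ (2 * n) < real k))) \<partial>measure_pmf p)"
    by (rule nn_integral_suminf[symmetric]) auto
  also have "\<dots> \<le> (\<integral>\<^sup>+k. ennreal (1 / ln \<rho> * (real k * ln (real k)) + real k) \<partial>measure_pmf p)"
  proof (rule nn_integral_mono)
    fix k :: nat
    show "(\<Sum>n. ennreal (real k * of_bool (\<rho> ^ (2 * n) < real k))) \<le> ennreal (1 / ln \<rho> * (real k * ln (real k)) + real k)"
    proof (cases "k = 0")
      case False
      \<comment> \<open>If \<open>\<rho> ^ (2 * n) < k\<close> then
        \<open>2 * n < ln k / ln \<rho>\<close>, so all terms from \<open>m\<close> on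
        vanish.\<close>
      define m where "m = nat \<lfloor>ln (real k) / ln \<rho>\<rfloor> + 1"
      have lnk: "ln (real k) \<ge> 0" and ln\<rho>: "ln \<rho> > 0" using False assms by auto
      have out: "n < m" if "\<rho> ^ (2 * n) < real k" for n
      proof -
        have "ln (\<rho> ^ (2 * n)) < ln (real k)" using that assms False by (subst ln_less_cancel_iff) auto
        then have "real (2 * n) * ln \<rho> < ln (real k)" using assms by (simp add: ln_realpow)
        then have "real (2 * n) < ln (real k) / ln \<rho>" using ln\<rho> by (simp add: field_simps)
        then show ?thesis unfolding m_def by linarith
      qed
      have "(\<Sum>n. ennreal (real k * of_bool (\<rho> ^ (2 * n) < real k))) = (\<Sum>n<m. ennreal (real k * of_bool (\<rho> ^ (2 * n) < real k)))"
        using out by (intro suminf_finite) auto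
      also have "\<dots> \<le> (\<Sum>n<m. ennreal (real k))"
        by (intro sum_mono ennreal_leI) auto
      also have "\<dots> = ennreal (real m * real k)" by (simp add: ennreal_mult ennreal_of_nat_eq_real_of_nat)
      also have "\<dots> \<le> ennreal (1 / ln \<rho> * (real k * ln (real k)) + real k)"
      proof (rule ennreal_leI)
        have "real m \<le> ln (real k) / ln \<rho> + 1" unfolding m_def using lnk ln\<rho> by (simp add: of_nat_nat)
        then have "real m * real k \<le> (ln (real k) / ln \<rho> + 1) * real k" by (rule mult_right_mono) simp
        then show "real m * real k \<le> 1 / ln \<rho> * (real k * ln (real k)) + real k" by (simp add: field_simps)
      qed
      finally show ?thesis .
    qed simp
  qed
  also have "\<dots> = ennreal (\<integral>k. 1 / ln \<rho> * (real k * ln (real k)) + real k \<partial>measure_pmf p)"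
  proof (rule nn_integral_eq_integral)
    show "integrable (measure_pmf p) (\<lambda>k. 1 / ln \<rho> * (real k * ln (real k)) + real k)"
      using NlogN integrable_N by (intro Bochner_Integration.integrable_add integrable_mult_right)
    have "0 \<le> 1 / ln \<rho> * (real k * ln (real k)) + real k" for k
      using assms by (cases "k = 0") auto
    then show "AE k in measure_pmf p. 0 \<le> 1 / ln \<rho> * (real k * ln (real k)) + real k" by simp
  qed
  also have "\<dots> < \<infinity>" by simp
  finally show ?thesis .
qed

text \<open>Each expected increment is at most a geometric variance part plus a multiple of a tail
  mean; the N log N condition enters through the summability of the latter.\<close>

lemma summable_expectation_increments:
  "(\<Sum>n. \<integral>\<^sup>+x. ennreal \<bar>tree_Z (Suc n) (tree x) / a ^ Suc n - tree_Z n (tree x) / a ^ n\<bar> \<partial>M) < \<infinity>"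
proof -
  \<comment> \<open>The fourth root lets both parameters be integer powers: the truncation level is
    of order \<open>a\<close> to the power n/2, and \<open>\<theta>\<close> of order
    \<open>a\<close> to the power 3n/4.\<close>
  define \<rho> where "\<rho> = root 4 a"
  have \<rho>: "\<rho> > 1" "\<rho> ^ 4 = a" using mean_gt_1 by (simp_all add: \<rho>_def)
  have \<rho>0: "\<rho> > 0" using \<rho> by simp
  have "(\<Sum>n. \<integral>\<^sup>+x. ennreal \<bar>tree_Z (Suc n) (tree x) / a ^ Suc n - tree_Z n (tree x) / a ^ n\<bar> \<partial>M)
     \<le> (\<Sum>n. ennreal ((1 / \<rho>) ^ n) + ennreal 2 * ennreal (tail_mean (\<rho> ^ (2 * n))))"
  proof (rule suminf_le)
    fix n
    \<comment> \<open>\<open>\<theta>\<close> balances the two halves of the bound, since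
      \<open>a ^ n * (b * a) = \<theta>\<^sup>2\<close>; after division by \<open>a ^ Suc n\<close>
      it leaves the geometric term \<open>1 / \<rho> ^ (n + 2)\<close>.\<close>
    let ?\<theta> = "\<rho> ^ (3 * n + 2)" and ?b = "\<rho> ^ (2 * n)"
    have an: "a ^ n = \<rho> ^ (4 * n)" "a ^ Suc n = \<rho> ^ (4 * n + 4)" 
      unfolding \<rho>(2)[symmetric] by (simp_all add: power_mult[symmetric] power_add[symmetric] algebra_simps)
    have "(a ^ n * (?b * a) / ?\<theta> + ?\<theta>) / 2 = ?\<theta>"
    proof -
      have "a ^ n * (?b * a) = ?\<theta> * ?\<theta>"
        unfolding an(1) unfolding \<rho>(2)[symmetric] unfolding power_add[symmetric]
        by (rule arg_cong[where f = "\<lambda>k. \<rho> ^ k"]) simp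
      then show ?thesis using \<rho>0 by simp
    qed
    then have "((a ^ n * (?b * a) / ?\<theta> + ?\<theta>) / 2 + 2 * a ^ n * tail_mean ?b) / a ^ Suc n
        = ?\<theta> / a ^ Suc n + 2 / a * tail_mean ?b"
      using mean_gt_1 by (simp add: add_divide_distrib)
    also have "\<dots> \<le> (1 / \<rho>) ^ n + 2 * tail_mean ?b"
    proof (rule add_mono)
      have e: "4 * n + 4 = (3 * n + 2) + (n + 2)" by simp
      have "?\<theta> / a ^ Suc n = ?\<theta> / (?\<theta> * \<rho> ^ (n + 2))"
        unfolding an(2) e power_add[of \<rho> "3 * n + 2" "n + 2"] by (rule refl)
      also have "\<dots> = 1 / \<rho> ^ (n + 2)" using \<rho>0 by simp
      also have "\<dots> \<le> 1 / \<rho> ^ n" using \<rho> by (intro divide_left_mono power_increasing) auto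
      finally show "?\<theta> / a ^ Suc n \<le> (1 / \<rho>) ^ n" by (simp add: power_divide)
      show "2 / a * tail_mean ?b \<le> 2 * tail_mean ?b"
        using mean_gt_1 tail_mean_nonneg[of ?b] by (intro mult_right_mono) (auto simp: field_simps)
    qed
    finally have "ennreal (((a ^ n * (?b * a) / ?\<theta> + ?\<theta>) / 2 + 2 * a ^ n * tail_mean ?b) / a ^ Suc n)
       \<le> ennreal ((1 / \<rho>) ^ n + 2 * tail_mean ?b)" by (rule ennreal_leI)
    also have "\<dots> = ennreal ((1 / \<rho>) ^ n) + ennreal 2 * ennreal (tail_mean ?b)"
      using \<rho>0 tail_mean_nonneg[of ?b] by (simp add: ennreal_plus ennreal_mult del: ennreal_numeral)
    finally show "(\<integral>\<^sup>+x. ennreal \<bar>tree_Z (Suc n) (tree x) / a ^ Suc n - tree_Z n (tree x) / a ^ n\<bar> \<partial>M)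
       \<le> ennreal ((1 / \<rho>) ^ n) + ennreal 2 * ennreal (tail_mean ?b)"
      using expectation_increment_le[of ?b ?\<theta> n] \<rho>0 by (auto intro: order_trans)
  qed auto
  also have "\<dots> = (\<Sum>n. ennreal ((1 / \<rho>) ^ n)) + ennreal 2 * (\<Sum>n. ennreal (tail_mean (\<rho> ^ (2 * n))))"
    by (simp add: suminf_add[symmetric])
  also have "\<dots> < \<infinity>"
  proof -
    have "(\<lambda>n. (1 / \<rho>) ^ n) sums (1 / (1 - 1 / \<rho>))" using \<rho> by (intro geometric_sums) auto
    then have "(\<Sum>n. ennreal ((1 / \<rho>) ^ n)) = ennreal (1 / (1 - 1 / \<rho>))"
      using \<rho>0 by (intro suminf_ennreal_eq) auto
    then show ?thesis using summable_tail_mean[OF \<rho>(1)] by (simp add: ennreal_mult_less_top)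
  qed
  finally show ?thesis .
qed

definition W :: "(nat list \<Rightarrow> nat) \<Rightarrow> real" where
  "W = gw_W p (\<lambda>v t. t v)"

lemma measurable_W [measurable]: "W \<in> borel_measurable tree_space"
  unfolding W_def by (rule measurable_tree_W)

text \<open>Summable expected absolute increments give almost sure convergence, and one plus the sum
  of the absolute increments is an integrable majorant of the whole sequence. Dominated convergence
  then preserves the mean 1.\<close>

lemma martingale_limit:
  shows AE_tendsto_W: "AE x in M. (\<lambda>n. tree_Z n (tree x) / a ^ n) \<longlonglongrightarrow> W (tree x)"
    and integrable_W: "integrable M (\<lambda>x. W (tree x))"
    and expectation_W: "(\<integral>x. W (tree x) \<partial>M) = 1"
proof -
  define D where "D n x = \<bar>tree_Z (Suc n) (tree x) / a ^ Suc n - tree_Z n (tree x) / a ^ n\<bar>" for n x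
  have [measurable]: "D n \<in> borel_measurable M" for n unfolding D_def[abs_def] by measurable
  have fin: "(\<integral>\<^sup>+x. (\<Sum>n. ennreal (D n x)) \<partial>M) < \<infinity>"
    using summable_expectation_increments unfolding D_def[symmetric] by (subst nn_integral_suminf) auto
  then have "AE x in M. (\<Sum>n. ennreal (D n x)) \<noteq> \<infinity>"
    by (intro nn_integral_noteq_infinite) auto
  then have sm: "AE x in M. summable (\<lambda>n. D n x)"
  proof eventually_elim
    case (elim x)
    then show ?case by (intro summable_suminf_not_top) (auto simp: D_def top.not_eq_extremum[symmetric])
  qed
  have bnd: "\<bar>tree_Z n (tree x) / a ^ n\<bar> \<le> 1 + (\<Sum>n. D n x)" if "summable (\<lambda>n. D n x)" for x n
  proof -
    have tri: "\<bar>1 + s\<bar> \<le> 1 + \<bar>s\<bar>" for s :: real by simp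
    let ?S = "\<Sum>i<n. tree_Z (Suc i) (tree x) / a ^ Suc i - tree_Z i (tree x) / a ^ i"
    have eq: "tree_Z n (tree x) / a ^ n = 1 + (\<Sum>i<n. tree_Z (Suc i) (tree x) / a ^ Suc i - tree_Z i (tree x) / a ^ i)"
      by (subst sum_lessThan_telescope) simp
    have "\<bar>tree_Z n (tree x) / a ^ n\<bar> \<le> 1 + \<bar>?S\<bar>"
      unfolding eq by (rule tri)
    also have "\<dots> \<le> 1 + (\<Sum>i<n. D i x)"
      unfolding D_def by (intro add_left_mono sum_abs)
    also have "\<dots> \<le> 1 + (\<Sum>n. D n x)"
      by (intro add_left_mono sum_le_suminf that) (auto simp: D_def)
    finally show ?thesis .
  qed
  show lim: "AE x in M. (\<lambda>n. tree_Z n (tree x) / a ^ n) \<longlonglongrightarrow> W (tree x)"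
    using sm
  proof eventually_elim
    case (elim x)
    have "summable (\<lambda>n. norm (tree_Z (Suc n) (tree x) / a ^ Suc n - tree_Z n (tree x) / a ^ n))"
      using elim by (simp add: D_def)
    then have "summable (\<lambda>n. tree_Z (Suc n) (tree x) / a ^ Suc n - tree_Z n (tree x) / a ^ n)"
      by (rule summable_norm_cancel)
    then have "convergent (\<lambda>n. \<Sum>i<n. tree_Z (Suc i) (tree x) / a ^ Suc i - tree_Z i (tree x) / a ^ i)"
      by (simp only: summable_iff_convergent)
    then have "convergent (\<lambda>n. tree_Z n (tree x) / a ^ n - tree_Z 0 (tree x) / a ^ 0)"
      by (simp only: sum_lessThan_telescope[of "\<lambda>i. tree_Z i (tree x) / a ^ i"])
    then have "convergent (\<lambda>n. tree_Z n (tree x) / a ^ n)"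
      by (simp only: convergent_diff_const_right_iff)
    then show ?case
      unfolding W_def gw_W_def by (simp only: convergent_LIMSEQ_iff)
  qed
  have "(\<integral>\<^sup>+x. ennreal (1 + (\<Sum>n. D n x)) \<partial>M) < \<infinity>"
  proof -
    have "(\<integral>\<^sup>+x. ennreal (1 + (\<Sum>n. D n x)) \<partial>M) = (\<integral>\<^sup>+x. 1 + (\<Sum>n. ennreal (D n x)) \<partial>M)"
      using sm
    proof (intro nn_integral_cong_AE, eventually_elim)
      case (elim x)
      have D0: "0 \<le> D n x" for n by (simp add: D_def)
      have "(\<Sum>n. ennreal (D n x)) = ennreal (\<Sum>n. D n x)"
        by (rule suminf_ennreal2[OF D0 elim(2)])
      then show ?case using suminf_nonneg[OF elim(2) D0] by (subst ennreal_plus) auto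
    qed
    also have "\<dots> = 1 + (\<integral>\<^sup>+x. (\<Sum>n. ennreal (D n x)) \<partial>M)"
      by (subst nn_integral_add) (auto simp: emeasure_space_1)
    finally show ?thesis using fin by simp
  qed
  then have iw: "integrable M (\<lambda>x. 1 + (\<Sum>n. D n x))"
    using sm by (intro integrableI_nonneg) (auto elim!: eventually_mono intro!: add_nonneg_nonneg suminf_nonneg simp: D_def)
  have b: "AE x in M. norm (tree_Z n (tree x) / a ^ n) \<le> 1 + (\<Sum>n. D n x)" for n
    using sm by eventually_elim (use bnd in simp)
  show "integrable M (\<lambda>x. W (tree x))"
    using integrable_dominated_convergence[OF _ _ iw lim b] by simp
  have "(\<lambda>n. \<integral>x. tree_Z n (tree x) / a ^ n \<partial>M) \<longlonglongrightarrow> (\<integral>x. W (tree x) \<partial>M)"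
    using integral_dominated_convergence[OF _ _ iw lim b] by simp
  moreover have "(\<lambda>n. \<integral>x. tree_Z n (tree x) / a ^ n \<partial>M) = (\<lambda>n. 1)"
    using integral_Z(2) mean_gt_1 by (simp add: fun_eq_iff)
  ultimately have "(\<lambda>n :: nat. 1) \<longlonglongrightarrow> (\<integral>x. W (tree x) \<partial>M)" by (simp only:)
  then show "(\<integral>x. W (tree x) \<partial>M) = 1" by (simp only: LIMSEQ_const_iff)
qed

lemma AE_W_nonneg: "AE x in M. 0 \<le> W (tree x)"
  using AE_tendsto_W
proof eventually_elim
  case (elim x)
  then show ?case using mean_gt_1 by (intro tendsto_lowerbound[OF elim]) auto
qed

text \<open>There are countably many words, so the limit exists in all subtrees simultaneously; the
  identity is the limit of the decomposition \<open>tree_Z_add\<close>.\<close>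

lemma AE_W_branching: "AE x in M. W (tree x) = (\<Sum>v\<in>tree_gen n (tree x). W (subtree v (tree x))) / a ^ n"
proof -
  have "AE x in M. (\<lambda>k. tree_Z k (subtree v (tree x)) / a ^ k) \<longlonglongrightarrow> W (subtree v (tree x))" for v
    using AE_subtree[of "\<lambda>t. (\<lambda>n. tree_Z n t / a ^ n) \<longlonglongrightarrow> W t" v] AE_tendsto_W by simp
  then have "AE x in M. \<forall>v. (\<lambda>k. tree_Z k (subtree v (tree x)) / a ^ k) \<longlonglongrightarrow> W (subtree v (tree x))"
    by (simp add: AE_all_countable)
  then show ?thesis
    using AE_tendsto_W
  proof eventually_elim
    case (elim x)
    have "(\<lambda>k. (\<Sum>v\<in>tree_gen n (tree x). tree_Z k (subtree v (tree x)) / a ^ k) / a ^ n)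
       \<longlonglongrightarrow> (\<Sum>v\<in>tree_gen n (tree x). W (subtree v (tree x))) / a ^ n"
      using elim(1) mean_gt_1 by (intro tendsto_divide tendsto_sum) auto
    also have "(\<lambda>k. (\<Sum>v\<in>tree_gen n (tree x). tree_Z k (subtree v (tree x)) / a ^ k) / a ^ n)
       = (\<lambda>k. tree_Z (k + n) (tree x) / a ^ (k + n))"
      by (simp add: fun_eq_iff add.commute[of _ n] tree_Z_add power_add sum_divide_distrib mult.commute)
    finally have "(\<lambda>k. tree_Z (k + n) (tree x) / a ^ (k + n)) \<longlonglongrightarrow> (\<Sum>v\<in>tree_gen n (tree x). W (subtree v (tree x))) / a ^ n" .
    moreover have "(\<lambda>k. tree_Z (k + n) (tree x) / a ^ (k + n)) \<longlonglongrightarrow> W (tree x)"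
      using elim(2) by (rule LIMSEQ_ignore_initial_segment)
    ultimately show ?case by (rule LIMSEQ_unique[symmetric])
  qed
qed

section \<open>The Boettcher function and the tilt parameter\<close>

sublocale off: nonneg_random_variable "measure_pmf p" real
  by unfold_locales auto

sublocale lim: nonneg_random_variable M "\<lambda>x. W (tree x)"
  by unfold_locales (use AE_W_nonneg in auto)

text \<open>In the coordinate \<open>s = exp (- t)\<close>, iterating the generating function means
  iterating \<open>G\<close>, which for large \<open>t\<close> is close to an affine map of slope
  \<open>\<mu>\<close>.\<close>

definition G :: "real \<Rightarrow> real" where "G = off.neg_log_laplace"

abbreviation G_iter :: "nat \<Rightarrow> real \<Rightarrow> real" where "G_iter m \<equiv> G ^^ m"

lemma gw_pgf_exp: "t \<ge> 0 \<Longrightarrow> gw_pgf p (exp (- t)) = exp (- G t)"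
proof -
  assume t: "t \<ge> 0"
  have "(\<lambda>n :: nat. exp (- t) ^ n) = (\<lambda>n. exp (- t * real n))"
    by (simp add: fun_eq_iff exp_of_nat_mult[symmetric] mult.commute)
  then show ?thesis
    using t by (simp add: gw_pgf_eq_integral G_def off.exp_neg_log_laplace off.laplace_moment_def)
qed

lemma ex_pmf_greater_mu: "\<exists>n>\<mu>. pmf p n > 0"
proof (rule ccontr)
  assume "\<not> ?thesis"
  then have "n = \<mu>" if "n \<in> set_pmf p" for n
    using pmf_less_mu[of n] that pmf_positive[of n p] by (metis linorder_neqE_nat less_irrefl)
  then have "AE n in measure_pmf p. n = \<mu>" by (intro AE_pmfI)
  then show False using nondegenerate by blast
qed

abbreviation lam :: nat where "lam \<equiv> gw_lambda p"

lemma lam: "lam > \<mu>" "pmf p lam > 0"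
  using LeastI_ex[OF ex_pmf_greater_mu] by (auto simp: gw_lambda_def)

lemma AE_mu_or_lam: "AE n in measure_pmf p. n = \<mu> \<or> lam \<le> n"
proof (rule AE_pmfI)
  fix n assume n: "n \<in> set_pmf p"
  show "n = \<mu> \<or> lam \<le> n"
  proof (rule ccontr)
    assume "\<not> ?thesis"
    then have "n < lam" "n \<noteq> \<mu>" by auto
    moreover have "n \<ge> \<mu>" using pmf_less_mu[of n] pmf_positive[OF n] by (cases "n < \<mu>") auto
    ultimately show False
      using not_less_Least[of n "\<lambda>n. \<mu> < n \<and> pmf p n > 0"] pmf_positive[OF n] by (auto simp: gw_lambda_def)
  qed
qed

lemma integrable_exp_off: "t \<ge> 0 \<Longrightarrow> integrable (measure_pmf p) (\<lambda>n. exp (- t * real n))"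
  using off.integrable_exp_laplace by simp

text \<open>The lower bound keeps the atoms at \<open>\<mu>\<close> and \<open>lam\<close>; the
  first upper bound moves all remaining mass down to \<open>lam\<close>.\<close>

lemma laplace_off_bounds:
  fixes t :: real assumes "t \<ge> 0"
  shows "pmf p \<mu> * exp (- t * real \<mu>) + pmf p lam * exp (- t * real lam) \<le> off.laplace_moment 0 t"
    and "off.laplace_moment 0 t \<le> pmf p \<mu> * exp (- t * real \<mu>) + exp (- t * real lam)"
    and "off.laplace_moment 0 t \<le> exp (- t * real \<mu>)"
proof -
  have ind: "integrable (measure_pmf p) (\<lambda>n. indicat_real {k} n * c)" "(\<integral>n. indicat_real {k} n * c \<partial>measure_pmf p) = pmf p k * c" for k c
    by (auto simp: pmf.rep_eq intro!: integrable_mult_left integrable_real_indicator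
        simp: measure_pmf.emeasure_eq_measure simp del: integrable_mult_left_iff)
  have "(\<integral>n. indicat_real {\<mu>} n * exp (- t * real \<mu>) + indicat_real {lam} n * exp (- t * real lam) \<partial>measure_pmf p)
      \<le> (\<integral>n. exp (- t * real n) \<partial>measure_pmf p)"
    using lam(1) by (intro integral_mono Bochner_Integration.integrable_add ind integrable_exp_off assms) (auto simp: indicator_def)
  then show "pmf p \<mu> * exp (- t * real \<mu>) + pmf p lam * exp (- t * real lam) \<le> off.laplace_moment 0 t"
    by (subst (asm) Bochner_Integration.integral_add[OF ind(1) ind(1)]) (simp add: ind(2) off.laplace_moment_def del: integral_mult_left_zero)
  have "(\<integral>n. exp (- t * real n) \<partial>measure_pmf p) \<le> (\<integral>n. indicat_real {\<mu>} n * exp (- t * real \<mu>) + exp (- t * real lam) \<partial>measure_pmf p)"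
  proof (intro integral_mono_AE Bochner_Integration.integrable_add ind integrable_exp_off assms)
    show "AE n in measure_pmf p. exp (- t * real n) \<le> indicat_real {\<mu>} n * exp (- t * real \<mu>) + exp (- t * real lam)"
      using AE_mu_or_lam
    proof eventually_elim
      case (elim n)
      then show ?case
      proof
        assume "lam \<le> n"
        then have "exp (- t * real n) \<le> exp (- t * real lam)" using assms by (simp add: mult_left_mono)
        then show ?thesis by (simp add: add_increasing)
      qed (simp add: indicator_def)
    qed
  qed simp
  then show "off.laplace_moment 0 t \<le> pmf p \<mu> * exp (- t * real \<mu>) + exp (- t * real lam)"
    by (subst (asm) Bochner_Integration.integral_add[OF ind(1)]) (simp_all add: ind(2) off.laplace_moment_def del: integral_mult_left_zero)
  have "(\<integral>n. exp (- t * real n) \<partial>measure_pmf p) \<le> (\<integral>n. exp (- t * real \<mu>) \<partial>measure_pmf p)"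
    using AE_mu_le assms by (intro integral_mono_AE integrable_exp_off) (auto elim!: eventually_mono intro: mult_left_mono)
  then show "off.laplace_moment 0 t \<le> exp (- t * real \<mu>)" by (simp add: off.laplace_moment_def)
qed

definition log_pmu :: real where "log_pmu = ln (pmf p \<mu>)"

lemma log_pmu_le_0: "log_pmu \<le> 0"
  unfolding log_pmu_def using pmf_mu_pos pmf_le_1[of p \<mu>] by simp

text \<open>Defect of the affine approximation of \<open>G\<close>: the logarithm of 1 plus the sum
  over \<open>n > \<mu>\<close> of
  \<open>pmf p n / pmf p \<mu> * exp (- (n - \<mu>) * t)\<close>.\<close>

definition eta :: "real \<Rightarrow> real" where "eta t = real \<mu> * t - log_pmu - G t"

text \<open>From \<open>ln (1 + y) \<ge> y / (1 + y)\<close> with \<open>y\<close> at most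
  \<open>pmf p lam / pmf p \<mu>\<close>.\<close>

definition eta_lower :: real where
  "eta_lower = (pmf p lam / pmf p \<mu>) / (1 + pmf p lam / pmf p \<mu>)"

lemma eta_lower_pos: "eta_lower > 0"
  unfolding eta_lower_def using lam pmf_mu_pos by (intro divide_pos_pos add_pos_pos) auto

lemma eta_bounds:
  fixes t :: real assumes "t \<ge> 0"
  shows "eta_lower * exp (- real (lam - \<mu>) * t) \<le> eta t" "eta t \<le> exp (- real (lam - \<mu>) * t) / pmf p \<mu>"
proof -
  define x where "x = exp (- real (lam - \<mu>) * t)"
  have x: "0 < x" "x \<le> 1" using assms by (auto simp: x_def)
  have xl: "exp (- t * real lam) = exp (- t * real \<mu>) * x"
    using lam(1) by (simp add: x_def exp_add[symmetric] of_nat_diff algebra_simps)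
  define L where "L = off.laplace_moment 0 t"
  have L: "L > 0" using off.laplace_moment_0_pos[OF assms] by (simp add: L_def)
  have pm: "pmf p \<mu> > 0" by (rule pmf_mu_pos)
  have eta: "eta t = ln (L * exp (t * real \<mu>) / pmf p \<mu>)"
    using L pm by (simp add: eta_def G_def off.neg_log_laplace_def L_def[symmetric] ln_div ln_mult log_pmu_def)
  let ?y = "pmf p lam / pmf p \<mu> * x"
  have y: "?y > 0" "?y \<le> pmf p lam / pmf p \<mu>" using x pm lam(2) by (auto intro!: divide_right_mono mult_left_le)
  have "pmf p \<mu> * exp (- t * real \<mu>) * (1 + ?y) \<le> L"
    using laplace_off_bounds(1)[OF assms] pm unfolding L_def xl by (simp add: algebra_simps)
  then have l: "1 + ?y \<le> L * exp (t * real \<mu>) / pmf p \<mu>"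
    using pm by (simp add: exp_minus field_simps)
  have "eta_lower * x = ?y / (1 + pmf p lam / pmf p \<mu>)" by (simp add: eta_lower_def)
  also have "\<dots> \<le> ?y / (1 + ?y)" using y by (intro divide_left_mono) (auto intro!: mult_pos_pos add_pos_pos)
  also have "\<dots> \<le> ln (1 + ?y)"
  proof -
    have "ln (1 / (1 + ?y)) \<le> 1 / (1 + ?y) - 1" using y by (intro ln_le_minus_one) auto
    also have "\<dots> = - (?y / (1 + ?y))"
    proof -
      have "1 / (1 + z) - 1 = - (z / (1 + z))" if "z > 0" for z :: real using that by (simp add: field_simps)
      then show ?thesis using y(1) by blast
    qed
    finally show ?thesis using y by (simp add: ln_div)
  qed
  also have "\<dots> \<le> eta t" unfolding eta using l y by (subst ln_le_cancel_iff) auto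
  finally show "eta_lower * exp (- real (lam - \<mu>) * t) \<le> eta t" by (simp add: x_def)
  have "L \<le> pmf p \<mu> * exp (- t * real \<mu>) * (1 + x / pmf p \<mu>)"
    using laplace_off_bounds(2)[OF assms] pm unfolding L_def xl by (simp add: algebra_simps)
  then have "L * exp (t * real \<mu>) \<le> pmf p \<mu> * exp (- t * real \<mu>) * (1 + x / pmf p \<mu>) * exp (t * real \<mu>)"
    by (rule mult_right_mono) simp
  also have "\<dots> = (1 + x / pmf p \<mu>) * pmf p \<mu>" by (simp add: exp_minus)
  finally have u: "L * exp (t * real \<mu>) / pmf p \<mu> \<le> 1 + x / pmf p \<mu>"
    using pm by (simp add: pos_divide_le_eq)
  have "eta t \<le> ln (1 + x / pmf p \<mu>)" unfolding eta using u L pm by (subst ln_le_cancel_iff) (auto intro!: add_pos_pos divide_pos_pos x)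
  also have "\<dots> \<le> x / pmf p \<mu>" using x pm by (intro ln_add_one_self_le_self) auto
  finally show "eta t \<le> exp (- real (lam - \<mu>) * t) / pmf p \<mu>" by (simp add: x_def)
qed

lemma eta_nonneg: "(t :: real) \<ge> 0 \<Longrightarrow> eta t \<ge> 0"
  using eta_bounds(1)[of t] eta_lower_pos by (meson exp_ge_zero less_imp_le mult_nonneg_nonneg order_trans)

lemma eta_le: "t \<ge> 0 \<Longrightarrow> eta t \<le> 1 / pmf p \<mu>"
proof -
  assume t: "t \<ge> 0"
  have "exp (- real (lam - \<mu>) * t) \<le> 1" using t by simp
  then have "exp (- real (lam - \<mu>) * t) / pmf p \<mu> \<le> 1 / pmf p \<mu>" by (rule divide_right_mono) simp
  then show ?thesis using eta_bounds(2)[OF t] by simp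
qed

lemma G_ge: "t \<ge> 0 \<Longrightarrow> real \<mu> * t \<le> G t"
proof -
  assume t: "t \<ge> 0"
  have "ln (off.laplace_moment 0 t) \<le> ln (exp (- t * real \<mu>))"
    using laplace_off_bounds(3)[OF t] off.laplace_moment_0_pos[OF t] by (subst ln_le_cancel_iff) auto
  then show ?thesis by (simp add: G_def off.neg_log_laplace_def mult.commute)
qed

lemma G_iter_ge: "t \<ge> 0 \<Longrightarrow> real \<mu> ^ m * t \<le> G_iter m t"
proof (induction m)
  case (Suc m)
  then have "0 \<le> G_iter m t" using mu_ge_2 by (meson mult_nonneg_nonneg of_nat_0_le_iff order_trans zero_le_power)
  then have "real \<mu> * G_iter m t \<le> G_iter (Suc m) t" using G_ge by simp
  moreover have "real \<mu> * (real \<mu> ^ m * t) \<le> real \<mu> * G_iter m t" using Suc by (intro mult_left_mono) auto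
  ultimately show ?case by (simp add: mult.assoc)
qed simp

lemma G_iter_ge_self: "t \<ge> 0 \<Longrightarrow> t \<le> G_iter m t"
  using G_iter_ge[of t m] mult_right_mono[of 1 "real \<mu> ^ m" t] mu_ge_2 one_le_power[of "real \<mu>" m] by simp

lemma G_iter_nonneg: "t \<ge> 0 \<Longrightarrow> 0 \<le> G_iter m t"
  using G_iter_ge_self[of t m] by simp

lemma gw_pgf_iter_exp: "t \<ge> 0 \<Longrightarrow> (gw_pgf p ^^ m) (exp (- t)) = exp (- G_iter m t)"
  by (induction m) (simp_all add: gw_pgf_exp G_iter_nonneg)

text \<open>The fixed point of the affine map \<open>\<mu> * t - log_pmu\<close> that approximates
  \<open>G\<close>.\<close>

definition log_c :: real where "log_c = log_pmu / (real \<mu> - 1)"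

text \<open>The Boettcher function in logarithmic coordinates, \<open>- b (exp (- t))\<close>; it
  conjugates \<open>G\<close> to multiplication by \<open>\<mu>\<close>.\<close>

definition bh :: "real \<Rightarrow> real" where "bh t = lim (\<lambda>m. G_iter m t / real \<mu> ^ m)"

text \<open>For an exactly affine \<open>G\<close>, \<open>bh t\<close> would equal
  \<open>t - log_c\<close>; this is the accumulated effect of \<open>eta\<close> along the orbit of
  \<open>t\<close>.\<close>

definition remainder :: "real \<Rightarrow> real" where "remainder t = t - log_c - bh t"

lemma mu_real: "real \<mu> \<ge> 2" using mu_ge_2 by linarith

lemma sums_mu: "(\<lambda>i. 1 / real \<mu> ^ Suc i) sums (1 / (real \<mu> - 1))"
proof -
  have "(\<lambda>i. 1 / real \<mu> * (1 / real \<mu>) ^ i) sums (1 / real \<mu> * (1 / (1 - 1 / real \<mu>)))"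
    using mu_real by (intro sums_mult geometric_sums) auto
  also have "1 / real \<mu> * (1 / (1 - 1 / real \<mu>)) = 1 / (real \<mu> - 1)" using mu_real by (simp add: field_simps)
  finally show ?thesis by (simp add: power_divide)
qed

text \<open>Unroll \<open>G t = \<mu> * t - log_pmu - eta t\<close> and divide by
  \<open>\<mu> ^ m\<close>. As \<open>eta\<close> is bounded, the series converges geometrically,
  and the constant terms sum to \<open>log_c\<close>.\<close>

lemma G_iter_div_tendsto_bh:
  fixes t :: real assumes "t \<ge> 0"
  shows "(\<lambda>m. G_iter m t / real \<mu> ^ m) \<longlonglongrightarrow> bh t"
    and remainder_sums: "(\<lambda>i. eta (G_iter i t) / real \<mu> ^ Suc i) sums remainder t"
proof -
  have mu: "real \<mu> > 0" using mu_real by simp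
  have expand: "G_iter m t / real \<mu> ^ m = t - (\<Sum>i<m. eta (G_iter i t) / real \<mu> ^ Suc i) - (\<Sum>i<m. log_pmu * (1 / real \<mu> ^ Suc i))" for m
  proof (induction m)
    case (Suc m)
    have "G_iter (Suc m) t = real \<mu> * G_iter m t - log_pmu - eta (G_iter m t)" by (simp add: eta_def)
    then have "G_iter (Suc m) t / real \<mu> ^ Suc m = G_iter m t / real \<mu> ^ m - log_pmu / real \<mu> ^ Suc m - eta (G_iter m t) / real \<mu> ^ Suc m"
      using mu by (simp add: diff_divide_distrib)
    then show ?case unfolding Suc by simp
  qed simp
  have sm: "summable (\<lambda>i. eta (G_iter i t) / real \<mu> ^ Suc i)"
  proof (rule summable_comparison_test')
    show "summable (\<lambda>i. 1 / pmf p \<mu> * (1 / real \<mu> ^ Suc i))"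
      using sums_mu by (intro summable_mult sums_summable)
    show "norm (eta (G_iter i t) / real \<mu> ^ Suc i) \<le> 1 / pmf p \<mu> * (1 / real \<mu> ^ Suc i)" if "i \<ge> 0" for i
    proof -
      have "norm (eta (G_iter i t) / real \<mu> ^ Suc i) = eta (G_iter i t) / real \<mu> ^ Suc i"
        using eta_nonneg[OF G_iter_nonneg[OF assms]] mu by simp
      also have "\<dots> \<le> (1 / pmf p \<mu>) / real \<mu> ^ Suc i"
        using mu by (intro divide_right_mono eta_le G_iter_nonneg assms) auto
      finally show ?thesis by simp
    qed
  qed
  let ?R = "\<Sum>i. eta (G_iter i t) / real \<mu> ^ Suc i"
  have "(\<lambda>m. t - (\<Sum>i<m. eta (G_iter i t) / real \<mu> ^ Suc i) - (\<Sum>i<m. log_pmu * (1 / real \<mu> ^ Suc i)))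
      \<longlonglongrightarrow> t - ?R - log_pmu * (1 / (real \<mu> - 1))"
    using summable_LIMSEQ[OF sm] sums_mult[OF sums_mu, of log_pmu] unfolding sums_def
    by (intro tendsto_intros) auto
  then have l: "(\<lambda>m. G_iter m t / real \<mu> ^ m) \<longlonglongrightarrow> t - ?R - log_pmu * (1 / (real \<mu> - 1))"
    unfolding expand .
  then have bh: "bh t = t - ?R - log_pmu * (1 / (real \<mu> - 1))" unfolding bh_def by (rule limI)
  show "(\<lambda>m. G_iter m t / real \<mu> ^ m) \<longlonglongrightarrow> bh t" using l unfolding bh .
  have "remainder t = ?R" unfolding remainder_def bh log_c_def by simp
  then show "(\<lambda>i. eta (G_iter i t) / real \<mu> ^ Suc i) sums remainder t" using sm by (simp add: sums_iff)
qed

text \<open>The term \<open>i = 0\<close> alone gives the lower bound. For the upper bound, no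
  iterate falls below \<open>t\<close>, and the weights sum to
  \<open>1 / (\<mu> - 1) \<le> 1\<close>.\<close>

lemma remainder_bounds:
  fixes t :: real assumes "t \<ge> 0"
  shows "eta_lower / real \<mu> * exp (- real (lam - \<mu>) * t) \<le> remainder t" "remainder t \<le> exp (- real (lam - \<mu>) * t) / pmf p \<mu>"
proof -
  have mu: "real \<mu> > 0" using mu_real by simp
  note s = remainder_sums[OF assms]
  have nn: "0 \<le> eta (G_iter i t) / real \<mu> ^ Suc i" for i
    using eta_nonneg[OF G_iter_nonneg[OF assms]] mu by simp
  have "eta t / real \<mu> \<le> remainder t"
    using sum_le_suminf[OF sums_summable[OF s], of "{0}"] nn sums_unique[OF s] by simp
  moreover have "eta_lower / real \<mu> * exp (- real (lam - \<mu>) * t) \<le> eta t / real \<mu>"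
    using divide_right_mono[OF eta_bounds(1)[OF assms], of "real \<mu>"] mu by simp
  ultimately show "eta_lower / real \<mu> * exp (- real (lam - \<mu>) * t) \<le> remainder t" by simp
  let ?x = "exp (- real (lam - \<mu>) * t) / pmf p \<mu>"
  have "remainder t \<le> ?x * (1 / (real \<mu> - 1))"
  proof (rule sums_le[OF _ s sums_mult[OF sums_mu, of ?x]])
    fix i
    have "eta (G_iter i t) \<le> exp (- real (lam - \<mu>) * G_iter i t) / pmf p \<mu>"
      by (rule eta_bounds(2)[OF G_iter_nonneg[OF assms]])
    also have "\<dots> \<le> ?x"
      using G_iter_ge_self[OF assms, of i] pmf_mu_pos by (intro divide_right_mono) (auto intro: mult_left_mono)
    finally have "eta (G_iter i t) / real \<mu> ^ Suc i \<le> ?x / real \<mu> ^ Suc i"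
      using mu by (intro divide_right_mono) auto
    then show "eta (G_iter i t) / real \<mu> ^ Suc i \<le> ?x * (1 / real \<mu> ^ Suc i)" by simp
  qed
  also have "\<dots> \<le> ?x * 1" using mu_real pmf_mu_pos by (intro mult_left_mono) auto
  finally show "remainder t \<le> ?x" by simp
qed

lemma remainder_nonneg: "t \<ge> 0 \<Longrightarrow> 0 \<le> remainder t"
  using remainder_bounds(1)[of t] eta_lower_pos mu_real
  by (meson divide_nonneg_nonneg exp_ge_zero less_imp_le mult_nonneg_nonneg of_nat_0_le_iff order_trans)

lemma bh_G: fixes t :: real assumes "t \<ge> 0" shows "bh (G t) = real \<mu> * bh t"
proof -
  have "(\<lambda>m. G_iter m (G t) / real \<mu> ^ m) \<longlonglongrightarrow> bh (G t)"
    using G_ge[OF assms] assms by (intro G_iter_div_tendsto_bh) (meson mult_nonneg_nonneg of_nat_0_le_iff order_trans)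
  moreover have "(\<lambda>m. G_iter m (G t) / real \<mu> ^ m) = (\<lambda>m. real \<mu> * (G_iter (Suc m) t / real \<mu> ^ Suc m))"
    using mu_real by (simp add: fun_eq_iff funpow_swap1)
  moreover have "(\<lambda>m. real \<mu> * (G_iter (Suc m) t / real \<mu> ^ Suc m)) \<longlonglongrightarrow> real \<mu> * bh t"
    using LIMSEQ_Suc[OF G_iter_div_tendsto_bh(1)[OF assms]] by (intro tendsto_mult_left)
  ultimately show ?thesis using LIMSEQ_unique by metis
qed

lemma bh_G_iter: "t \<ge> 0 \<Longrightarrow> bh (G_iter m t) = real \<mu> ^ m * bh t"
  by (induction m) (simp_all add: bh_G G_iter_nonneg mult.assoc)

lemma bh_ge_self: "t \<ge> 0 \<Longrightarrow> t \<le> bh t"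
proof (rule LIMSEQ_le_const[OF G_iter_div_tendsto_bh(1)])
  assume "t \<ge> 0"
  then show "\<exists>n. \<forall>m\<ge>n. t \<le> G_iter m t / real \<mu> ^ m"
    using G_iter_ge[of t] mu_real by (auto simp: field_simps)
qed

lemma gw_b_exp: "t \<ge> 0 \<Longrightarrow> gw_b p (exp (- t)) = - bh t"
  unfolding gw_b_def using tendsto_minus[OF G_iter_div_tendsto_bh(1)[of t]]
  by (intro limI) (simp add: gw_pgf_iter_exp)

text \<open>Each of the individuals in the first k generations has exactly \<open>\<mu>\<close>
  children; their number \<open>(\<mu> ^ k - 1) / (\<mu> - 1)\<close> times \<open>log_pmu\<close>
  is the exponent.\<close>

lemma prob_Z_minimal:
  "prob {x \<in> space M. tree_Z k (tree x) = \<mu> ^ k} = exp ((real \<mu> ^ k - 1) * log_c)"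
proof (induction k)
  case (Suc k)
  have "prob {x \<in> space M. tree_Z (Suc k) (tree x) = \<mu> ^ Suc k}
      = exp ((real \<mu> ^ k - 1) * log_c) * pmf p \<mu> ^ (\<mu> ^ k)"
    using prob_Z_Suc_minimal[of \<mu> k] pmf_less_mu mu_ge_2 unfolding Suc by auto
  also have "pmf p \<mu> ^ (\<mu> ^ k) = exp (real \<mu> ^ k * log_pmu)"
    using pmf_mu_pos exp_of_nat_mult[of "\<mu> ^ k" log_pmu] by (simp add: log_pmu_def)
  also have "log_pmu = log_c * (real \<mu> - 1)" using mu_real by (simp add: log_c_def)
  finally show ?case by (simp add: exp_add[symmetric] algebra_simps)
qed (simp add: prob_space)

section \<open>Derivatives of the iterates and of the Boettcher function\<close>

lemma DERIV_G: "t > 0 \<Longrightarrow> (G has_real_derivative off.tilted_mean t) (at t)"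
  unfolding G_def by (rule off.DERIV_neg_log_laplace)

lemma laplace_off_ge: "t \<ge> 0 \<Longrightarrow> pmf p \<mu> * exp (- t * real \<mu>) \<le> off.laplace_moment 0 t"
  using laplace_off_bounds(1)[of t] lam(2) by (smt (verit) exp_gt_zero mult_pos_pos)

text \<open>For large \<open>t\<close> the tilted offspring law concentrates at
  \<open>\<mu>\<close>. The factor \<open>exp (- t)\<close> comes from
  \<open>n \<ge> \<mu> + 1\<close> off this atom, and drives the convergence of all series
  below.\<close>

lemma off_tilted_mean_bounds:
  assumes "t > 0"
  shows "real \<mu> \<le> off.tilted_mean t" "off.tilted_mean t \<le> real \<mu> + a / pmf p \<mu> * exp (- t)"
proof -
  have t0: "t \<ge> 0" using assms by simp
  let ?L = "off.laplace_moment 0 t"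
  have L: "?L > 0" by (rule off.laplace_moment_0_pos[OF t0])
  have i1: "integrable (measure_pmf p) (\<lambda>n. real n ^ 1 * exp (- t * real n))"
    by (rule off.integrable_laplace_moment[OF assms])
  have i: "integrable (measure_pmf p) (\<lambda>n. (real n - real \<mu>) * exp (- t * real n))"
    using i1 integrable_exp_off[OF t0] by (simp add: left_diff_distrib)
  have e: "(\<integral>n. (real n - real \<mu>) * exp (- t * real n) \<partial>measure_pmf p) = (off.tilted_mean t - real \<mu>) * ?L"
  proof -
    have "(\<integral>n. (real n - real \<mu>) * exp (- t * real n) \<partial>measure_pmf p) = off.laplace_moment 1 t - real \<mu> * ?L"
      using i1 integrable_exp_off[OF t0] by (simp add: left_diff_distrib off.laplace_moment_def)
    also have "off.laplace_moment 1 t = off.tilted_mean t * ?L" using L by (simp add: off.tilted_mean_def)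
    also have "off.tilted_mean t * ?L - real \<mu> * ?L = (off.tilted_mean t - real \<mu>) * ?L"
      by (rule left_diff_distrib[symmetric])
    finally show ?thesis .
  qed
  have "0 \<le> (\<integral>n. (real n - real \<mu>) * exp (- t * real n) \<partial>measure_pmf p)"
    using AE_mu_le by (intro integral_nonneg_AE) (auto elim!: eventually_mono)
  then show "real \<mu> \<le> off.tilted_mean t" using L unfolding e by (simp add: zero_le_mult_iff)
  have "(\<integral>n. (real n - real \<mu>) * exp (- t * real n) \<partial>measure_pmf p) \<le> (\<integral>n. real n * (exp (- t * real \<mu>) * exp (- t)) \<partial>measure_pmf p)"
  proof (rule integral_mono_AE[OF i])
    show "integrable (measure_pmf p) (\<lambda>n. real n * (exp (- t * real \<mu>) * exp (- t)))"
      using integrable_N by (rule integrable_mult_left)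
    show "AE n in measure_pmf p. (real n - real \<mu>) * exp (- t * real n) \<le> real n * (exp (- t * real \<mu>) * exp (- t))"
      using AE_mu_le
    proof eventually_elim
      case (elim n)
      show ?case
      proof (cases "n = \<mu>")
        case False
        then have "real \<mu> + 1 \<le> real n" using elim by simp
        then have "t * (real \<mu> + 1) \<le> t * real n" using t0 by (rule mult_left_mono)
        then have "exp (- t * real n) \<le> exp (- t * real \<mu>) * exp (- t)"
          by (simp add: exp_add[symmetric] algebra_simps)
        then show ?thesis using elim by (intro mult_mono) auto
      qed simp
    qed
  qed
  also have "\<dots> = a * (exp (- t * real \<mu>) * exp (- t))" by (simp add: gw_mean_def)
  also have "\<dots> = a / pmf p \<mu> * exp (- t) * (pmf p \<mu> * exp (- t * real \<mu>))" using pmf_mu_pos by simp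
  also have "\<dots> \<le> a / pmf p \<mu> * exp (- t) * ?L"
    using laplace_off_ge[OF t0] mean_gt_1 pmf_mu_pos by (intro mult_left_mono) auto
  finally have "(off.tilted_mean t - real \<mu>) * ?L \<le> a / pmf p \<mu> * exp (- t) * ?L" unfolding e .
  then have "off.tilted_mean t - real \<mu> \<le> a / pmf p \<mu> * exp (- t)" by (rule mult_right_le_imp_le[OF _ L])
  then show "off.tilted_mean t \<le> real \<mu> + a / pmf p \<mu> * exp (- t)" by simp
qed

text \<open>Second moments of the offspring are not assumed, so a part \<open>t0\<close> of the tilt
  is spent on bounding \<open>k\<^sup>2 * exp (- t0 * k)\<close> with \<open>k = n - \<mu>\<close>;
  the rest gives \<open>exp (- (t - t0))\<close>, as \<open>k \<ge> 1\<close> in all nonzero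
  terms.\<close>

lemma off_tilted_variance_le:
  assumes "t0 > 0" "t0 \<le> t"
  shows "off.tilted_variance t \<le> 2 * exp t0 / (t0\<^sup>2 * pmf p \<mu>) * exp (- t)"
proof -
  have t: "t > 0" "t \<ge> 0" using assms by auto
  let ?L = "off.laplace_moment 0 t" and ?c = "2 * exp t0 / t0\<^sup>2 * exp (- t)"
  have L: "?L > 0" by (rule off.laplace_moment_0_pos[OF t(2)])
  have "?L * off.tilted_variance t \<le> ?L * (off.tilted_variance t + (off.tilted_mean t - real \<mu>)\<^sup>2)"
    using L by (intro mult_left_mono) auto
  also have "\<dots> = (\<integral>n. (real n - real \<mu>)\<^sup>2 * exp (- t * real n) \<partial>measure_pmf p)"
    by (rule off.integral_centred_sq(1)[OF t(1), symmetric])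
  also have "\<dots> \<le> (\<integral>n. ?c * exp (- t * real \<mu>) \<partial>measure_pmf p)"
  proof (rule integral_mono_AE[OF off.integral_centred_sq(2)[OF t(1)]])
    show "AE n in measure_pmf p. (real n - real \<mu>)\<^sup>2 * exp (- t * real n) \<le> ?c * exp (- t * real \<mu>)"
      using AE_mu_le
    proof eventually_elim
      case (elim n)
      show ?case
      proof (cases "n = \<mu>")
        case False
        define k where "k = real n - real \<mu>"
        have k: "k \<ge> 1" using elim False by (simp add: k_def)
        have "(t - t0) * 1 \<le> (t - t0) * k" using k assms by (intro mult_left_mono) auto
        then have e1: "exp (- ((t - t0) * k)) \<le> exp t0 * exp (- t)" by (simp add: exp_add[symmetric])
        have e2: "k\<^sup>2 * exp (- t0 * k) \<le> 2 / t0\<^sup>2"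
          using off.power_exp_le[OF assms(1), of k 2] k by simp
        have "k\<^sup>2 * exp (- t * real n) = (k\<^sup>2 * exp (- t0 * k)) * exp (- ((t - t0) * k)) * exp (- t * real \<mu>)"
          by (simp add: k_def exp_add[symmetric] algebra_simps)
        also have "\<dots> \<le> (2 / t0\<^sup>2) * (exp t0 * exp (- t)) * exp (- t * real \<mu>)"
          using e1 e2 by (intro mult_right_mono mult_mono) auto
        finally show ?thesis by (simp add: k_def)
      qed simp
    qed
  qed simp
  also have "\<dots> = ?c / pmf p \<mu> * (pmf p \<mu> * exp (- t * real \<mu>))" using pmf_mu_pos by simp
  also have "\<dots> \<le> ?c / pmf p \<mu> * ?L"
    using laplace_off_ge[OF t(2)] pmf_mu_pos by (intro mult_left_mono) auto
  finally have "off.tilted_variance t * ?L \<le> ?c / pmf p \<mu> * ?L" by (simp add: mult.commute)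
  then have "off.tilted_variance t \<le> ?c / pmf p \<mu>" by (rule mult_right_le_imp_le[OF _ L])
  then show ?thesis by (simp add: field_simps)
qed

text \<open>\<open>G_iter i t\<close> grows at least like \<open>\<mu> ^ i * t0\<close>. Of the
  resulting superexponential decay only a geometric rate is kept, with exponent 2 so that one factor
  \<open>\<mu> ^ i\<close> can still be lost.\<close>

lemma exp_G_iter_le:
  assumes "t0 > 0" "t0 \<le> t"
  shows "exp (- G_iter i t) \<le> 2 / t0\<^sup>2 / real \<mu> ^ (2 * i)"
proof -
  have "real \<mu> ^ i * t0 \<le> real \<mu> ^ i * t" using assms by (intro mult_left_mono) auto
  also have "\<dots> \<le> G_iter i t" using assms by (intro G_iter_ge) auto
  finally have "exp (- G_iter i t) \<le> exp (- t0 * real \<mu> ^ i)" by (simp add: mult.commute)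
  moreover have "(real \<mu> ^ i)\<^sup>2 * exp (- t0 * real \<mu> ^ i) \<le> 2 / t0\<^sup>2"
    using off.power_exp_le[OF assms(1), of "real \<mu> ^ i" 2] by simp
  ultimately have "(real \<mu> ^ i)\<^sup>2 * exp (- G_iter i t) \<le> 2 / t0\<^sup>2"
    by (meson mult_left_mono order_trans zero_le_power2)
  then have "real \<mu> ^ (2 * i) * exp (- G_iter i t) \<le> 2 / t0\<^sup>2" by (simp add: power_mult[symmetric] mult.commute)
  moreover have "real \<mu> ^ (2 * i) > 0" using mu_real by simp
  ultimately show ?thesis by (subst pos_le_divide_eq) (simp_all add: mult.commute)
qed

lemma inverse_mu_power_le: "1 / real \<mu> ^ i \<le> (1 / 2) ^ i"
proof -
  have "(1 / real \<mu>) ^ i \<le> (1 / 2) ^ i" using mu_real by (intro power_mono divide_left_mono) auto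
  then show ?thesis by (simp add: power_divide)
qed

text \<open>The chain-rule product for the derivative of \<open>G_iter m\<close>; it is also the
  mean of generation \<open>m\<close> under the tilt by \<open>exp (- t * Z)\<close>.\<close>

definition dG :: "nat \<Rightarrow> real \<Rightarrow> real" where
  "dG m t = (\<Prod>i<m. off.tilted_mean (G_iter i t))"

text \<open>Minus the second derivative of \<open>G_iter m\<close>, so that it is the tilted
  variance of generation \<open>m\<close>; the recursion is the product rule.\<close>

fun ddG :: "nat \<Rightarrow> real \<Rightarrow> real" where
  "ddG 0 t = 0"
| "ddG (Suc m) t = off.tilted_variance (G_iter m t) * (dG m t)\<^sup>2 + off.tilted_mean (G_iter m t) * ddG m t"

lemma dG_0 [simp]: "dG 0 t = 1" and dG_Suc: "dG (Suc m) t = off.tilted_mean (G_iter m t) * dG m t"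
  by (simp_all add: dG_def)

lemma G_iter_pos: "t > 0 \<Longrightarrow> G_iter m t > 0"
  using G_iter_ge_self[of t m] by simp

lemma DERIV_G_iter: "t > 0 \<Longrightarrow> (G_iter m has_real_derivative dG m t) (at t)"
proof (induction m)
  case (Suc m)
  have "(G_iter (Suc m)) = (\<lambda>t. G (G_iter m t))" by (simp add: fun_eq_iff)
  moreover have "((\<lambda>t. G (G_iter m t)) has_real_derivative off.tilted_mean (G_iter m t) * dG m t) (at t)"
    by (rule DERIV_chain2[OF DERIV_G[OF G_iter_pos[OF Suc.prems]] Suc.IH[OF Suc.prems]])
  ultimately show ?case by (simp only: dG_Suc)
qed (simp add: id_def)

lemma DERIV_dG: "t > 0 \<Longrightarrow> (dG m has_real_derivative - ddG m t) (at t)"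
proof (induction m)
  case 0
  have "dG 0 = (\<lambda>t. 1)" by (simp add: fun_eq_iff)
  then show ?case by simp
next
  case (Suc m)
  have eq: "dG (Suc m) = (\<lambda>t. off.tilted_mean (G_iter m t) * dG m t)" by (simp add: fun_eq_iff dG_Suc)
  have 1: "((\<lambda>t. off.tilted_mean (G_iter m t)) has_real_derivative - off.tilted_variance (G_iter m t) * dG m t) (at t)"
    by (rule DERIV_chain2[OF off.DERIV_tilted_mean[OF G_iter_pos[OF Suc.prems]] DERIV_G_iter[OF Suc.prems]])
  show ?case unfolding eq
    by (rule DERIV_cong[OF DERIV_mult[OF 1 Suc.IH[OF Suc.prems]]]) (simp add: power2_eq_square algebra_simps)
qed

lemma dG_ge: "t > 0 \<Longrightarrow> real \<mu> ^ m \<le> dG m t"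
proof (induction m)
  case (Suc m)
  have "real \<mu> * real \<mu> ^ m \<le> off.tilted_mean (G_iter m t) * dG m t"
    using off_tilted_mean_bounds(1)[OF G_iter_pos[OF Suc.prems, of m]] Suc mu_real by (intro mult_mono) auto
  then show ?case by (simp add: dG_Suc)
qed simp

lemma dG_pos: "t > 0 \<Longrightarrow> dG m t > 0"
  using dG_ge[of t m] mu_real by (meson less_le_trans order_less_le_trans zero_less_numeral zero_less_power)

lemma G_iter_mono: "0 < s \<Longrightarrow> s \<le> t \<Longrightarrow> G_iter m s \<le> G_iter m t"
  by (rule DERIV_nonneg_imp_nondecreasing[of s t])
     (auto intro!: exI[of _ "dG m _"] DERIV_G_iter less_imp_le[OF dG_pos])

lemma dG_antimono: "0 < s \<Longrightarrow> s \<le> t \<Longrightarrow> dG m t \<le> dG m s"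
proof (induction m)
  case (Suc m)
  then show ?case
    unfolding dG_Suc
    by (intro mult_mono off.tilted_mean_antimono G_iter_mono G_iter_pos less_imp_le[OF dG_pos] off.tilted_mean_nonneg)
       (auto intro: G_iter_nonneg)
qed simp

text \<open>With \<open>c = a / pmf p \<mu> * (2 / t0\<^sup>2)\<close>, the factors of
  \<open>dG m t / \<mu> ^ m\<close> are at most \<open>1 + c * (1 / 2) ^ i\<close>, and their
  product is at most \<open>exp (2 * c)\<close>.\<close>

definition dG_const :: "real \<Rightarrow> real" where
  "dG_const t0 = exp (2 * (a / pmf p \<mu> * (2 / t0\<^sup>2)))"

lemma dG_const_pos: "dG_const t0 > 0" by (simp add: dG_const_def)

lemma dG_le:
  assumes "t0 > 0" "t0 \<le> t"
  shows "dG m t \<le> dG_const t0 * real \<mu> ^ m"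
proof -
  let ?c = "a / pmf p \<mu> * (2 / t0\<^sup>2)"
  have c: "?c \<ge> 0" using mean_gt_1 by simp
  have t: "t > 0" using assms by simp
  have "dG m t \<le> exp (?c * (2 - 2 * (1 / 2) ^ m)) * real \<mu> ^ m"
  proof (induction m)
    case (Suc m)
    have "off.tilted_mean (G_iter m t) \<le> real \<mu> + a / pmf p \<mu> * exp (- G_iter m t)"
      by (rule off_tilted_mean_bounds(2)[OF G_iter_pos[OF t]])
    also have "\<dots> \<le> real \<mu> + a / pmf p \<mu> * (2 / t0\<^sup>2 / real \<mu> ^ (2 * m))"
      using exp_G_iter_le[OF assms, of m] mean_gt_1 by (intro add_left_mono mult_left_mono) auto
    also have "\<dots> = real \<mu> + ?c * (1 / real \<mu> ^ (2 * m))" by simp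
    also have "\<dots> \<le> real \<mu> + ?c * (1 / 2) ^ m"
    proof -
      have "1 / real \<mu> ^ (2 * m) \<le> (1 / 2) ^ (2 * m)" by (rule inverse_mu_power_le)
      also have "\<dots> \<le> (1 / 2) ^ m" by (rule power_decreasing) auto
      finally show ?thesis using c by (intro add_left_mono mult_left_mono) auto
    qed
    also have "\<dots> \<le> real \<mu> * (1 + ?c * (1 / 2) ^ m)"
    proof -
      have gen: "real \<mu> + x \<le> real \<mu> * (1 + x)" if "x \<ge> 0" for x
        using mu_real that mult_right_mono[of 1 "real \<mu>" x] by (simp add: algebra_simps)
      show ?thesis by (rule gen[OF mult_nonneg_nonneg[OF c]]) simp
    qed
    also have "\<dots> \<le> real \<mu> * exp (?c * (1 / 2) ^ m)"
      by (intro mult_left_mono exp_ge_add_one_self) auto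
    finally have "dG (Suc m) t \<le> (real \<mu> * exp (?c * (1 / 2) ^ m)) * (exp (?c * (2 - 2 * (1 / 2) ^ m)) * real \<mu> ^ m)"
      unfolding dG_Suc using Suc dG_pos[OF t, of m] off.tilted_mean_nonneg[OF G_iter_nonneg, of t m] t
      by (intro mult_mono) auto
    also have "\<dots> = (exp (?c * (1 / 2) ^ m) * exp (?c * (2 - 2 * (1 / 2) ^ m))) * real \<mu> ^ Suc m" by simp
    also have "exp (?c * (1 / 2) ^ m) * exp (?c * (2 - 2 * (1 / 2) ^ m)) = exp (?c * (2 - 2 * (1 / 2) ^ Suc m))"
      unfolding exp_add[symmetric] distrib_left[symmetric] by simp
    finally show ?case .
  qed simp
  also have "\<dots> \<le> dG_const t0 * real \<mu> ^ m"
  proof (rule mult_right_mono)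
    have "?c * (2 - 2 * (1 / 2) ^ m) \<le> ?c * 2" using c by (intro mult_left_mono) auto
    then show "exp (?c * (2 - 2 * (1 / 2) ^ m)) \<le> dG_const t0" by (simp add: dG_const_def mult.commute)
  qed simp
  finally show ?thesis .
qed

definition ddG_const :: "real \<Rightarrow> real" where
  "ddG_const t0 = 2 * exp t0 / (t0\<^sup>2 * pmf p \<mu>) * (2 / t0\<^sup>2) * dG_const t0"

lemma ddG_const_nonneg: "ddG_const t0 \<ge> 0"
  using dG_const_pos[of t0] by (simp add: ddG_const_def)

text \<open>In units of \<open>dG m t\<close>, the recursion adds at most
  \<open>ddG_const t0 * (1 / 2) ^ m\<close> per step, because the offspring variance at
  \<open>G_iter m t\<close> decays like \<open>1 / \<mu> ^ (2 * m)\<close>. So the tilted variance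
  of generation \<open>m\<close> is of no larger order than its mean.\<close>

lemma ddG_le:
  assumes "t0 > 0" "t0 \<le> t"
  shows "ddG m t \<le> 2 * ddG_const t0 * dG_const t0 * real \<mu> ^ m"
proof -
  let ?B = "ddG_const t0" and ?v = "2 * exp t0 / (t0\<^sup>2 * pmf p \<mu>)"
  have t: "t > 0" using assms by simp
  have "ddG m t \<le> ?B * (2 - 2 * (1 / 2) ^ m) * dG m t"
  proof (induction m)
    case (Suc m)
    have d: "dG m t \<le> dG (Suc m) t"
      unfolding dG_Suc using off_tilted_mean_bounds(1)[OF G_iter_pos[OF t, of m]] mu_real dG_pos[OF t, of m]
        mult_right_mono[of 1 "off.tilted_mean (G_iter m t)" "dG m t"] by simp
    have "t0 \<le> G_iter m t" using assms G_iter_ge_self[of t m] by simp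
    then have "off.tilted_variance (G_iter m t) \<le> ?v * exp (- G_iter m t)"
      by (rule off_tilted_variance_le[OF assms(1)])
    also have "\<dots> \<le> ?v * (2 / t0\<^sup>2 / real \<mu> ^ (2 * m))"
      using exp_G_iter_le[OF assms, of m] by (intro mult_left_mono) auto
    finally have v: "off.tilted_variance (G_iter m t) \<le> ?v * (2 / t0\<^sup>2 / real \<mu> ^ (2 * m))" .
    have "off.tilted_variance (G_iter m t) * dG m t \<le> ?v * (2 / t0\<^sup>2 / real \<mu> ^ (2 * m)) * (dG_const t0 * real \<mu> ^ m)"
      using v dG_le[OF assms, of m] dG_pos[OF t, of m] by (intro mult_mono) auto
    also have "\<dots> = ?B * (1 / real \<mu> ^ m)"
    proof -
      have gen: "v * (2 / t0\<^sup>2 / (z * z)) * (k * z) = v * (2 / t0\<^sup>2) * k * (1 / z)" if "z \<noteq> 0" for v k z :: real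
        using that by simp
      have sq: "real \<mu> ^ (2 * m) = real \<mu> ^ m * real \<mu> ^ m" by (simp add: mult_2 power_add)
      have nz: "real \<mu> ^ m \<noteq> 0" using mu_real by simp
      show ?thesis unfolding ddG_const_def sq by (rule gen[OF nz])
    qed
    also have "\<dots> \<le> ?B * (1 / 2) ^ m"
      using inverse_mu_power_le[of m] ddG_const_nonneg[of t0] by (intro mult_left_mono) auto
    finally have v2: "off.tilted_variance (G_iter m t) * dG m t \<le> ?B * (1 / 2) ^ m" .
    have "off.tilted_variance (G_iter m t) * (dG m t)\<^sup>2 = (off.tilted_variance (G_iter m t) * dG m t) * dG m t"
      by (simp add: power2_eq_square)
    also have "\<dots> \<le> (?B * (1 / 2) ^ m) * dG (Suc m) t"
      using dG_pos[OF t, of m] ddG_const_nonneg[of t0] by (intro mult_mono[OF v2 d]) auto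
    finally have 1: "off.tilted_variance (G_iter m t) * (dG m t)\<^sup>2 \<le> (?B * (1 / 2) ^ m) * dG (Suc m) t" .
    have "off.tilted_mean (G_iter m t) * ddG m t \<le> off.tilted_mean (G_iter m t) * (?B * (2 - 2 * (1 / 2) ^ m) * dG m t)"
      using Suc off.tilted_mean_nonneg[OF G_iter_nonneg, of t m] t by (intro mult_left_mono) auto
    then have 2: "off.tilted_mean (G_iter m t) * ddG m t \<le> ?B * (2 - 2 * (1 / 2) ^ m) * dG (Suc m) t"
      by (simp add: dG_Suc mult_ac)
    have "ddG (Suc m) t \<le> (?B * (1 / 2) ^ m) * dG (Suc m) t + ?B * (2 - 2 * (1 / 2) ^ m) * dG (Suc m) t"
      using 1 2 by simp
    also have "\<dots> = ?B * (2 - 2 * (1 / 2) ^ Suc m) * dG (Suc m) t"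
      by (simp add: algebra_simps)
    finally show ?case .
  qed simp
  also have "\<dots> \<le> ?B * 2 * (dG_const t0 * real \<mu> ^ m)"
    using dG_le[OF assms, of m] dG_pos[OF t, of m] ddG_const_nonneg[of t0] power_le_one[of "1 / 2 :: real" m]
    by (intro mult_mono) auto
  finally show ?thesis by (simp add: mult_ac)
qed

text \<open>The limit of \<open>dG m t / \<mu> ^ m\<close>, written as a telescoping series so that it can be shown to converge
  uniformly; it is the derivative of bh.\<close>

definition bp :: "real \<Rightarrow> real" where
  "bp t = 1 + (\<Sum>m. dG (Suc m) t / real \<mu> ^ Suc m - dG m t / real \<mu> ^ m)"

definition bp_const :: "real \<Rightarrow> real" where
  "bp_const t0 = dG_const t0 * (a / pmf p \<mu> * (2 / t0\<^sup>2))"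

lemma bp_const_nonneg: "bp_const t0 \<ge> 0"
  using dG_const_pos[of t0] mean_gt_1 by (simp add: bp_const_def)

lemma dG_increment:
  assumes "t0 > 0" "t0 \<le> t"
  shows "0 \<le> dG (Suc m) t / real \<mu> ^ Suc m - dG m t / real \<mu> ^ m"
    and "dG (Suc m) t / real \<mu> ^ Suc m - dG m t / real \<mu> ^ m \<le> bp_const t0 / real \<mu> ^ (2 * m)"
proof -
  have t: "t > 0" using assms by simp
  have mu: "real \<mu> > 0" using mu_real by simp
  have eq: "dG (Suc m) t / real \<mu> ^ Suc m - dG m t / real \<mu> ^ m
     = (dG m t / real \<mu> ^ m) * ((off.tilted_mean (G_iter m t) - real \<mu>) / real \<mu>)"
    using mu by (simp add: dG_Suc field_simps)
  have d: "0 \<le> dG m t / real \<mu> ^ m" "dG m t / real \<mu> ^ m \<le> dG_const t0"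
    using dG_pos[OF t, of m] dG_le[OF assms, of m] mu by (auto simp: field_simps)
  have q: "0 \<le> (off.tilted_mean (G_iter m t) - real \<mu>) / real \<mu>"
    using off_tilted_mean_bounds(1)[OF G_iter_pos[OF t, of m]] mu by simp
  show "0 \<le> dG (Suc m) t / real \<mu> ^ Suc m - dG m t / real \<mu> ^ m"
    unfolding eq by (rule mult_nonneg_nonneg[OF d(1) q])
  have "(off.tilted_mean (G_iter m t) - real \<mu>) / real \<mu> \<le> (off.tilted_mean (G_iter m t) - real \<mu>) / 1"
    using off_tilted_mean_bounds(1)[OF G_iter_pos[OF t, of m]] mu_real by (intro divide_left_mono) auto
  also have "\<dots> \<le> a / pmf p \<mu> * exp (- G_iter m t)"
    using off_tilted_mean_bounds(2)[OF G_iter_pos[OF t, of m]] by simp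
  also have "\<dots> \<le> a / pmf p \<mu> * (2 / t0\<^sup>2 / real \<mu> ^ (2 * m))"
    using exp_G_iter_le[OF assms, of m] mean_gt_1 by (intro mult_left_mono) auto
  finally have "dG (Suc m) t / real \<mu> ^ Suc m - dG m t / real \<mu> ^ m \<le> dG_const t0 * (a / pmf p \<mu> * (2 / t0\<^sup>2 / real \<mu> ^ (2 * m)))"
    unfolding eq using d q dG_const_pos[of t0] by (intro mult_mono) auto
  then show "dG (Suc m) t / real \<mu> ^ Suc m - dG m t / real \<mu> ^ m \<le> bp_const t0 / real \<mu> ^ (2 * m)"
    by (simp add: bp_const_def)
qed

lemma dG_increment_le_half:
  assumes "t0 > 0" "t0 \<le> t"
  shows "norm (dG (Suc m) t / real \<mu> ^ Suc m - dG m t / real \<mu> ^ m) \<le> bp_const t0 * (1 / 2) ^ m"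
proof -
  have "1 / real \<mu> ^ (2 * m) \<le> (1 / 2) ^ (2 * m)" by (rule inverse_mu_power_le)
  also have "\<dots> \<le> (1 / 2) ^ m" by (rule power_decreasing) auto
  finally have "bp_const t0 * (1 / real \<mu> ^ (2 * m)) \<le> bp_const t0 * (1 / 2) ^ m"
    using bp_const_nonneg by (intro mult_left_mono) auto
  then show ?thesis using dG_increment[OF assms, of m] by simp
qed

lemma dG_sums_bp:
  assumes "t > 0"
  shows "(\<lambda>m. dG m t / real \<mu> ^ m) \<longlonglongrightarrow> bp t"
    and "summable (\<lambda>m. dG (Suc m) t / real \<mu> ^ Suc m - dG m t / real \<mu> ^ m)"
proof -
  let ?f = "\<lambda>m. dG (Suc m) t / real \<mu> ^ Suc m - dG m t / real \<mu> ^ m"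
  show sm: "summable ?f"
    by (rule summable_comparison_test'[where g = "\<lambda>m. bp_const t * (1 / 2) ^ m" and N = 0])
       (use dG_increment_le_half[OF assms order_refl] in \<open>auto intro: summable_mult summable_geometric\<close>)
  have "(\<lambda>m. 1 + (\<Sum>i<m. ?f i)) \<longlonglongrightarrow> bp t"
    unfolding bp_def using summable_LIMSEQ[OF sm] by (intro tendsto_intros)
  also have "(\<lambda>m. 1 + (\<Sum>i<m. ?f i)) = (\<lambda>m. dG m t / real \<mu> ^ m)"
    by (simp add: fun_eq_iff sum_lessThan_telescope[of "\<lambda>i. dG i t / real \<mu> ^ i"] del: power_Suc)
  finally show "(\<lambda>m. dG m t / real \<mu> ^ m) \<longlonglongrightarrow> bp t" .
qed

lemma bp_ge_1: "t > 0 \<Longrightarrow> bp t \<ge> 1"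
  unfolding bp_def using dG_increment(1)[OF _ order_refl, of t] suminf_nonneg[OF dG_sums_bp(2)[of t]] by simp

lemma bp_antimono: "0 < s \<Longrightarrow> s \<le> t \<Longrightarrow> bp t \<le> bp s"
  by (rule LIMSEQ_le[OF dG_sums_bp(1) dG_sums_bp(1)])
     (auto intro!: exI[of _ 0] divide_right_mono dG_antimono)

text \<open>The increments decay like \<open>1 / \<mu> ^ (2 * m)\<close>, so the tail stays bounded
  even after multiplication by \<open>\<mu> ^ m\<close>. Replacing the tilted mean by
  \<open>\<mu> ^ m * bp t\<close> is harmless against deviations of order
  \<open>sqrt (\<mu> ^ m)\<close>.\<close>

lemma bp_minus_dG:
  assumes "t0 > 0" "t0 \<le> t"
  shows "\<bar>real \<mu> ^ m * bp t - dG m t\<bar> \<le> 2 * bp_const t0"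
proof -
  have t: "t > 0" using assms by simp
  let ?f = "\<lambda>m. dG (Suc m) t / real \<mu> ^ Suc m - dG m t / real \<mu> ^ m"
  have bp: "bp t = dG m t / real \<mu> ^ m + (\<Sum>i. ?f (i + m))"
    unfolding bp_def suminf_split_initial_segment[OF dG_sums_bp(2)[OF t], of m]
    by (simp add: sum_lessThan_telescope[of "\<lambda>i. dG i t / real \<mu> ^ i"] del: power_Suc)
  have sm: "summable (\<lambda>i. ?f (i + m))" using dG_sums_bp(2)[OF t] by (rule summable_ignore_initial_segment)
  have g: "(\<lambda>i. bp_const t0 / real \<mu> ^ m * (1 / 2) ^ i) sums (bp_const t0 / real \<mu> ^ m * 2)"
    using sums_mult[OF geometric_sums[of "1 / 2 :: real"], of "bp_const t0 / real \<mu> ^ m"] by simp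
  have "(\<Sum>i. ?f (i + m)) \<le> bp_const t0 / real \<mu> ^ m * 2"
  proof (rule sums_le[OF _ summable_sums[OF sm] g])
    fix i
    have "?f (i + m) \<le> bp_const t0 / real \<mu> ^ (2 * (i + m))" by (rule dG_increment(2)[OF assms])
    also have "\<dots> = bp_const t0 / real \<mu> ^ m * (1 / real \<mu> ^ (2 * i + m))"
      by (simp add: power_add[symmetric] algebra_simps)
    also have "\<dots> \<le> bp_const t0 / real \<mu> ^ m * (1 / 2) ^ i"
    proof (intro mult_left_mono)
      have "1 / real \<mu> ^ (2 * i + m) \<le> (1 / 2) ^ (2 * i + m)" by (rule inverse_mu_power_le)
      also have "\<dots> \<le> (1 / 2) ^ i" by (rule power_decreasing) auto
      finally show "1 / real \<mu> ^ (2 * i + m) \<le> (1 / 2) ^ i" .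
    qed (use bp_const_nonneg in auto)
    finally show "?f (i + m) \<le> bp_const t0 / real \<mu> ^ m * (1 / 2) ^ i" .
  qed
  moreover have "0 \<le> (\<Sum>i. ?f (i + m))"
    using dG_increment(1)[OF assms] by (intro suminf_nonneg sm)
  moreover have "real \<mu> ^ m * bp t - dG m t = real \<mu> ^ m * (\<Sum>i. ?f (i + m))"
    unfolding bp using mu_real by (simp add: distrib_left)
  ultimately have "0 \<le> real \<mu> ^ m * bp t - dG m t" "real \<mu> ^ m * bp t - dG m t \<le> real \<mu> ^ m * (bp_const t0 / real \<mu> ^ m * 2)"
    by (simp_all only: mult_left_mono mult_nonneg_nonneg zero_le_power of_nat_0_le_iff)
  then show ?thesis using mu_real by simp
qed

text \<open>Termwise differentiation of the telescoping series of
  \<open>G_iter m t / \<mu> ^ m\<close>, by uniform convergence of the derivatives on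
  \<open>{t0..}\<close>; \<open>t0 = t / 2\<close> makes \<open>t\<close> an interior point.\<close>

lemma
  assumes t: "t > 0"
  shows DERIV_bh: "(bh has_real_derivative bp t) (at t)" and isCont_bp: "isCont bp t"
proof -
  define t0 where "t0 = t / 2"
  have t0: "t0 > 0" "t0 < t" using t by (auto simp: t0_def)
  let ?f = "\<lambda>m t. G_iter (Suc m) t / real \<mu> ^ Suc m - G_iter m t / real \<mu> ^ m"
  let ?f' = "\<lambda>m t. dG (Suc m) t / real \<mu> ^ Suc m - dG m t / real \<mu> ^ m"
  have ul: "uniform_limit {t0..} (\<lambda>n x. \<Sum>i<n. ?f' i x) (\<lambda>x. \<Sum>i. ?f' i x) sequentially"
    by (rule Weierstrass_m_test[where M = "\<lambda>m. bp_const t0 * (1 / 2) ^ m"])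
       (use dG_increment_le_half[OF t0(1)] in \<open>auto intro: summable_mult summable_geometric\<close>)
  have D: "(?f m has_real_derivative ?f' m x) (at x within {t0..})" if "x \<in> {t0..}" for m x
    using that t0 by (intro DERIV_diff DERIV_cdivide has_field_derivative_at_within[OF DERIV_G_iter]) auto
  have int: "t \<in> interior {t0..}" using t0 by (simp add: interior_real_atLeast)
  have tele: "(\<lambda>m. ?f m s) sums (bh s - s)" if "s \<ge> 0" for s
    using telescope_sums[OF G_iter_div_tendsto_bh(1)[OF that]] by (simp add: id_def)
  have "((\<lambda>x. \<Sum>m. ?f m x) has_real_derivative (\<Sum>m. ?f' m t)) (at t)"
  proof (rule has_field_derivative_series'(2)[OF _ D _ _ _ int])
    show "uniformly_convergent_on {t0..} (\<lambda>n x. \<Sum>i<n. ?f' i x)"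
      using ul by (auto simp: uniformly_convergent_on_def)
    show "summable (\<lambda>n. ?f n t)" using tele[of t] t by (auto intro: sums_summable)
  qed (use t0 in auto)
  then have "((\<lambda>x. x + (\<Sum>m. ?f m x)) has_real_derivative bp t) (at t)"
    unfolding bp_def by (intro DERIV_add DERIV_ident)
  then show "(bh has_real_derivative bp t) (at t)"
  proof (rule has_field_derivative_transform_within_open[where S = "{0<..}"])
    fix x :: real assume "x \<in> {0<..}"
    then show "x + (\<Sum>m. ?f m x) = bh x" using sums_unique[OF tele[of x], symmetric] by simp
  qed (use t in auto)
  have "continuous_on {t0..} (\<lambda>x. \<Sum>i. ?f' i x)"
  proof (rule uniform_limit_theorem[OF _ ul])
    have "continuous_on {t0..} (dG m)" for m
      using t0 by (intro continuous_at_imp_continuous_on ballI DERIV_isCont[OF DERIV_dG]) auto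
    then show "\<forall>\<^sub>F n in sequentially. continuous_on {t0..} (\<lambda>x. \<Sum>i<n. ?f' i x)"
      using mu_real by (intro always_eventually allI continuous_intros) auto
  qed simp
  then have "continuous_on {t0..} bp" unfolding bp_def[abs_def] by (intro continuous_intros)
  then show "isCont bp t" using int by (simp add: continuous_on_interior)
qed

section \<open>The Laplace transform of W and the equation for the tilt\<close>

text \<open>Poincare's functional equation, from the branching decomposition of \<open>W\<close> at
  generation 1.\<close>

lemma laplace_W_mean_mult:
  assumes u: "u \<ge> 0"
  shows "lim.laplace_moment 0 (a * u) = gw_pgf p (lim.laplace_moment 0 u)"
proof -
  \<comment> \<open>\<open>W\<close> is nonnegative only almost surely; the minimum keeps
    \<open>F\<close> in \<open>{0..1}\<close> everywhere, as \<open>expectation_gen_prod\<close>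
    demands.\<close>
  define F where "F t = min 1 (exp (- u * W t))" for t
  have Fm[measurable]: "F \<in> borel_measurable tree_space" unfolding F_def[abs_def] by measurable
  have F01: "0 \<le> F t" "F t \<le> 1" for t by (simp_all add: F_def)
  have F_eq: "F t = exp (- u * W t)" if "0 \<le> W t" for t
    using mult_nonneg_nonneg[OF u that] by (simp add: F_def)
  have eF: "(\<integral>x. F (tree x) \<partial>M) = lim.laplace_moment 0 u"
  proof -
    have "(\<integral>x. F (tree x) \<partial>M) = (\<integral>x. exp (- u * W (tree x)) \<partial>M)"
      using AE_W_nonneg by (intro integral_cong_AE) (auto elim!: eventually_mono simp: F_eq)
    then show ?thesis by (simp add: lim.laplace_moment_def)
  qed
  have [measurable]: "(\<lambda>t. \<Prod>v\<in>tree_gen 1 t. F (subtree v t)) \<in> borel_measurable tree_space"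
    using measurable_gen_compose[of "\<lambda>t. t" tree_space "\<lambda>A t. \<Prod>v\<in>A. F (subtree v t)" borel 1] by simp
  have "AE x in M. 0 \<le> W (subtree v (tree x))" for v
    using AE_subtree[of "\<lambda>t. 0 \<le> W t" v] AE_W_nonneg by simp
  then have "AE x in M. \<forall>v. 0 \<le> W (subtree v (tree x))" by (simp add: AE_all_countable)
  then have AEp: "AE x in M. exp (- (a * u) * W (tree x)) = 1 * (\<Prod>v\<in>tree_gen 1 (tree x). F (subtree v (tree x)))"
    using AE_W_branching[of 1]
  proof eventually_elim
    case (elim x)
    have "- (a * u) * W (tree x) = (\<Sum>v\<in>tree_gen 1 (tree x). - u * W (subtree v (tree x)))"
      unfolding elim(2) sum_distrib_left[symmetric] using mean_gt_1 by simp
    then have "exp (- (a * u) * W (tree x)) = (\<Prod>v\<in>tree_gen 1 (tree x). exp (- u * W (subtree v (tree x))))"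
      by (simp only: exp_sum[OF finite_tree_gen])
    then show ?case using elim(1) by (simp only: F_eq mult_1)
  qed
  have "lim.laplace_moment 0 (a * u) = (\<integral>x. exp (- (a * u) * W (tree x)) \<partial>M)"
    by (simp add: lim.laplace_moment_def)
  also have "\<dots> = (\<integral>x. 1 * (\<Prod>v\<in>tree_gen 1 (tree x). F (subtree v (tree x))) \<partial>M)"
    by (rule integral_cong_AE[OF _ _ AEp]) measurable
  also have "\<dots> = (\<integral>x. 1 * (\<integral>y. F (tree y) \<partial>M) ^ tree_Z 1 (tree x) \<partial>M)"
    by (rule expectation_gen_prod[where \<psi> = "\<lambda>_. 1"]) (use F01 in auto)
  also have "\<dots> = gw_pgf p (lim.laplace_moment 0 u)"
    unfolding eF using expectation_power_Z[of "lim.laplace_moment 0 u" 1] lim.laplace_moment_nonneg lim.laplace_moment_0_le_1[OF u]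
    by simp
  finally show ?thesis .
qed

abbreviation l :: "real \<Rightarrow> real" where "l \<equiv> lim.neg_log_laplace"

lemma l_mean_mult:
  assumes "u \<ge> 0"
  shows "l (a * u) = G (l u)"
proof -
  have "exp (- l (a * u)) = exp (- G (l u))"
    using assms mean_gt_1 laplace_W_mean_mult[OF assms] gw_pgf_exp[OF lim.neg_log_laplace_nonneg[OF assms]]
    by (simp add: lim.exp_neg_log_laplace)
  then show ?thesis by simp
qed

text \<open>A constant \<open>W\<close> would be 1, so that \<open>G u = a * u\<close>; this
  contradicts \<open>G u \<le> \<mu> * u - log_pmu\<close> for large \<open>u\<close>, because
  \<open>\<mu> < a\<close>.\<close>

lemma W_nonconst: "\<not> (AE x in M. W (tree x) = c)"
proof
  assume AE: "AE x in M. W (tree x) = c"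
  have "(\<integral>x. W (tree x) \<partial>M) = (\<integral>x. c \<partial>M)"
    using AE by (intro integral_cong_AE) auto
  then have c: "c = 1" using expectation_W by (simp add: prob_space)
  have phi: "lim.laplace_moment 0 u = exp (- u)" for u
  proof -
    have "(\<integral>x. exp (- u * W (tree x)) \<partial>M) = (\<integral>x. exp (- u) \<partial>M)"
      using AE by (intro integral_cong_AE) (auto elim!: eventually_mono simp: c)
    then show ?thesis by (simp add: lim.laplace_moment_def prob_space)
  qed
  have G: "G u = a * u" if "u \<ge> 0" for u
    using l_mean_mult[OF that] by (simp add: lim.neg_log_laplace_def phi)
  \<comment> \<open>Chosen so that \<open>(a - \<mu>) * u\<close> exceeds by 1 the value
    \<open>- log_pmu\<close> that \<open>eta u \<ge> 0\<close> permits.\<close>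
  define u where "u = (- log_pmu + 1) / (a - real \<mu>)"
  have d: "a - real \<mu> > 0" using mu_less_mean by simp
  have u: "u \<ge> 0" using d log_pmu_le_0 by (simp add: u_def)
  have "0 \<le> eta u" by (rule eta_nonneg[OF u])
  then have "(a - real \<mu>) * u \<le> - log_pmu" unfolding eta_def G[OF u] by (simp add: algebra_simps)
  moreover have "(a - real \<mu>) * u = - log_pmu + 1" unfolding u_def using d by simp
  ultimately show False by simp
qed

lemma l_pos:
  assumes "u > 0"
  shows "l u > 0"
proof (rule ccontr)
  assume "\<not> ?thesis"
  then have "l u = 0" using lim.neg_log_laplace_nonneg[of u] assms by simp
  then have "lim.laplace_moment 0 u = 1" using lim.exp_neg_log_laplace[of u] assms by simp
  then have "(\<integral>x. 1 - exp (- u * W (tree x)) \<partial>M) = 0"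
    using lim.integrable_exp_laplace[of u] assms by (simp add: lim.laplace_moment_def prob_space)
  moreover have "AE x in M. 0 \<le> 1 - exp (- u * W (tree x))"
    using AE_W_nonneg assms by (auto elim!: eventually_mono)
  ultimately have "AE x in M. 1 - exp (- u * W (tree x)) = 0"
    using lim.integrable_exp_laplace[of u] assms by (subst (asm) integral_nonneg_eq_0_iff_AE) auto
  then have "AE x in M. W (tree x) = 0" using assms by simp
  then show False using W_nonconst by blast
qed

text \<open>This is \<open>- b (phi u)\<close>; multiplying \<open>u\<close> by \<open>a\<close>
  multiplies it by \<open>\<mu>\<close>.\<close>

definition Bh :: "real \<Rightarrow> real" where "Bh u = bh (l u)"

lemma gw_W_eq: "gw_W p N x = W (tree x)"
  using gw_W_eq_tree[of p N x] by (simp add: W_def tree_def)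

lemma gw_phi_eq: "gw_phi M p N u = lim.laplace_moment 0 u"
  by (simp add: gw_phi_def lim.laplace_moment_def gw_W_eq)

lemma gw_b_phi_eq:
  assumes "u \<ge> 0"
  shows "gw_b p (gw_phi M p N u) = - Bh u"
  using gw_b_exp[OF lim.neg_log_laplace_nonneg[OF assms]]
  by (simp add: gw_phi_eq Bh_def lim.exp_neg_log_laplace[OF assms])

lemma Bh_mean_mult: "u \<ge> 0 \<Longrightarrow> Bh (a * u) = real \<mu> * Bh u"
  by (simp add: Bh_def l_mean_mult bh_G lim.neg_log_laplace_nonneg)

lemma Bh_pos: "u > 0 \<Longrightarrow> Bh u > 0"
  unfolding Bh_def using bh_ge_self[of "l u"] l_pos[of u] by simp

definition DB :: "real \<Rightarrow> real" where "DB u = bp (l u) * lim.tilted_mean u"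

lemma DERIV_Bh: "u > 0 \<Longrightarrow> (Bh has_real_derivative DB u) (at u)"
  unfolding Bh_def[abs_def] DB_def
  by (rule DERIV_chain2[OF DERIV_bh[OF l_pos] lim.DERIV_neg_log_laplace])

text \<open>Differentiated form of \<open>Bh (a * u) = \<mu> * Bh u\<close>. As
  \<open>\<mu> / a < 1\<close>, it forces the limits infinity at 0 and 0 at infinity, and relates
  all values of \<open>DB\<close> to those on one period.\<close>

lemma DB_mean_mult:
  assumes "u > 0"
  shows "DB (a * u) = real \<mu> / a * DB u"
proof -
  have a: "a > 0" using mean_gt_1 by simp
  have "((\<lambda>u. Bh (a * u)) has_real_derivative DB (a * u) * a) (at u)"
    using assms a by (intro DERIV_chain2[where f = Bh, OF DERIV_Bh]) (auto intro!: derivative_eq_intros)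
  moreover have "((\<lambda>u. Bh (a * u)) has_real_derivative real \<mu> * DB u) (at u)"
  proof (rule has_field_derivative_transform_within_open[where S = "{0<..}"])
    show "((\<lambda>u. real \<mu> * Bh u) has_real_derivative real \<mu> * DB u) (at u)"
      using assms by (intro DERIV_cmult DERIV_Bh)
  qed (use assms Bh_mean_mult in auto)
  ultimately have "DB (a * u) * a = real \<mu> * DB u" by (rule DERIV_unique)
  then show ?thesis using a by (simp add: field_simps)
qed

lemma l_mono: "0 < u \<Longrightarrow> u \<le> v \<Longrightarrow> l u \<le> l v"
  by (rule DERIV_nonneg_imp_nondecreasing[of u v])
     (auto intro!: exI[of _ "lim.tilted_mean _"] lim.DERIV_neg_log_laplace lim.tilted_mean_nonneg)

lemma DB_strict_antimono:
  assumes "0 < u" "u < v"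
  shows "DB v < DB u"
proof -
  have "bp (l v) * lim.tilted_mean v < bp (l v) * lim.tilted_mean u"
    using bp_ge_1[OF l_pos, of v] assms lim.tilted_mean_strict_antimono[OF assms W_nonconst] by (intro mult_strict_left_mono) auto
  also have "\<dots> \<le> bp (l u) * lim.tilted_mean u"
    using assms lim.tilted_mean_nonneg[of u] by (intro mult_right_mono bp_antimono l_mono l_pos) auto
  finally show ?thesis by (simp add: DB_def)
qed

text \<open>Strict decrease and self-similarity give \<open>\<mu> / a * DB u < DB u\<close>, which
  is impossible for \<open>DB u \<le> 0\<close> since \<open>\<mu> < a\<close>.\<close>

lemma DB_pos:
  assumes "u > 0"
  shows "DB u > 0"
proof -
  have "DB (a * u) < DB u" using assms mean_gt_1 by (intro DB_strict_antimono) auto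
  then have "(1 - real \<mu> / a) * DB u > 0" unfolding DB_mean_mult[OF assms] by (simp add: algebra_simps)
  moreover have "1 - real \<mu> / a > 0" using mu_less_mean mean_gt_1 by simp
  ultimately show ?thesis by (simp add: zero_less_mult_iff)
qed

lemma DB_mean_power_mult: "u > 0 \<Longrightarrow> DB (a ^ k * u) = (real \<mu> / a) ^ k * DB u"
proof (induction k)
  case (Suc k)
  have "DB (a ^ Suc k * u) = DB (a * (a ^ k * u))" by (simp add: mult.assoc)
  also have "\<dots> = real \<mu> / a * DB (a ^ k * u)" using Suc.prems mean_gt_1 by (intro DB_mean_mult) auto
  finally show ?case using Suc by simp
qed simp

lemma isCont_DB:
  assumes "u > 0"
  shows "isCont DB u"
proof -
  have 1: "isCont (\<lambda>u. bp (l u)) u"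
    by (rule isCont_o2[OF DERIV_isCont[OF lim.DERIV_neg_log_laplace[OF assms]] isCont_bp[OF l_pos[OF assms]]])
  show ?thesis
    unfolding DB_def[abs_def] by (intro isCont_mult 1 DERIV_isCont[OF lim.DERIV_tilted_mean[OF assms]])
qed

lemma ex_DB_ge: "\<exists>u>0. DB u \<ge> c"
proof -
  have r: "0 < real \<mu> / a" "real \<mu> / a < 1" using mu_less_mean mean_gt_1 mu_real by auto
  obtain k where k: "(real \<mu> / a) ^ k < DB 1 / (\<bar>c\<bar> + 1)"
    using real_arch_pow_inv[OF _ r(2), of "DB 1 / (\<bar>c\<bar> + 1)"] DB_pos[of 1] by auto
  define u where "u = 1 / a ^ k"
  have u: "u > 0" using mean_gt_1 by (simp add: u_def)
  have "DB 1 = (real \<mu> / a) ^ k * DB u"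
    using DB_mean_power_mult[OF u, of k] mean_gt_1 by (simp add: u_def)
  also have "\<dots> < DB 1 / (\<bar>c\<bar> + 1) * DB u" using k DB_pos[OF u] by (intro mult_strict_right_mono)
  finally have "DB 1 * (\<bar>c\<bar> + 1) < DB 1 * DB u" by (simp add: pos_less_divide_eq mult.commute)
  then have "\<bar>c\<bar> + 1 < DB u" using DB_pos[of 1] by (simp only: mult_less_cancel_left_pos zero_less_one)
  then show ?thesis using u by (intro exI[of _ u]) auto
qed

lemma ex_DB_le: "c > 0 \<Longrightarrow> \<exists>u>0. DB u \<le> c"
proof -
  assume c: "c > 0"
  have r: "0 < real \<mu> / a" "real \<mu> / a < 1" using mu_less_mean mean_gt_1 mu_real by auto
  obtain k where k: "(real \<mu> / a) ^ k < c / DB 1"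
    using real_arch_pow_inv[OF _ r(2), of "c / DB 1"] DB_pos[of 1] c by auto
  have "DB (a ^ k * 1) \<le> c"
    using DB_mean_power_mult[of 1 k] k DB_pos[of 1] by (simp add: field_simps)
  then show ?thesis using mean_gt_1 by (intro exI[of _ "a ^ k * 1"]) auto
qed

lemma ex1_DB:
  assumes "y > 0"
  shows "\<exists>!u. u > 0 \<and> DB u = y"
proof -
  obtain u where u: "u > 0" "DB u \<ge> y" using ex_DB_ge by blast
  obtain v where v: "v > 0" "DB v \<le> y" using ex_DB_le[OF assms] by blast
  have uv: "u \<le> v" using DB_strict_antimono[of v u] u v by (meson less_le_not_le not_le order_trans)
  have "\<exists>x\<ge>u. x \<le> v \<and> DB x = y"
    by (rule IVT2[OF v(2) u(2) uv]) (use u in \<open>auto intro: isCont_DB\<close>)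
  then obtain x where "u \<le> x" "DB x = y" by blast
  then have "x > 0" "DB x = y" using u(1) by auto
  then show ?thesis
    using DB_strict_antimono by (intro ex1I[of _ x]) (metis less_irrefl linorder_neqE_linordered_idom)+
qed

lemma has_derivative_gw_b_phi:
  assumes "u > 0"
  shows "(gw_b p \<circ> gw_phi M p N has_real_derivative - y) (at u) \<longleftrightarrow> DB u = y"
proof -
  have D: "(gw_b p \<circ> gw_phi M p N has_real_derivative - DB u) (at u)"
  proof (rule has_field_derivative_transform_within_open[where S = "{0<..}"])
    show "((\<lambda>u. - Bh u) has_real_derivative - DB u) (at u)" by (intro DERIV_minus DERIV_Bh assms)
  qed (use assms gw_b_phi_eq in auto)
  then show ?thesis using DERIV_unique[OF D, of "- y"] by auto
qed

lemma gw_u1: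
  assumes "gw_y p \<epsilon> > 0"
  shows "gw_u1 M p N \<epsilon> > 0" "DB (gw_u1 M p N \<epsilon>) = gw_y p \<epsilon>"
proof -
  have "gw_u1 M p N \<epsilon> = (THE u. u > 0 \<and> DB u = gw_y p \<epsilon>)"
    unfolding gw_u1_def by (rule arg_cong[where f = The]) (auto simp: fun_eq_iff has_derivative_gw_b_phi)
  then show "gw_u1 M p N \<epsilon> > 0" "DB (gw_u1 M p N \<epsilon>) = gw_y p \<epsilon>"
    using theI'[OF ex1_DB[OF assms]] by auto
qed

text \<open>The values in question fill one period of \<open>DB\<close>, the image of
  \<open>{U..a * U}\<close> with \<open>DB U = 1\<close>. Compactness of this interval is what makes
  the local limit constants uniform in \<open>\<epsilon>\<close>.\<close>

lemma u1_range:
  obtains U V where "0 < U" "U \<le> V" "\<And>u. u > 0 \<Longrightarrow> real \<mu> / a < DB u \<Longrightarrow> DB u \<le> 1 \<Longrightarrow> u \<in> {U..V}"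
proof -
  obtain U where U: "U > 0" "DB U = 1" using ex1_DB[of 1] by auto
  have "u \<in> {U..a * U}" if "u > 0" "real \<mu> / a < DB u" "DB u \<le> 1" for u
  proof -
    have "DB (a * U) = real \<mu> / a" using DB_mean_mult[OF U(1)] U(2) by simp
    then show ?thesis
      using DB_strict_antimono[of u U] DB_strict_antimono[of "a * U" u] that U mean_gt_1
      by (auto simp: not_less[symmetric])
  qed
  then show ?thesis using U mean_gt_1 by (intro that[of U "a * U"]) auto
qed

text \<open>Chebyshev's inequality under the tilt by \<open>exp (- t * Z)\<close>. The Laplace
  exponent of generation \<open>k\<close> is \<open>G_iter k\<close>, so uniqueness of derivatives
  identifies its tilted mean and variance as \<open>dG\<close> and \<open>ddG\<close>; both
  deviations from the centre are within order \<open>\<mu> ^ k\<close> after squaring.\<close>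

lemma Z_concentration:
  assumes "t0 > 0"
  shows "\<exists>C>0. \<forall>k. \<forall>t\<ge>t0. \<forall>A>0.
    (\<integral>x. of_bool (A * sqrt (real \<mu> ^ k) < \<bar>real (tree_Z k (tree x)) - real \<mu> ^ k * bp t\<bar>) * exp (- t * tree_Z k (tree x)) \<partial>M)
      \<le> C / A\<^sup>2 * exp (- G_iter k t)"
proof -
  define C where "C = 2 * ddG_const t0 * dG_const t0 + (2 * bp_const t0)\<^sup>2 + 1"
  have C: "C > 0" using ddG_const_nonneg[of t0] dG_const_pos[of t0] by (auto simp: C_def intro!: add_nonneg_pos)
  moreover have "(\<integral>x. of_bool (A * sqrt (real \<mu> ^ k) < \<bar>real (tree_Z k (tree x)) - real \<mu> ^ k * bp t\<bar>) * exp (- t * tree_Z k (tree x)) \<partial>M)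
      \<le> C / A\<^sup>2 * exp (- G_iter k t)" if t: "t \<ge> t0" and A: "A > 0" for k t A
  proof -
    have t0: "t > 0" using t assms by simp
    let ?M = "real \<mu> ^ k"
    have M: "?M > 0" "?M \<ge> 1" using mu_real by auto
    define c where "c = ?M * bp t"
    interpret Z: nonneg_random_variable M "\<lambda>x. real (tree_Z k (tree x))"
      by unfold_locales auto
    have L: "Z.laplace_moment 0 s = exp (- G_iter k s)" if "s \<ge> 0" for s
    proof -
      have "Z.laplace_moment 0 s = (\<integral>x. exp (- s) ^ tree_Z k (tree x) \<partial>M)"
        by (simp add: Z.laplace_moment_def exp_of_nat_mult[symmetric] mult.commute)
      then show ?thesis using expectation_power_Z[of "exp (- s)" k] gw_pgf_iter_exp[OF that] that by simp
    qed
    have m: "Z.tilted_mean s = dG k s" if "s > 0" for s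
    proof (rule DERIV_unique[OF Z.DERIV_neg_log_laplace[OF that]])
      show "(Z.neg_log_laplace has_real_derivative dG k s) (at s)"
        by (rule has_field_derivative_transform_within_open[OF DERIV_G_iter[OF that], where S = "{0<..}"])
           (use that in \<open>auto simp: Z.neg_log_laplace_def L\<close>)
    qed
    have v: "Z.tilted_variance t = ddG k t"
    proof -
      have "(Z.tilted_mean has_real_derivative - ddG k t) (at t)"
        by (rule has_field_derivative_transform_within_open[OF DERIV_dG[OF t0], where S = "{0<..}"])
           (use t0 in \<open>auto simp: m\<close>)
      from DERIV_unique[OF Z.DERIV_tilted_mean[OF t0] this] show ?thesis by simp
    qed
    have b: "ddG k t + (dG k t - c)\<^sup>2 \<le> C * ?M"
    proof -
      have "(dG k t - c)\<^sup>2 \<le> (2 * bp_const t0)\<^sup>2"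
        using bp_minus_dG[OF assms t, of k] by (intro abs_le_imp_sq_le) (simp add: c_def abs_minus_commute)
      also have "\<dots> \<le> (2 * bp_const t0)\<^sup>2 * ?M" using M by (intro mult_right_le_one_le') auto
      finally show ?thesis using ddG_le[OF assms t, of k] M by (simp add: C_def algebra_simps)
    qed
    let ?B = "\<lambda>x. of_bool (A * sqrt ?M < \<bar>real (tree_Z k (tree x)) - c\<bar>) :: real"
    have pt: "A\<^sup>2 * ?M * (?B x * exp (- t * tree_Z k (tree x))) \<le> (real (tree_Z k (tree x)) - c)\<^sup>2 * exp (- t * tree_Z k (tree x))" for x
    proof (cases "A * sqrt ?M < \<bar>real (tree_Z k (tree x)) - c\<bar>")
      case True
      then have "(A * sqrt ?M)\<^sup>2 \<le> \<bar>real (tree_Z k (tree x)) - c\<bar>\<^sup>2" using A M by (intro power_mono) auto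
      then have "A\<^sup>2 * ?M \<le> (real (tree_Z k (tree x)) - c)\<^sup>2" using M by (simp add: power_mult_distrib)
      then show ?thesis using True by (simp add: mult_right_mono)
    qed simp
    have iB: "integrable M (\<lambda>x. ?B x * exp (- t * tree_Z k (tree x)))"
      using t0 by (intro Bochner_Integration.integrable_bound[OF Z.integrable_exp_laplace[of t]]) auto
    have "A\<^sup>2 * ?M * (\<integral>x. ?B x * exp (- t * tree_Z k (tree x)) \<partial>M) = (\<integral>x. A\<^sup>2 * ?M * (?B x * exp (- t * tree_Z k (tree x))) \<partial>M)"
      by simp
    also have "\<dots> \<le> (\<integral>x. (real (tree_Z k (tree x)) - c)\<^sup>2 * exp (- t * tree_Z k (tree x)) \<partial>M)"
      by (rule integral_mono[OF integrable_mult_right[OF iB] Z.integral_centred_sq(2)[OF t0] pt])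
    also have "\<dots> = exp (- G_iter k t) * (ddG k t + (dG k t - c)\<^sup>2)"
      using Z.integral_centred_sq(1)[OF t0, of c] L[of t] t0 by (simp add: v m)
    also have "\<dots> \<le> exp (- G_iter k t) * (C * ?M)" using b by (intro mult_left_mono) auto
    finally have "A\<^sup>2 * (\<integral>x. ?B x * exp (- t * tree_Z k (tree x)) \<partial>M) * ?M \<le> exp (- G_iter k t) * C * ?M"
      by (simp add: mult_ac)
    then have "A\<^sup>2 * (\<integral>x. ?B x * exp (- t * tree_Z k (tree x)) \<partial>M) \<le> exp (- G_iter k t) * C"
      by (rule mult_right_le_imp_le[OF _ M(1)])
    then show ?thesis unfolding c_def[symmetric] using A by (simp add: field_simps)
  qed
  ultimately show ?thesis by blast
qed

section \<open>Conditioning on a small martingale limit versus tilting\<close>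

lemma AE_Z_ge: "AE x in M. \<mu> ^ k \<le> tree_Z k (tree x)"
proof -
  have "AE x in M. \<mu> \<le> N v x" for v using AE_mu_le by (simp add: AE_offspring)
  then have "AE x in M. \<forall>v. \<mu> \<le> N v x" by (simp add: AE_all_countable)
  then show ?thesis
  proof eventually_elim
    case (elim x)
    show ?case
    proof (induction k)
      case (Suc k)
      have "\<mu> * tree_Z k (tree x) \<le> tree_Z (Suc k) (tree x)"
        unfolding tree_Z_Suc using elim sum_bounded_below[of "tree_gen k (tree x)" \<mu> "tree x"]
        by (simp add: gw_Z_def tree_def mult.commute)
      then show ?case using order_trans[OF mult_le_mono2[OF Suc, of \<mu>]] by simp
    qed simp
  qed
qed

lemma laplace_W_power: "u \<ge> 0 \<Longrightarrow> lim.laplace_moment 0 u ^ n = exp (- l u * n)"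
  by (simp add: lim.exp_neg_log_laplace[symmetric] exp_of_nat_mult[symmetric] mult.commute)

lemma integrable_tilted_indicator:
  assumes "u \<ge> 0" and [measurable]: "Measurable.pred tree_space Q"
  shows "integrable M (\<lambda>x. of_bool (Q (tree x)) * exp (- l u * tree_Z k (tree x)) :: real)"
  using lim.neg_log_laplace_nonneg[OF assms(1)]
  by (intro integrable_const_bound[where B = 1]) auto

lemma measurable_prob_sum_gen [measurable]:
  "(\<lambda>t. prob {y \<in> space M. (\<Sum>v\<in>tree_gen k t. W (subtree v (tree y))) < s}) \<in> borel_measurable tree_space"
  using measurable_gen_compose[of "\<lambda>t. t" tree_space "\<lambda>A t. prob {y \<in> space M. (\<Sum>v\<in>A. W (subtree v (tree y))) < s}" borel k]
  by simp

lemma prob_event_W_less: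
  assumes [measurable]: "Measurable.pred tree_space Q"
    and loc: "\<And>t s. (\<And>v. length v < k \<Longrightarrow> t v = s v) \<Longrightarrow> Q t = Q s"
  shows "prob {x \<in> space M. Q (tree x) \<and> W (tree x) < s / a ^ k}
     = (\<integral>x. of_bool (Q (tree x)) * prob {y \<in> space M. (\<Sum>v\<in>tree_gen k (tree x). W (subtree v (tree y))) < s} \<partial>M)"
proof -
  have m2[measurable]: "(\<lambda>t. \<Sum>v\<in>tree_gen k t. W (subtree v t)) \<in> borel_measurable tree_space"
    using measurable_gen_compose[of "\<lambda>t. t" tree_space "\<lambda>A t. \<Sum>v\<in>A. W (subtree v t)" borel k] by simp
  have "prob {x \<in> space M. Q (tree x) \<and> W (tree x) < s / a ^ k}
      = prob {x \<in> space M. Q (tree x) \<and> (\<Sum>v\<in>tree_gen k (tree x). W (subtree v (tree x))) < s}"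
  proof (rule prob_eq_AE)
    show "AE x in M. (Q (tree x) \<and> W (tree x) < s / a ^ k) = (Q (tree x) \<and> (\<Sum>v\<in>tree_gen k (tree x). W (subtree v (tree x))) < s)"
      using AE_W_branching[of k]
    proof eventually_elim
      case (elim x)
      have pos: "a ^ k > 0" using mean_gt_1 by simp
      have gen: "y / c < z / c \<longleftrightarrow> y < z" if "c > 0" for c y z :: real
        using that by (simp add: divide_less_cancel)
      show ?case unfolding elim gen[OF pos] by (rule refl)
    qed
  qed measurable
  also have "\<dots> = (\<integral>x. of_bool (Q (tree x)) * prob {y \<in> space M. (\<Sum>v\<in>tree_gen k (tree x). W (subtree v (tree y))) < s} \<partial>M)"
    by (rule prob_split_sum_subtrees[OF measurable_W assms(1) loc])
  finally show ?thesis .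
qed

lemma subtrees_iid:
  "indep_vars (\<lambda>_. borel) (\<lambda>v y. W (subtree v (tree y))) (tree_gen k t)"
  "\<forall>v\<in>tree_gen k t. distr M borel (\<lambda>y. W (subtree v (tree y))) = distr M borel (\<lambda>y. W (tree y))"
  by (auto intro!: indep_vars_subtree_fun[where n = k] distr_subtree_fun dest: length_tree_gen)

text \<open>Given generation \<open>k\<close>, \<open>a ^ k * W\<close> is a sum of
  \<open>Z k\<close> copies of \<open>W\<close>. Since \<open>Z k \<ge> \<mu> ^ k\<close>, the local
  factor is at most \<open>C / sqrt (\<mu> ^ k)\<close>, and the power of the Laplace transform is
  the tilting weight.\<close>

lemma prob_event_W_less_le:
  assumes "0 < U" "U \<le> V"
  shows "\<exists>C>0. \<forall>u\<in>{U..V}. \<forall>k Q s. Measurable.pred tree_space Q \<longrightarrow>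
     (\<forall>t t'. (\<forall>v. length v < k \<longrightarrow> t v = t' v) \<longrightarrow> Q t = Q t') \<longrightarrow>
     prob {x \<in> space M. Q (tree x) \<and> W (tree x) < s / a ^ k}
       \<le> C / sqrt (real \<mu> ^ k) * exp (u * s) * (\<integral>x. of_bool (Q (tree x)) * exp (- l u * tree_Z k (tree x)) \<partial>M)"
proof -
  obtain C where C: "C > 0" and est: "\<forall>u\<in>{U..V}. \<forall>(A :: nat list set) Y s. finite A \<longrightarrow> A \<noteq> {} \<longrightarrow> indep_vars (\<lambda>_. borel) Y A \<longrightarrow>
     (\<forall>i\<in>A. distr M borel (Y i) = distr M borel (\<lambda>x. W (tree x))) \<longrightarrow>
     prob {x \<in> space M. (\<Sum>i\<in>A. Y i x) < s} \<le> C / sqrt (card A) * exp (u * s) * lim.laplace_moment 0 u ^ card A"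
    using lim.prob_sum_iid_less_le[OF assms W_nonconst] by (elim exE conjE)
  have "prob {x \<in> space M. Q (tree x) \<and> W (tree x) < s / a ^ k}
       \<le> C / sqrt (real \<mu> ^ k) * exp (u * s) * (\<integral>x. of_bool (Q (tree x)) * exp (- l u * tree_Z k (tree x)) \<partial>M)"
    if u: "u \<in> {U..V}" and Q[measurable]: "Measurable.pred tree_space Q"
      and loc: "\<forall>t t'. (\<forall>v. length v < k \<longrightarrow> t v = t' v) \<longrightarrow> Q t = Q t'" for u k Q s
  proof -
    have u0: "u \<ge> 0" using u assms by auto
    let ?c = "C / sqrt (real \<mu> ^ k) * exp (u * s)"
    let ?h = "\<lambda>x. prob {y \<in> space M. (\<Sum>v\<in>tree_gen k (tree x). W (subtree v (tree y))) < s}"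
    have "prob {x \<in> space M. Q (tree x) \<and> W (tree x) < s / a ^ k} = (\<integral>x. of_bool (Q (tree x)) * ?h x \<partial>M)"
      by (rule prob_event_W_less[OF Q]) (use loc in blast)
    also have "\<dots> \<le> (\<integral>x. ?c * (of_bool (Q (tree x)) * exp (- l u * tree_Z k (tree x))) \<partial>M)"
    proof (rule integral_mono_AE)
      show "integrable M (\<lambda>x. of_bool (Q (tree x)) * ?h x)"
        by (intro integrable_const_bound[where B = 1]) auto
      show "integrable M (\<lambda>x. ?c * (of_bool (Q (tree x)) * exp (- l u * tree_Z k (tree x))))"
        by (intro integrable_mult_right integrable_tilted_indicator u0 Q)
      show "AE x in M. of_bool (Q (tree x)) * ?h x \<le> ?c * (of_bool (Q (tree x)) * exp (- l u * tree_Z k (tree x)))"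
        using AE_Z_ge[of k]
      proof eventually_elim
        case (elim x)
        let ?A = "tree_gen k (tree x)"
        have mu: "\<mu> ^ k > 0" using mu_ge_2 by simp
        have cA: "card ?A \<ge> \<mu> ^ k" using elim by (simp add: gw_Z_def)
        then have "?A \<noteq> {}" using mu by (metis card.empty le_zero_eq less_irrefl)
        from est[THEN bspec, OF u, THEN spec, THEN spec, THEN spec, THEN mp, OF finite_tree_gen, THEN mp, OF this,
            THEN mp, OF subtrees_iid(1), THEN mp, OF subtrees_iid(2), of s]
        have "?h x \<le> C / sqrt (card ?A) * exp (u * s) * exp (- l u * tree_Z k (tree x))"
          unfolding laplace_W_power[OF u0] by (simp add: gw_Z_def)
        also have "\<dots> \<le> ?c * exp (- l u * tree_Z k (tree x))"
        proof (intro mult_right_mono divide_left_mono)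
          have "real (\<mu> ^ k) \<le> real (card ?A)" using cA by (rule of_nat_mono)
          then show "sqrt (real \<mu> ^ k) \<le> sqrt (real (card ?A))" by simp
          show "0 < sqrt (real (card ?A)) * sqrt (real \<mu> ^ k)" using less_le_trans[OF mu cA] mu_ge_2
            by (intro mult_pos_pos) auto
        qed (use C in auto)
        finally show ?case by auto
      qed
    qed
    also have "\<dots> = ?c * (\<integral>x. of_bool (Q (tree x)) * exp (- l u * tree_Z k (tree x)) \<partial>M)" by simp
    finally show ?thesis .
  qed
  then show ?thesis using C by blast
qed

text \<open>The weight of untypical generation sizes is subtracted on the whole space, so one
  constant works for every \<open>Q\<close>. On the other generations the threshold is close enough
  to the tilted mean of the sum for the lower local bound.\<close>

lemma prob_event_W_less_ge:
  assumes "0 < U" "U \<le> V" "b > 0"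
  shows "\<exists>c>0. \<exists>k0. \<forall>u\<in>{U..V}. \<forall>k\<ge>k0. \<forall>Q. Measurable.pred tree_space Q \<longrightarrow>
     (\<forall>t t'. (\<forall>v. length v < k \<longrightarrow> t v = t' v) \<longrightarrow> Q t = Q t') \<longrightarrow>
     c / sqrt (real \<mu> ^ k) * exp (u * (real \<mu> ^ k * DB u)) *
       ((\<integral>x. of_bool (Q (tree x)) * exp (- l u * tree_Z k (tree x)) \<partial>M)
        - (\<integral>x. of_bool (b * sqrt (real \<mu> ^ k) < \<bar>real (tree_Z k (tree x)) - real \<mu> ^ k * bp (l u)\<bar>) * exp (- l u * tree_Z k (tree x)) \<partial>M))
     \<le> prob {x \<in> space M. Q (tree x) \<and> W (tree x) < real \<mu> ^ k * DB u / a ^ k}"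
proof -
  have U0: "lim.tilted_mean U \<ge> 0" using assms by (intro lim.tilted_mean_nonneg) auto
  \<comment> \<open>A deviation of the generation size by \<open>b * sqrt R\<close> moves the tilted
    mean of the sum by at most \<open>lim.tilted_mean U * b * sqrt R\<close>, the tilted mean being
    largest at \<open>U\<close>; adding 1 ensures positivity.\<close>
  define b' where "b' = lim.tilted_mean U * b + 1"
  have b': "b' > 0" using U0 assms by (simp add: b'_def add_nonneg_pos)
  obtain c r0 where c: "c > 0" and est: "\<forall>u\<in>{U..V}. \<forall>(A :: nat list set) Y s. finite A \<longrightarrow> card A \<ge> r0 \<longrightarrow> A \<noteq> {} \<longrightarrow> indep_vars (\<lambda>_. borel) Y A \<longrightarrow>
     (\<forall>i\<in>A. distr M borel (Y i) = distr M borel (\<lambda>x. W (tree x))) \<longrightarrow> \<bar>s - card A * lim.tilted_mean u\<bar> \<le> b' * sqrt (card A) \<longrightarrow>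
     c / sqrt (card A) * exp (u * s) * lim.laplace_moment 0 u ^ card A \<le> prob {x \<in> space M. (\<Sum>i\<in>A. Y i x) < s}"
    using lim.prob_sum_iid_less_ge[OF assms(1,2) b' W_nonconst] by (elim exE conjE)
  \<comment> \<open>Typical generation sizes are at most \<open>B * R\<close>, which allows
    \<open>sqrt r\<close> to be exchanged for \<open>sqrt R\<close> at the cost of
    \<open>sqrt B\<close>.\<close>
  define B where "B = bp (l U) + b"
  have B: "B > 0" using bp_ge_1[OF l_pos[OF assms(1)]] assms by (simp add: B_def)
  define c2 where "c2 = c / sqrt B"
  have c2: "c2 > 0" using c B by (simp add: c2_def)
  have "c2 / sqrt (real \<mu> ^ k) * exp (u * (real \<mu> ^ k * DB u)) *
       ((\<integral>x. of_bool (Q (tree x)) * exp (- l u * tree_Z k (tree x)) \<partial>M)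
        - (\<integral>x. of_bool (b * sqrt (real \<mu> ^ k) < \<bar>real (tree_Z k (tree x)) - real \<mu> ^ k * bp (l u)\<bar>) * exp (- l u * tree_Z k (tree x)) \<partial>M))
     \<le> prob {x \<in> space M. Q (tree x) \<and> W (tree x) < real \<mu> ^ k * DB u / a ^ k}"
    if u: "u \<in> {U..V}" and k: "k \<ge> r0" and Q[measurable]: "Measurable.pred tree_space Q"
      and loc: "\<forall>t t'. (\<forall>v. length v < k \<longrightarrow> t v = t' v) \<longrightarrow> Q t = Q t'" for u k Q
  proof -
    have u0: "u > 0" "u \<ge> 0" using u assms by auto
    define R where "R = real \<mu> ^ k"
    have R: "R \<ge> 1" using mu_real by (simp add: R_def)
    define s where "s = R * DB u"
    define cc where "cc = c2 / sqrt R * exp (u * s)"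
    have cc: "cc \<ge> 0" using c2 R by (simp add: cc_def)
    let ?h = "\<lambda>x. prob {y \<in> space M. (\<Sum>v\<in>tree_gen k (tree x). W (subtree v (tree y))) < s}"
    let ?bad = "\<lambda>t. b * sqrt R < \<bar>real (tree_Z k t) - R * bp (l u)\<bar>"
    let ?e = "\<lambda>x. exp (- l u * tree_Z k (tree x))"
    have i1: "integrable M (\<lambda>x. of_bool (Q (tree x)) * ?e x)" by (intro integrable_tilted_indicator u0 Q)
    have i2: "integrable M (\<lambda>x. of_bool (?bad (tree x)) * ?e x)" by (intro integrable_tilted_indicator u0) measurable
    have "cc * ((\<integral>x. of_bool (Q (tree x)) * ?e x \<partial>M) - (\<integral>x. of_bool (?bad (tree x)) * ?e x \<partial>M))
      = (\<integral>x. cc * (of_bool (Q (tree x)) * ?e x - of_bool (?bad (tree x)) * ?e x) \<partial>M)"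
      using i1 i2 by simp
    also have "\<dots> \<le> (\<integral>x. of_bool (Q (tree x)) * ?h x \<partial>M)"
    proof (rule integral_mono_AE)
      show "integrable M (\<lambda>x. of_bool (Q (tree x)) * ?h x)"
        by (intro integrable_const_bound[where B = 1]) auto
      show "integrable M (\<lambda>x. cc * (of_bool (Q (tree x)) * ?e x - of_bool (?bad (tree x)) * ?e x))"
        by (intro integrable_mult_right Bochner_Integration.integrable_diff i1 i2)
      show "AE x in M. cc * (of_bool (Q (tree x)) * ?e x - of_bool (?bad (tree x)) * ?e x) \<le> of_bool (Q (tree x)) * ?h x"
        using AE_Z_ge[of k]
      proof eventually_elim
        case (elim x)
        show ?case
        proof (cases "Q (tree x) \<and> \<not> ?bad (tree x)")
          case False
          then have "of_bool (Q (tree x)) * ?e x - of_bool (?bad (tree x)) * ?e x \<le> 0" by auto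
          then have "cc * (of_bool (Q (tree x)) * ?e x - of_bool (?bad (tree x)) * ?e x) \<le> 0"
            using cc by (rule mult_nonneg_nonpos[rotated])
          then show ?thesis by (rule order_trans) simp
        next
          case True
          let ?A = "tree_gen k (tree x)"
          define r where "r = real (card ?A)"
          have "real (\<mu> ^ k) \<le> r" unfolding r_def using elim by (intro of_nat_mono) (simp add: gw_Z_def)
          then have rR: "R \<le> r" by (simp add: R_def)
          have near: "\<bar>r - R * bp (l u)\<bar> \<le> b * sqrt R" using True by (simp add: gw_Z_def r_def)
          \<comment> \<open>Thus \<open>k \<ge> r0\<close> already makes the generation have at
            least \<open>r0\<close> members, and \<open>r0\<close> itself can serve as
            \<open>k0\<close>.\<close>
          have "k < 2 ^ k" by (rule less_exp)
          also have "(2::nat) ^ k \<le> \<mu> ^ k" using mu_ge_2 by (intro power_mono) auto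
          finally have "card ?A \<ge> r0" using k elim by (simp add: gw_Z_def)
          moreover have "?A \<noteq> {}" using rR R by (auto simp: r_def)
          moreover have "\<bar>s - card ?A * lim.tilted_mean u\<bar> \<le> b' * sqrt (card ?A)"
          proof -
            have tm: "0 \<le> lim.tilted_mean u" "lim.tilted_mean u \<le> lim.tilted_mean U"
              using u assms by (auto intro!: lim.tilted_mean_nonneg lim.tilted_mean_antimono)
            \<comment> \<open>\<open>DB u\<close> is the product of \<open>bp (l u)\<close> and the
              tilted mean of \<open>W\<close>, so the threshold is the tilted mean of a sum over a
              generation of exactly the typical size.\<close>
            have "s - r * lim.tilted_mean u = (R * bp (l u) - r) * lim.tilted_mean u"
              by (simp add: s_def DB_def algebra_simps)
            then have "\<bar>s - r * lim.tilted_mean u\<bar> = \<bar>r - R * bp (l u)\<bar> * lim.tilted_mean u"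
              using tm by (simp add: abs_mult abs_minus_commute)
            also have "\<dots> \<le> (b * sqrt R) * lim.tilted_mean U"
              using near tm assms R by (intro mult_mono) auto
            also have "\<dots> \<le> (b * sqrt r) * lim.tilted_mean U"
              using rR U0 assms by (intro mult_right_mono mult_left_mono) auto
            also have "\<dots> \<le> b' * sqrt r" using rR R by (simp add: b'_def algebra_simps)
            finally show ?thesis by (simp add: r_def)
          qed
          ultimately have "c / sqrt (card ?A) * exp (u * s) * lim.laplace_moment 0 u ^ card ?A \<le> ?h x"
            using est[THEN bspec, OF u, THEN spec, THEN spec, THEN spec, THEN mp, OF finite_tree_gen, THEN mp, THEN mp,
              THEN mp, OF _ _ subtrees_iid(1), THEN mp, OF _ _ subtrees_iid(2), THEN mp, of k "tree x" s] by blast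
          then have "c / sqrt r * exp (u * s) * ?e x \<le> ?h x"
            unfolding laplace_W_power[OF u0(2)] by (simp add: gw_Z_def r_def)
          moreover have "cc * ?e x \<le> c / sqrt r * exp (u * s) * ?e x"
          proof -
            have "bp (l u) \<le> bp (l U)" using u assms by (intro bp_antimono l_pos l_mono) auto
            then have "R * bp (l u) \<le> R * bp (l U)" using R by (intro mult_left_mono) auto
            moreover have "sqrt R \<le> R"
              using R mult_left_mono[of 1 R R] by (intro real_le_lsqrt) (auto simp: power2_eq_square)
            then have "b * sqrt R \<le> b * R" using assms(3) by (intro mult_left_mono) auto
            ultimately have "r \<le> R * B" using near by (simp add: B_def algebra_simps)
            then have "sqrt r \<le> sqrt R * sqrt B" by (simp flip: real_sqrt_mult)
            then have "c / (sqrt R * sqrt B) \<le> c / sqrt r"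
              using c rR R B by (intro divide_left_mono) (auto intro!: mult_pos_pos)
            then show ?thesis unfolding cc_def c2_def by (intro mult_right_mono) (auto simp: mult.commute)
          qed
          ultimately show ?thesis using True by simp
        qed
      qed
    qed
    also have "\<dots> = prob {x \<in> space M. Q (tree x) \<and> W (tree x) < s / a ^ k}"
      by (rule prob_event_W_less[OF Q, symmetric]) (use loc in blast)
    finally show ?thesis unfolding cc_def s_def R_def .
  qed
  then show ?thesis using c2 by blast
qed

section \<open>The tilt belonging to epsilon and the comparison of the two laws\<close>

text \<open>For \<open>\<epsilon> < 1\<close> the integer \<open>gw_kappa p \<epsilon>\<close> is
  nonnegative, so \<open>nat\<close> truncates nothing.\<close>

definition kappa :: "real \<Rightarrow> nat" where "kappa \<epsilon> = nat (gw_kappa p \<epsilon>)"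

abbreviation u1 :: "real \<Rightarrow> real" where "u1 \<equiv> gw_u1 M p N"
abbreviation yy :: "real \<Rightarrow> real" where "yy \<equiv> gw_y p"

definition log_ratio :: real where "log_ratio = ln (a / real \<mu>)"

lemma log_ratio_pos: "log_ratio > 0"
  unfolding log_ratio_def using mu_less_mean mu_real by (simp add: field_simps)

lemma exp_log_ratio: "exp log_ratio = a / real \<mu>"
  unfolding log_ratio_def using mean_gt_1 mu_real by simp

context
  fixes \<epsilon> :: real
  assumes eps: "0 < \<epsilon>" "\<epsilon> < 1"
begin

lemma kappa_bounds: "real (kappa \<epsilon>) * log_ratio \<le> ln (1 / \<epsilon>)" "ln (1 / \<epsilon>) < (real (kappa \<epsilon>) + 1) * log_ratio"
proof -
  have L: "ln (1 / \<epsilon>) \<ge> 0" using eps by (simp add: ln_div)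
  have k: "real (kappa \<epsilon>) = of_int \<lfloor>ln (1 / \<epsilon>) / log_ratio\<rfloor>"
    using L log_ratio_pos by (simp add: kappa_def gw_kappa_def log_ratio_def[symmetric])
  show "real (kappa \<epsilon>) * log_ratio \<le> ln (1 / \<epsilon>)"
    unfolding k by (rule pos_le_divide_eq[THEN iffD1, OF log_ratio_pos of_int_floor_le])
  have "ln (1 / \<epsilon>) / log_ratio < of_int \<lfloor>ln (1 / \<epsilon>) / log_ratio\<rfloor> + 1" by linarith
  then show "ln (1 / \<epsilon>) < (real (kappa \<epsilon>) + 1) * log_ratio"
    unfolding k by (rule pos_divide_less_eq[THEN iffD1, OF log_ratio_pos])
qed

lemma yy_eq: "yy \<epsilon> = exp (real (kappa \<epsilon>) * log_ratio - ln (1 / \<epsilon>))" "yy \<epsilon> = \<epsilon> * (a / real \<mu>) ^ kappa \<epsilon>"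
proof -
  have "0 \<le> ln (1 / \<epsilon>) / log_ratio"
    using eps log_ratio_pos by (intro divide_nonneg_pos) (simp_all add: ln_div)
  then have "gw_kappa p \<epsilon> \<ge> 0"
    unfolding gw_kappa_def log_ratio_def[symmetric] by (simp only: zero_le_floor)
  then show y: "yy \<epsilon> = \<epsilon> * (a / real \<mu>) ^ kappa \<epsilon>"
    unfolding gw_y_def kappa_def by (simp add: power_int_def)
  show "yy \<epsilon> = exp (real (kappa \<epsilon>) * log_ratio - ln (1 / \<epsilon>))"
    unfolding y exp_diff exp_of_nat_mult exp_log_ratio using eps by simp
qed

lemma yy_bounds: "real \<mu> / a < yy \<epsilon>" "yy \<epsilon> \<le> 1" "yy \<epsilon> > 0"
proof -
  have "exp (- log_ratio) < yy \<epsilon>" unfolding yy_eq(1) using kappa_bounds by (simp add: algebra_simps)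
  then show "real \<mu> / a < yy \<epsilon>" by (simp add: exp_minus exp_log_ratio)
  show "yy \<epsilon> \<le> 1" unfolding yy_eq(1) using kappa_bounds by simp
  show "yy \<epsilon> > 0" unfolding yy_eq(1) by simp
qed

lemma u1_props: "u1 \<epsilon> > 0" "DB (u1 \<epsilon>) = yy \<epsilon>"
  using gw_u1[OF yy_bounds(3)] by auto

text \<open>The equation defining \<open>u1\<close> makes the threshold of the lower local bound,
  rescaled by \<open>a ^ kappa \<epsilon>\<close>, equal to \<open>\<epsilon>\<close>.\<close>

lemma eps_eq: "real \<mu> ^ kappa \<epsilon> * DB (u1 \<epsilon>) / a ^ kappa \<epsilon> = \<epsilon>"
  using mean_gt_1 mu_real unfolding u1_props(2) yy_eq(2) by (simp add: power_divide)

end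

lemma filterlim_kappa: "filterlim kappa at_top (at_right 0)"
proof -
  have "filterlim (\<lambda>\<epsilon>. ln (1 / \<epsilon>) / log_ratio - 1) at_top (at_right (0::real))"
    using log_ratio_pos by real_asymp
  then have "filterlim (\<lambda>\<epsilon>. real (kappa \<epsilon>)) at_top (at_right 0)"
  proof (rule filterlim_at_top_mono)
    have "\<forall>\<^sub>F \<epsilon> in at_right 0. \<epsilon> \<in> {0<..<1::real}" by (rule eventually_at_right_real) simp
    then show "\<forall>\<^sub>F \<epsilon> in at_right 0. ln (1 / \<epsilon>) / log_ratio - 1 \<le> real (kappa \<epsilon>)"
    proof eventually_elim
      case (elim \<epsilon>)
      then have "ln (1 / \<epsilon>) / log_ratio < real (kappa \<epsilon>) + 1"
        using kappa_bounds(2)[of \<epsilon>] log_ratio_pos by (simp add: pos_divide_less_eq)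
      then show ?case by simp
    qed
  qed
  then show ?thesis
    unfolding filterlim_at_top by (metis (mono_tags, lifting) eventually_mono of_nat_le_iff)
qed

text \<open>Stands for measurability with respect to the first \<open>k\<close> levels; the locality
  clause is the form that splitting the levels requires.\<close>

definition local_event :: "nat \<Rightarrow> ((nat list \<Rightarrow> nat) \<Rightarrow> bool) \<Rightarrow> bool" where
  "local_event k Q \<longleftrightarrow> Measurable.pred tree_space Q \<and> (\<forall>t t'. (\<forall>v. length v < k \<longrightarrow> t v = t' v) \<longrightarrow> Q t = Q t')"

text \<open>Given generation \<open>\<kappa>(\<epsilon>)\<close>, the conditional expectation of \<open>exp (- u\<^sub>1 a ^ \<kappa> W)\<close> is \<open>exp (- l u\<^sub>1) ^ Z \<kappa>\<close>,
  so this is the tilted law of the tree restricted to its first \<open>\<kappa>(\<epsilon>)\<close> generations.\<close>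

definition tilted_prob :: "real \<Rightarrow> ((nat list \<Rightarrow> nat) \<Rightarrow> bool) \<Rightarrow> real" where
  "tilted_prob \<epsilon> Q = (\<integral>x. of_bool (Q (tree x)) * exp (- l (u1 \<epsilon>) * tree_Z (kappa \<epsilon>) (tree x)) \<partial>M)
     / exp (- G_iter (kappa \<epsilon>) (l (u1 \<epsilon>)))"

lemma expectation_exp_Z: "(t :: real) \<ge> 0 \<Longrightarrow> (\<integral>x. exp (- t * tree_Z k (tree x)) \<partial>M) = exp (- G_iter k t)"
proof -
  assume t: "t \<ge> 0"
  have "(\<integral>x. exp (- t * tree_Z k (tree x)) \<partial>M) = (\<integral>x. exp (- t) ^ tree_Z k (tree x) \<partial>M)"
    by (simp add: exp_of_nat_mult[symmetric] mult.commute)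
  then show ?thesis using expectation_power_Z[of "exp (- t)" k] gw_pgf_iter_exp[OF t] t by simp
qed

lemma tilted_prob_True: "u1 \<epsilon> > 0 \<Longrightarrow> tilted_prob \<epsilon> (\<lambda>_. True) = 1"
  unfolding tilted_prob_def using expectation_exp_Z[of "l (u1 \<epsilon>)" "kappa \<epsilon>"] lim.neg_log_laplace_nonneg[of "u1 \<epsilon>"] by simp

lemma tilted_prob_nonneg: "tilted_prob \<epsilon> Q \<ge> 0"
  unfolding tilted_prob_def by (intro divide_nonneg_nonneg integral_nonneg_AE AE_I2) auto

lemma tilted_prob_not:
  assumes u: "u1 \<epsilon> > 0" and [measurable]: "Measurable.pred tree_space Q"
  shows "tilted_prob \<epsilon> (\<lambda>t. \<not> Q t) = 1 - tilted_prob \<epsilon> Q"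
proof -
  have "tilted_prob \<epsilon> Q + tilted_prob \<epsilon> (\<lambda>t. \<not> Q t) = tilted_prob \<epsilon> (\<lambda>_. True)"
  proof -
    let ?e = "\<lambda>x. exp (- l (u1 \<epsilon>) * tree_Z (kappa \<epsilon>) (tree x))"
    have "(\<integral>x. of_bool (Q (tree x)) * ?e x \<partial>M) + (\<integral>x. of_bool (\<not> Q (tree x)) * ?e x \<partial>M)
        = (\<integral>x. of_bool (Q (tree x)) * ?e x + of_bool (\<not> Q (tree x)) * ?e x \<partial>M)"
      using u by (intro Bochner_Integration.integral_add[symmetric] integrable_tilted_indicator) auto
    also have "\<dots> = (\<integral>x. of_bool True * ?e x \<partial>M)"
      by (intro Bochner_Integration.integral_cong) auto
    finally show ?thesis
      unfolding tilted_prob_def add_divide_distrib[symmetric] by simp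
  qed
  then show ?thesis using tilted_prob_True[OF u] by simp
qed

text \<open>Up to constants, the probability of \<open>W < \<epsilon>\<close>.\<close>

definition scale :: "real \<Rightarrow> real" where
  "scale \<epsilon> = exp (u1 \<epsilon> * (real \<mu> ^ kappa \<epsilon> * DB (u1 \<epsilon>))) * exp (- G_iter (kappa \<epsilon>) (l (u1 \<epsilon>))) / sqrt (real \<mu> ^ kappa \<epsilon>)"

lemma scale_pos: "scale \<epsilon> > 0"
  unfolding scale_def using mu_real by simp

text \<open>\<open>u1 \<epsilon>\<close> stays in a compact interval, so both local bounds apply
  with common constants. The loss \<open>\<eta>\<close> dominates the tilted probability of
  untypical generation sizes; \<open>c\<close> depends on \<open>\<eta>\<close> but not on
  \<open>Q\<close>.\<close>

lemma prob_event_scale: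
  shows "\<exists>C>0. \<forall>\<epsilon>\<in>{0<..<1}. \<forall>Q. local_event (kappa \<epsilon>) Q \<longrightarrow>
      prob {x \<in> space M. Q (tree x) \<and> W (tree x) < \<epsilon>} \<le> C * scale \<epsilon> * tilted_prob \<epsilon> Q" (is ?upper)
    and "\<eta> > 0 \<Longrightarrow> \<exists>c>0. \<forall>\<^sub>F \<epsilon> in at_right 0. \<forall>Q. local_event (kappa \<epsilon>) Q \<longrightarrow>
      c * scale \<epsilon> * (tilted_prob \<epsilon> Q - \<eta>) \<le> prob {x \<in> space M. Q (tree x) \<and> W (tree x) < \<epsilon>}" (is "_ \<Longrightarrow> ?lower")
proof -
  obtain U V where UV: "0 < U" "U \<le> V" "\<And>u. u > 0 \<Longrightarrow> real \<mu> / a < DB u \<Longrightarrow> DB u \<le> 1 \<Longrightarrow> u \<in> {U..V}"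
    using u1_range by blast
  have u1: "u1 \<epsilon> \<in> {U..V}" if "0 < \<epsilon>" "\<epsilon> < 1" for \<epsilon>
    using UV(3)[OF u1_props(1)[OF that]] u1_props(2)[OF that] yy_bounds[OF that] by simp
  show ?upper
  proof -
    obtain C where C: "C > 0" and est: "\<forall>u\<in>{U..V}. \<forall>k Q s. Measurable.pred tree_space Q \<longrightarrow>
     (\<forall>t t'. (\<forall>v. length v < k \<longrightarrow> t v = t' v) \<longrightarrow> Q t = Q t') \<longrightarrow>
     prob {x \<in> space M. Q (tree x) \<and> W (tree x) < s / a ^ k}
       \<le> C / sqrt (real \<mu> ^ k) * exp (u * s) * (\<integral>x. of_bool (Q (tree x)) * exp (- l u * tree_Z k (tree x)) \<partial>M)"
      using prob_event_W_less_le[OF UV(1,2)] by (elim exE conjE)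
    have "prob {x \<in> space M. Q (tree x) \<and> W (tree x) < \<epsilon>} \<le> C * scale \<epsilon> * tilted_prob \<epsilon> Q"
      if e: "0 < \<epsilon>" "\<epsilon> < 1" and Q: "local_event (kappa \<epsilon>) Q" for \<epsilon> Q
    proof -
      note est[THEN bspec, OF u1[OF e], THEN spec, THEN spec, THEN spec, THEN mp, THEN mp, of Q "kappa \<epsilon>" "real \<mu> ^ kappa \<epsilon> * DB (u1 \<epsilon>)"]
      then show ?thesis
        using Q unfolding eps_eq[OF e] local_event_def scale_def tilted_prob_def by (simp add: mult_ac)
    qed
    then show ?thesis using C by auto
  qed
  show ?lower if eta: "\<eta> > 0"
  proof -
    obtain Cz where Cz: "Cz > 0" and conc: "\<forall>k. \<forall>t\<ge>l U. \<forall>A>0.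
      (\<integral>x. of_bool (A * sqrt (real \<mu> ^ k) < \<bar>real (tree_Z k (tree x)) - real \<mu> ^ k * bp t\<bar>) * exp (- t * tree_Z k (tree x)) \<partial>M)
        \<le> Cz / A\<^sup>2 * exp (- G_iter k t)"
      using Z_concentration[OF l_pos[OF UV(1)]] by (elim exE conjE)
    \<comment> \<open>The deviation at which the Chebyshev bound \<open>Cz / b\<^sup>2\<close>
      equals \<open>\<eta>\<close>.\<close>
    define b where "b = sqrt (Cz / \<eta>)"
    have b: "b > 0" "Cz / b\<^sup>2 = \<eta>" using Cz eta by (simp_all add: b_def)
    obtain c k0 where c: "c > 0" and est: "\<forall>u\<in>{U..V}. \<forall>k\<ge>k0. \<forall>Q. Measurable.pred tree_space Q \<longrightarrow>
     (\<forall>t t'. (\<forall>v. length v < k \<longrightarrow> t v = t' v) \<longrightarrow> Q t = Q t') \<longrightarrow>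
     c / sqrt (real \<mu> ^ k) * exp (u * (real \<mu> ^ k * DB u)) *
       ((\<integral>x. of_bool (Q (tree x)) * exp (- l u * tree_Z k (tree x)) \<partial>M)
        - (\<integral>x. of_bool (b * sqrt (real \<mu> ^ k) < \<bar>real (tree_Z k (tree x)) - real \<mu> ^ k * bp (l u)\<bar>) * exp (- l u * tree_Z k (tree x)) \<partial>M))
     \<le> prob {x \<in> space M. Q (tree x) \<and> W (tree x) < real \<mu> ^ k * DB u / a ^ k}"
      using prob_event_W_less_ge[OF UV(1,2) b(1)] by (elim exE conjE)
    have "\<forall>\<^sub>F \<epsilon> in at_right 0. \<epsilon> \<in> {0<..<1::real}" by (rule eventually_at_right_real) simp
    moreover have "\<forall>\<^sub>F \<epsilon> in at_right 0. k0 \<le> kappa \<epsilon>" using filterlim_kappa by (simp add: filterlim_at_top)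
    ultimately have "\<forall>\<^sub>F \<epsilon> in at_right 0. \<forall>Q. local_event (kappa \<epsilon>) Q \<longrightarrow>
      c * scale \<epsilon> * (tilted_prob \<epsilon> Q - \<eta>) \<le> prob {x \<in> space M. Q (tree x) \<and> W (tree x) < \<epsilon>}"
    proof eventually_elim
      case (elim \<epsilon>)
      then have e: "0 < \<epsilon>" "\<epsilon> < 1" by auto
      have lU: "l U \<le> l (u1 \<epsilon>)" using u1[OF e] UV(1) by (intro l_mono) auto
      let ?bad = "\<integral>x. of_bool (b * sqrt (real \<mu> ^ kappa \<epsilon>) < \<bar>real (tree_Z (kappa \<epsilon>) (tree x)) - real \<mu> ^ kappa \<epsilon> * bp (l (u1 \<epsilon>))\<bar>) * exp (- l (u1 \<epsilon>) * tree_Z (kappa \<epsilon>) (tree x)) \<partial>M"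
      let ?f = "exp (- G_iter (kappa \<epsilon>) (l (u1 \<epsilon>)))"
      have bad: "?bad \<le> \<eta> * ?f"
        using conc[THEN spec, THEN spec, THEN mp, OF lU, THEN spec, THEN mp, OF b(1), of "kappa \<epsilon>"] unfolding b(2) .
      show ?case
      proof (intro allI impI)
        fix Q assume Q: "local_event (kappa \<epsilon>) Q"
        let ?I = "\<integral>x. of_bool (Q (tree x)) * exp (- l (u1 \<epsilon>) * tree_Z (kappa \<epsilon>) (tree x)) \<partial>M"
        let ?c = "c / sqrt (real \<mu> ^ kappa \<epsilon>) * exp (u1 \<epsilon> * (real \<mu> ^ kappa \<epsilon> * DB (u1 \<epsilon>)))"
        have "?c * (?I - ?bad) \<le> prob {x \<in> space M. Q (tree x) \<and> W (tree x) < \<epsilon>}"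
          using est[THEN bspec, OF u1[OF e], THEN spec, THEN mp, OF elim(2), THEN spec, THEN mp, THEN mp, of Q] Q
          unfolding eps_eq[OF e] local_event_def by blast
        moreover have "?c * (?I - \<eta> * ?f) \<le> ?c * (?I - ?bad)"
          using bad c mu_real by (intro mult_left_mono) auto
        moreover have "?c * (?I - \<eta> * ?f) = c * scale \<epsilon> * (tilted_prob \<epsilon> Q - \<eta>)"
        proof -
          have gen: "c / s * E * (I - \<eta> * f) = c * (E * f / s) * (I / f - \<eta>)" if "f \<noteq> 0" for s E I f :: real
            using that by (simp add: algebra_simps)
          show ?thesis unfolding scale_def tilted_prob_def by (rule gen) simp
        qed
        ultimately show "c * scale \<epsilon> * (tilted_prob \<epsilon> Q - \<eta>) \<le> prob {x \<in> space M. Q (tree x) \<and> W (tree x) < \<epsilon>}"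
          by linarith
      qed
    qed
    then show ?thesis using c by blast
  qed
qed

definition cond :: "real \<Rightarrow> ((nat list \<Rightarrow> nat) \<Rightarrow> bool) \<Rightarrow> real" where
  "cond \<epsilon> Q = prob {x \<in> space M. Q (tree x) \<and> W (tree x) < \<epsilon>} / prob {x \<in> space M. W (tree x) < \<epsilon>}"

lemma local_event_True: "local_event k (\<lambda>_. True)" by (simp add: local_event_def)

text \<open>The whole space has tilted probability 1, so the lower bound with loss one half still
  leaves half of \<open>c * scale \<epsilon>\<close>.\<close>

lemma prob_W_less_pos: "\<exists>c>0. \<forall>\<^sub>F \<epsilon> in at_right 0. c * scale \<epsilon> \<le> prob {x \<in> space M. W (tree x) < \<epsilon>}"
proof -
  obtain c where c: "c > 0" and lo: "\<forall>\<^sub>F \<epsilon> in at_right 0. \<forall>Q. local_event (kappa \<epsilon>) Q \<longrightarrow>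
      c * scale \<epsilon> * (tilted_prob \<epsilon> Q - 1 / 2) \<le> prob {x \<in> space M. Q (tree x) \<and> W (tree x) < \<epsilon>}"
    using prob_event_scale(2)[of "1 / 2"] by auto
  have "\<forall>\<^sub>F \<epsilon> in at_right 0. \<epsilon> \<in> {0<..<1::real}" by (rule eventually_at_right_real) simp
  with lo have "\<forall>\<^sub>F \<epsilon> in at_right 0. c / 2 * scale \<epsilon> \<le> prob {x \<in> space M. W (tree x) < \<epsilon>}"
  proof eventually_elim
    case (elim \<epsilon>)
    then show ?case
      using elim(1)[THEN spec, THEN mp, OF local_event_True] tilted_prob_True[OF u1_props(1), of \<epsilon>] by (simp add: mult.commute)
  qed
  then show ?thesis using c by (intro exI[of _ "c / 2"]) auto
qed

text \<open>Upper bound for the joint event over lower bound for \<open>W < \<epsilon>\<close>; the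
  common order \<open>scale \<epsilon>\<close> cancels.\<close>

lemma cond_le: "\<exists>C>0. \<forall>\<^sub>F \<epsilon> in at_right 0. prob {x \<in> space M. W (tree x) < \<epsilon>} > 0 \<and>
    (\<forall>Q. local_event (kappa \<epsilon>) Q \<longrightarrow> cond \<epsilon> Q \<le> C * tilted_prob \<epsilon> Q)"
proof -
  obtain c where c: "c > 0" and lo: "\<forall>\<^sub>F \<epsilon> in at_right 0. c * scale \<epsilon> \<le> prob {x \<in> space M. W (tree x) < \<epsilon>}"
    using prob_W_less_pos by auto
  obtain C where C: "C > 0" and up: "\<forall>\<epsilon>\<in>{0<..<1}. \<forall>Q. local_event (kappa \<epsilon>) Q \<longrightarrow>
      prob {x \<in> space M. Q (tree x) \<and> W (tree x) < \<epsilon>} \<le> C * scale \<epsilon> * tilted_prob \<epsilon> Q"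
    using prob_event_scale(1) by (elim exE conjE)
  have "\<forall>\<^sub>F \<epsilon> in at_right 0. \<epsilon> \<in> {0<..<1::real}" by (rule eventually_at_right_real) simp
  with lo have "\<forall>\<^sub>F \<epsilon> in at_right 0. prob {x \<in> space M. W (tree x) < \<epsilon>} > 0 \<and>
    (\<forall>Q. local_event (kappa \<epsilon>) Q \<longrightarrow> cond \<epsilon> Q \<le> C / c * tilted_prob \<epsilon> Q)"
  proof eventually_elim
    case (elim \<epsilon>)
    have s: "c * scale \<epsilon> > 0" using c scale_pos by simp
    then have pos: "prob {x \<in> space M. W (tree x) < \<epsilon>} > 0" using elim(1) by linarith
    have "cond \<epsilon> Q \<le> C / c * tilted_prob \<epsilon> Q" if "local_event (kappa \<epsilon>) Q" for Q
    proof -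
      have "prob {x \<in> space M. Q (tree x) \<and> W (tree x) < \<epsilon>} \<le> C * scale \<epsilon> * tilted_prob \<epsilon> Q"
        using up elim(2) that by blast
      then have "cond \<epsilon> Q \<le> (C * scale \<epsilon> * tilted_prob \<epsilon> Q) / (c * scale \<epsilon>)"
        unfolding cond_def using elim(1) s C scale_pos[of \<epsilon>] tilted_prob_nonneg[of \<epsilon> Q] by (intro frac_le) auto
      then show ?thesis using c scale_pos[of \<epsilon>] by simp
    qed
    then show ?case using pos by blast
  qed
  then show ?thesis using c C by (intro exI[of _ "C / c"]) auto
qed

text \<open>Here the joint event is bounded from below and \<open>W < \<epsilon>\<close> from above.
  If the tilted probability does not exceed \<open>\<eta>\<close>, nonnegativity of
  \<open>cond\<close> is enough.\<close>

lemma cond_ge: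
  assumes "\<eta> > 0"
  shows "\<exists>c>0. \<forall>\<^sub>F \<epsilon> in at_right 0. \<forall>Q. local_event (kappa \<epsilon>) Q \<longrightarrow> c * (tilted_prob \<epsilon> Q - \<eta>) \<le> cond \<epsilon> Q"
proof -
  obtain c where c: "c > 0" and lo: "\<forall>\<^sub>F \<epsilon> in at_right 0. \<forall>Q. local_event (kappa \<epsilon>) Q \<longrightarrow>
      c * scale \<epsilon> * (tilted_prob \<epsilon> Q - \<eta>) \<le> prob {x \<in> space M. Q (tree x) \<and> W (tree x) < \<epsilon>}"
    using prob_event_scale(2)[OF assms] by (elim exE conjE)
  obtain C where C: "C > 0" and up: "\<forall>\<epsilon>\<in>{0<..<1}. \<forall>Q. local_event (kappa \<epsilon>) Q \<longrightarrow>
      prob {x \<in> space M. Q (tree x) \<and> W (tree x) < \<epsilon>} \<le> C * scale \<epsilon> * tilted_prob \<epsilon> Q"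
    using prob_event_scale(1) by (elim exE conjE)
  obtain C' where pos: "\<forall>\<^sub>F \<epsilon> in at_right 0. prob {x \<in> space M. W (tree x) < \<epsilon>} > 0 \<and>
    (\<forall>Q. local_event (kappa \<epsilon>) Q \<longrightarrow> cond \<epsilon> Q \<le> C' * tilted_prob \<epsilon> Q)"
    using cond_le by (elim exE conjE)
  have "\<forall>\<^sub>F \<epsilon> in at_right 0. \<epsilon> \<in> {0<..<1::real}" by (rule eventually_at_right_real) simp
  with lo pos have "\<forall>\<^sub>F \<epsilon> in at_right 0. \<forall>Q. local_event (kappa \<epsilon>) Q \<longrightarrow> c / C * (tilted_prob \<epsilon> Q - \<eta>) \<le> cond \<epsilon> Q"
  proof eventually_elim
    case (elim \<epsilon>)
    let ?P = "prob {x \<in> space M. W (tree x) < \<epsilon>}"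
    have P: "?P > 0" using elim(2) by blast
    have Pu: "?P \<le> C * scale \<epsilon>"
      using up[THEN bspec, OF elim(3), THEN spec, THEN mp, OF local_event_True] tilted_prob_True[OF u1_props(1), of \<epsilon>] elim(3)
      by simp
    show ?case
    proof (intro allI impI)
      fix Q assume Q: "local_event (kappa \<epsilon>) Q"
      show "c / C * (tilted_prob \<epsilon> Q - \<eta>) \<le> cond \<epsilon> Q"
      proof (cases "tilted_prob \<epsilon> Q \<le> \<eta>")
        case True
        then have "c / C * (tilted_prob \<epsilon> Q - \<eta>) \<le> 0" using c C by (intro mult_nonneg_nonpos) auto
        also have "0 \<le> cond \<epsilon> Q" by (simp add: cond_def)
        finally show ?thesis .
      next
        case False
        have "c / C * (tilted_prob \<epsilon> Q - \<eta>) = (c * scale \<epsilon> * (tilted_prob \<epsilon> Q - \<eta>)) / (C * scale \<epsilon>)"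
          using scale_pos[of \<epsilon>] by simp
        also have "\<dots> \<le> cond \<epsilon> Q"
          unfolding cond_def using elim(1) Q Pu P by (intro frac_le) auto
        finally show ?thesis .
      qed
    qed
  qed
  then show ?thesis using c C by (intro exI[of _ "c / C"]) auto
qed

definition minimal :: "nat \<Rightarrow> (nat list \<Rightarrow> nat) \<Rightarrow> bool" where
  "minimal k t \<longleftrightarrow> tree_Z k t = \<mu> ^ k"

lemma measurable_minimal [measurable]: "Measurable.pred tree_space (minimal k)"
  unfolding minimal_def[abs_def] by measurable

lemma local_event_minimal: "k \<le> j \<Longrightarrow> local_event j (minimal k)"
  using measurable_minimal[of k] unfolding local_event_def minimal_def gw_Z_def by (metis tree_gen_cong)

lemma local_event_not: "local_event k Q \<Longrightarrow> local_event k (\<lambda>t. \<not> Q t)"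
  unfolding local_event_def by (auto intro: pred_intros_logic)

text \<open>The logarithm is \<open>(\<mu> ^ k - 1) * log_c - \<mu> ^ k * G_iter (\<kappa> - k) t +
  G_iter \<kappa> t\<close> with \<open>\<kappa> = kappa \<epsilon>\<close>. Since \<open>bh\<close>
  multiplies by \<open>\<mu>\<close> under each iteration, the Boettcher parts cancel and so do the
  constants, leaving only remainders.\<close>

lemma tilted_prob_minimal:
  assumes "u1 \<epsilon> > 0" "k \<le> kappa \<epsilon>"
  shows "tilted_prob \<epsilon> (minimal k)
    = exp (remainder (G_iter (kappa \<epsilon>) (l (u1 \<epsilon>))) - real \<mu> ^ k * remainder (G_iter (kappa \<epsilon> - k) (l (u1 \<epsilon>))))"
proof -
  define t where "t = l (u1 \<epsilon>)"
  have t: "t \<ge> 0" using lim.neg_log_laplace_nonneg[of "u1 \<epsilon>"] assms by (simp add: t_def)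
  define j where "j = kappa \<epsilon> - k"
  have kj: "kappa \<epsilon> = k + j" using assms by (simp add: j_def)
  have "(\<integral>x. of_bool (minimal k (tree x)) * exp (- t * tree_Z (kappa \<epsilon>) (tree x)) \<partial>M)
      = (\<integral>x. of_bool (tree_Z k (tree x) = \<mu> ^ k) * exp (- t) ^ tree_Z (k + j) (tree x) \<partial>M)"
    by (simp add: minimal_def kj exp_of_nat_mult[symmetric] mult.commute)
  also have "\<dots> = exp ((real \<mu> ^ k - 1) * log_c) * exp (- G_iter j t) ^ (\<mu> ^ k)"
    using t by (subst expectation_indicator_power_Z) (auto simp: prob_Z_minimal gw_pgf_iter_exp)
  also have "exp (- G_iter j t) ^ (\<mu> ^ k) = exp (- (real \<mu> ^ k * G_iter j t))"
    by (simp add: exp_of_nat_mult[symmetric])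
  finally have eq: "(\<integral>x. of_bool (minimal k (tree x)) * exp (- t * tree_Z (kappa \<epsilon>) (tree x)) \<partial>M)
      = exp ((real \<mu> ^ k - 1) * log_c) * exp (- (real \<mu> ^ k * G_iter j t))" .
  have "exp c * exp (- d) / exp (- e) = exp (c - d + e)" for c d e :: real
    by (simp add: exp_add exp_diff exp_minus field_simps)
  then have "tilted_prob \<epsilon> (minimal k) = exp ((real \<mu> ^ k - 1) * log_c - real \<mu> ^ k * G_iter j t + G_iter (kappa \<epsilon>) t)"
    unfolding tilted_prob_def t_def[symmetric] eq by blast
  also have "(real \<mu> ^ k - 1) * log_c - real \<mu> ^ k * G_iter j t + G_iter (kappa \<epsilon>) t
     = remainder (G_iter (kappa \<epsilon>) t) - real \<mu> ^ k * remainder (G_iter j t)"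
    using bh_G_iter[OF t, of j] bh_G_iter[OF t, of "k + j"] unfolding remainder_def kj by (simp add: power_add algebra_simps)
  finally show ?thesis by (simp add: t_def j_def)
qed

section \<open>The order of the tilted probability near generation gamma\<close>

abbreviation \<alpha> :: real where "\<alpha> \<equiv> gw_alpha p"
abbreviation \<gamma> :: "real \<Rightarrow> real" where "\<gamma> \<equiv> gw_gamma M p N"
abbreviation \<omega> :: "real \<Rightarrow> real" where "\<omega> \<equiv> gw_omega M p N"

definition ln_mu :: real where "ln_mu = ln (real \<mu>)"
definition gap :: real where "gap = real lam - real \<mu>"

lemma ln_mu_pos: "ln_mu > 0" and exp_ln_mu: "exp ln_mu = real \<mu>"
  using mu_real by (simp_all add: ln_mu_def)

lemma gap_pos: "gap > 0" and gap_eq: "gap = real (lam - \<mu>)"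
  using lam(1) by (simp_all add: gap_def of_nat_diff)

lemma alpha_eq: "\<alpha> = ln_mu / log_ratio"
proof -
  have lr: "log_ratio = ln a - ln_mu"
    using mean_gt_1 mu_real by (simp add: log_ratio_def ln_mu_def ln_div)
  have "ln a > 0" using mean_gt_1 by simp
  then show ?thesis
    using log_ratio_pos unfolding gw_alpha_def gw_beta_def ln_mu_def[symmetric] lr by (simp add: field_simps)
qed

lemma alpha_pos: "\<alpha> > 0"
  unfolding alpha_eq using ln_mu_pos log_ratio_pos by simp

text \<open>Equal to \<open>\<mu>\<close> raised to the power
  \<open>gw_H M p N \<epsilon>\<close>.\<close>

definition theta_coeff :: "real \<Rightarrow> real" where
  "theta_coeff \<epsilon> = Bh (u1 \<epsilon>) * yy \<epsilon> powr \<alpha> * gap / \<alpha>"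

text \<open>The order of minus the logarithm of the tilted probability of \<open>minimal k\<close>:
  the remainder after \<open>kappa \<epsilon> - k\<close> iterations, with the Boettcher coordinate
  in the exponent, times \<open>\<mu> ^ k\<close>. Meant for
  \<open>k \<le> kappa \<epsilon>\<close>, as the subtraction is in \<open>nat\<close>.\<close>

definition theta :: "real \<Rightarrow> nat \<Rightarrow> real" where
  "theta \<epsilon> k = real \<mu> ^ k * exp (- gap * (real \<mu> ^ (kappa \<epsilon> - k) * Bh (u1 \<epsilon>)))"

text \<open>\<open>u1 \<epsilon>\<close> lies in a compact interval, and
  \<open>yy \<epsilon>\<close> between \<open>\<mu> / a\<close> and 1; by the choice of
  \<open>\<alpha>\<close>, the power \<open>\<alpha>\<close> of \<open>\<mu> / a\<close> is
  \<open>1 / \<mu>\<close>.\<close>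

lemma theta_coeff_bounds: "\<exists>E1>0. \<exists>E2. \<forall>\<epsilon>. 0 < \<epsilon> \<longrightarrow> \<epsilon> < 1 \<longrightarrow> E1 \<le> theta_coeff \<epsilon> \<and> theta_coeff \<epsilon> \<le> E2"
  and Bh_u1_bounds: "\<exists>B1>0. \<exists>B2. \<forall>\<epsilon>. 0 < \<epsilon> \<longrightarrow> \<epsilon> < 1 \<longrightarrow> B1 \<le> Bh (u1 \<epsilon>) \<and> Bh (u1 \<epsilon>) \<le> B2"
proof -
  obtain U V where UV: "0 < U" "U \<le> V" "\<And>u. u > 0 \<Longrightarrow> real \<mu> / a < DB u \<Longrightarrow> DB u \<le> 1 \<Longrightarrow> u \<in> {U..V}"
    using u1_range by blast
  have Bmono: "Bh u \<le> Bh v" if "0 < u" "u \<le> v" for u v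
    using that(2) by (rule DERIV_nonneg_imp_nondecreasing)
      (use that in \<open>auto intro!: exI[of _ "DB _"] DERIV_Bh less_imp_le[OF DB_pos]\<close>)
  have B: "Bh U \<le> Bh (u1 \<epsilon>) \<and> Bh (u1 \<epsilon>) \<le> Bh V" if "0 < \<epsilon>" "\<epsilon> < 1" for \<epsilon>
    using UV(3)[OF u1_props(1)[OF that]] u1_props[OF that] yy_bounds[OF that] UV(1) by (auto intro!: Bmono)
  then show "\<exists>B1>0. \<exists>B2. \<forall>\<epsilon>. 0 < \<epsilon> \<longrightarrow> \<epsilon> < 1 \<longrightarrow> B1 \<le> Bh (u1 \<epsilon>) \<and> Bh (u1 \<epsilon>) \<le> B2"
    using Bh_pos[OF UV(1)] by blast
  have y: "1 / real \<mu> \<le> yy \<epsilon> powr \<alpha> \<and> yy \<epsilon> powr \<alpha> \<le> 1" if e: "0 < \<epsilon>" "\<epsilon> < 1" for \<epsilon>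
  proof -
    have "(exp (- log_ratio)) powr \<alpha> \<le> yy \<epsilon> powr \<alpha>"
      using yy_bounds(1)[OF e] alpha_pos mean_gt_1 by (intro powr_mono2) (auto simp: exp_minus exp_log_ratio)
    moreover have "(exp (- log_ratio)) powr \<alpha> = 1 / real \<mu>"
    proof -
      have "- log_ratio * \<alpha> = - ln_mu" using log_ratio_pos by (simp add: alpha_eq)
      then have "(exp (- log_ratio)) powr \<alpha> = exp (- ln_mu)" by (simp only: exp_powr_real)
      then show ?thesis by (simp add: exp_minus exp_ln_mu divide_inverse)
    qed
    moreover have "yy \<epsilon> powr \<alpha> \<le> 1 powr \<alpha>"
      using yy_bounds[OF e] alpha_pos by (intro powr_mono2) auto
    ultimately show ?thesis by simp
  qed
  have "Bh U * (1 / real \<mu>) * gap / \<alpha> \<le> theta_coeff \<epsilon> \<and> theta_coeff \<epsilon> \<le> Bh V * 1 * gap / \<alpha>" if e: "0 < \<epsilon>" "\<epsilon> < 1" for \<epsilon>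
    unfolding theta_coeff_def using B[OF e] y[OF e] Bh_pos[OF UV(1)] gap_pos alpha_pos
    by (intro conjI divide_right_mono mult_right_mono mult_mono) auto
  moreover have "Bh U * (1 / real \<mu>) * gap / \<alpha> > 0"
    using Bh_pos[OF UV(1)] gap_pos alpha_pos mu_real by (intro divide_pos_pos mult_pos_pos) auto
  ultimately show "\<exists>E1>0. \<exists>E2. \<forall>\<epsilon>. 0 < \<epsilon> \<longrightarrow> \<epsilon> < 1 \<longrightarrow> E1 \<le> theta_coeff \<epsilon> \<and> theta_coeff \<epsilon> \<le> E2"
    by blast
qed

context
  fixes \<epsilon> :: real
  assumes eps: "0 < \<epsilon>" "\<epsilon> < 1"
begin

private abbreviation (input) "L \<equiv> ln (1 / \<epsilon>)"

lemma L_pos: "L > 0" using eps by (simp add: ln_div)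

lemma theta_coeff_pos: "theta_coeff \<epsilon> > 0"
  unfolding theta_coeff_def using Bh_pos[OF u1_props(1)[OF eps]] gap_pos alpha_pos yy_bounds(3)[OF eps]
  by (intro divide_pos_pos mult_pos_pos) auto

lemma gamma_eq: "\<gamma> \<epsilon> * ln_mu = \<alpha> * L - ln L + ln (theta_coeff \<epsilon>)"
proof -
  have "gw_H M p N \<epsilon> = 1 / ln_mu * ln (theta_coeff \<epsilon>)"
    unfolding gw_H_def theta_coeff_def gap_def ln_mu_def using gw_b_phi_eq[of "u1 \<epsilon>"] u1_props(1)[OF eps] by simp
  then show ?thesis
    unfolding gw_gamma_def log_ratio_def[symmetric] ln_mu_def[symmetric] alpha_eq
    using ln_mu_pos by (simp add: field_simps)
qed

text \<open>Since \<open>yy \<epsilon> powr \<alpha>\<close> equals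
  \<open>\<mu> ^ kappa \<epsilon> * \<epsilon> powr \<alpha>\<close>, the term
  \<open>\<alpha> * L\<close> is exchanged for \<open>kappa \<epsilon>\<close>. This form measures
  the distance from \<open>\<gamma> \<epsilon>\<close> to \<open>kappa \<epsilon>\<close>.\<close>

lemma gamma_eq': "\<gamma> \<epsilon> * ln_mu = real (kappa \<epsilon>) * ln_mu - ln L + ln (Bh (u1 \<epsilon>) * gap / \<alpha>)"
proof -
  have B: "Bh (u1 \<epsilon>) > 0" by (rule Bh_pos[OF u1_props(1)[OF eps]])
  have "yy \<epsilon> powr \<alpha> = exp (\<alpha> * (real (kappa \<epsilon>) * log_ratio - L))"
    by (simp add: yy_eq(1)[OF eps] powr_def)
  also have "\<alpha> * (real (kappa \<epsilon>) * log_ratio - L) = real (kappa \<epsilon>) * ln_mu - \<alpha> * L"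
    using log_ratio_pos by (simp add: alpha_eq field_simps)
  finally have y: "yy \<epsilon> powr \<alpha> = exp (real (kappa \<epsilon>) * ln_mu - \<alpha> * L)" .
  have "theta_coeff \<epsilon> = (Bh (u1 \<epsilon>) * gap / \<alpha>) * yy \<epsilon> powr \<alpha>" by (simp add: theta_coeff_def)
  then have "ln (theta_coeff \<epsilon>) = ln (Bh (u1 \<epsilon>) * gap / \<alpha>) + (real (kappa \<epsilon>) * ln_mu - \<alpha> * L)"
  proof -
    have gen: "ln (x * exp z) = ln x + z" if "x > 0" for x z :: real using that by (simp add: ln_mult)
    have "Bh (u1 \<epsilon>) * gap / \<alpha> > 0" using B gap_pos alpha_pos by simp
    then show ?thesis unfolding \<open>theta_coeff \<epsilon> = _\<close> y by (rule gen)
  qed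
  then show ?thesis unfolding gamma_eq by simp
qed

text \<open>The two forms of \<open>\<gamma> \<epsilon>\<close> say that at the real level
  \<open>\<gamma> \<epsilon>\<close> the exponent of \<open>theta\<close> equals
  \<open>\<alpha> * L\<close>, while \<open>\<mu>\<close> to the power
  \<open>\<gamma> \<epsilon>\<close> is
  \<open>exp (\<alpha> * L) / L * theta_coeff \<epsilon>\<close>. Moving to level \<open>k\<close>
  multiplies the latter and divides the former by the same power of \<open>\<mu>\<close>.\<close>

lemma theta_eq:
  assumes "k \<le> kappa \<epsilon>"
  shows "theta \<epsilon> k = exp ((real k - \<gamma> \<epsilon>) * ln_mu) * (theta_coeff \<epsilon> / L) * exp (\<alpha> * L * (1 - exp (- ((real k - \<gamma> \<epsilon>) * ln_mu))))"
proof -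
  have B: "Bh (u1 \<epsilon>) > 0" by (rule Bh_pos[OF u1_props(1)[OF eps]])
  have muk: "real \<mu> ^ n = exp (real n * ln_mu)" for n by (simp add: exp_of_nat_mult exp_ln_mu)
  have eg: "exp (\<gamma> \<epsilon> * ln_mu) = exp (\<alpha> * L) / L * theta_coeff \<epsilon>"
    unfolding gamma_eq using L_pos theta_coeff_pos by (simp add: exp_add exp_diff)
  have eg': "exp (real (kappa \<epsilon>) * ln_mu) * Bh (u1 \<epsilon>) * gap = \<alpha> * L * exp (\<gamma> \<epsilon> * ln_mu)"
    unfolding gamma_eq' using L_pos B gap_pos alpha_pos by (simp add: exp_add exp_diff)
  have 1: "real \<mu> ^ k = exp ((real k - \<gamma> \<epsilon>) * ln_mu) * (exp (\<alpha> * L) / L * theta_coeff \<epsilon>)"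
    unfolding muk eg[symmetric] exp_add[symmetric] by (simp add: algebra_simps)
  have "gap * (real \<mu> ^ (kappa \<epsilon> - k) * Bh (u1 \<epsilon>)) = exp (- (real k * ln_mu)) * (exp (real (kappa \<epsilon>) * ln_mu) * Bh (u1 \<epsilon>) * gap)"
    unfolding muk using assms by (simp add: of_nat_diff left_diff_distrib exp_diff exp_minus field_simps)
  also have "\<dots> = \<alpha> * L * exp (- ((real k - \<gamma> \<epsilon>) * ln_mu))"
    unfolding eg' by (simp add: exp_add[symmetric] algebra_simps)
  finally have 2: "gap * (real \<mu> ^ (kappa \<epsilon> - k) * Bh (u1 \<epsilon>)) = \<alpha> * L * exp (- ((real k - \<gamma> \<epsilon>) * ln_mu))" .
  have gen: "A * (exp c / M * E) * exp (- (c * q)) = A * (E / M) * exp (c * (1 - q))" for A c q M E :: real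
    by (simp add: right_diff_distrib exp_diff exp_minus field_simps)
  show ?thesis
    unfolding theta_def 1 mult_minus_left 2 by (rule gen)
qed

lemma upper_frac_bounds: "0 \<le> upper_frac x" "upper_frac x < 1"
  unfolding upper_frac_def by linarith+

lemma omega_eq: "\<omega> \<epsilon> = exp (\<alpha> * L * (1 - exp (- (upper_frac (\<gamma> \<epsilon>) * ln_mu)))) / L"
  unfolding gw_omega_def using eps mu_real
  by (simp add: powr_def ln_mu_def ln_div algebra_simps)

lemma omega_pos: "\<omega> \<epsilon> > 0"
  unfolding omega_eq using L_pos by simp

text \<open>At the ceiling, \<open>k - \<gamma> \<epsilon>\<close> is
  \<open>upper_frac (\<gamma> \<epsilon>)\<close>, so the last factor over \<open>L\<close> is
  \<open>\<omega> \<epsilon>\<close> and the prefactor lies between 1 and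
  \<open>\<mu>\<close>.\<close>

lemma theta_ceiling:
  assumes "k \<le> kappa \<epsilon>" "int k = \<lceil>\<gamma> \<epsilon>\<rceil>"
  shows "theta_coeff \<epsilon> * \<omega> \<epsilon> \<le> theta \<epsilon> k" "theta \<epsilon> k \<le> real \<mu> * (theta_coeff \<epsilon> * \<omega> \<epsilon>)"
proof -
  have d: "real k - \<gamma> \<epsilon> = upper_frac (\<gamma> \<epsilon>)"
    using arg_cong[OF assms(2), of real_of_int] by (simp add: upper_frac_def)
  have t: "theta \<epsilon> k = exp (upper_frac (\<gamma> \<epsilon>) * ln_mu) * (theta_coeff \<epsilon> * \<omega> \<epsilon>)"
    unfolding theta_eq[OF assms(1)] d omega_eq by simp
  have p: "theta_coeff \<epsilon> * \<omega> \<epsilon> \<ge> 0" using theta_coeff_pos omega_pos by simp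
  have "1 \<le> exp (upper_frac (\<gamma> \<epsilon>) * ln_mu)" using upper_frac_bounds[of "\<gamma> \<epsilon>"] ln_mu_pos by simp
  then show "theta_coeff \<epsilon> * \<omega> \<epsilon> \<le> theta \<epsilon> k" unfolding t using mult_right_mono[OF _ p, of 1] by simp
  have "upper_frac (\<gamma> \<epsilon>) * ln_mu \<le> 1 * ln_mu" using upper_frac_bounds[of "\<gamma> \<epsilon>"] ln_mu_pos by (intro mult_right_mono) auto
  then have "exp (upper_frac (\<gamma> \<epsilon>) * ln_mu) \<le> real \<mu>" unfolding exp_ln_mu[symmetric] by simp
  then show "theta \<epsilon> k \<le> real \<mu> * (theta_coeff \<epsilon> * \<omega> \<epsilon>)" unfolding t using p by (rule mult_right_mono)
qed

text \<open>Here \<open>k < \<gamma> \<epsilon>\<close>, so the prefactor is at most 1 and the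
  exponent of the last factor is nonpositive.\<close>

lemma theta_below_ceiling:
  assumes "k \<le> kappa \<epsilon>" "int k = \<lceil>\<gamma> \<epsilon>\<rceil> - 1"
  shows "theta \<epsilon> k \<le> theta_coeff \<epsilon> / L"
proof -
  have "real k - \<gamma> \<epsilon> = upper_frac (\<gamma> \<epsilon>) - 1"
    using arg_cong[OF assms(2), of real_of_int] by (simp add: upper_frac_def)
  then have "(real k - \<gamma> \<epsilon>) * ln_mu \<le> 0" using upper_frac_bounds[of "\<gamma> \<epsilon>"] ln_mu_pos by (simp add: mult_nonpos_nonneg)
  then have "exp ((real k - \<gamma> \<epsilon>) * ln_mu) \<le> 1" "exp (- ((real k - \<gamma> \<epsilon>) * ln_mu)) \<ge> 1" by simp_all
  then have "exp ((real k - \<gamma> \<epsilon>) * ln_mu) \<le> 1" "exp (\<alpha> * L * (1 - exp (- ((real k - \<gamma> \<epsilon>) * ln_mu)))) \<le> 1"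
    using alpha_pos L_pos by (simp_all add: mult_nonneg_nonpos)
  then have "theta \<epsilon> k \<le> 1 * (theta_coeff \<epsilon> / L) * 1"
    unfolding theta_eq[OF assms(1)] using theta_coeff_pos L_pos by (intro mult_mono) auto
  then show ?thesis by simp
qed

text \<open>Here \<open>k \<ge> \<gamma> \<epsilon> + 1\<close>, so the last factor is at least a
  fixed negative power of \<open>\<epsilon>\<close>, which outweighs the division by
  \<open>L\<close>.\<close>

lemma theta_above_ceiling:
  assumes "k \<le> kappa \<epsilon>" "int k = \<lceil>\<gamma> \<epsilon>\<rceil> + 1"
  shows "theta_coeff \<epsilon> * (exp (\<alpha> * L * (1 - 1 / real \<mu>)) / L) \<le> theta \<epsilon> k"
proof -
  have "real k - \<gamma> \<epsilon> = upper_frac (\<gamma> \<epsilon>) + 1"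
    using arg_cong[OF assms(2), of real_of_int] by (simp add: upper_frac_def)
  then have x: "ln_mu \<le> (real k - \<gamma> \<epsilon>) * ln_mu" using upper_frac_bounds[of "\<gamma> \<epsilon>"] ln_mu_pos by simp
  then have "exp (- ((real k - \<gamma> \<epsilon>) * ln_mu)) \<le> exp (- ln_mu)" by simp
  then have "1 - 1 / real \<mu> \<le> 1 - exp (- ((real k - \<gamma> \<epsilon>) * ln_mu))" by (simp add: exp_minus exp_ln_mu divide_inverse)
  then have "\<alpha> * L * (1 - 1 / real \<mu>) \<le> \<alpha> * L * (1 - exp (- ((real k - \<gamma> \<epsilon>) * ln_mu)))"
    using alpha_pos L_pos by (intro mult_left_mono) auto
  then have "1 * (theta_coeff \<epsilon> / L) * exp (\<alpha> * L * (1 - 1 / real \<mu>)) \<le> theta \<epsilon> k"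
    unfolding theta_eq[OF assms(1)] using theta_coeff_pos L_pos x ln_mu_pos by (intro mult_mono) auto
  then show ?thesis by simp
qed

end

text \<open>\<open>G_iter j t\<close> differs from \<open>\<mu> ^ j * bh t\<close> by
  \<open>log_c\<close> and a bounded remainder, so exchanging them in the exponent costs a constant
  factor. The term with \<open>theta \<epsilon> 0\<close> bounds the remainder after all
  \<open>kappa \<epsilon>\<close> iterations and will vanish in the limit.\<close>

lemma tilted_prob_minimal_bounds:
  "\<exists>r1>0. \<exists>r2>0. \<forall>\<epsilon> k. 0 < \<epsilon> \<longrightarrow> \<epsilon> < 1 \<longrightarrow> k \<le> kappa \<epsilon> \<longrightarrow>
     exp (- (r2 * theta \<epsilon> k)) \<le> tilted_prob \<epsilon> (minimal k) \<and>
     tilted_prob \<epsilon> (minimal k) \<le> exp (r2 * theta \<epsilon> 0 - r1 * theta \<epsilon> k)"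
proof -
  \<comment> \<open>The remainder lies between 0 and \<open>1 / pmf p \<mu>\<close>: its upper bound
    enters \<open>r1\<close>, its lower bound gives \<open>r2\<close>.\<close>
  define r1 where "r1 = eta_lower / real \<mu> * exp (- gap * (1 / pmf p \<mu> + log_c))"
  define r2 where "r2 = exp (- gap * log_c) / pmf p \<mu>"
  have r: "r1 > 0" "r2 > 0" using eta_lower_pos mu_real pmf_mu_pos by (auto simp: r1_def r2_def)
  have rb: "r1 * exp (- gap * (real \<mu> ^ j * bh t)) \<le> remainder (G_iter j t) \<and> remainder (G_iter j t) \<le> r2 * exp (- gap * (real \<mu> ^ j * bh t))"
    if t: "t \<ge> 0" for j t
  proof -
    let ?G = "G_iter j t"
    have G0: "?G \<ge> 0" by (rule G_iter_nonneg[OF t])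
    have G: "?G = remainder ?G + log_c + real \<mu> ^ j * bh t" using bh_G_iter[OF t, of j] by (simp add: remainder_def)
    have e1: "exp (- gap * ?G) \<le> 1" using G0 gap_pos by simp
    have remainder: "0 \<le> remainder ?G" "remainder ?G \<le> 1 / pmf p \<mu>"
    proof -
      show "0 \<le> remainder ?G" by (rule remainder_nonneg[OF G0])
      have "remainder ?G \<le> exp (- gap * ?G) / pmf p \<mu>" using remainder_bounds(2)[OF G0] by (simp add: gap_eq)
      also have "\<dots> \<le> 1 / pmf p \<mu>" using e1 pmf_mu_pos by (intro divide_right_mono) auto
      finally show "remainder ?G \<le> 1 / pmf p \<mu>" .
    qed
    have gG: "gap * ?G = gap * remainder ?G + gap * log_c + gap * (real \<mu> ^ j * bh t)"
      unfolding distrib_left[symmetric] by (rule arg_cong[OF G])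
    have gr: "0 \<le> gap * remainder ?G" "gap * remainder ?G \<le> gap * (1 / pmf p \<mu>)"
      using remainder gap_pos by (auto intro!: mult_left_mono simp del: times_divide_eq_right)
    have ge: "gap * log_c + gap * (real \<mu> ^ j * bh t) \<le> gap * ?G"
      unfolding gG using gr by linarith
    have le: "gap * ?G \<le> gap * (1 / pmf p \<mu> + log_c) + gap * (real \<mu> ^ j * bh t)"
      unfolding gG distrib_left using gr by linarith
    have "r1 * exp (- gap * (real \<mu> ^ j * bh t)) = eta_lower / real \<mu> * exp (- (gap * (1 / pmf p \<mu> + log_c) + gap * (real \<mu> ^ j * bh t)))"
      by (simp add: r1_def exp_add[symmetric] algebra_simps)
    also have "\<dots> \<le> eta_lower / real \<mu> * exp (- (gap * ?G))"
      using le eta_lower_pos mu_real by (intro mult_left_mono) auto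
    also have "\<dots> \<le> remainder ?G" using remainder_bounds(1)[OF G0] by (simp add: gap_eq)
    finally have 1: "r1 * exp (- gap * (real \<mu> ^ j * bh t)) \<le> remainder ?G" .
    have "remainder ?G \<le> exp (- (gap * ?G)) / pmf p \<mu>" using remainder_bounds(2)[OF G0] by (simp add: gap_eq)
    also have "\<dots> \<le> exp (- (gap * log_c + gap * (real \<mu> ^ j * bh t))) / pmf p \<mu>"
      using ge pmf_mu_pos by (intro divide_right_mono) auto
    also have "\<dots> = r2 * exp (- gap * (real \<mu> ^ j * bh t))"
      by (simp add: r2_def exp_diff exp_minus field_simps)
    finally show ?thesis using 1 by blast
  qed
  have "exp (- (r2 * theta \<epsilon> k)) \<le> tilted_prob \<epsilon> (minimal k) \<and>
     tilted_prob \<epsilon> (minimal k) \<le> exp (r2 * theta \<epsilon> 0 - r1 * theta \<epsilon> k)"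
    if e: "0 < \<epsilon>" "\<epsilon> < 1" and k: "k \<le> kappa \<epsilon>" for \<epsilon> k
  proof -
    have u: "u1 \<epsilon> > 0" by (rule u1_props(1)[OF e])
    have t: "l (u1 \<epsilon>) \<ge> 0" using lim.neg_log_laplace_nonneg[of "u1 \<epsilon>"] u by simp
    let ?r0 = "remainder (G_iter (kappa \<epsilon>) (l (u1 \<epsilon>)))" and ?rk = "remainder (G_iter (kappa \<epsilon> - k) (l (u1 \<epsilon>)))"
    have 0: "0 \<le> ?r0" "?r0 \<le> r2 * theta \<epsilon> 0"
      using remainder_nonneg[OF G_iter_nonneg[OF t]] rb[OF t, of "kappa \<epsilon>"] by (auto simp: theta_def Bh_def)
    have m: "real \<mu> ^ k \<ge> 0" by simp
    have up: "real \<mu> ^ k * ?rk \<le> r2 * theta \<epsilon> k"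
      using mult_left_mono[OF conjunct2[OF rb[OF t, of "kappa \<epsilon> - k"]] m] by (simp add: theta_def Bh_def mult_ac)
    have lo: "r1 * theta \<epsilon> k \<le> real \<mu> ^ k * ?rk"
      using mult_left_mono[OF conjunct1[OF rb[OF t, of "kappa \<epsilon> - k"]] m] by (simp add: theta_def Bh_def mult_ac)
    show ?thesis unfolding tilted_prob_minimal[OF u k] using 0 up lo by simp
  qed
  then show ?thesis using r by blast
qed

lemma theta_0_tendsto: "((\<lambda>\<epsilon>. theta \<epsilon> 0) \<longlongrightarrow> 0) (at_right 0)"
proof -
  obtain B1 B2 where B: "B1 > 0" "\<forall>\<epsilon>. 0 < \<epsilon> \<longrightarrow> \<epsilon> < 1 \<longrightarrow> B1 \<le> Bh (u1 \<epsilon>) \<and> Bh (u1 \<epsilon>) \<le> B2"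
    using Bh_u1_bounds by blast
  define c where "c = gap * B1"
  have c: "c > 0" using gap_pos B by (simp add: c_def)
  have "((\<lambda>\<epsilon>. exp (- c * real (kappa \<epsilon>))) \<longlongrightarrow> 0) (at_right 0)"
  proof (rule filterlim_compose[OF _ filterlim_kappa])
    show "((\<lambda>n. exp (- c * real n)) \<longlongrightarrow> 0) sequentially" using c by real_asymp
  qed
  moreover have "\<forall>\<^sub>F \<epsilon> in at_right 0. norm (theta \<epsilon> 0) \<le> exp (- c * real (kappa \<epsilon>))"
  proof -
    have "\<forall>\<^sub>F \<epsilon> in at_right 0. \<epsilon> \<in> {0<..<1::real}" by (rule eventually_at_right_real) simp
    then show ?thesis
    proof eventually_elim
      case (elim \<epsilon>)
      have "real (kappa \<epsilon>) < 2 ^ kappa \<epsilon>" by (rule of_nat_less_two_power)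
      also have "\<dots> \<le> real \<mu> ^ kappa \<epsilon>" using mu_real by (intro power_mono) auto
      finally have "B1 * real (kappa \<epsilon>) \<le> Bh (u1 \<epsilon>) * real \<mu> ^ kappa \<epsilon>" using B elim by (intro mult_mono) auto
      then have "gap * (B1 * real (kappa \<epsilon>)) \<le> gap * (Bh (u1 \<epsilon>) * real \<mu> ^ kappa \<epsilon>)" using gap_pos by (intro mult_left_mono) auto
      then show ?case by (simp add: theta_def c_def mult_ac)
    qed
  qed
  ultimately show ?thesis by (rule Lim_null_comparison[rotated])
qed

text \<open>The leading term \<open>\<alpha> * L\<close> of the first form of
  \<open>\<gamma> \<epsilon>\<close> makes it positive; in the second form \<open>ln L\<close>
  exceeds every bounded term, which keeps \<open>\<gamma> \<epsilon>\<close> at least 2 below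
  \<open>kappa \<epsilon>\<close>.\<close>

lemma ceiling_gamma_range: "\<forall>\<^sub>F \<epsilon> in at_right 0. 1 \<le> \<lceil>\<gamma> \<epsilon>\<rceil> \<and> \<lceil>\<gamma> \<epsilon>\<rceil> + 1 \<le> int (kappa \<epsilon>)"
proof -
  obtain E1 E2 where E: "E1 > 0" "\<forall>\<epsilon>. 0 < \<epsilon> \<longrightarrow> \<epsilon> < 1 \<longrightarrow> E1 \<le> theta_coeff \<epsilon> \<and> theta_coeff \<epsilon> \<le> E2"
    using theta_coeff_bounds by blast
  obtain B1 B2 where B: "B1 > 0" "\<forall>\<epsilon>. 0 < \<epsilon> \<longrightarrow> \<epsilon> < 1 \<longrightarrow> B1 \<le> Bh (u1 \<epsilon>) \<and> Bh (u1 \<epsilon>) \<le> B2"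
    using Bh_u1_bounds by blast
  have "filterlim (\<lambda>\<epsilon>. \<alpha> * ln (1 / \<epsilon>) - ln (ln (1 / \<epsilon>)) + ln E1) at_top (at_right 0)"
    using alpha_pos by real_asymp
  then have 1: "\<forall>\<^sub>F \<epsilon> in at_right 0. 0 < \<alpha> * ln (1 / \<epsilon>) - ln (ln (1 / \<epsilon>)) + ln E1"
    by (simp add: filterlim_at_top_dense)
  have "filterlim (\<lambda>\<epsilon>. ln (ln (1 / \<epsilon>)) - ln (B2 * gap / \<alpha>)) at_top (at_right (0::real))"
    by real_asymp
  then have 2: "\<forall>\<^sub>F \<epsilon> in at_right 0. 2 * ln_mu \<le> ln (ln (1 / \<epsilon>)) - ln (B2 * gap / \<alpha>)"
    by (simp add: filterlim_at_top)
  have "\<forall>\<^sub>F \<epsilon> in at_right 0. \<epsilon> \<in> {0<..<1::real}" by (rule eventually_at_right_real) simp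
  with 1 2 show ?thesis
  proof eventually_elim
    case (elim \<epsilon>)
    then have e: "0 < \<epsilon>" "\<epsilon> < 1" by auto
    have "ln E1 \<le> ln (theta_coeff \<epsilon>)" using E e theta_coeff_pos[OF e] by (subst ln_le_cancel_iff) auto
    then have "\<gamma> \<epsilon> * ln_mu > 0" unfolding gamma_eq[OF e] using elim(1) by linarith
    then have g: "\<gamma> \<epsilon> > 0" using ln_mu_pos by (simp add: zero_less_mult_iff)
    have Bp: "Bh (u1 \<epsilon>) > 0" by (rule Bh_pos[OF u1_props(1)[OF e]])
    have "Bh (u1 \<epsilon>) * gap / \<alpha> \<le> B2 * gap / \<alpha>" using B e gap_pos alpha_pos by (intro divide_right_mono mult_right_mono) auto
    then have "ln (Bh (u1 \<epsilon>) * gap / \<alpha>) \<le> ln (B2 * gap / \<alpha>)"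
      using Bp gap_pos alpha_pos by (intro ln_mono) (auto intro!: divide_pos_pos)
    then have "\<gamma> \<epsilon> * ln_mu \<le> (real (kappa \<epsilon>) - 2) * ln_mu"
      unfolding gamma_eq'[OF e] using elim(2) by (simp add: algebra_simps)
    then have "\<gamma> \<epsilon> \<le> real (kappa \<epsilon>) - 2" using ln_mu_pos by simp
    then show ?case using g by linarith
  qed
qed

section \<open>The generation K in terms of minimal generations\<close>

text \<open>With at least \<open>\<mu>\<close> children each, a generation that exceeds the minimal
  size passes its excess on, so \<open>minimal\<close> holds on an initial segment. The segment is
  almost surely finite because \<open>log_c < 0\<close> sends the probability of
  \<open>minimal k\<close> to 0.\<close>

lemma AE_gw_K:
  "AE x in M. \<forall>k. minimal k (tree x) \<longleftrightarrow> k < gw_K p N x"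
proof -
  have "AE x in M. \<mu> \<le> N v x" for v using AE_mu_le by (simp add: AE_offspring)
  then have AEN: "AE x in M. \<forall>v. \<mu> \<le> N v x" by (simp add: AE_all_countable)
  have lc: "log_c < 0"
  proof -
    have "pmf p \<mu> + pmf p lam = measure_pmf.prob p {\<mu>, lam}"
      using lam(1) by (subst measure_measure_pmf_finite) auto
    also have "\<dots> \<le> 1" by simp
    finally have "pmf p \<mu> < 1" using lam(2) by linarith
    then have "log_pmu < 0" unfolding log_pmu_def using pmf_mu_pos by simp
    then show ?thesis unfolding log_c_def using mu_real by (simp add: divide_neg_pos)
  qed
  have "prob {x \<in> space M. \<forall>k. minimal k (tree x)} \<le> 0"
  proof (rule LIMSEQ_le_const)
    have "(\<lambda>k. exp (log_c * real k)) \<longlonglongrightarrow> 0" using lc by real_asymp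
    then show "(\<lambda>k. exp (log_c * (real k - 1))) \<longlonglongrightarrow> 0" using lc by real_asymp
    have "prob {x \<in> space M. \<forall>k. minimal k (tree x)} \<le> exp (log_c * (real k - 1))" for k
    proof -
      have "prob {x \<in> space M. \<forall>k. minimal k (tree x)} \<le> prob {x \<in> space M. tree_Z k (tree x) = \<mu> ^ k}"
        by (rule finite_measure_mono) (auto simp: minimal_def)
      also have "\<dots> = exp (log_c * (real \<mu> ^ k - 1))" unfolding prob_Z_minimal by (simp add: mult.commute)
      also have "\<dots> \<le> exp (log_c * (real k - 1))"
      proof -
        have "real k < 2 ^ k" by (rule of_nat_less_two_power)
        also have "\<dots> \<le> real \<mu> ^ k" using mu_real by (intro power_mono) auto
        finally show ?thesis using lc by (simp add: mult_left_mono_neg)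
      qed
      finally show ?thesis .
    qed
    then show "\<exists>N. \<forall>k\<ge>N. prob {x \<in> space M. \<forall>k. minimal k (tree x)} \<le> exp (log_c * (real k - 1))" by blast
  qed
  then have "prob {x \<in> space M. \<forall>k. minimal k (tree x)} = 0" using measure_nonneg by (rule antisym)
  then have "AE x in M. \<not> (\<forall>k. minimal k (tree x))"
    by (subst (asm) prob_Collect_eq_0) auto
  then show ?thesis using AEN
  proof eventually_elim
    case (elim x)
    have step: "\<mu> * tree_Z k (tree x) \<le> tree_Z (Suc k) (tree x)" for k
      unfolding tree_Z_Suc using elim(2) sum_bounded_below[of "tree_gen k (tree x)" \<mu> "tree x"]
      by (simp add: gw_Z_def tree_def mult.commute)
    have ge: "\<mu> ^ k \<le> tree_Z k (tree x)" for k
    proof (induction k)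
      case (Suc k)
      show ?case using order_trans[OF mult_le_mono2[OF Suc, of \<mu>] step] by simp
    qed simp
    let ?P = "\<lambda>k. \<mu> ^ k < tree_Z k (tree x)"
    have P: "minimal k (tree x) \<longleftrightarrow> \<not> ?P k" for k using ge[of k] by (auto simp: minimal_def)
    have up: "?P (Suc k)" if "?P k" for k
    proof -
      have "\<mu> ^ Suc k < \<mu> * tree_Z k (tree x)" using that mu_ge_2 by simp
      also note step
      finally show ?thesis .
    qed
    have mono: "?P k" if "?P j" "j \<le> k" for j k
      using that(2)
    proof (induction k rule: dec_induct)
      case (step n)
      show ?case by (rule up[OF step.IH])
    qed (rule that(1))
    have K: "gw_K p N x = (LEAST k. ?P k)"
      by (simp add: gw_K_def gw_Z_eq_tree[of N] tree_def)
    obtain k0 where "?P k0" using elim(1) P by blast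
    then have PK: "?P (gw_K p N x)" unfolding K by (rule LeastI)
    show ?case
    proof
      fix k
      show "minimal k (tree x) \<longleftrightarrow> k < gw_K p N x"
      proof (cases "k < gw_K p N x")
        case True
        then have "\<not> ?P k" unfolding K by (rule not_less_Least)
        then show ?thesis using True P by simp
      next
        case False
        then have "?P k" using mono[OF PK] by simp
        then show ?thesis using False P by simp
      qed
    qed
  qed
qed

lemma measurable_gw_K [measurable]: "gw_K p N \<in> M \<rightarrow>\<^sub>M count_space UNIV"
  unfolding gw_K_def[abs_def] gw_Z_eq_tree[of N] tree_def[symmetric] by measurable

text \<open>The events \<open>minimal k\<close> decrease in \<open>k\<close>, so
  \<open>K = Suc k\<close> is the difference of two of them. The value \<open>K = 0\<close> is left
  out; it has probability 0, as generation 0 is always minimal.\<close>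

lemma cond_prob_gw_K:
  "cond_prob M (\<lambda>x. gw_K p N x = Suc k) (\<lambda>x. gw_W p N x < \<epsilon>) = cond \<epsilon> (minimal k) - cond \<epsilon> (minimal (Suc k))"
proof -
  let ?A = "\<lambda>k. {x \<in> space M. minimal k (tree x) \<and> W (tree x) < \<epsilon>}"
  have "prob {x \<in> space M. gw_K p N x = Suc k \<and> W (tree x) < \<epsilon>} = prob (?A k - {x \<in> space M. minimal k (tree x) \<and> minimal (Suc k) (tree x) \<and> W (tree x) < \<epsilon>})"
  proof (rule finite_measure_eq_AE)
    show "AE x in M. (x \<in> {x \<in> space M. gw_K p N x = Suc k \<and> W (tree x) < \<epsilon>}) =
       (x \<in> ?A k - {x \<in> space M. minimal k (tree x) \<and> minimal (Suc k) (tree x) \<and> W (tree x) < \<epsilon>})"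
      using AE_gw_K
    proof eventually_elim
      case (elim x)
      have "minimal k (tree x) \<longleftrightarrow> k < gw_K p N x" "minimal (Suc k) (tree x) \<longleftrightarrow> Suc k < gw_K p N x"
        using elim by blast+
      then show ?case by auto
    qed
  qed measurable
  also have "\<dots> = prob (?A k) - prob {x \<in> space M. minimal k (tree x) \<and> minimal (Suc k) (tree x) \<and> W (tree x) < \<epsilon>}"
    by (rule finite_measure_Diff) auto
  also have "prob {x \<in> space M. minimal k (tree x) \<and> minimal (Suc k) (tree x) \<and> W (tree x) < \<epsilon>} = prob (?A (Suc k))"
  proof (rule finite_measure_eq_AE)
    show "AE x in M. (x \<in> {x \<in> space M. minimal k (tree x) \<and> minimal (Suc k) (tree x) \<and> W (tree x) < \<epsilon>}) = (x \<in> ?A (Suc k))"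
      using AE_gw_K
    proof eventually_elim
      case (elim x)
      have "minimal k (tree x) \<longleftrightarrow> k < gw_K p N x" "minimal (Suc k) (tree x) \<longleftrightarrow> Suc k < gw_K p N x"
        using elim by blast+
      then show ?case by auto
    qed
  qed measurable
  finally show ?thesis
    unfolding cond_prob_def gw_W_eq cond_def by (simp add: diff_divide_distrib)
qed

lemma cond_not:
  assumes "prob {x \<in> space M. W (tree x) < \<epsilon>} > 0" and [measurable]: "Measurable.pred tree_space Q"
  shows "cond \<epsilon> (\<lambda>t. \<not> Q t) = 1 - cond \<epsilon> Q"
proof -
  let ?A = "{x \<in> space M. Q (tree x) \<and> W (tree x) < \<epsilon>}" and ?B = "{x \<in> space M. \<not> Q (tree x) \<and> W (tree x) < \<epsilon>}"
  have "{x \<in> space M. W (tree x) < \<epsilon>} = ?A \<union> ?B" by auto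
  moreover have "prob (?A \<union> ?B) = prob ?A + prob ?B" by (rule finite_measure_Union) auto
  ultimately show ?thesis using assms(1) unfolding cond_def by (simp add: field_simps)
qed

lemma cond_01: "0 \<le> cond \<epsilon> Q" "Measurable.pred tree_space Q \<Longrightarrow> cond \<epsilon> Q \<le> 1"
proof -
  show "0 \<le> cond \<epsilon> Q" by (simp add: cond_def)
  assume [measurable]: "Measurable.pred tree_space Q"
  have "prob {x \<in> space M. Q (tree x) \<and> W (tree x) < \<epsilon>} \<le> prob {x \<in> space M. W (tree x) < \<epsilon>}"
    by (rule finite_measure_mono) auto
  then show "cond \<epsilon> Q \<le> 1" unfolding cond_def
    by (cases "prob {x \<in> space M. W (tree x) < \<epsilon>} = 0") (simp_all add: divide_le_eq_1 zero_less_measure_iff)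
qed

section \<open>The three generations around the ceiling of gamma\<close>

definition ceiling_gamma :: "real \<Rightarrow> nat" where "ceiling_gamma \<epsilon> = nat \<lceil>\<gamma> \<epsilon>\<rceil>"

lemma eventually_range:
  "\<forall>\<^sub>F \<epsilon> in at_right 0. 0 < \<epsilon> \<and> \<epsilon> < 1 \<and> 1 \<le> ceiling_gamma \<epsilon> \<and> int (ceiling_gamma \<epsilon>) = \<lceil>\<gamma> \<epsilon>\<rceil> \<and> ceiling_gamma \<epsilon> + 1 \<le> kappa \<epsilon>"
proof -
  have "\<forall>\<^sub>F \<epsilon> in at_right 0. \<epsilon> \<in> {0<..<1::real}" by (rule eventually_at_right_real) simp
  with ceiling_gamma_range show ?thesis
  proof eventually_elim
    case (elim \<epsilon>)
    have "1 \<le> \<lceil>\<gamma> \<epsilon>\<rceil>" and "\<lceil>\<gamma> \<epsilon>\<rceil> + 1 \<le> int (kappa \<epsilon>)" using elim by blast+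
    moreover have "0 < \<epsilon>" "\<epsilon> < 1" using elim by auto
    ultimately show ?case unfolding ceiling_gamma_def by linarith
  qed
qed

text \<open>One level below the ceiling \<open>theta\<close> is of order at most
  \<open>1 / L\<close>, so the complement of \<open>minimal\<close> has vanishing tilted
  probability; \<open>cond_le\<close> transfers this to the conditional law.\<close>

lemma cond_below_tendsto: "((\<lambda>\<epsilon>. cond \<epsilon> (minimal (ceiling_gamma \<epsilon> - 1))) \<longlongrightarrow> 1) (at_right 0)"
proof -
  obtain C where C: "C > 0" "\<forall>\<^sub>F \<epsilon> in at_right 0. prob {x \<in> space M. W (tree x) < \<epsilon>} > 0 \<and>
    (\<forall>Q. local_event (kappa \<epsilon>) Q \<longrightarrow> cond \<epsilon> Q \<le> C * tilted_prob \<epsilon> Q)"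
    using cond_le by (elim exE conjE)
  obtain r1 r2 where r: "r1 > 0" "r2 > 0" and tb: "\<forall>\<epsilon> k. 0 < \<epsilon> \<longrightarrow> \<epsilon> < 1 \<longrightarrow> k \<le> kappa \<epsilon> \<longrightarrow>
     exp (- (r2 * theta \<epsilon> k)) \<le> tilted_prob \<epsilon> (minimal k) \<and>
     tilted_prob \<epsilon> (minimal k) \<le> exp (r2 * theta \<epsilon> 0 - r1 * theta \<epsilon> k)"
    using tilted_prob_minimal_bounds by (elim exE conjE)
  obtain E1 E2 where E: "E1 > 0" "\<forall>\<epsilon>. 0 < \<epsilon> \<longrightarrow> \<epsilon> < 1 \<longrightarrow> E1 \<le> theta_coeff \<epsilon> \<and> theta_coeff \<epsilon> \<le> E2"
    using theta_coeff_bounds by (elim exE conjE)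
  have "((\<lambda>\<epsilon>. C * (1 - exp (- (r2 * (E2 / ln (1 / \<epsilon>)))))) \<longlongrightarrow> 0) (at_right (0::real))"
    by real_asymp
  moreover have "\<forall>\<^sub>F \<epsilon> in at_right 0. norm (1 - cond \<epsilon> (minimal (ceiling_gamma \<epsilon> - 1))) \<le> C * (1 - exp (- (r2 * (E2 / ln (1 / \<epsilon>)))))"
    using C(2) eventually_range
  proof eventually_elim
    case (elim \<epsilon>)
    then have e: "0 < \<epsilon>" "\<epsilon> < 1" by auto
    let ?k = "ceiling_gamma \<epsilon> - 1" and ?q = "E2 / ln (1 / \<epsilon>)"
    have k: "?k \<le> kappa \<epsilon>" using elim(2) by linarith
    have ik: "int ?k = \<lceil>\<gamma> \<epsilon>\<rceil> - 1" using elim(2) by linarith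
    have u: "u1 \<epsilon> > 0" by (rule u1_props(1)[OF e])
    have "theta \<epsilon> ?k \<le> theta_coeff \<epsilon> / ln (1 / \<epsilon>)" by (rule theta_below_ceiling[OF e k ik])
    also have "\<dots> \<le> ?q" using E(2) e L_pos[OF e] by (intro divide_right_mono) auto
    finally have "r2 * theta \<epsilon> ?k \<le> r2 * ?q" using r by (intro mult_left_mono) auto
    then have "exp (- (r2 * ?q)) \<le> exp (- (r2 * theta \<epsilon> ?k))" by simp
    also have "\<dots> \<le> tilted_prob \<epsilon> (minimal ?k)" using tb e k by blast
    finally have t: "1 - tilted_prob \<epsilon> (minimal ?k) \<le> 1 - exp (- (r2 * ?q))" by simp
    have "1 - cond \<epsilon> (minimal ?k) = cond \<epsilon> (\<lambda>t. \<not> minimal ?k t)"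
      using elim(1) by (subst cond_not) auto
    also have "\<dots> \<le> C * tilted_prob \<epsilon> (\<lambda>t. \<not> minimal ?k t)"
      using elim(1) local_event_not[OF local_event_minimal[OF k]] by blast
    also have "\<dots> = C * (1 - tilted_prob \<epsilon> (minimal ?k))" by (subst tilted_prob_not[OF u]) auto
    also have "\<dots> \<le> C * (1 - exp (- (r2 * ?q)))" using t C(1) by (intro mult_left_mono) auto
    finally show ?case using cond_01(2)[of "minimal ?k" \<epsilon>] by simp
  qed
  ultimately have "((\<lambda>\<epsilon>. 1 - cond \<epsilon> (minimal (ceiling_gamma \<epsilon> - 1))) \<longlongrightarrow> 0) (at_right 0)"
    by (rule Lim_null_comparison[rotated])
  then have "((\<lambda>\<epsilon>. 1 - (1 - cond \<epsilon> (minimal (ceiling_gamma \<epsilon> - 1)))) \<longlongrightarrow> 1 - 0) (at_right 0)"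
    by (intro tendsto_intros)
  then show ?thesis by simp
qed

text \<open>One level above the ceiling \<open>theta\<close> is at least of the order of a negative
  power of \<open>\<epsilon>\<close> over \<open>L\<close>, so \<open>minimal\<close> itself has
  vanishing tilted probability, and \<open>cond_le\<close> applies directly.\<close>

lemma cond_above_tendsto: "((\<lambda>\<epsilon>. cond \<epsilon> (minimal (ceiling_gamma \<epsilon> + 1))) \<longlongrightarrow> 0) (at_right 0)"
proof -
  obtain C where C: "C > 0" "\<forall>\<^sub>F \<epsilon> in at_right 0. prob {x \<in> space M. W (tree x) < \<epsilon>} > 0 \<and>
    (\<forall>Q. local_event (kappa \<epsilon>) Q \<longrightarrow> cond \<epsilon> Q \<le> C * tilted_prob \<epsilon> Q)"
    using cond_le by (elim exE conjE)
  obtain r1 r2 where r: "r1 > 0" "r2 > 0" and tb: "\<forall>\<epsilon> k. 0 < \<epsilon> \<longrightarrow> \<epsilon> < 1 \<longrightarrow> k \<le> kappa \<epsilon> \<longrightarrow>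
     exp (- (r2 * theta \<epsilon> k)) \<le> tilted_prob \<epsilon> (minimal k) \<and>
     tilted_prob \<epsilon> (minimal k) \<le> exp (r2 * theta \<epsilon> 0 - r1 * theta \<epsilon> k)"
    using tilted_prob_minimal_bounds by (elim exE conjE)
  obtain E1 E2 where E: "E1 > 0" "\<forall>\<epsilon>. 0 < \<epsilon> \<longrightarrow> \<epsilon> < 1 \<longrightarrow> E1 \<le> theta_coeff \<epsilon> \<and> theta_coeff \<epsilon> \<le> E2"
    using theta_coeff_bounds by (elim exE conjE)
  define s where "s = \<alpha> * (1 - 1 / real \<mu>)"
  have s: "s > 0" using alpha_pos mu_real by (simp add: s_def)
  define c where "c = r1 * E1"
  have c: "c > 0" using r E by (simp add: c_def)
  have lim1: "((\<lambda>\<epsilon>. exp (- (c * (exp (s * ln (1 / \<epsilon>)) / ln (1 / \<epsilon>))))) \<longlongrightarrow> 0) (at_right (0::real))"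
    using s c by real_asymp
  have lim2: "((\<lambda>\<epsilon>. exp (r2 * theta \<epsilon> 0)) \<longlongrightarrow> exp (r2 * 0)) (at_right 0)"
    by (intro tendsto_intros theta_0_tendsto)
  have "((\<lambda>\<epsilon>. C * (exp (r2 * theta \<epsilon> 0) * exp (- (c * (exp (s * ln (1 / \<epsilon>)) / ln (1 / \<epsilon>)))))) \<longlongrightarrow> C * (exp (r2 * 0) * 0)) (at_right 0)"
    by (intro tendsto_mult tendsto_const lim1 lim2)
  then have "((\<lambda>\<epsilon>. C * (exp (r2 * theta \<epsilon> 0) * exp (- (c * (exp (s * ln (1 / \<epsilon>)) / ln (1 / \<epsilon>)))))) \<longlongrightarrow> 0) (at_right 0)"
    by simp
  moreover have "\<forall>\<^sub>F \<epsilon> in at_right 0. norm (cond \<epsilon> (minimal (ceiling_gamma \<epsilon> + 1))) \<le> C * (exp (r2 * theta \<epsilon> 0) * exp (- (c * (exp (s * ln (1 / \<epsilon>)) / ln (1 / \<epsilon>)))))"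
    using C(2) eventually_range
  proof eventually_elim
    case (elim \<epsilon>)
    then have e: "0 < \<epsilon>" "\<epsilon> < 1" by auto
    let ?k = "ceiling_gamma \<epsilon> + 1" and ?q = "exp (s * ln (1 / \<epsilon>)) / ln (1 / \<epsilon>)"
    have k: "?k \<le> kappa \<epsilon>" using elim(2) by linarith
    have ik: "int ?k = \<lceil>\<gamma> \<epsilon>\<rceil> + 1" using elim(2) by linarith
    have "theta_coeff \<epsilon> * (exp (\<alpha> * ln (1 / \<epsilon>) * (1 - 1 / real \<mu>)) / ln (1 / \<epsilon>)) \<le> theta \<epsilon> ?k"
      by (rule theta_above_ceiling[OF e k ik])
    moreover have "\<alpha> * ln (1 / \<epsilon>) * (1 - 1 / real \<mu>) = s * ln (1 / \<epsilon>)" by (simp add: s_def)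
    ultimately have "theta_coeff \<epsilon> * ?q \<le> theta \<epsilon> ?k" by simp
    moreover have "E1 * ?q \<le> theta_coeff \<epsilon> * ?q" using E(2) e L_pos[OF e] by (intro mult_right_mono) auto
    ultimately have "r1 * (E1 * ?q) \<le> r1 * theta \<epsilon> ?k" using r by (intro mult_left_mono) auto
    then have "c * ?q \<le> r1 * theta \<epsilon> ?k" by (simp only: c_def mult.assoc)
    then have "exp (r2 * theta \<epsilon> 0 - r1 * theta \<epsilon> ?k) \<le> exp (r2 * theta \<epsilon> 0) * exp (- (c * ?q))"
      unfolding exp_add[symmetric] by simp
    moreover have "tilted_prob \<epsilon> (minimal ?k) \<le> exp (r2 * theta \<epsilon> 0 - r1 * theta \<epsilon> ?k)" using tb e k by blast
    ultimately have t: "tilted_prob \<epsilon> (minimal ?k) \<le> exp (r2 * theta \<epsilon> 0) * exp (- (c * ?q))" by linarith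
    have "cond \<epsilon> (minimal ?k) \<le> C * tilted_prob \<epsilon> (minimal ?k)"
      using elim(1) local_event_minimal[OF k] by blast
    also have "\<dots> \<le> C * (exp (r2 * theta \<epsilon> 0) * exp (- (c * ?q)))" using t C(1) by (intro mult_left_mono) auto
    finally show ?case using cond_01(1)[of \<epsilon> "minimal ?k"] by simp
  qed
  ultimately show ?thesis by (rule Lim_null_comparison[rotated])
qed

text \<open>\<open>cond_le\<close> is applied to the event and to its complement, since with an
  arbitrary constant \<open>C\<close> only the one of vanishing tilted probability yields
  information.\<close>

lemma cond_ceiling_bounds:
  "\<exists>C>0. \<exists>\<kappa>1>0. \<exists>\<kappa>2>0. \<exists>\<rho>. (\<rho> \<longlongrightarrow> 0) (at_right 0) \<and> (\<forall>\<^sub>F \<epsilon> in at_right 0.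
     exp (- (\<kappa>2 * \<omega> \<epsilon>)) \<le> tilted_prob \<epsilon> (minimal (ceiling_gamma \<epsilon>)) \<and> tilted_prob \<epsilon> (minimal (ceiling_gamma \<epsilon>)) \<le> exp (\<rho> \<epsilon> - \<kappa>1 * \<omega> \<epsilon>) \<and>
     cond \<epsilon> (minimal (ceiling_gamma \<epsilon>)) \<le> C * tilted_prob \<epsilon> (minimal (ceiling_gamma \<epsilon>)) \<and>
     1 - cond \<epsilon> (minimal (ceiling_gamma \<epsilon>)) \<le> C * (1 - tilted_prob \<epsilon> (minimal (ceiling_gamma \<epsilon>))))"
proof -
  obtain C where C: "C > 0" "\<forall>\<^sub>F \<epsilon> in at_right 0. prob {x \<in> space M. W (tree x) < \<epsilon>} > 0 \<and>
    (\<forall>Q. local_event (kappa \<epsilon>) Q \<longrightarrow> cond \<epsilon> Q \<le> C * tilted_prob \<epsilon> Q)"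
    using cond_le by (elim exE conjE)
  obtain r1 r2 where r: "r1 > 0" "r2 > 0" and tb: "\<forall>\<epsilon> k. 0 < \<epsilon> \<longrightarrow> \<epsilon> < 1 \<longrightarrow> k \<le> kappa \<epsilon> \<longrightarrow>
     exp (- (r2 * theta \<epsilon> k)) \<le> tilted_prob \<epsilon> (minimal k) \<and>
     tilted_prob \<epsilon> (minimal k) \<le> exp (r2 * theta \<epsilon> 0 - r1 * theta \<epsilon> k)"
    using tilted_prob_minimal_bounds by (elim exE conjE)
  obtain E1 E2 where E: "E1 > 0" "\<forall>\<epsilon>. 0 < \<epsilon> \<longrightarrow> \<epsilon> < 1 \<longrightarrow> E1 \<le> theta_coeff \<epsilon> \<and> theta_coeff \<epsilon> \<le> E2"
    using theta_coeff_bounds by (elim exE conjE)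
  \<comment> \<open>Any point of the open unit interval shows \<open>E1 \<le> E2\<close> and hence
    that \<open>E2\<close> is positive.\<close>
  have "E1 \<le> theta_coeff (1 / 2) \<and> theta_coeff (1 / 2) \<le> E2" using E(2) by simp
  then have E2: "E2 > 0" using E(1) by linarith
  define \<kappa>1 \<kappa>2 where "\<kappa>1 = r1 * E1" and "\<kappa>2 = r2 * (real \<mu> * E2)"
  have kk: "\<kappa>1 > 0" "\<kappa>2 > 0" using r E E2 mu_real by (auto simp: \<kappa>1_def \<kappa>2_def)
  have rho: "((\<lambda>\<epsilon>. r2 * theta \<epsilon> 0) \<longlongrightarrow> 0) (at_right 0)"
    using tendsto_mult_left[OF theta_0_tendsto, of r2] by simp
  have "\<forall>\<^sub>F \<epsilon> in at_right 0.
     exp (- (\<kappa>2 * \<omega> \<epsilon>)) \<le> tilted_prob \<epsilon> (minimal (ceiling_gamma \<epsilon>)) \<and> tilted_prob \<epsilon> (minimal (ceiling_gamma \<epsilon>)) \<le> exp (r2 * theta \<epsilon> 0 - \<kappa>1 * \<omega> \<epsilon>) \<and>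
     cond \<epsilon> (minimal (ceiling_gamma \<epsilon>)) \<le> C * tilted_prob \<epsilon> (minimal (ceiling_gamma \<epsilon>)) \<and>
     1 - cond \<epsilon> (minimal (ceiling_gamma \<epsilon>)) \<le> C * (1 - tilted_prob \<epsilon> (minimal (ceiling_gamma \<epsilon>)))"
    using C(2) eventually_range
  proof eventually_elim
    case (elim \<epsilon>)
    then have e: "0 < \<epsilon>" "\<epsilon> < 1" by auto
    let ?k = "ceiling_gamma \<epsilon>"
    have k: "?k \<le> kappa \<epsilon>" and ik: "int ?k = \<lceil>\<gamma> \<epsilon>\<rceil>" using elim(2) by auto
    have u: "u1 \<epsilon> > 0" by (rule u1_props(1)[OF e])
    have w: "\<omega> \<epsilon> > 0" by (rule omega_pos[OF e])
    have "E1 * \<omega> \<epsilon> \<le> theta_coeff \<epsilon> * \<omega> \<epsilon>" using E(2) e w by (intro mult_right_mono) auto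
    also have "\<dots> \<le> theta \<epsilon> ?k" by (rule theta_ceiling(1)[OF e k ik])
    finally have "r1 * (E1 * \<omega> \<epsilon>) \<le> r1 * theta \<epsilon> ?k" using r by (intro mult_left_mono) auto
    then have lo: "\<kappa>1 * \<omega> \<epsilon> \<le> r1 * theta \<epsilon> ?k" by (simp only: \<kappa>1_def mult.assoc)
    have "theta \<epsilon> ?k \<le> real \<mu> * (theta_coeff \<epsilon> * \<omega> \<epsilon>)" by (rule theta_ceiling(2)[OF e k ik])
    also have "\<dots> \<le> real \<mu> * (E2 * \<omega> \<epsilon>)" using E(2) e w by (intro mult_left_mono mult_right_mono) auto
    finally have "r2 * theta \<epsilon> ?k \<le> r2 * (real \<mu> * (E2 * \<omega> \<epsilon>))" using r by (intro mult_left_mono) auto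
    then have up: "r2 * theta \<epsilon> ?k \<le> \<kappa>2 * \<omega> \<epsilon>" by (simp only: \<kappa>2_def mult.assoc)
    have t: "exp (- (r2 * theta \<epsilon> ?k)) \<le> tilted_prob \<epsilon> (minimal ?k)"
       "tilted_prob \<epsilon> (minimal ?k) \<le> exp (r2 * theta \<epsilon> 0 - r1 * theta \<epsilon> ?k)" using tb e k by blast+
    have "exp (- (\<kappa>2 * \<omega> \<epsilon>)) \<le> exp (- (r2 * theta \<epsilon> ?k))" using up by simp
    moreover have "exp (r2 * theta \<epsilon> 0 - r1 * theta \<epsilon> ?k) \<le> exp (r2 * theta \<epsilon> 0 - \<kappa>1 * \<omega> \<epsilon>)" using lo by simp
    moreover have "cond \<epsilon> (minimal ?k) \<le> C * tilted_prob \<epsilon> (minimal ?k)"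
      using elim(1) local_event_minimal[OF k] by blast
    moreover have "1 - cond \<epsilon> (minimal ?k) \<le> C * (1 - tilted_prob \<epsilon> (minimal ?k))"
    proof -
      have "1 - cond \<epsilon> (minimal ?k) = cond \<epsilon> (\<lambda>t. \<not> minimal ?k t)"
        using elim(1) by (subst cond_not) auto
      also have "\<dots> \<le> C * tilted_prob \<epsilon> (\<lambda>t. \<not> minimal ?k t)"
        using elim(1) local_event_not[OF local_event_minimal[OF k]] by blast
      finally show ?thesis using tilted_prob_not[OF u measurable_minimal] by simp
    qed
    ultimately show ?case using t by linarith
  qed
  then show ?thesis using C(1) kk rho by blast
qed

text \<open>The lossy lower bound for both the event and its complement; it is informative once both
  tilted probabilities exceed \<open>\<eta>\<close> by a fixed amount.\<close>

lemma cond_ceiling_bounded_away: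
  assumes "\<eta> > 0"
  shows "\<exists>c>0. \<forall>\<^sub>F \<epsilon> in at_right 0. c * (tilted_prob \<epsilon> (minimal (ceiling_gamma \<epsilon>)) - \<eta>) \<le> cond \<epsilon> (minimal (ceiling_gamma \<epsilon>)) \<and>
     c * (1 - tilted_prob \<epsilon> (minimal (ceiling_gamma \<epsilon>)) - \<eta>) \<le> 1 - cond \<epsilon> (minimal (ceiling_gamma \<epsilon>))"
proof -
  obtain c where c: "c > 0" "\<forall>\<^sub>F \<epsilon> in at_right 0. \<forall>Q. local_event (kappa \<epsilon>) Q \<longrightarrow> c * (tilted_prob \<epsilon> Q - \<eta>) \<le> cond \<epsilon> Q"
    using cond_ge[OF assms] by (elim exE conjE)
  obtain C where C: "\<forall>\<^sub>F \<epsilon> in at_right 0. prob {x \<in> space M. W (tree x) < \<epsilon>} > 0 \<and>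
    (\<forall>Q. local_event (kappa \<epsilon>) Q \<longrightarrow> cond \<epsilon> Q \<le> C * tilted_prob \<epsilon> Q)"
    using cond_le by (elim exE conjE)
  from c(2) C eventually_range
  have "\<forall>\<^sub>F \<epsilon> in at_right 0. c * (tilted_prob \<epsilon> (minimal (ceiling_gamma \<epsilon>)) - \<eta>) \<le> cond \<epsilon> (minimal (ceiling_gamma \<epsilon>)) \<and>
     c * (1 - tilted_prob \<epsilon> (minimal (ceiling_gamma \<epsilon>)) - \<eta>) \<le> 1 - cond \<epsilon> (minimal (ceiling_gamma \<epsilon>))"
  proof eventually_elim
    case (elim \<epsilon>)
    then have e: "0 < \<epsilon>" "\<epsilon> < 1" and k: "ceiling_gamma \<epsilon> \<le> kappa \<epsilon>" by auto
    have u: "u1 \<epsilon> > 0" by (rule u1_props(1)[OF e])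
    have "c * (tilted_prob \<epsilon> (\<lambda>t. \<not> minimal (ceiling_gamma \<epsilon>) t) - \<eta>) \<le> cond \<epsilon> (\<lambda>t. \<not> minimal (ceiling_gamma \<epsilon>) t)"
      using elim(1) local_event_not[OF local_event_minimal[OF k]] by blast
    moreover have "c * (tilted_prob \<epsilon> (minimal (ceiling_gamma \<epsilon>)) - \<eta>) \<le> cond \<epsilon> (minimal (ceiling_gamma \<epsilon>))"
      using elim(1) local_event_minimal[OF k] by blast
    ultimately show ?case
      using tilted_prob_not[OF u measurable_minimal] cond_not[OF conjunct1[OF elim(2)] measurable_minimal] by simp
  qed
  then show ?thesis using c(1) by blast
qed

end

section \<open>The three regimes of omega\<close>

theorem theorem4:
  fixes M :: "'a measure" and p :: "nat pmf" and N :: "nat list \<Rightarrow> 'a \<Rightarrow> nat"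
    and \<epsilon> :: "nat \<Rightarrow> real"
  assumes "galton_watson M p N"
    and "\<And>c. \<not> (AE n in measure_pmf p. n = c)"
    and "pmf p 0 = 0"
    and "integrable (measure_pmf p) (\<lambda>n. real n * ln (real n))"
    and "gw_mu p \<ge> 2"
    and "\<And>j. \<epsilon> j > 0" and "decseq \<epsilon>" and "\<epsilon> \<longlonglongrightarrow> 0"
  shows
    "(filterlim (\<lambda>j. gw_omega M p N (\<epsilon> j)) at_top sequentially \<longrightarrow>
        (\<lambda>j. \<P>(x in M. int (gw_K p N x) = \<lceil>gw_gamma M p N (\<epsilon> j)\<rceil> \<bar> gw_W p N x < \<epsilon> j))
          \<longlonglongrightarrow> 1)
   \<and> ((\<exists>c C. 0 < c \<and> (\<forall>\<^sub>F j in sequentially.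
            c \<le> gw_omega M p N (\<epsilon> j) \<and> gw_omega M p N (\<epsilon> j) \<le> C)) \<longrightarrow>
        (\<exists>c C. 0 < c \<and> C < 1 \<and> (\<forall>\<^sub>F j in sequentially.
            c \<le> \<P>(x in M. int (gw_K p N x) = \<lceil>gw_gamma M p N (\<epsilon> j)\<rceil> \<bar> gw_W p N x < \<epsilon> j) \<and>
            \<P>(x in M. int (gw_K p N x) = \<lceil>gw_gamma M p N (\<epsilon> j)\<rceil> \<bar> gw_W p N x < \<epsilon> j) \<le> C)) \<and>
        (\<exists>c C. 0 < c \<and> C < 1 \<and> (\<forall>\<^sub>F j in sequentially.
            c \<le> \<P>(x in M. int (gw_K p N x) = \<lceil>gw_gamma M p N (\<epsilon> j)\<rceil> + 1 \<bar> gw_W p N x < \<epsilon> j) \<and>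
            \<P>(x in M. int (gw_K p N x) = \<lceil>gw_gamma M p N (\<epsilon> j)\<rceil> + 1 \<bar> gw_W p N x < \<epsilon> j) \<le> C)))
   \<and> ((\<lambda>j. gw_omega M p N (\<epsilon> j)) \<longlonglongrightarrow> 0 \<longrightarrow>
        (\<lambda>j. \<P>(x in M. int (gw_K p N x) = \<lceil>gw_gamma M p N (\<epsilon> j)\<rceil> + 1 \<bar> gw_W p N x < \<epsilon> j))
          \<longlonglongrightarrow> 1)"
proof -
  interpret boettcher_galton_watson M p N
    using assms(1,2,4,5)
    by (intro boettcher_galton_watson.intro boettcher_galton_watson_axioms.intro)
  define w0 c0 c1 c2 t where "w0 = (\<lambda>j. \<omega> (\<epsilon> j))"
    and "c0 = (\<lambda>j. cond (\<epsilon> j) (minimal (ceiling_gamma (\<epsilon> j) - 1)))"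
    and "c1 = (\<lambda>j. cond (\<epsilon> j) (minimal (ceiling_gamma (\<epsilon> j))))"
    and "c2 = (\<lambda>j. cond (\<epsilon> j) (minimal (ceiling_gamma (\<epsilon> j) + 1)))"
    and "t = (\<lambda>j. tilted_prob (\<epsilon> j) (minimal (ceiling_gamma (\<epsilon> j))))"
  define P1 P2 where "P1 = (\<lambda>j. \<P>(x in M. int (gw_K p N x) = \<lceil>\<gamma> (\<epsilon> j)\<rceil> \<bar> gw_W p N x < \<epsilon> j))"
    and "P2 = (\<lambda>j. \<P>(x in M. int (gw_K p N x) = \<lceil>\<gamma> (\<epsilon> j)\<rceil> + 1 \<bar> gw_W p N x < \<epsilon> j))"
  have lim: "filterlim \<epsilon> (at_right 0) sequentially"
    using assms(8) by (auto simp: filterlim_at assms(6) less_imp_neq[OF assms(6), symmetric])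
  note ev = eventually_compose_filterlim[OF _ lim]
  note tl = filterlim_compose[OF _ lim]
  have c0: "c0 \<longlonglongrightarrow> 1" unfolding c0_def by (rule tl[OF cond_below_tendsto])
  have c2: "c2 \<longlonglongrightarrow> 0" unfolding c2_def by (rule tl[OF cond_above_tendsto])
  have bounds: "0 \<le> c1 j" "c1 j \<le> 1" "c0 j \<le> 1" "0 \<le> c2 j" for j
    by (simp_all add: c0_def c1_def c2_def cond_01)
  have P: "\<forall>\<^sub>F j in sequentially. P1 j = c0 j - c1 j \<and> P2 j = c1 j - c2 j"
    using ev[OF eventually_range]
  proof eventually_elim
    case (elim j)
    have "int (gw_K p N x) = \<lceil>\<gamma> (\<epsilon> j)\<rceil> \<longleftrightarrow> gw_K p N x = Suc (ceiling_gamma (\<epsilon> j) - 1)" for x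
      using elim by linarith
    moreover have "int (gw_K p N x) = \<lceil>\<gamma> (\<epsilon> j)\<rceil> + 1 \<longleftrightarrow> gw_K p N x = Suc (ceiling_gamma (\<epsilon> j))" for x
      using elim by linarith
    ultimately show ?case unfolding P1_def P2_def c0_def c1_def c2_def
      using elim by (simp only: cond_prob_gw_K) simp
  qed
  \<comment> \<open>The neighbours of the ceiling contribute 1 and 0 in the limit, so a limit of
    \<open>c1\<close> determines the limits of both conditional probabilities.\<close>
  have lim_P: "P1 \<longlonglongrightarrow> 1 - l" "P2 \<longlonglongrightarrow> l" if "c1 \<longlonglongrightarrow> l" for l
  proof -
    have "(\<lambda>j. c0 j - c1 j) \<longlonglongrightarrow> 1 - l" using c0 that by (intro tendsto_intros)
    then show "P1 \<longlonglongrightarrow> 1 - l" by (rule Lim_transform_eventually) (use P in eventually_elim, simp)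
    have "(\<lambda>j. c1 j - c2 j) \<longlonglongrightarrow> l" using tendsto_diff[OF that c2] by simp
    then show "P2 \<longlonglongrightarrow> l" by (rule tendsto_cong[THEN iffD1, rotated]) (use P in eventually_elim, simp)
  qed
  obtain C \<kappa>1 \<kappa>2 \<rho> where C: "C > 0" and \<kappa>: "\<kappa>1 > 0" "\<kappa>2 > 0" and \<rho>: "(\<rho> \<longlongrightarrow> 0) (at_right 0)"
    and b: "\<forall>\<^sub>F \<epsilon> in at_right 0.
     exp (- (\<kappa>2 * \<omega> \<epsilon>)) \<le> tilted_prob \<epsilon> (minimal (ceiling_gamma \<epsilon>)) \<and> tilted_prob \<epsilon> (minimal (ceiling_gamma \<epsilon>)) \<le> exp (\<rho> \<epsilon> - \<kappa>1 * \<omega> \<epsilon>) \<and>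
     cond \<epsilon> (minimal (ceiling_gamma \<epsilon>)) \<le> C * tilted_prob \<epsilon> (minimal (ceiling_gamma \<epsilon>)) \<and>
     1 - cond \<epsilon> (minimal (ceiling_gamma \<epsilon>)) \<le> C * (1 - tilted_prob \<epsilon> (minimal (ceiling_gamma \<epsilon>)))"
    using cond_ceiling_bounds by (elim exE conjE)
  define r where "r = (\<lambda>j. \<rho> (\<epsilon> j))"
  have r: "r \<longlonglongrightarrow> 0" unfolding r_def by (rule tl[OF \<rho>])
  have b: "\<forall>\<^sub>F j in sequentially. exp (- (\<kappa>2 * w0 j)) \<le> t j \<and> t j \<le> exp (r j - \<kappa>1 * w0 j) \<and>
      c1 j \<le> C * t j \<and> 1 - c1 j \<le> C * (1 - t j)"
    using ev[OF b] by (simp only: w0_def t_def c1_def r_def)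
  have a: "P1 \<longlonglongrightarrow> 1" if w: "filterlim w0 at_top sequentially"
  proof -
    have "filterlim (\<lambda>j. \<kappa>1 * w0 j) at_top sequentially"
      by (rule filterlim_tendsto_pos_mult_at_top[OF tendsto_const \<kappa>(1) w])
    then have "filterlim (\<lambda>j. - r j + \<kappa>1 * w0 j) at_top sequentially"
      by (intro filterlim_tendsto_add_at_top[OF tendsto_minus[OF r]])
    then have "filterlim (\<lambda>j. r j - \<kappa>1 * w0 j) at_bot sequentially"
      by (subst filterlim_uminus_at_bot) (simp add: algebra_simps)
    then have "(\<lambda>j. exp (r j - \<kappa>1 * w0 j)) \<longlonglongrightarrow> 0" by (rule filterlim_compose[OF exp_at_bot])
    then have "(\<lambda>j. C * exp (r j - \<kappa>1 * w0 j)) \<longlonglongrightarrow> C * 0" by (intro tendsto_intros)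
    then have "(\<lambda>j. C * exp (r j - \<kappa>1 * w0 j)) \<longlonglongrightarrow> 0" by simp
    moreover have "\<forall>\<^sub>F j in sequentially. norm (c1 j) \<le> C * exp (r j - \<kappa>1 * w0 j)"
      using b
    proof eventually_elim
      case (elim j)
      then have "C * t j \<le> C * exp (r j - \<kappa>1 * w0 j)" using C by (intro mult_left_mono) auto
      then have "c1 j \<le> C * exp (r j - \<kappa>1 * w0 j)" using elim by linarith
      then show ?case using bounds(1)[of j] by simp
    qed
    ultimately have "c1 \<longlonglongrightarrow> 0" by (rule Lim_null_comparison[rotated])
    from lim_P(1)[OF this] show ?thesis by simp
  qed
  have c: "P2 \<longlonglongrightarrow> 1" if w: "w0 \<longlonglongrightarrow> 0"
  proof -
    have "(\<lambda>j. C * (1 - exp (- (\<kappa>2 * w0 j)))) \<longlonglongrightarrow> C * (1 - exp (- (\<kappa>2 * 0)))"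
      using w by (intro tendsto_intros)
    then have "(\<lambda>j. C * (1 - exp (- (\<kappa>2 * w0 j)))) \<longlonglongrightarrow> 0" by simp
    moreover have "\<forall>\<^sub>F j in sequentially. norm (1 - c1 j) \<le> C * (1 - exp (- (\<kappa>2 * w0 j)))"
      using b
    proof eventually_elim
      case (elim j)
      then have "C * (1 - t j) \<le> C * (1 - exp (- (\<kappa>2 * w0 j)))" using C by (intro mult_left_mono) auto
      then have "1 - c1 j \<le> C * (1 - exp (- (\<kappa>2 * w0 j)))" using elim by linarith
      then show ?case using bounds(2)[of j] by simp
    qed
    ultimately have "(\<lambda>j. 1 - c1 j) \<longlonglongrightarrow> 0" by (rule Lim_null_comparison[rotated])
    then have "(\<lambda>j. 1 - (1 - c1 j)) \<longlonglongrightarrow> 1 - 0" by (intro tendsto_intros)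
    then have "c1 \<longlonglongrightarrow> 1" by simp
    then show ?thesis by (rule lim_P(2))
  qed
  have bb: "\<exists>d>0. \<forall>\<^sub>F j in sequentially. d \<le> P1 j \<and> P1 j \<le> 1 - d \<and> d \<le> P2 j \<and> P2 j \<le> 1 - d"
    if d: "0 < d1" and w: "\<forall>\<^sub>F j in sequentially. d1 \<le> w0 j \<and> w0 j \<le> d2" for d1 d2
  proof -
    \<comment> \<open>Half of the smaller of the two lower bounds for \<open>t\<close> and
      \<open>1 - t\<close>, so that after the loss of \<open>\<eta>\<close> at least
      \<open>\<eta>\<close> is left in both. Only half of \<open>\<kappa>1 * d1\<close> is used, the
      other half absorbing the vanishing error \<open>r\<close>.\<close>
    define \<eta> where "\<eta> = min (exp (- (\<kappa>2 * d2))) (1 - exp (- (\<kappa>1 * d1 / 2))) / 2"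
    have "\<kappa>1 * d1 > 0" using \<kappa> d by simp
    then have \<eta>: "\<eta> > 0" by (simp add: \<eta>_def)
    have \<eta>_le: "2 * \<eta> \<le> exp (- (\<kappa>2 * d2))" "2 * \<eta> \<le> 1 - exp (- (\<kappa>1 * d1 / 2))" by (simp_all add: \<eta>_def)
    obtain e where e: "e > 0" "\<forall>\<^sub>F \<epsilon> in at_right 0. e * (tilted_prob \<epsilon> (minimal (ceiling_gamma \<epsilon>)) - \<eta>) \<le> cond \<epsilon> (minimal (ceiling_gamma \<epsilon>)) \<and>
       e * (1 - tilted_prob \<epsilon> (minimal (ceiling_gamma \<epsilon>)) - \<eta>) \<le> 1 - cond \<epsilon> (minimal (ceiling_gamma \<epsilon>))"
      using cond_ceiling_bounded_away[OF \<eta>] by (elim exE conjE)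
    have ee: "\<forall>\<^sub>F j in sequentially. e * (t j - \<eta>) \<le> c1 j \<and> e * (1 - t j - \<eta>) \<le> 1 - c1 j"
      using ev[OF e(2)] by (simp only: t_def c1_def)
    \<comment> \<open>Both \<open>c1\<close> and \<open>1 - c1\<close> will be at least
      \<open>d\<close>; half of it is then given up for the distances of \<open>c0\<close> from 1
      and of \<open>c2\<close> from 0.\<close>
    define d where "d = e * \<eta>"
    have d: "d > 0" using e \<eta> by (simp add: d_def)
    have "\<forall>\<^sub>F j in sequentially. r j < \<kappa>1 * d1 / 2"
      using \<open>\<kappa>1 * d1 > 0\<close> by (intro order_tendstoD(2)[OF r]) simp
    moreover have "\<forall>\<^sub>F j in sequentially. c0 j > 1 - d / 2"
      using d by (intro order_tendstoD(1)[OF c0]) simp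
    moreover have "\<forall>\<^sub>F j in sequentially. c2 j < d / 2"
      using d by (intro order_tendstoD(2)[OF c2]) simp
    ultimately have "\<forall>\<^sub>F j in sequentially. d / 2 \<le> P1 j \<and> P1 j \<le> 1 - d / 2 \<and> d / 2 \<le> P2 j \<and> P2 j \<le> 1 - d / 2"
      using P b w ee
    proof eventually_elim
      case (elim j)
      have "\<kappa>2 * w0 j \<le> \<kappa>2 * d2" using elim \<kappa> by (intro mult_left_mono) auto
      then have "exp (- (\<kappa>2 * d2)) \<le> exp (- (\<kappa>2 * w0 j))" by simp
      then have "2 * \<eta> \<le> t j" using elim \<eta>_le by linarith
      then have "e * \<eta> \<le> e * (t j - \<eta>)" using e by (intro mult_left_mono) auto
      then have l: "d \<le> c1 j" using elim unfolding d_def by linarith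
      have "\<kappa>1 * d1 \<le> \<kappa>1 * w0 j" using elim \<kappa> by (intro mult_left_mono) auto
      then have "r j - \<kappa>1 * w0 j \<le> - (\<kappa>1 * d1 / 2)" using elim by linarith
      then have "exp (r j - \<kappa>1 * w0 j) \<le> exp (- (\<kappa>1 * d1 / 2))" by simp
      then have "2 * \<eta> \<le> 1 - t j" using elim \<eta>_le by linarith
      then have "e * \<eta> \<le> e * (1 - t j - \<eta>)" using e by (intro mult_left_mono) auto
      then have u: "d \<le> 1 - c1 j" using elim unfolding d_def by linarith
      show ?case using l u elim bounds[of j] d by linarith
    qed
    then show ?thesis using d by (intro exI[of _ "d / 2"]) simp
  qed
  have "(\<exists>c C. 0 < c \<and> C < 1 \<and> (\<forall>\<^sub>F j in sequentially. c \<le> P1 j \<and> P1 j \<le> C)) \<and>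
      (\<exists>c C. 0 < c \<and> C < 1 \<and> (\<forall>\<^sub>F j in sequentially. c \<le> P2 j \<and> P2 j \<le> C))"
    if h: "\<exists>c C. 0 < c \<and> (\<forall>\<^sub>F j in sequentially. c \<le> w0 j \<and> w0 j \<le> C)"
  proof -
    obtain d1 d2 where "0 < d1" "\<forall>\<^sub>F j in sequentially. d1 \<le> w0 j \<and> w0 j \<le> d2"
      using h by (elim exE conjE)
    from bb[OF this] obtain d where d: "d > 0"
      and *: "\<forall>\<^sub>F j in sequentially. d \<le> P1 j \<and> P1 j \<le> 1 - d \<and> d \<le> P2 j \<and> P2 j \<le> 1 - d"
      by (elim exE conjE)
    show ?thesis
      by (intro conjI exI[of _ d] exI[of _ "1 - d"]; (use d in simp | rule eventually_mono[OF *], simp))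
  qed
  then show ?thesis using a c unfolding w0_def P1_def P2_def by blast
qed

end
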